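(* Let $q>1$ be a constant. Let $\Omega\subset\mathbb{R}^2$ be a $C^2$ domain which is star-shaped with respect to the origin with an admissible radius function $\rho$ (with respect to $q$) such that $\rho'\neq0$ almost everywhere in $[0,2\pi)$, and such that for every $t$, $\rho'(t)=0$ if and only if $\rho'(t+\pi)=0$. Assume furthermore that $\rho$ satisfies at least one of the following two conditions: (i) for each $t$, $\operatorname{sgn}\rho'(t)=\operatorname{sgn}\rho'(t+\pi)$; or (ii) for each $t$ with $\rho'(t)=0$, $|\rho''(t)|+|\rho''(t+\pi)|>0$. Let $\phi$ be a $C^1$ function on $\mathbb{S}^1$ which is not identically zero. Then there are at most finitely many wave numbers $k>0$ such that $\Omega$ is non-scattering in the presence of the incident wave $v=\mathbf{H}[k,\phi]$.
   Context: We identify $\mathbb{S}^1$ with $[0,2\pi)$ (and with $\mathbb{R}/(2\pi\mathbb{Z})$) via $\theta\mapsto\vec\theta=(\cos\theta,\sin\theta)^T$; for $\xi\in\mathbb{S}^1$, $\theta_\xi$ denotes its angular coordinate. A bounded, simply connected $C^2$ domain $\Omega\subset\mathbb{R}^2$ containing the origin is star-shaped with respect to the origin if $\partial\Omega=\{\rho(\theta)\vec\theta:\theta\in[0,2\pi)\}$ for a positive $2\pi$-periodic $C^2$ function $\rho$, called its radius function. Given $q>1$, $\rho$ is admissible (with respect to $q$) if $(\ln\rho)''(t)<\sqrt{q}/(1+\sqrt{q})$ for all $t$. For $k>0$ and $\phi\in L^2(\mathbb{S}^1)$ the Herglotz wave is $\mathbf{H}[k,\phi](x)=\int_{-\pi}^{\pi}\phi(\xi)e^{\mathrm{i}k\xi\cdot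 x}\,d\theta_\xi$. $\Omega$ is non-scattering in the presence of $\mathbf{H}[k,\phi]$ (index of refraction the constant $q$) if there exists $u\in H^1(\Omega)$ with $\Delta u+k^2qu=0$ in $\Omega$ and $u=\mathbf{H}[k,\phi]$, $\partial_\nu u=\partial_\nu\mathbf{H}[k,\phi]$ on $\partial\Omega$. *)

theory Defs
  imports "HOL-Analysis.Analysis"
begin

definition star_domain :: "(real \<Rightarrow> real) \<Rightarrow> (real^2) set" where
  "star_domain \<rho> = {r *\<^sub>R vector [cos t, sin t] | r t. 0 \<le> r \<and> r < \<rho> t}"

definition C2_fun :: "(real \<Rightarrow> real) \<Rightarrow> bool" where
  "C2_fun f \<longleftrightarrow> (\<forall>t. f differentiable (at t)) \<and> (\<forall>t. deriv f differentiable (at t))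
     \<and> continuous_on UNIV (deriv (deriv f))"

definition admissible :: "real \<Rightarrow> (real \<Rightarrow> real) \<Rightarrow> bool" where
  "admissible q \<rho> \<longleftrightarrow> (\<forall>t. deriv (deriv (\<lambda>s. ln (\<rho> s))) t < sqrt q / (1 + sqrt q))"

definition herglotz :: "real \<Rightarrow> (real \<Rightarrow> complex) \<Rightarrow> real^2 \<Rightarrow> complex" where
  "herglotz k \<phi> x = integral {-pi..pi}
      (\<lambda>\<theta>. \<phi> \<theta> * exp (\<i> * complex_of_real (k * (cos \<theta> * x$1 + sin \<theta> * x$2))))"

definition pd :: "2 \<Rightarrow> (real^2 \<Rightarrow> complex) \<Rightarrow> real^2 \<Rightarrow> complex" where
  "pd i f x = frechet_derivative f (at x) (axis i 1)"

fun iter_pd :: "2 list \<Rightarrow> (real^2 \<Rightarrow> complex) \<Rightarrow> real^2 \<Rightarrow> complex" where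
  "iter_pd [] f = f"
| "iter_pd (i # is) f = pd i (iter_pd is f)"

definition smooth_fun :: "(real^2 \<Rightarrow> complex) \<Rightarrow> bool" where
  "smooth_fun f \<longleftrightarrow> (\<forall>is x. iter_pd is f differentiable (at x))"

definition test_fun :: "(real^2) set \<Rightarrow> (real^2 \<Rightarrow> complex) \<Rightarrow> bool" where
  "test_fun U \<psi> \<longleftrightarrow> smooth_fun \<psi> \<and> compact (closure {x. \<psi> x \<noteq> 0})
      \<and> closure {x. \<psi> x \<noteq> 0} \<subseteq> U"

definition L2_on :: "(real^2) set \<Rightarrow> (real^2 \<Rightarrow> complex) \<Rightarrow> bool" where
  "L2_on \<Omega> f \<longleftrightarrow> f \<in> borel_measurable (lebesgue_on \<Omega>)
      \<and> integrable (lebesgue_on \<Omega>) (\<lambda>x. (cmod (f x))\<^sup>2)"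

definition weak_grad :: "(real^2) set \<Rightarrow> (real^2 \<Rightarrow> complex) \<Rightarrow> (2 \<Rightarrow> real^2 \<Rightarrow> complex) \<Rightarrow> bool" where
  "weak_grad \<Omega> u G \<longleftrightarrow> (\<forall>\<psi> i. test_fun \<Omega> \<psi> \<longrightarrow>
      integral\<^sup>L (lebesgue_on \<Omega>) (\<lambda>x. u x * pd i \<psi> x)
        = - integral\<^sup>L (lebesgue_on \<Omega>) (\<lambda>x. G i x * \<psi> x))"

definition H1_with_grad :: "(real^2) set \<Rightarrow> (real^2 \<Rightarrow> complex) \<Rightarrow> (2 \<Rightarrow> real^2 \<Rightarrow> complex) \<Rightarrow> bool" where
  "H1_with_grad \<Omega> u G \<longleftrightarrow> L2_on \<Omega> u \<and> (\<forall>i. L2_on \<Omega> (G i)) \<and> weak_grad \<Omega> u G"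

text \<open>Non-scattering: there is u in H^1(Omega) (weak gradient G) with
  (1) Delta u + k^2 q u = 0 weakly in Omega;
  (2) u = H on the boundary, i.e. u - H lies in H^1_0(Omega) (the H^1-closure of C_c^infinity(Omega));
  (3) d_nu u = d_nu H on the boundary in the weak (H^{-1/2}) sense given by Green's formula:
      for all psi in C_c^infinity(R^2),
      int_Omega grad u . grad psi - k^2 q u psi = int_Omega grad H . grad psi - k^2 H psi.\<close>
definition non_scattering :: "(real^2) set \<Rightarrow> real \<Rightarrow> real \<Rightarrow> (real \<Rightarrow> complex) \<Rightarrow> bool" where
  "non_scattering \<Omega> q k \<phi> \<longleftrightarrow> (let H = herglotz k \<phi> in
     \<exists>u G. H1_with_grad \<Omega> u G
       \<and> (\<forall>\<psi>. test_fun \<Omega> \<psi> \<longrightarrow>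
            integral\<^sup>L (lebesgue_on \<Omega>)
              (\<lambda>x. (\<Sum>i\<in>UNIV. G i x * pd i \<psi> x) - complex_of_real (k\<^sup>2 * q) * u x * \<psi> x) = 0)
       \<and> (\<exists>\<psi>s :: nat \<Rightarrow> real^2 \<Rightarrow> complex. (\<forall>n. test_fun \<Omega> (\<psi>s n))
            \<and> (\<lambda>n. integral\<^sup>L (lebesgue_on \<Omega>) (\<lambda>x. (cmod (\<psi>s n x - (u x - H x)))\<^sup>2)) \<longlonglongrightarrow> 0
            \<and> (\<forall>i. (\<lambda>n. integral\<^sup>L (lebesgue_on \<Omega>)
                   (\<lambda>x. (cmod (pd i (\<psi>s n) x - (G i x - pd i H x)))\<^sup>2)) \<longlonglongrightarrow> 0))
       \<and> (\<forall>\<psi>. test_fun UNIV \<psi> \<longrightarrow>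
            integral\<^sup>L (lebesgue_on \<Omega>)
              (\<lambda>x. (\<Sum>i\<in>UNIV. G i x * pd i \<psi> x) - complex_of_real (k\<^sup>2 * q) * u x * \<psi> x)
          = integral\<^sup>L (lebesgue_on \<Omega>)
              (\<lambda>x. (\<Sum>i\<in>UNIV. pd i H x * pd i \<psi> x) - complex_of_real (k\<^sup>2) * H x * \<psi> x)))"

end

theory Submission
  imports Defs "HOL-Complex_Analysis.Complex_Analysis"
begin

text \<open>Put \<open>c = sqrt q\<close>. The plane waves \<open>exp (\<i> k c \<eta> \<bullet> x)\<close> solve the interior equation, so Green's formula
  turns non-scattering into orthogonality of the Herglotz wave to all of them on the domain. By the
  divergence theorem this becomes the vanishing, for every direction \<open>\<eta>\<close>, of an oscillatory integral over
  the boundary angle and a relative angle \<open>s\<close>, with phase \<open>k \<rho>(\<theta>) (cos s + c cos (\<theta> - \<eta>))\<close>. It is entire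
  in \<open>k\<close>, so infinitely many wave numbers give a sequence tending to infinity along which it vanishes for
  all \<open>\<eta>\<close>. Stationary phase reduces it to four exponentials, one for each critical angle; by admissibility
  these depend invertibly on \<open>\<eta>\<close> through Snell's law. Averaging over short intervals of directions
  shows that an exponential with nonzero coefficient must share the slope of its phase with another one,
  and this links a point where the density is nonzero to one with direction \<open>\<eta> + pi\<close>. Condition (i)
  forbids such links by signs; under (ii), iterating them leads to a critical point of \<open>\<rho>\<close>, where the
  limiting slopes contradict each other. So the density vanishes wherever \<open>\<rho>' \<noteq> 0\<close>, hence everywhere.\<close>

text \<open>The density is only C1 and the phase only C2, and this shapes the analysis. The integral
  over s is split by explicit trigonometric cutoffs whose model integral can be differentiated
  exactly in the frequency; the rest vanishes where \<open>sin s = 0\<close>. The outcome is a sum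
  of oscillating terms without a limit of its own, so coefficients can only be compared after
  averaging over directions. The constant c / (1 + c) in admissibility is the reciprocal of 1 + 1 /
  c, the largest factor by which Snell's law magnifies the turning of the normal against the radius:
  below it the refracted direction increases strictly with the boundary angle and every critical
  point is nondegenerate. Where \<rho>' does not vanish, the maxima of the two orientations for one
  direction \<eta> have different slopes, so a maximum can only be balanced by a minimum, and the
  minima for \<eta> belong to rays of direction \<eta> + pi. Slopes carry the sign of \<rho>', so a
  link reverses the sign of \<rho>' between \<eta> and \<eta> + pi.\<close>

no_notation fps_nth (infixl "$" 75)

abbreviation expi :: "real \<Rightarrow> complex" where "expi x \<equiv> exp (\<i> * complex_of_real x)"

section \<open>Riemann--Lebesgue lemmas\<close>

text \<open>Bound and limit are demanded only off a null set because \<open>0 powr (-1/2)\<close> is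
  0: the dominating functions used later are built from inverse square roots, and such bounds may
  fail at the zeros.\<close>

lemma integral_tendsto_0_negligible:
  fixes f :: "nat \<Rightarrow> 'a::euclidean_space \<Rightarrow> complex"
  assumes T: "negligible T" and f: "\<And>n. f n integrable_on S" and h: "h integrable_on S"
    and le: "\<And>n x. x \<in> S - T \<Longrightarrow> norm (f n x) \<le> h x"
    and lim: "\<And>x. x \<in> S - T \<Longrightarrow> (\<lambda>n. f n x) \<longlonglongrightarrow> 0"
  shows "(\<lambda>n. integral S (f n)) \<longlonglongrightarrow> 0"
proof -
  define g where "g n x = (if x \<in> T then 0 else f n x)" for n x
  define h' where "h' x = (if x \<in> T then 0 else h x)" for x
  have g: "g n integrable_on S" for n
    by (rule integrable_spike[OF f T]) (auto simp: g_def)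
  have h': "h' integrable_on S"
    by (rule integrable_spike[OF h T]) (auto simp: h'_def)
  have "(\<lambda>n. integral S (g n)) \<longlonglongrightarrow> integral S (\<lambda>x. 0)"
  proof (rule dominated_convergence(2)[OF g h'])
    show "norm (g n x) \<le> h' x" if "x \<in> S" for n x
      using le that by (auto simp: g_def h'_def)
    show "(\<lambda>n. g n x) \<longlonglongrightarrow> 0" if "x \<in> S" for x
      using lim that by (cases "x \<in> T") (auto simp: g_def)
  qed
  moreover have "integral S (g n) = integral S (f n)" for n
    by (rule integral_spike[OF T]) (auto simp: g_def)
  ultimately show ?thesis by simp
qed

lemma integral_of_real_continuous:
  fixes f :: "real \<Rightarrow> real"
  assumes "continuous_on {a..b} f"
  shows "integral {a..b} (\<lambda>x. complex_of_real (f x)) = complex_of_real (integral {a..b} f)"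
  using has_integral_of_real[OF integrable_integral[OF integrable_continuous_interval[OF assms]]]
  by (rule integral_unique)

lemma norm_exp_i_real [simp]: "norm (expi x) = 1"
  by (rule norm_exp_i_times)

lemma has_vector_derivative_exp_i:
  assumes "(f has_real_derivative f') (at x within S)"
  shows "((\<lambda>x. expi (f x)) has_vector_derivative
           (\<i> * complex_of_real f') * expi (f x)) (at x within S)"
proof -
  have "((\<lambda>x. \<i> * complex_of_real (f x)) has_vector_derivative \<i> * complex_of_real f') (at x within S)"
    using assms by (auto intro!: derivative_eq_intros simp: has_real_derivative_iff_has_vector_derivative)
  from field_vector_diff_chain_within[OF this DERIV_subset[OF DERIV_exp]]
  show ?thesis by (simp add: o_def)
qed

lemma norm_integral_le_real:
  fixes f :: "real \<Rightarrow> complex"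
  assumes "a \<le> b" "continuous_on {a..b} f" "\<And>x. x \<in> {a..b} \<Longrightarrow> norm (f x) \<le> B"
  shows "norm (integral {a..b} f) \<le> B * (b - a)"
  using integral_bound[OF assms] .

text \<open>With \<psi>' as a factor of the amplitude the oscillating part is a derivative, so
  stationary points do no harm. The merely continuous G is replaced by a polynomial, for which
  integration by parts gains 1 / l n; the replacement costs a small constant uniformly in n.\<close>

lemma Riemann_Lebesgue_phase_deriv:
  fixes G :: "real \<Rightarrow> complex" and \<psi> \<psi>' :: "real \<Rightarrow> real" and l :: "nat \<Rightarrow> real"
  assumes ab: "a \<le> b" and G: "continuous_on {a..b} G"
    and \<psi>: "\<And>x. x \<in> {a..b} \<Longrightarrow> (\<psi> has_real_derivative \<psi>' x) (at x within {a..b})"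
    and \<psi>': "continuous_on {a..b} \<psi>'"
    and l: "filterlim l at_top sequentially"
  shows "(\<lambda>n. integral {a..b} (\<lambda>x. G x * complex_of_real (\<psi>' x) * expi (l n * \<psi> x))) \<longlonglongrightarrow> 0"
proof (rule LIMSEQ_I)
  fix e :: real assume e: "e > 0"
  have \<psi>c: "continuous_on {a..b} \<psi>"
    using \<psi> DERIV_continuous_on by blast
  obtain M where M: "M > 0" "\<And>x. x \<in> {a..b} \<Longrightarrow> \<bar>\<psi>' x\<bar> \<le> M"
    using compact_imp_bounded[OF compact_continuous_image[OF \<psi>' compact_Icc]]
    by (auto simp: bounded_pos)
  \<comment> \<open>Chosen so that \<open>d * M * (b - a)\<close> stays below \<open>e / 2\<close>;
    the summand 1 covers the case a = b.\<close>
  define d where "d = e / (2 * M * (b - a + 1))"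
  have d: "d > 0" using e M ab by (auto simp: d_def intro!: divide_pos_pos mult_pos_pos)
  obtain p where p: "polynomial_function p" "\<And>x. x \<in> {a..b} \<Longrightarrow> norm (G x - p x) < d"
    using Stone_Weierstrass_polynomial_function[OF compact_Icc G d] by blast
  obtain p' where p': "polynomial_function p'" "\<And>x. (p has_vector_derivative p' x) (at x)"
    using has_vector_derivative_polynomial_function[OF p(1)] by blast
  have pc: "continuous_on {a..b} p" "continuous_on {a..b} p'"
    using p(1) p'(1) continuous_on_polymonial_function by blast+
  obtain P where P: "P > 0" "\<And>x. x \<in> {a..b} \<Longrightarrow> norm (p x) \<le> P"
    using compact_imp_bounded[OF compact_continuous_image[OF pc(1) compact_Icc]]
    by (auto simp: bounded_pos)
  obtain P' where P': "P' > 0" "\<And>x. x \<in> {a..b} \<Longrightarrow> norm (p' x) \<le> P'"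
    using compact_imp_bounded[OF compact_continuous_image[OF pc(2) compact_Icc]]
    by (auto simp: bounded_pos)
  define C where "C = 2 * P + P' * (b - a)"
  have C: "C > 0" using P P' ab by (auto simp: C_def intro!: add_pos_nonneg)
  define E where "E t x = expi (t * \<psi> x)" for t x
  have Ec: "continuous_on {a..b} (E t)" for t
    unfolding E_def by (intro continuous_intros \<psi>c)
  have nE: "norm (E t x) = 1" for t x
    unfolding E_def by (rule norm_exp_i_real)
  have bound: "norm (integral {a..b} (\<lambda>x. G x * complex_of_real (\<psi>' x) * E t x)) \<le> d * M * (b - a) + C / t"
    if t: "t > 0" for t
  proof -
    have 1: "((\<lambda>x. p' x * E t x + p x * (\<i> * complex_of_real (t * \<psi>' x) * E t x)) has_integral
        p b * E t b - p a * E t a) {a..b}"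
    proof (rule fundamental_theorem_of_calculus[OF ab])
      fix x assume x: "x \<in> {a..b}"
      have "((\<lambda>x. t * \<psi> x) has_real_derivative t * \<psi>' x) (at x within {a..b})"
        using \<psi>[OF x] by (rule DERIV_cmult)
      from has_vector_derivative_exp_i[OF this]
      have "(E t has_vector_derivative \<i> * complex_of_real (t * \<psi>' x) * E t x) (at x within {a..b})"
        unfolding E_def .
      from has_vector_derivative_mult[OF has_vector_derivative_at_within[OF p'(2)] this]
      show "((\<lambda>x. p x * E t x) has_vector_derivative p' x * E t x + p x * (\<i> * complex_of_real (t * \<psi>' x) * E t x)) (at x within {a..b})"
        by (simp add: add.commute)
    qed
    have i1: "(\<lambda>x. p' x * E t x) integrable_on {a..b}"
      by (intro integrable_continuous_interval continuous_intros pc Ec)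
    have i2: "(\<lambda>x. p x * (\<i> * complex_of_real (t * \<psi>' x) * E t x)) integrable_on {a..b}"
      by (intro integrable_continuous_interval continuous_intros pc Ec \<psi>')
    have i3: "(\<lambda>x. p x * complex_of_real (\<psi>' x) * E t x) integrable_on {a..b}"
      by (intro integrable_continuous_interval continuous_intros pc Ec \<psi>')
    have i4: "(\<lambda>x. (G x - p x) * complex_of_real (\<psi>' x) * E t x) integrable_on {a..b}"
      by (intro integrable_continuous_interval continuous_intros pc Ec \<psi>' G)
    have "integral {a..b} (\<lambda>x. p' x * E t x) + integral {a..b} (\<lambda>x. p x * (\<i> * complex_of_real (t * \<psi>' x) * E t x))
       = p b * E t b - p a * E t a"
      using integral_unique[OF 1] integral_add[OF i1 i2] by simp
    moreover have "integral {a..b} (\<lambda>x. p x * (\<i> * complex_of_real (t * \<psi>' x) * E t x))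
        = \<i> * complex_of_real t * integral {a..b} (\<lambda>x. p x * complex_of_real (\<psi>' x) * E t x)"
      by (subst integral_mult_right[symmetric]) (auto intro!: integral_cong simp: algebra_simps)
    ultimately have "\<i> * complex_of_real t * integral {a..b} (\<lambda>x. p x * complex_of_real (\<psi>' x) * E t x)
        = p b * E t b - p a * E t a - integral {a..b} (\<lambda>x. p' x * E t x)"
      by (simp add: algebra_simps)
    then have "norm (\<i> * complex_of_real t * integral {a..b} (\<lambda>x. p x * complex_of_real (\<psi>' x) * E t x))
        \<le> norm (p b * E t b) + norm (p a * E t a) + norm (integral {a..b} (\<lambda>x. p' x * E t x))"
      by (simp only:) (intro norm_triangle_le_diff add_right_mono norm_triangle_ineq4)
    also have "\<dots> \<le> P + P + P' * (b - a)"
    proof (intro add_mono)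
      show "norm (p b * E t b) \<le> P" "norm (p a * E t a) \<le> P"
        using P ab by (auto simp: norm_mult nE)
      show "norm (integral {a..b} (\<lambda>x. p' x * E t x)) \<le> P' * (b - a)"
        by (rule norm_integral_le_real[OF ab]) (auto intro!: continuous_intros pc Ec P' simp: norm_mult nE)
    qed
    finally have "t * norm (integral {a..b} (\<lambda>x. p x * complex_of_real (\<psi>' x) * E t x)) \<le> C"
      using t by (simp add: norm_mult C_def)
    then have A: "norm (integral {a..b} (\<lambda>x. p x * complex_of_real (\<psi>' x) * E t x)) \<le> C / t"
      using t by (simp add: field_simps)
    have B: "norm (integral {a..b} (\<lambda>x. (G x - p x) * complex_of_real (\<psi>' x) * E t x)) \<le> d * M * (b - a)"
    proof (rule norm_integral_le_real[OF ab])
      show "continuous_on {a..b} (\<lambda>x. (G x - p x) * complex_of_real (\<psi>' x) * E t x)"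
        by (intro continuous_intros pc Ec \<psi>' G)
      fix x assume "x \<in> {a..b}"
      then show "norm ((G x - p x) * complex_of_real (\<psi>' x) * E t x) \<le> d * M"
        unfolding norm_mult nE norm_of_real mult_1_right
        using p(2)[of x] M(2)[of x] d by (intro mult_mono) auto
    qed
    have "integral {a..b} (\<lambda>x. G x * complex_of_real (\<psi>' x) * E t x) =
        integral {a..b} (\<lambda>x. (G x - p x) * complex_of_real (\<psi>' x) * E t x)
        + integral {a..b} (\<lambda>x. p x * complex_of_real (\<psi>' x) * E t x)"
      unfolding integral_add[OF i4 i3, symmetric] by (intro integral_cong) (simp add: left_diff_distrib)
    then show ?thesis using norm_triangle_mono[OF B A] by simp
  qed
  have dM: "d * M * (b - a) < e / 2 + 0" 
  proof -
    have "d * M * (b - a) = (e / 2) * ((b - a) / (b - a + 1))"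
      using M by (simp add: d_def)
    also have "\<dots> < e / 2 * 1"
      using e ab by (intro mult_strict_left_mono) auto
    finally show ?thesis by simp
  qed
  have "eventually (\<lambda>n. l n > max 1 (2 * C / e)) sequentially"
    using l unfolding filterlim_at_top_dense by blast
  then obtain N where N: "\<And>n. n \<ge> N \<Longrightarrow> l n > max 1 (2 * C / e)"
    by (auto simp: eventually_sequentially)
  show "\<exists>no. \<forall>n\<ge>no. norm (integral {a..b} (\<lambda>x. G x * complex_of_real (\<psi>' x) * expi (l n * \<psi> x)) - 0) < e"
  proof (intro exI allI impI)
    fix n assume "n \<ge> N"
    then have t: "l n > 1" "l n > 2 * C / e" using N by auto
    then have "C / l n < e / 2" using e by (simp add: field_simps)
    moreover have "0 < l n" using t by simp
    ultimately show "norm (integral {a..b} (\<lambda>x. G x * complex_of_real (\<psi>' x) * expi (l n * \<psi> x)) - 0) < e"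
      using bound[of "l n"] dM unfolding E_def diff_zero by linarith
  qed
qed

lemma Riemann_Lebesgue_phase:
  fixes g :: "real \<Rightarrow> complex" and \<psi> \<psi>' :: "real \<Rightarrow> real" and l :: "nat \<Rightarrow> real"
  assumes ab: "a \<le> b" and g: "continuous_on {a..b} g"
    and \<psi>: "\<And>x. x \<in> {a..b} \<Longrightarrow> (\<psi> has_real_derivative \<psi>' x) (at x within {a..b})"
    and \<psi>': "continuous_on {a..b} \<psi>'" and nz: "\<And>x. x \<in> {a..b} \<Longrightarrow> \<psi>' x \<noteq> 0"
    and l: "filterlim l at_top sequentially"
  shows "(\<lambda>n. integral {a..b} (\<lambda>x. g x * expi (l n * \<psi> x))) \<longlonglongrightarrow> 0"
proof -
  have "continuous_on {a..b} (\<lambda>x. g x / complex_of_real (\<psi>' x))"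
    using nz by (intro continuous_intros g \<psi>') auto
  from Riemann_Lebesgue_phase_deriv[OF ab this \<psi> \<psi>' l]
  have "(\<lambda>n. integral {a..b} (\<lambda>x. g x / complex_of_real (\<psi>' x) * complex_of_real (\<psi>' x) * expi (l n * \<psi> x))) \<longlonglongrightarrow> 0"
    by simp
  moreover have "integral {a..b} (\<lambda>x. g x / complex_of_real (\<psi>' x) * complex_of_real (\<psi>' x) * expi (l n * \<psi> x))
     = integral {a..b} (\<lambda>x. g x * expi (l n * \<psi> x))" for n
    using nz by (intro integral_cong) auto
  ultimately show ?thesis by simp
qed

text \<open>The phase may be stationary at finitely many points: there the factor
  \<open>\<psi>'\<^sup>2 / (\<psi>'\<^sup>2 + \<delta>)\<close> removes a neighbourhood of small measure.\<close>
lemma Riemann_Lebesgue_phase_finite: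
  fixes g :: "real \<Rightarrow> complex" and \<psi> \<psi>' :: "real \<Rightarrow> real" and l :: "nat \<Rightarrow> real"
  assumes ab: "a \<le> b" and g: "continuous_on {a..b} g"
    and \<psi>: "\<And>x. x \<in> {a..b} \<Longrightarrow> (\<psi> has_real_derivative \<psi>' x) (at x within {a..b})"
    and \<psi>': "continuous_on {a..b} \<psi>'" and nz: "finite {x \<in> {a..b}. \<psi>' x = 0}"
    and l: "filterlim l at_top sequentially"
  shows "(\<lambda>n. integral {a..b} (\<lambda>x. g x * expi (l n * \<psi> x))) \<longlonglongrightarrow> 0"
proof (rule LIMSEQ_I)
  fix e :: real assume e: "e > 0"
  have \<psi>c: "continuous_on {a..b} \<psi>"
    using \<psi> DERIV_continuous_on by blast
  define w where "w m x = (\<psi>' x)\<^sup>2 + 1 / real (Suc m)" for m x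
  have w: "w m x > 0" for m x
    unfolding w_def by (intro add_nonneg_pos) auto
  have wc: "continuous_on {a..b} (w m)" for m
    unfolding w_def by (intro continuous_intros \<psi>')
  \<comment> \<open>The modulus of the part of g that the factor takes away; its integral is small
    for large m by dominated convergence. It is complex-valued only to fit the convergence
    lemma.\<close>
  define r where "r m x = complex_of_real (norm (g x) * ((1 / real (Suc m)) / w m x))" for m x
  have rc: "continuous_on {a..b} (r m)" for m
    unfolding r_def using w by (intro continuous_intros g wc) (auto simp: less_imp_neq[symmetric])
  have "(\<lambda>m. integral {a..b} (r m)) \<longlonglongrightarrow> 0"
  proof (rule integral_tendsto_0_negligible[where T = "{x \<in> {a..b}. \<psi>' x = 0}" and h = "\<lambda>x. norm (g x)"])
    show "negligible {x \<in> {a..b}. \<psi>' x = 0}" using nz by (rule negligible_finite)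
    show "r m integrable_on {a..b}" for m by (intro integrable_continuous_interval rc)
    show "(\<lambda>x. norm (g x)) integrable_on {a..b}" by (intro integrable_continuous_interval continuous_intros g)
    show "norm (r m x) \<le> norm (g x)" for m x
    proof -
      have "(1 / real (Suc m)) / w m x \<le> 1" unfolding w_def using w[of m x] by (subst divide_le_eq_1_pos) (auto simp: w_def)
      moreover have "0 \<le> (1 / real (Suc m)) / w m x" using w[of m x] by (intro divide_nonneg_pos) auto
      ultimately show ?thesis unfolding r_def norm_of_real abs_mult
        by (metis abs_norm_cancel abs_of_nonneg mult_left_le norm_ge_zero)
    qed
    fix x assume "x \<in> {a..b} - {x \<in> {a..b}. \<psi>' x = 0}"
    then have x: "(\<psi>' x)\<^sup>2 > 0" by auto
    have s: "(\<lambda>m. 1 / real (Suc m)) \<longlonglongrightarrow> 0"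
      using LIMSEQ_inverse_real_of_nat by (simp add: inverse_eq_divide)
    have "(\<lambda>m. norm (g x) * ((1 / real (Suc m)) / w m x)) \<longlonglongrightarrow> norm (g x) * (0 / ((\<psi>' x)\<^sup>2 + 0))"
      unfolding w_def using x by (intro tendsto_intros s) auto
    then show "(\<lambda>m. r m x) \<longlonglongrightarrow> 0"
      unfolding r_def by (metis add.right_neutral div_0 mult_zero_right of_real_0 tendsto_of_real)
  qed
  then obtain m where "norm (integral {a..b} (r m)) < e / 2"
    using LIMSEQ_D[of "\<lambda>m. integral {a..b} (r m)" 0 "e/2"] e by auto
  then have m: "norm (integral {a..b} (\<lambda>x. norm (g x) * ((1 / real (Suc m)) / w m x))) < e / 2"
    unfolding r_def using w by (subst (asm) integral_of_real_continuous)
      (auto intro!: continuous_intros g wc simp: less_imp_neq[symmetric])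
  define G where "G x = g x * complex_of_real (\<psi>' x / w m x)" for x
  have Gc: "continuous_on {a..b} G"
    unfolding G_def using w by (intro continuous_intros g wc \<psi>') (auto simp: less_imp_neq[symmetric])
  obtain N where N: "\<And>n. n \<ge> N \<Longrightarrow> norm (integral {a..b} (\<lambda>x. G x * complex_of_real (\<psi>' x) * expi (l n * \<psi> x))) < e / 2"
    using LIMSEQ_D[OF Riemann_Lebesgue_phase_deriv[OF ab Gc \<psi> \<psi>' l], of "e/2"] e by auto
  show "\<exists>no. \<forall>n\<ge>no. norm (integral {a..b} (\<lambda>x. g x * expi (l n * \<psi> x)) - 0) < e"
  proof (intro exI allI impI)
    fix n assume n: "n \<ge> N"
    define E where "E x = expi (l n * \<psi> x)" for x
    have Ec: "continuous_on {a..b} E"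
      unfolding E_def by (intro continuous_intros \<psi>c)
    \<comment> \<open>The remaining part of g is G times \<psi>', the shape required by
      \<open>Riemann_Lebesgue_phase_deriv\<close>.\<close>
    have eq: "g x * E x = G x * complex_of_real (\<psi>' x) * E x + g x * complex_of_real ((1 / real (Suc m)) / w m x) * E x" for x
    proof -
      have "\<psi>' x / w m x * \<psi>' x + (1 / real (Suc m)) / w m x = 1"
        using w[of m x] unfolding times_divide_eq_left add_divide_distrib[symmetric]
        by (simp add: w_def power2_eq_square)
      then have "complex_of_real (\<psi>' x / w m x) * complex_of_real (\<psi>' x) + complex_of_real ((1 / real (Suc m)) / w m x) = 1"
        by (metis of_real_1 of_real_add of_real_mult)
      then show ?thesis unfolding G_def
        by (metis (no_types, lifting) distrib_left distrib_right mult.assoc mult.right_neutral)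
    qed
    have i2: "continuous_on {a..b} (\<lambda>x. g x * complex_of_real ((1 / real (Suc m)) / w m x) * E x)"
      using w by (intro continuous_intros g wc Ec) (auto simp: less_imp_neq[symmetric])
    have i1: "continuous_on {a..b} (\<lambda>x. G x * complex_of_real (\<psi>' x) * E x)"
      by (intro continuous_intros Gc \<psi>' Ec)
    have i3: "continuous_on {a..b} (\<lambda>x. norm (g x) * ((1 / real (Suc m)) / w m x))"
      using w by (intro continuous_intros g wc) (auto simp: less_imp_neq[symmetric])
    have "norm (integral {a..b} (\<lambda>x. g x * complex_of_real ((1 / real (Suc m)) / w m x) * E x)) \<le>
       integral {a..b} (\<lambda>x. norm (g x) * ((1 / real (Suc m)) / w m x))"
    proof (rule integral_norm_bound_integral)
      show "norm (g x * complex_of_real ((1 / real (Suc m)) / w m x) * E x) \<le> norm (g x) * ((1 / real (Suc m)) / w m x)" for x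
        using w[of m x] unfolding E_def norm_mult norm_exp_i_real norm_of_real by (simp add: abs_of_pos)
    qed (intro integrable_continuous_interval i2 i3)+
    also have "\<dots> < e / 2" using m by simp
    finally have 1: "norm (integral {a..b} (\<lambda>x. g x * complex_of_real ((1 / real (Suc m)) / w m x) * E x)) < e / 2" .
    have "integral {a..b} (\<lambda>x. g x * E x) = integral {a..b} (\<lambda>x. G x * complex_of_real (\<psi>' x) * E x)
        + integral {a..b} (\<lambda>x. g x * complex_of_real ((1 / real (Suc m)) / w m x) * E x)"
      unfolding eq by (intro integral_add integrable_continuous_interval i1 i2)
    then show "norm (integral {a..b} (\<lambda>x. g x * expi (l n * \<psi> x)) - 0) < e"
      using N[OF n] 1 unfolding E_def[symmetric]
      by (metis (no_types, lifting) add_strict_mono diff_zero field_sum_of_halves norm_triangle_lt)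
  qed
qed

lemma inverse_sqrt_abs_integrable_on:
  fixes x0 :: real
  assumes "u \<le> x0" "x0 \<le> v"
  shows "(\<lambda>x. \<bar>x - x0\<bar> powr (-1/2)) integrable_on {u..v}"
proof -
  have base: "(\<lambda>x::real. x powr (-1/2)) integrable_on {0..c}" if "c \<ge> 0" for c
    using that by (intro integrable_on_powr_from_0) auto
  have 1: "(\<lambda>x. \<bar>x - x0\<bar> powr (-1/2)) integrable_on {x0..v}"
  proof -
    have "(\<lambda>x. (x + - x0) powr (-1/2)) integrable_on {x0..v}"
      using integrable_shift_real_ivl[OF base[of "v - x0"], of "-x0"] assms by simp
    then show ?thesis by (rule integrable_eq) auto
  qed
  have 2: "(\<lambda>x. \<bar>x - x0\<bar> powr (-1/2)) integrable_on {u..x0}"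
  proof -
    have "(\<lambda>x. (x + x0) powr (-1/2)) integrable_on {-x0..-u}"
      using integrable_shift_real_ivl[OF base[of "x0 - u"], of "x0"] assms by simp
    then have "(\<lambda>x. (- x + x0) powr (-1/2)) integrable_on {u..x0}"
      using Henstock_Kurzweil_Integration.integrable_reflect_real[where f = "\<lambda>x. (x + x0) powr (-1/2)" and a = "-x0" and b = "-u"] by simp
    then show ?thesis by (rule integrable_eq) auto
  qed
  show ?thesis by (rule Henstock_Kurzweil_Integration.integrable_combine[OF assms 2 1])
qed

section \<open>Oscillatory integrals in two angles\<close>

lemma simple_zero_lower_bound:
  fixes f :: "real \<Rightarrow> real"
  assumes "(f has_real_derivative D) (at x)" "f x = 0" "D \<noteq> 0"
  obtains d where "d > 0" "\<And>y. \<bar>y - x\<bar> < d \<Longrightarrow> \<bar>f y\<bar> \<ge> \<bar>D\<bar> / 2 * \<bar>y - x\<bar>"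
proof -
  have "((\<lambda>y. (f y - f x) / (y - x)) \<longlongrightarrow> D) (at x)"
    using assms(1) by (simp add: has_field_derivative_iff)
  from tendstoD[OF tendsto_rabs[OF this], of "\<bar>D\<bar> / 2"] assms(3)
  obtain d where d: "d > 0" "\<And>y. y \<noteq> x \<Longrightarrow> dist y x < d \<Longrightarrow> dist \<bar>(f y - f x) / (y - x)\<bar> \<bar>D\<bar> < \<bar>D\<bar> / 2"
    unfolding eventually_at by auto
  have "\<bar>f y\<bar> \<ge> \<bar>D\<bar> / 2 * \<bar>y - x\<bar>" if "\<bar>y - x\<bar> < d" for y
  proof (cases "y = x")
    case False
    have "\<bar>D\<bar> / 2 \<le> \<bar>(f y - f x) / (y - x)\<bar>"
      using d(2)[OF False] that unfolding dist_real_def by linarith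
    then show ?thesis using False assms(2) by (simp add: abs_divide le_divide_eq)
  qed (use assms in simp)
  with d(1) show thesis by (rule that)
qed

text \<open>Infinitely many zeros in a compact interval accumulate at a zero, against the linear
  lower bound for |f| near a simple zero.\<close>

lemma finite_simple_zeros:
  fixes f f' :: "real \<Rightarrow> real"
  assumes f: "\<And>x. (f has_real_derivative f' x) (at x)"
    and simple: "\<And>x. f x = 0 \<Longrightarrow> f' x \<noteq> 0"
  shows "finite {x \<in> {a..b}. f x = 0}"
proof (rule ccontr)
  assume inf: "infinite {x \<in> {a..b}. f x = 0}"
  then obtain x where x: "x \<in> {a..b}" "x islimpt {x \<in> {a..b}. f x = 0}"
    using compact_Icc[of a b] unfolding compact_eq_Bolzano_Weierstrass
    by (metis (no_types, lifting) mem_Collect_eq subsetI)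
  have cont: "continuous_on UNIV f" using f DERIV_continuous_on by (metis UNIV_I)
  have "closed {x. f x = 0}" by (intro closed_Collect_eq cont continuous_on_const)
  moreover have "x islimpt {x. f x = 0}" by (rule islimpt_subset[OF x(2)]) auto
  ultimately have fx: "f x = 0" by (auto simp: closed_limpt)
  obtain d where d: "d > 0" "\<And>y. \<bar>y - x\<bar> < d \<Longrightarrow> \<bar>f y\<bar> \<ge> \<bar>f' x\<bar> / 2 * \<bar>y - x\<bar>"
    using simple_zero_lower_bound[OF f fx simple[OF fx]] by blast
  obtain y where y: "f y = 0" "y \<noteq> x" "dist y x < d"
    using x(2) d(1) unfolding islimpt_approachable by blast
  then have "\<bar>f' x\<bar> / 2 * \<bar>y - x\<bar> \<le> 0" using d(2)[of y] by (simp add: dist_real_def)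
  with y(2) simple[OF fx] show False by (simp add: mult_le_0_iff)
qed

text \<open>Near a simple zero x the modulus of f is at least a multiple of |y - x|, so an
  integrable power dominates; compactness of the interval glues the local statements.\<close>

lemma inverse_sqrt_simple_zeros_integrable_on:
  fixes f f' :: "real \<Rightarrow> real"
  assumes f: "\<And>x. (f has_real_derivative f' x) (at x)"
    and simple: "\<And>x. f x = 0 \<Longrightarrow> f' x \<noteq> 0"
  shows "(\<lambda>x. \<bar>f x\<bar> powr (-1/2)) integrable_on {a..b}"
proof -
  have cont: "continuous_on UNIV f" using f DERIV_continuous_on by (metis UNIV_I)
  have "(\<lambda>x. \<bar>f x\<bar> powr (-1/2)) integrable_on cbox a b"
  proof (rule integrable_on_little_subintervals, intro ballI)
    fix x assume "x \<in> cbox a b"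
    show "\<exists>d>0. \<forall>u v. x \<in> cbox u v \<and> cbox u v \<subseteq> ball x d \<and> cbox u v \<subseteq> cbox a b \<longrightarrow>
        (\<lambda>x. \<bar>f x\<bar> powr (-1/2)) integrable_on cbox u v"
    proof (cases "f x = 0")
      case False
      have "open {y. f y \<noteq> 0}" by (intro open_Collect_neq cont continuous_on_const)
      then obtain d where d: "d > 0" "ball x d \<subseteq> {y. f y \<noteq> 0}"
        using False open_contains_ball by blast
      have "(\<lambda>x. \<bar>f x\<bar> powr (-1/2)) integrable_on cbox u v" if "cbox u v \<subseteq> ball x d" for u v
        by (intro integrable_continuous continuous_intros continuous_on_subset[OF cont]) (use that d in auto)
      with d(1) show ?thesis by blast
    next
      case True
      obtain d where d: "d > 0" "\<And>y. \<bar>y - x\<bar> < d \<Longrightarrow> \<bar>f y\<bar> \<ge> \<bar>f' x\<bar> / 2 * \<bar>y - x\<bar>"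
        using simple_zero_lower_bound[OF f True simple[OF True]] by blast
      define m where "m = \<bar>f' x\<bar> / 2"
      have m: "m > 0" using simple[OF True] by (simp add: m_def)
      have "(\<lambda>x. \<bar>f x\<bar> powr (-1/2)) integrable_on cbox u v" if uv: "x \<in> cbox u v" "cbox u v \<subseteq> ball x d" for u v
      proof (rule measurable_bounded_by_integrable_imp_integrable)
        show "(\<lambda>x. \<bar>f x\<bar> powr (-1/2)) \<in> borel_measurable (lebesgue_on (cbox u v))"
          using borel_measurable_continuous_onI[OF cont] by (intro measurable_completion measurable_restrict_space1) measurable
        show "(\<lambda>y. m powr (-1/2) * \<bar>y - x\<bar> powr (-1/2)) integrable_on cbox u v"
          using inverse_sqrt_abs_integrable_on[of u x v] uv(1) by (intro integrable_on_mult_right) auto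
        show "cbox u v \<in> sets lebesgue" by simp
        fix y assume y: "y \<in> cbox u v"
        show "norm (\<bar>f y\<bar> powr (-1/2)) \<le> m powr (-1/2) * \<bar>y - x\<bar> powr (-1/2)"
        \<comment> \<open>At the zero itself both sides are 0, since \<open>0 powr (-1/2)\<close> is
          0.\<close>
        proof (cases "y = x")
          case False
          have "\<bar>y - x\<bar> < d" using uv y by (auto simp: dist_real_def subset_iff)
          from d(2)[OF this] have "m * \<bar>y - x\<bar> \<le> \<bar>f y\<bar>" by (simp add: m_def)
          then have "\<bar>f y\<bar> powr (-1/2) \<le> (m * \<bar>y - x\<bar>) powr (-1/2)"
            using m False by (intro powr_mono2') auto
          then show ?thesis using m by (simp add: powr_mult)
        qed (use True in simp)
      qed
      with d(1) show ?thesis by blast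
    qed
  qed
  then show ?thesis by simp
qed

lemma integral_swap_real:
  fixes f :: "real \<Rightarrow> real \<Rightarrow> complex"
  assumes "continuous_on UNIV (\<lambda>p. f (fst p) (snd p))"
  shows "integral {a..b} (\<lambda>t. integral {c..d} (\<lambda>s. f s t)) = integral {c..d} (\<lambda>s. integral {a..b} (\<lambda>t. f s t))"
proof -
  have "continuous_on (cbox (c,a) (d,b)) (\<lambda>(s,t). f s t)"
    using continuous_on_subset[OF assms subset_UNIV] by (simp add: case_prod_unfold)
  from integral_swap_continuous[OF this] show ?thesis by simp
qed

lemma continuous_on_integral_param:
  fixes f :: "real \<Rightarrow> real \<Rightarrow> complex"
  assumes "continuous_on UNIV (\<lambda>p. f (fst p) (snd p))"
  shows "continuous_on UNIV (\<lambda>t. integral {c..d} (\<lambda>s. f s t))"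
proof -
  have "continuous_on UNIV (\<lambda>p. f (snd p) (fst p))"
    by (rule continuous_on_compose2[OF assms, where f = "\<lambda>p. (snd p, fst p)", simplified]) (auto intro!: continuous_intros)
  from continuous_on_subset[OF this subset_UNIV]
  have "continuous_on (UNIV \<times> cbox c d) (\<lambda>(t,s). f s t)" by (simp add: case_prod_unfold)
  from integral_continuous_on_param[OF this] show ?thesis by simp
qed

section \<open>Phases on the torus that are linear in \<open>cos s\<close>\<close>

text \<open>For the phase \<open>r t * cos s + m t\<close> positivity of r forces
  \<open>sin s = 0\<close> at critical points. There the phase restricts to m + r or m - r, and the
  last two assumptions make the critical points of these two functions nondegenerate. In the
  application r is \<rho> and m is \<open>c * \<rho> t * cos (t - \<eta>)\<close>.\<close>

locale polar_phase =
  fixes r r1 r2 m m1 m2 :: "real \<Rightarrow> real"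
  assumes r: "\<And>t. (r has_real_derivative r1 t) (at t)"
    and r1: "\<And>t. (r1 has_real_derivative r2 t) (at t)"
    and r2: "continuous_on UNIV r2"
    and m: "\<And>t. (m has_real_derivative m1 t) (at t)"
    and m1: "\<And>t. (m1 has_real_derivative m2 t) (at t)"
    and m2: "continuous_on UNIV m2"
    and r_pos: "\<And>t. r t > 0"
    and r_per: "\<And>t. r (t + 2 * pi) = r t"
    and m_per: "\<And>t. m (t + 2 * pi) = m t"
    and simple_plus: "\<And>t. m1 t + r1 t = 0 \<Longrightarrow> m2 t + r2 t \<noteq> 0"
    and simple_minus: "\<And>t. m1 t - r1 t = 0 \<Longrightarrow> m2 t - r2 t \<noteq> 0"
begin

lemma cont_r [continuous_intros]: "continuous_on A f \<Longrightarrow> continuous_on A (\<lambda>x. r (f x))"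
  and cont_r1 [continuous_intros]: "continuous_on A f \<Longrightarrow> continuous_on A (\<lambda>x. r1 (f x))"
  and cont_r2 [continuous_intros]: "continuous_on A f \<Longrightarrow> continuous_on A (\<lambda>x. r2 (f x))"
  and cont_m [continuous_intros]: "continuous_on A f \<Longrightarrow> continuous_on A (\<lambda>x. m (f x))"
  and cont_m1 [continuous_intros]: "continuous_on A f \<Longrightarrow> continuous_on A (\<lambda>x. m1 (f x))"
  and cont_m2 [continuous_intros]: "continuous_on A f \<Longrightarrow> continuous_on A (\<lambda>x. m2 (f x))"
  for f :: "'a::t2_space \<Rightarrow> real"
proof -
  have *: "continuous_on UNIV r" "continuous_on UNIV r1" "continuous_on UNIV m" "continuous_on UNIV m1"
    using r r1 m m1 DERIV_continuous_on by (metis UNIV_I)+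
  show "continuous_on A f \<Longrightarrow> continuous_on A (\<lambda>x. r (f x))"
    "continuous_on A f \<Longrightarrow> continuous_on A (\<lambda>x. r1 (f x))"
    "continuous_on A f \<Longrightarrow> continuous_on A (\<lambda>x. r2 (f x))"
    "continuous_on A f \<Longrightarrow> continuous_on A (\<lambda>x. m (f x))"
    "continuous_on A f \<Longrightarrow> continuous_on A (\<lambda>x. m1 (f x))"
    "continuous_on A f \<Longrightarrow> continuous_on A (\<lambda>x. m2 (f x))"
    using * r2 m2 by (auto intro: continuous_on_compose2)
qed

lemma deriv_periodic:
  fixes f f' :: "real \<Rightarrow> real"
  assumes "\<And>t. (f has_real_derivative f' t) (at t)" "\<And>t. f (t + p) = f t"
  shows "f' (t + p) = f' t"
proof -
  have "((\<lambda>t. f (t + p)) has_real_derivative f' (t + p)) (at t)"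
    using assms(1)[of "t + p"] by (simp add: DERIV_shift)
  with assms show ?thesis by (simp add: DERIV_unique)
qed

lemma r1_per: "r1 (t + 2 * pi) = r1 t" and m1_per: "m1 (t + 2 * pi) = m1 t"
  by (rule deriv_periodic[OF r r_per], rule deriv_periodic[OF m m_per])

definition "Phi s t = r t * cos s + m t"
definition "Ps s t = - r t * sin s"
definition "Pt s t = r1 t * cos s + m1 t"
definition "Pss s t = - r t * cos s"
definition "Pst s t = - r1 t * sin s"
definition "Ptt s t = r2 t * cos s + m2 t"
text \<open>The squared length of the gradient; \<open>ws e + wt e\<close> below is the divergence
  of the regularised field (Ps, Pt) / (NN + e).\<close>

definition "NN s t = (Ps s t)\<^sup>2 + (Pt s t)\<^sup>2"
definition "ws e s t = (Pss s t * (NN s t + e) - Ps s t * (2 * (Ps s t * Pss s t + Pt s t * Pst s t))) / (NN s t + e)\<^sup>2"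
definition "wt e s t = (Ptt s t * (NN s t + e) - Pt s t * (2 * (Ps s t * Pst s t + Pt s t * Ptt s t))) / (NN s t + e)\<^sup>2"

lemma NN_nonneg: "NN s t \<ge> 0" by (simp add: NN_def)

lemma deriv_Phi_s: "((\<lambda>s. Phi s t) has_real_derivative Ps s t) (at s)"
  unfolding Phi_def Ps_def by (auto intro!: derivative_eq_intros)

lemma deriv_Phi_t: "((\<lambda>t. Phi s t) has_real_derivative Pt s t) (at t)"
  unfolding Phi_def Pt_def by (auto intro!: derivative_eq_intros r m)

lemma deriv_ws:
  assumes "e > 0"
  shows "((\<lambda>s. Ps s t / (NN s t + e)) has_real_derivative ws e s t) (at s)"
proof -
  have "NN s t + e \<noteq> 0" using NN_nonneg[of s t] assms by linarith
  moreover have "((\<lambda>s. Ps s t) has_real_derivative Pss s t) (at s)"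
    unfolding Ps_def Pss_def by (auto intro!: derivative_eq_intros)
  moreover have "((\<lambda>s. Pt s t) has_real_derivative Pst s t) (at s)"
    unfolding Pt_def Pst_def by (auto intro!: derivative_eq_intros)
  ultimately show ?thesis unfolding NN_def ws_def
    by (auto intro!: derivative_eq_intros simp: power2_eq_square)
qed

lemma deriv_wt:
  assumes "e > 0"
  shows "((\<lambda>t. Pt s t / (NN s t + e)) has_real_derivative wt e s t) (at t)"
proof -
  have "NN s t + e \<noteq> 0" using NN_nonneg[of s t] assms by linarith
  moreover have "((\<lambda>t. Ps s t) has_real_derivative Pst s t) (at t)"
    unfolding Ps_def Pst_def by (auto intro!: derivative_eq_intros r)
  moreover have "((\<lambda>t. Pt s t) has_real_derivative Ptt s t) (at t)"
    unfolding Pt_def Ptt_def by (auto intro!: derivative_eq_intros r1 m1)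
  ultimately show ?thesis unfolding NN_def wt_def
    by (auto intro!: derivative_eq_intros simp: power2_eq_square)
qed

lemma cont_phase [continuous_intros]:
  fixes f g :: "'a::t2_space \<Rightarrow> real"
  assumes "continuous_on A f" "continuous_on A g"
  shows "continuous_on A (\<lambda>x. Phi (f x) (g x))" "continuous_on A (\<lambda>x. Ps (f x) (g x))"
    "continuous_on A (\<lambda>x. Pt (f x) (g x))" "continuous_on A (\<lambda>x. Pss (f x) (g x))"
    "continuous_on A (\<lambda>x. Pst (f x) (g x))" "continuous_on A (\<lambda>x. Ptt (f x) (g x))"
    "continuous_on A (\<lambda>x. NN (f x) (g x))"
  unfolding Phi_def Ps_def Pt_def Pss_def Pst_def Ptt_def NN_def by (intro continuous_intros assms)+

lemma cont_w [continuous_intros]: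
  fixes f g :: "'a::t2_space \<Rightarrow> real"
  assumes "continuous_on A f" "continuous_on A g" "\<And>x. x \<in> A \<Longrightarrow> NN (f x) (g x) + e > 0"
  shows "continuous_on A (\<lambda>x. ws e (f x) (g x))" "continuous_on A (\<lambda>x. wt e (f x) (g x))"
  unfolding ws_def wt_def using assms(3) by (auto intro!: continuous_intros assms(1,2) simp: less_imp_neq[symmetric])

lemma phase_second_bound:
  obtains B where "B > 0" "\<And>s t. t \<in> {-pi..pi} \<Longrightarrow> \<bar>Pss s t\<bar> \<le> B" "\<And>s t. t \<in> {-pi..pi} \<Longrightarrow> \<bar>Pst s t\<bar> \<le> B"
    "\<And>s t. t \<in> {-pi..pi} \<Longrightarrow> \<bar>Ptt s t\<bar> \<le> B" "\<And>t. t \<in> {-pi..pi} \<Longrightarrow> \<bar>r1 t\<bar> \<le> B"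
proof -
  have "bounded (h ` {-pi..pi})" if "continuous_on {-pi..pi} h" for h :: "real \<Rightarrow> real"
    using compact_imp_bounded[OF compact_continuous_image[OF that compact_Icc]] .
  then have *: "\<exists>B>0. \<forall>t\<in>{-pi..pi}. \<bar>h t\<bar> \<le> B" if "continuous_on {-pi..pi} h" for h :: "real \<Rightarrow> real"
    using that unfolding bounded_pos by fastforce
  have "continuous_on {-pi..pi} (\<lambda>t. \<bar>r t\<bar> + \<bar>r1 t\<bar> + \<bar>r2 t\<bar> + \<bar>m2 t\<bar>)"
    by (intro continuous_intros)
  from *[OF this] obtain A where A: "A > 0" "\<And>t. t \<in> {-pi..pi} \<Longrightarrow> \<bar>\<bar>r t\<bar> + \<bar>r1 t\<bar> + \<bar>r2 t\<bar> + \<bar>m2 t\<bar>\<bar> \<le> A"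
    by blast
  have cs: "\<bar>x * cos s\<bar> \<le> \<bar>x\<bar>" "\<bar>x * sin s\<bar> \<le> \<bar>x\<bar>" for x s :: real
    by (auto simp: abs_mult mult_left_le)
  show thesis
  proof (rule that[OF A(1)])
    fix s t assume t: "t \<in> {-pi..pi}"
    have S: "\<bar>r t\<bar> + \<bar>r1 t\<bar> + \<bar>r2 t\<bar> + \<bar>m2 t\<bar> \<le> A" using A(2)[OF t] by (rule order_trans[OF abs_ge_self])
      note nn = abs_ge_zero[of "r t"] abs_ge_zero[of "r1 t"] abs_ge_zero[of "r2 t"] abs_ge_zero[of "m2 t"]
      have *: "x \<le> A" "y \<le> A" "z + w \<le> A" if "x + y + z + w \<le> A" "0 \<le> x" "0 \<le> y" "0 \<le> z" "0 \<le> w" for x y z w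
        using that by linarith+
      note b = *[OF S nn]
      show "\<bar>r1 t\<bar> \<le> A" by (rule b(2))
      show "\<bar>Pss s t\<bar> \<le> A" using order_trans[OF cs(1) b(1)] by (simp add: Pss_def)
      show "\<bar>Pst s t\<bar> \<le> A" using order_trans[OF cs(2) b(2)] by (simp add: Pst_def)
      show "\<bar>Ptt s t\<bar> \<le> A" unfolding Ptt_def
        by (rule order_trans[OF abs_triangle_ineq order_trans[OF add_right_mono[OF cs(1)] b(3)]])
  qed
qed

text \<open>The bound is independent of e, so e may tend to 0. It has size 1 / NN; together with an
  amplitude of size sqrt NN this leaves 1 / sqrt NN, which is still integrable.\<close>

lemma w_bound:
  assumes "e \<ge> 0" "NN s t > 0" "\<bar>Pss s t\<bar> \<le> B" "\<bar>Pst s t\<bar> \<le> B" "\<bar>Ptt s t\<bar> \<le> B"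
  shows "\<bar>ws e s t\<bar> \<le> 5 * B / NN s t" "\<bar>wt e s t\<bar> \<le> 5 * B / NN s t"
proof -
  have main: "\<bar>(z * (N + e) - x * (2 * (x * z' + y * z''))) / (N + e)\<^sup>2\<bar> \<le> 5 * B / N"
    if N: "N = NN s t" and xy: "x\<^sup>2 + y\<^sup>2 = N" and z: "\<bar>z\<bar> \<le> B" "\<bar>z'\<bar> \<le> B" "\<bar>z''\<bar> \<le> B" for x y z z' z'' N
  proof -
    have Np: "N > 0" using assms N by simp
    have B: "B \<ge> 0" using z(1) by linarith
    have xx: "\<bar>x\<bar> * \<bar>x\<bar> \<le> N" using xy by (simp add: power2_eq_square[symmetric]) (metis le_add_same_cancel1 zero_le_power2)
    have "2 * (\<bar>x\<bar> * \<bar>y\<bar>) \<le> \<bar>x\<bar>\<^sup>2 + \<bar>y\<bar>\<^sup>2" using sum_squares_bound[of "\<bar>x\<bar>" "\<bar>y\<bar>"] by simp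
    then have xy2: "\<bar>x\<bar> * \<bar>y\<bar> \<le> N / 2" using xy by simp
    have "\<bar>z * (N + e) - x * (2 * (x * z' + y * z''))\<bar> \<le> \<bar>z * (N + e)\<bar> + \<bar>x * (2 * (x * z' + y * z''))\<bar>"
      by (rule abs_triangle_ineq4)
    also have "\<bar>z * (N + e)\<bar> \<le> B * (N + e)" using z assms(1) Np by (simp add: abs_mult mult_right_mono)
    also have "\<bar>x * (2 * (x * z' + y * z''))\<bar> \<le> 2 * (\<bar>x\<bar> * \<bar>x\<bar> * \<bar>z'\<bar>) + 2 * (\<bar>x\<bar> * \<bar>y\<bar> * \<bar>z''\<bar>)"
    proof -
      have "x * (2 * (x * z' + y * z'')) = 2 * (x * x * z') + 2 * (x * y * z'')" by algebra
      then have "\<bar>x * (2 * (x * z' + y * z''))\<bar> \<le> \<bar>2 * (x * x * z')\<bar> + \<bar>2 * (x * y * z'')\<bar>"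
        by (simp only: abs_triangle_ineq)
      then show ?thesis by (simp add: abs_mult)
    qed
    also have "\<bar>x\<bar> * \<bar>x\<bar> * \<bar>z'\<bar> \<le> N * B" using xx z B Np by (intro mult_mono) auto
    also have "\<bar>x\<bar> * \<bar>y\<bar> * \<bar>z''\<bar> \<le> (N / 2) * B" using xy2 z B Np by (intro mult_mono) auto
    finally have "\<bar>z * (N + e) - x * (2 * (x * z' + y * z''))\<bar> \<le> B * (N + e) + (3 * N * B)" by (simp add: algebra_simps)
    also have "\<dots> \<le> 5 * B * (N + e)"
      using mult_nonneg_nonneg[OF B assms(1)] mult_nonneg_nonneg[OF B less_imp_le[OF Np]]
      by (simp add: algebra_simps)
    finally have "\<bar>z * (N + e) - x * (2 * (x * z' + y * z''))\<bar> / (N + e)\<^sup>2 \<le> 5 * B * (N + e) / (N + e)\<^sup>2"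
      by (intro divide_right_mono) auto
    also have "\<dots> = 5 * B / (N + e)" using Np assms(1) by (simp add: power2_eq_square)
    also have "\<dots> \<le> 5 * B / N" using Np assms(1) B by (intro divide_left_mono) auto
    finally show ?thesis by (simp add: abs_divide)
  qed
  show "\<bar>ws e s t\<bar> \<le> 5 * B / NN s t" unfolding ws_def
    by (rule main[OF refl _ assms(3,3,4)]) (simp add: NN_def)
  have "Pt s t * (2 * (Ps s t * Pst s t + Pt s t * Ptt s t)) = Pt s t * (2 * (Pt s t * Ptt s t + Ps s t * Pst s t))"
    by (simp add: add.commute)
  then show "\<bar>wt e s t\<bar> \<le> 5 * B / NN s t" unfolding wt_def
    using main[OF refl _ assms(5,5,4), of "Pt s t" "Ps s t"] by (simp add: NN_def add.commute)
qed

text \<open>Up to constants, sqrt NN dominates |sin s| and also one of |m1 + r1|, |m1 - r1|,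
  depending on the sign of \<open>cos s\<close>. The geometric mean of the two estimates separates
  the variables: 1 / sqrt NN is bounded by a product of inverse square roots in s and in t, each
  integrable.\<close>

lemma inverse_sqrt_NN_bound:
  obtains C where "C > 0" "\<And>(s::real) t. t \<in> {-pi..pi} \<Longrightarrow> sin s \<noteq> 0 \<Longrightarrow> m1 t + r1 t \<noteq> 0 \<Longrightarrow> m1 t - r1 t \<noteq> 0 \<Longrightarrow>
     NN s t > 0 \<and> 1 / sqrt (NN s t) \<le> C * \<bar>sin s\<bar> powr (-1/2) * (\<bar>m1 t + r1 t\<bar> powr (-1/2) + \<bar>m1 t - r1 t\<bar> powr (-1/2))"
proof -
  have ex: "\<exists>x\<in>{-pi..pi}. \<forall>y\<in>{-pi..pi}. r x \<le> r y"
    by (rule continuous_attains_inf) (auto intro!: continuous_intros)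
  then obtain p where p: "p > 0" "\<And>t. t \<in> {-pi..pi} \<Longrightarrow> p \<le> r t" using r_pos by blast
  obtain B where B: "B > 0" "\<And>t. t \<in> {-pi..pi} \<Longrightarrow> \<bar>r1 t\<bar> \<le> B" using phase_second_bound by metis
  define K where "K = (1 + B / p) / p"
  have K: "K > 0" using p B by (auto simp: K_def intro!: divide_pos_pos add_pos_pos)
  have key: "1 / sqrt N \<le> sqrt K * \<bar>x\<bar> powr (-1/2) * \<bar>f\<bar> powr (-1/2)"
    if N: "N > 0" "\<bar>x\<bar> \<le> sqrt N / p" "\<bar>f\<bar> \<le> (1 + B / p) * sqrt N" "x \<noteq> 0" "f \<noteq> 0" for N x f
  proof -
    have "\<bar>x\<bar> * \<bar>f\<bar> \<le> sqrt N / p * ((1 + B / p) * sqrt N)" using that p B by (intro mult_mono) auto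
    also have "\<dots> = K * N" using N by (simp add: K_def)
    finally have "1 / N \<le> K / (\<bar>x\<bar> * \<bar>f\<bar>)" using N by (simp add: field_simps)
    then have "sqrt (1 / N) \<le> sqrt (K / (\<bar>x\<bar> * \<bar>f\<bar>))" by (rule real_sqrt_le_mono)
    also have "\<dots> = sqrt K * \<bar>x\<bar> powr (-1/2) * \<bar>f\<bar> powr (-1/2)"
    proof -
      have pw: "y powr (-1/2) = 1 / sqrt y" if "y > 0" for y :: real
        using powr_minus_divide[of y "1/2"] powr_half_sqrt[of y] that by simp
      have "\<bar>x\<bar> > 0" "\<bar>f\<bar> > 0" using that by auto
      then show ?thesis by (simp only: real_sqrt_divide real_sqrt_mult pw) simp
    qed
    finally show ?thesis by (simp add: real_sqrt_divide)
  qed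
  show thesis
  proof (rule that[of "sqrt K"])
    show "sqrt K > 0" using K by simp
    fix s t :: real assume t: "t \<in> {-pi..pi}" and s: "sin s \<noteq> 0" and f: "m1 t + r1 t \<noteq> 0" "m1 t - r1 t \<noteq> 0"
    have "Ps s t \<noteq> 0" using s r_pos[of t] by (simp add: Ps_def)
    then have N: "NN s t > 0" by (simp add: NN_def sum_power2_gt_zero_iff)
    have Ps: "\<bar>Ps s t\<bar> \<le> sqrt (NN s t)" and Pt: "\<bar>Pt s t\<bar> \<le> sqrt (NN s t)"
      unfolding NN_def by (auto intro: real_le_rsqrt)
    have "p * \<bar>sin s\<bar> \<le> \<bar>Ps s t\<bar>" using p(2)[OF t] r_pos[of t] by (simp add: Ps_def abs_mult mult_right_mono)
    with Ps have sn: "\<bar>sin s\<bar> \<le> sqrt (NN s t) / p" using p(1) by (simp add: field_simps)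
    have up: "B * \<bar>sin s\<bar> \<le> B / p * sqrt (NN s t)" using mult_left_mono[OF sn, of B] B by simp
    \<comment> \<open>Replacing \<open>cos s\<close> by its sign in Pt changes it by at most B |sin
      s|, which Ps controls.\<close>
    have c1: "1 - \<bar>cos s\<bar> \<le> \<bar>sin s\<bar>"
    proof -
      have "1 = \<bar>sin s\<bar>\<^sup>2 + \<bar>cos s\<bar>\<^sup>2" by simp
      also have "\<dots> \<le> \<bar>sin s\<bar> + \<bar>cos s\<bar>" by (unfold power2_eq_square, intro add_mono mult_left_le) auto
      finally show ?thesis by simp
    qed
    have aux: "\<bar>r1 t * (1 - \<bar>cos s\<bar>)\<bar> \<le> B * \<bar>sin s\<bar>"
      unfolding abs_mult using B(2)[OF t] c1 B(1) by (intro mult_mono) auto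
    define u v w where "u = \<bar>m1 t + r1 t\<bar> powr (-1/2)" and "v = \<bar>m1 t - r1 t\<bar> powr (-1/2)" and "w = sqrt K * \<bar>sin s\<bar> powr (-1/2)"
    have nonneg: "u \<ge> 0" "v \<ge> 0" "w \<ge> 0" using K by (auto simp: u_def v_def w_def)
    have "1 / sqrt (NN s t) \<le> w * u \<or> 1 / sqrt (NN s t) \<le> w * v"
    proof (cases "cos s \<ge> 0")
      case True
      have "m1 t + r1 t = Pt s t + r1 t * (1 - \<bar>cos s\<bar>)" using True by (simp add: Pt_def algebra_simps)
      then have "\<bar>m1 t + r1 t\<bar> \<le> (1 + B / p) * sqrt (NN s t)"
        using abs_triangle_ineq[of "Pt s t" "r1 t * (1 - \<bar>cos s\<bar>)"] aux up Pt by (simp add: distrib_right)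
      from key[OF N sn this s f(1)] show ?thesis unfolding u_def v_def w_def by blast
    next
      case False
      have "m1 t - r1 t = Pt s t + - (r1 t * (1 - \<bar>cos s\<bar>))" using False by (simp add: Pt_def algebra_simps)
      then have "\<bar>m1 t - r1 t\<bar> \<le> (1 + B / p) * sqrt (NN s t)"
        using abs_triangle_ineq[of "Pt s t" "- (r1 t * (1 - \<bar>cos s\<bar>))"] aux up Pt by (simp add: distrib_right)
      from key[OF N sn this s f(2)] show ?thesis unfolding u_def v_def w_def by blast
    qed
    then have "1 / sqrt (NN s t) \<le> w * (u + v)"
      using mult_nonneg_nonneg[OF nonneg(3,1)] mult_nonneg_nonneg[OF nonneg(3,2)] by (auto simp: distrib_left)
    with N show "NN s t > 0 \<and> 1 / sqrt (NN s t) \<le> sqrt K * \<bar>sin s\<bar> powr (-1/2) * (\<bar>m1 t + r1 t\<bar> powr (-1/2) + \<bar>m1 t - r1 t\<bar> powr (-1/2))"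
      unfolding u_def v_def w_def by simp
  qed
qed

end

lemma integral_periodic_derivative_0:
  fixes U U' :: "real \<Rightarrow> complex"
  assumes "\<And>x. (U has_vector_derivative U' x) (at x)" "\<And>x. U (x + 2 * pi) = U x"
  shows "integral {-pi..pi} U' = 0"
proof -
  have "(U' has_integral U pi - U (-pi)) {-pi..pi}"
    by (rule fundamental_theorem_of_calculus) (auto intro: has_vector_derivative_at_within assms)
  moreover have "U pi = U (-pi)" using assms(2)[of "-pi"] by simp
  ultimately show ?thesis by (simp add: integral_unique)
qed

context polar_phase
begin

lemma phase_per:
  "Ps (s + 2 * pi) t = Ps s t" "Pt (s + 2 * pi) t = Pt s t" "Phi (s + 2 * pi) t = Phi s t" "NN (s + 2 * pi) t = NN s t"
  "Ps s (t + 2 * pi) = Ps s t" "Pt s (t + 2 * pi) = Pt s t" "Phi s (t + 2 * pi) = Phi s t" "NN s (t + 2 * pi) = NN s t"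
  unfolding Ps_def Pt_def Phi_def NN_def by (simp_all add: r_per m_per r1_per m1_per)

text \<open>The double integral is integrated by parts against the regularised field
  \<open>\<nabla>\<Phi> / (\<bar>\<nabla>\<Phi>\<bar>\<^sup>2 + \<epsilon>)\<close> with \<open>\<epsilon> = \<kappa>\<^sup>-\<^sup>4\<close>; since the amplitude vanishes at \<open>s = 0\<close> and \<open>s = pi\<close>,
  what remains is dominated by an integrable function.\<close>
lemma remainder_tendsto_0:
  fixes a a1 a2 :: "real \<Rightarrow> real \<Rightarrow> complex" and \<kappa> :: "nat \<Rightarrow> real"
  assumes a1: "\<And>s t. ((\<lambda>s. a s t) has_vector_derivative a1 s t) (at s)"
    and a2: "\<And>s t. ((\<lambda>t. a s t) has_vector_derivative a2 s t) (at t)"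
    and ca: "continuous_on UNIV (\<lambda>p. a (fst p) (snd p))"
    and cas: "continuous_on UNIV (\<lambda>p. a1 (fst p) (snd p))"
    and cat: "continuous_on UNIV (\<lambda>p. a2 (fst p) (snd p))"
    and per: "\<And>s t. a (s + 2 * pi) t = a s t" "\<And>s t. a s (t + 2 * pi) = a s t"
    and van: "\<And>s t. s \<in> {-pi..pi} \<Longrightarrow> t \<in> {-pi..pi} \<Longrightarrow> norm (a s t) \<le> C * \<bar>sin s\<bar>"
    and \<kappa>: "filterlim \<kappa> at_top sequentially" and \<kappa>_pos: "\<And>n. \<kappa> n > 0"
  shows "(\<lambda>n. \<kappa> n * integral {-pi..pi} (\<lambda>t. integral {-pi..pi} (\<lambda>s. a s t * expi (\<kappa> n * Phi s t)))) \<longlonglongrightarrow> 0"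
proof -
  have cont2: "continuous_on A (\<lambda>x. h (f x) (g x))" if h: "continuous_on UNIV (\<lambda>p. h (fst p) (snd p))"
      and fg: "continuous_on A f" "continuous_on A g"
    for h :: "real \<Rightarrow> real \<Rightarrow> complex" and f g :: "'b::t2_space \<Rightarrow> real" and A
    using continuous_on_compose2[OF h continuous_on_Pair[OF fg]] by simp
  have ca1: "continuous_on A (\<lambda>x. a (f x) (g x))" "continuous_on A (\<lambda>x. a1 (f x) (g x))" "continuous_on A (\<lambda>x. a2 (f x) (g x))"
    if "continuous_on A f" "continuous_on A g" for f g :: "real \<Rightarrow> real" and A
    using that ca cas cat by (auto intro: cont2)
  have ca2: "continuous_on A (\<lambda>x. a (f x) (g x))" "continuous_on A (\<lambda>x. a1 (f x) (g x))" "continuous_on A (\<lambda>x. a2 (f x) (g x))"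
    if "continuous_on A f" "continuous_on A g" for f g :: "real \<times> real \<Rightarrow> real" and A
    using that ca cas cat by (auto intro: cont2)
  \<comment> \<open>The divergence of a times the regularised field, that is, the amplitude left by
    one integration by parts.\<close>
  define G where "G e s t = a1 s t * complex_of_real (Ps s t / (NN s t + e)) + a s t * complex_of_real (ws e s t)
     + (a2 s t * complex_of_real (Pt s t / (NN s t + e)) + a s t * complex_of_real (wt e s t))" for e s t
  define E where "E k s t = expi (k * Phi s t)" for k s t
  have E_s: "((\<lambda>s. E k s t) has_vector_derivative \<i> * complex_of_real (k * Ps s t) * E k s t) (at s)" for k s t
    unfolding E_def by (rule has_vector_derivative_exp_i) (rule DERIV_cmult[OF deriv_Phi_s])
  have E_t: "((\<lambda>t. E k s t) has_vector_derivative \<i> * complex_of_real (k * Pt s t) * E k s t) (at t)" for k s t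
    unfolding E_def by (rule has_vector_derivative_exp_i) (rule DERIV_cmult[OF deriv_Phi_t])
  have nE: "norm (E k s t) = 1" for k s t unfolding E_def by (rule norm_exp_i_real)
  have Ne: "NN s t + e > 0" if "e > 0" for e s t using NN_nonneg[of s t] that by linarith
  have Ne0: "NN s t + e \<noteq> 0" if "e > 0" for e s t using Ne[OF that, of s t] by simp
  have cE: "continuous_on A (\<lambda>x. E k (f x) (g x))" if "continuous_on A f" "continuous_on A g"
    for k A and f g :: "'b::t2_space \<Rightarrow> real"
    unfolding E_def by (intro continuous_intros that)
  have cpair: "continuous_on UNIV (fst :: real \<times> real \<Rightarrow> real)" "continuous_on UNIV (snd :: real \<times> real \<Rightarrow> real)"
    by (intro continuous_intros)+
  have cG: "continuous_on UNIV (\<lambda>p. G e (fst p) (snd p))" if "e > 0" for e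
    unfolding G_def by (intro continuous_intros ca2 cpair) (use Ne Ne0 that in auto)
  have cN: "continuous_on UNIV (\<lambda>p. complex_of_real (NN (fst p) (snd p) / (NN (fst p) (snd p) + e)))" if "e > 0" for e
    by (intro continuous_intros cpair) (use Ne0 that in auto)
  \<comment> \<open>The divergence theorem on the torus for a times field times E: Us and Ut are the
    two partial derivatives, each with integral 0 over a period. Differentiating E pairs the field
    with the gradient, whence the factor NN / (NN + e).\<close>
  have parts: "integral {-pi..pi} (\<lambda>t. integral {-pi..pi} (\<lambda>s. (G e s t + \<i> * complex_of_real k * a s t * complex_of_real (NN s t / (NN s t + e))) * E k s t)) = 0"
    if e: "e > 0" for e k
  proof -
    define Us where "Us s t = (a1 s t * complex_of_real (Ps s t / (NN s t + e)) + a s t * complex_of_real (ws e s t)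
        + a s t * complex_of_real (Ps s t / (NN s t + e)) * (\<i> * complex_of_real (k * Ps s t))) * E k s t" for s t
    define Ut where "Ut s t = (a2 s t * complex_of_real (Pt s t / (NN s t + e)) + a s t * complex_of_real (wt e s t)
        + a s t * complex_of_real (Pt s t / (NN s t + e)) * (\<i> * complex_of_real (k * Pt s t))) * E k s t" for s t
    have cUs: "continuous_on UNIV (\<lambda>p. Us (fst p) (snd p))" and cUt: "continuous_on UNIV (\<lambda>p. Ut (fst p) (snd p))"
      unfolding Us_def Ut_def by (intro continuous_intros ca2 cE cpair; use Ne Ne0 e in auto)+
    have Us0: "integral {-pi..pi} (\<lambda>s. Us s t) = 0" for t
    proof (rule integral_periodic_derivative_0)
      show "((\<lambda>s. a s t * complex_of_real (Ps s t / (NN s t + e)) * E k s t) has_vector_derivative Us s t) (at s)" for s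
        using has_vector_derivative_mult[OF has_vector_derivative_mult[OF a1 has_vector_derivative_of_real[OF deriv_ws[OF e]]] E_s]
        unfolding Us_def by (rule has_vector_derivative_eq_rhs) (simp add: algebra_simps)
    qed (simp add: phase_per per E_def)
    have Ut0: "integral {-pi..pi} (\<lambda>t. Ut s t) = 0" for s
    proof (rule integral_periodic_derivative_0)
      show "((\<lambda>t. a s t * complex_of_real (Pt s t / (NN s t + e)) * E k s t) has_vector_derivative Ut s t) (at t)" for t
        using has_vector_derivative_mult[OF has_vector_derivative_mult[OF a2 has_vector_derivative_of_real[OF deriv_wt[OF e]]] E_t]
        unfolding Ut_def by (rule has_vector_derivative_eq_rhs) (simp add: algebra_simps)
    qed (simp add: phase_per per E_def)
    have eq: "(G e s t + \<i> * complex_of_real k * a s t * complex_of_real (NN s t / (NN s t + e))) * E k s t = Us s t + Ut s t" for s t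
    proof -
      have "complex_of_real (NN s t / (NN s t + e)) = complex_of_real (Ps s t / (NN s t + e)) * complex_of_real (Ps s t)
          + complex_of_real (Pt s t / (NN s t + e)) * complex_of_real (Pt s t)"
        unfolding of_real_mult[symmetric] of_real_add[symmetric]
        by (simp add: NN_def power2_eq_square add_divide_distrib)
      then show ?thesis unfolding G_def Us_def Ut_def by (simp add: algebra_simps)
    qed
    have i: "(\<lambda>s. Us s t) integrable_on {-pi..pi}" "(\<lambda>s. Ut s t) integrable_on {-pi..pi}" for t
      by (intro integrable_continuous_interval cont2[OF cUs] cont2[OF cUt] continuous_intros)+
    have "integral {-pi..pi} (\<lambda>t. integral {-pi..pi} (\<lambda>s. Us s t + Ut s t)) = integral {-pi..pi} (\<lambda>t. integral {-pi..pi} (\<lambda>s. Ut s t))"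
      by (simp add: integral_add[OF i] Us0)
    also have "\<dots> = integral {-pi..pi} (\<lambda>s. integral {-pi..pi} (\<lambda>t. Ut s t))"
      by (rule integral_swap_real[OF cUt])
    finally show ?thesis unfolding eq Ut0 by simp
  qed
  obtain B where B: "B > 0" "\<And>s t. t \<in> {-pi..pi} \<Longrightarrow> \<bar>Pss s t\<bar> \<le> B" "\<And>s t. t \<in> {-pi..pi} \<Longrightarrow> \<bar>Pst s t\<bar> \<le> B"
    "\<And>s t. t \<in> {-pi..pi} \<Longrightarrow> \<bar>Ptt s t\<bar> \<le> B"
    using phase_second_bound by metis
  have "\<exists>x\<in>{-pi..pi}. \<forall>y\<in>{-pi..pi}. r x \<le> r y"
    by (rule continuous_attains_inf) (auto intro!: continuous_intros)
  then obtain p where p: "p > 0" "\<And>t. t \<in> {-pi..pi} \<Longrightarrow> p \<le> r t" using r_pos by blast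
  have "bounded ((\<lambda>x. norm (a1 (fst x) (snd x)) + norm (a2 (fst x) (snd x))) ` ({-pi..pi} \<times> {-pi..pi}))"
    by (intro compact_imp_bounded compact_continuous_image continuous_intros ca2 compact_Times compact_Icc)
  then obtain A where A: "A > 0" "\<And>s t. s \<in> {-pi..pi} \<Longrightarrow> t \<in> {-pi..pi} \<Longrightarrow> norm (a1 s t) + norm (a2 s t) \<le> A"
    unfolding bounded_pos by fastforce
  have C: "C \<ge> 0" using order_trans[OF norm_ge_zero van[of "pi/2" 0]] by simp
  have a_le: "norm (a s t) \<le> C / p * sqrt (NN s t)" if st: "s \<in> {-pi..pi}" "t \<in> {-pi..pi}" for s t
  proof -
    have "p * \<bar>sin s\<bar> \<le> \<bar>Ps s t\<bar>" using p(2)[OF st(2)] r_pos[of t] by (simp add: Ps_def abs_mult mult_right_mono)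
    also have "\<dots> \<le> sqrt (NN s t)" unfolding NN_def by simp
    finally have "\<bar>sin s\<bar> \<le> sqrt (NN s t) / p" using p(1) by (simp add: field_simps)
    from mult_left_mono[OF this C] show ?thesis using van[OF st] by simp
  qed
  define K where "K = A + C / p * (10 * B)"
  have K: "K > 0" using A C p B by (auto simp: K_def intro!: add_pos_nonneg mult_nonneg_nonneg)
  have G_le: "norm (G e s t) \<le> K / sqrt (NN s t)"
    if e: "e \<ge> 0" and st: "s \<in> {-pi..pi}" "t \<in> {-pi..pi}" and N: "NN s t > 0" for e s t
  proof -
    define S where "S = sqrt (NN s t)"
    have S: "S > 0" "NN s t = S * S" using N by (auto simp: S_def)
    have P: "\<bar>Ps s t\<bar> \<le> S" "\<bar>Pt s t\<bar> \<le> S" unfolding S_def NN_def by auto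
    have frac: "\<bar>x / (NN s t + e)\<bar> \<le> 1 / S" if "\<bar>x\<bar> \<le> S" for x
    proof -
      have "\<bar>x / (NN s t + e)\<bar> \<le> S / (NN s t)"
        unfolding abs_divide using that e N S(1) by (intro frac_le) auto
      then show ?thesis using S by simp
    qed
    have w: "\<bar>ws e s t\<bar> \<le> 5 * B / NN s t" "\<bar>wt e s t\<bar> \<le> 5 * B / NN s t"
      by (rule w_bound[OF e N B(2-4)[OF st(2)]])+
    have "norm (G e s t) \<le> norm (a1 s t) * (1 / S) + norm (a s t) * (5 * B / NN s t) + (norm (a2 s t) * (1 / S) + norm (a s t) * (5 * B / NN s t))"
      unfolding G_def by (intro norm_triangle_mono; unfold norm_mult norm_of_real; intro mult_left_mono frac P w norm_ge_zero)
    also have "\<dots> = (norm (a1 s t) + norm (a2 s t)) * (1 / S) + norm (a s t) * (10 * B / NN s t)"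
      by (simp add: add_divide_distrib)
    also have "\<dots> \<le> A * (1 / S) + C / p * S * (10 * B / NN s t)"
      using A(2)[OF st] a_le[OF st, folded S_def] S(1) N B(1)
      by (intro add_mono mult_right_mono divide_nonneg_pos mult_nonneg_nonneg) simp_all
    also have "\<dots> = K / S" using S by (simp add: K_def field_simps)
    finally show ?thesis by (simp add: S_def)
  qed
  \<comment> \<open>Written as the square of d = 1 / \<kappa>\<kappa>. The share ep / (NN + ep) of
    an amplitude of size sqrt NN is at most a multiple of d by the inequality between the means, and
    \<kappa> d still tends to 0.\<close>
  define ep where "ep n = (1 / (\<kappa> n)\<^sup>2)\<^sup>2" for n
  have ep: "ep n > 0" for n using \<kappa>_pos[of n] by (simp add: ep_def)
  have inv: "(\<lambda>n. 1 / \<kappa> n) \<longlonglongrightarrow> 0"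
    using tendsto_inverse_0_at_top[OF \<kappa>] by (simp add: inverse_eq_divide)
  have ep0: "ep \<longlonglongrightarrow> 0"
  proof -
    have "ep = (\<lambda>n. (1 / \<kappa> n) ^ 4)"
      unfolding ep_def by (rule ext) (simp only: power_one_over power_mult[symmetric], simp)
    moreover have "(0::real) ^ 4 = 0" by simp
    ultimately show ?thesis using tendsto_power[OF inv, of 4] by metis
  qed
  define J where "J n t = integral {-pi..pi} (\<lambda>s. G (ep n) s t * E (\<kappa> n) s t)" for n t
  define u where "u t = \<bar>m1 t + r1 t\<bar> powr (-1/2) + \<bar>m1 t - r1 t\<bar> powr (-1/2)" for t
  define Z where "Z = {t \<in> {-pi..pi}. m1 t + r1 t = 0} \<union> {t \<in> {-pi..pi}. m1 t - r1 t = 0}"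
  have dp: "((\<lambda>t. m1 t + r1 t) has_real_derivative m2 t + r2 t) (at t)" "((\<lambda>t. m1 t - r1 t) has_real_derivative m2 t - r2 t) (at t)" for t
    by (auto intro!: derivative_intros r1 m1)
  have Z: "finite Z" unfolding Z_def
    using finite_simple_zeros[OF dp(1) simple_plus] finite_simple_zeros[OF dp(2) simple_minus] by blast
  have u: "u integrable_on {-pi..pi}" unfolding u_def
    by (intro integrable_add inverse_sqrt_simple_zeros_integrable_on[OF dp(1) simple_plus] inverse_sqrt_simple_zeros_integrable_on[OF dp(2) simple_minus])
  have sin_simple: "cos x \<noteq> 0" if "sin x = 0" for x :: real
    using sin_zero_abs_cos_one[OF that] by auto
  have sin_int: "(\<lambda>s. \<bar>sin s\<bar> powr (-1/2)) integrable_on {-pi..pi}"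
    by (rule inverse_sqrt_simple_zeros_integrable_on[OF DERIV_sin sin_simple])
  have sin_fin: "finite {s \<in> {-pi..pi}. sin s = (0::real)}"
    by (rule finite_simple_zeros[OF DERIV_sin sin_simple])
  obtain L where L: "L > 0" "\<And>s t. t \<in> {-pi..pi} \<Longrightarrow> sin s \<noteq> 0 \<Longrightarrow> m1 t + r1 t \<noteq> 0 \<Longrightarrow> m1 t - r1 t \<noteq> 0 \<Longrightarrow>
     NN s t > 0 \<and> 1 / sqrt (NN s t) \<le> L * \<bar>sin s\<bar> powr (-1/2) * u t"
    using inverse_sqrt_NN_bound unfolding u_def by blast
  have J_le: "norm (J n t) \<le> (K * L * integral {-pi..pi} (\<lambda>s. \<bar>sin s\<bar> powr (-1/2))) * u t" if t: "t \<in> {-pi..pi} - Z" for n t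
  proof -
    have tt: "t \<in> {-pi..pi}" "m1 t + r1 t \<noteq> 0" "m1 t - r1 t \<noteq> 0" using t by (auto simp: Z_def)
    define f where "f s = (if sin s = 0 then 0 else G (ep n) s t * E (\<kappa> n) s t)" for s
    have int: "(\<lambda>s. G (ep n) s t * E (\<kappa> n) s t) integrable_on {-pi..pi}"
      by (intro integrable_continuous_interval continuous_intros cont2[OF cG[OF ep]] cE)
    have f_eq: "f s = G (ep n) s t * E (\<kappa> n) s t" if "s \<in> {-pi..pi} - {s \<in> {-pi..pi}. sin s = 0}" for s
      using that by (auto simp: f_def)
    have "J n t = integral {-pi..pi} f" unfolding J_def
      by (rule integral_spike[OF negligible_finite[OF sin_fin]]) (use f_eq in auto)
    moreover have "norm (integral {-pi..pi} f) \<le> integral {-pi..pi} (\<lambda>s. K * L * u t * \<bar>sin s\<bar> powr (-1/2))"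
    proof (rule integral_norm_bound_integral)
      show "f integrable_on {-pi..pi}"
        by (rule integrable_spike[OF int negligible_finite[OF sin_fin]]) (use f_eq in auto)
      show "(\<lambda>s. K * L * u t * \<bar>sin s\<bar> powr (-1/2)) integrable_on {-pi..pi}"
        by (rule integrable_on_mult_right[OF sin_int])
      fix s assume s: "s \<in> {-pi..pi}"
      show "norm (f s) \<le> K * L * u t * \<bar>sin s\<bar> powr (-1/2)"
      proof (cases "sin s = 0")
        case False
        have "norm (f s) \<le> K / sqrt (NN s t)"
          using False G_le[OF less_imp_le[OF ep] s tt(1)] L(2)[OF tt(1) False tt(2,3)] by (simp add: f_def norm_mult nE)
        also have "\<dots> = K * (1 / sqrt (NN s t))" by simp
        also have "\<dots> \<le> K * (L * \<bar>sin s\<bar> powr (-1/2) * u t)"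
          using L(2)[OF tt(1) False tt(2,3)] K by (intro mult_left_mono) auto
        finally show ?thesis by (simp add: mult_ac)
      qed (simp add: f_def)
    qed
    ultimately show ?thesis by (simp add: mult_ac)
  qed
  \<comment> \<open>For t outside Z the gradient has no zero in s. So e = 0 is allowed there:
    Riemann--Lebesgue applies to \<open>G 0\<close>, and \<open>G (ep n)\<close> converges to it
    boundedly.\<close>
  have J0: "(\<lambda>n. J n t) \<longlonglongrightarrow> 0" if t: "t \<in> {-pi..pi} - Z" for t
  proof -
    have tt: "t \<in> {-pi..pi}" "m1 t + r1 t \<noteq> 0" "m1 t - r1 t \<noteq> 0" using t by (auto simp: Z_def)
    have Npos: "NN s t > 0" for s
    proof (cases "sin s = 0")
      case True
      then have "cos s = 1 \<or> cos s = -1" using sin_zero_abs_cos_one[OF True] by auto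
      then have "Pt s t \<noteq> 0" using tt by (auto simp: Pt_def)
      then show ?thesis by (simp add: NN_def sum_power2_gt_zero_iff)
    qed (use L(2) tt in blast)
    have N0: "NN s t \<noteq> 0" for s using Npos[of s] by simp
    have "\<exists>x\<in>{-pi..pi}. \<forall>y\<in>{-pi..pi}. NN x t \<le> NN y t"
      by (rule continuous_attains_inf) (auto intro!: continuous_intros)
    then obtain N1 where N1: "N1 > 0" "\<And>s. s \<in> {-pi..pi} \<Longrightarrow> N1 \<le> NN s t" using Npos by blast
    have cG0: "continuous_on {-pi..pi} (\<lambda>s. G 0 s t)"
      unfolding G_def by (intro continuous_intros ca1) (use Npos N0 in auto)
    have dP: "((\<lambda>s. Phi s t) has_real_derivative Ps s t) (at s within {-pi..pi})" for s
      by (rule has_field_derivative_at_within[OF deriv_Phi_s])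
    have fin: "finite {s \<in> {-pi..pi}. Ps s t = 0}"
      using sin_fin r_pos[of t] by (auto simp: Ps_def)
    have 1: "(\<lambda>n. integral {-pi..pi} (\<lambda>s. G 0 s t * E (\<kappa> n) s t)) \<longlonglongrightarrow> 0"
      unfolding E_def by (rule Riemann_Lebesgue_phase_finite[OF _ cG0 dP _ fin \<kappa>]) (auto intro!: continuous_intros)
    have ci: "continuous_on {-pi..pi} (\<lambda>s. G (ep n) s t)" for n
      by (intro cont2[OF cG[OF ep]] continuous_intros)
    have 2: "(\<lambda>n. integral {-pi..pi} (\<lambda>s. (G (ep n) s t - G 0 s t) * E (\<kappa> n) s t)) \<longlonglongrightarrow> 0"
    proof (rule integral_tendsto_0_negligible[OF negligible_empty])
      show "(\<lambda>s. (G (ep n) s t - G 0 s t) * E (\<kappa> n) s t) integrable_on {-pi..pi}" for n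
        by (intro integrable_continuous_interval continuous_intros ci cG0 cE)
      show "(\<lambda>s. 2 * (K / sqrt N1)) integrable_on {-pi..pi}" by (intro integrable_continuous_interval continuous_intros)
      fix s assume "s \<in> {-pi..pi} - {}"
      then have s: "s \<in> {-pi..pi}" by simp
      have Gn: "norm (G e s t) \<le> K / sqrt N1" if "e \<ge> 0" for e
        using N1(2)[OF s] N1(1) K by (intro order_trans[OF G_le[OF that s tt(1) Npos] divide_left_mono]) auto
      show "norm ((G (ep n) s t - G 0 s t) * E (\<kappa> n) s t) \<le> 2 * (K / sqrt N1)" for n
        using norm_triangle_ineq4[of "G (ep n) s t" "G 0 s t"] Gn[OF less_imp_le[OF ep[of n]]] Gn[of 0]
        by (simp add: norm_mult nE)
      have "(\<lambda>n. G (ep n) s t) \<longlonglongrightarrow> G 0 s t"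
        unfolding G_def ws_def wt_def using N0[of s] by (intro tendsto_intros ep0) auto
      then have "(\<lambda>n. norm (G (ep n) s t - G 0 s t)) \<longlonglongrightarrow> 0"
        by (intro tendsto_norm_zero) (simp add: LIM_zero_iff)
      then show "(\<lambda>n. (G (ep n) s t - G 0 s t) * E (\<kappa> n) s t) \<longlonglongrightarrow> 0"
        by (rule Lim_null_comparison[rotated]) (simp add: norm_mult nE)
    qed
    have "J n t = integral {-pi..pi} (\<lambda>s. G 0 s t * E (\<kappa> n) s t) + integral {-pi..pi} (\<lambda>s. (G (ep n) s t - G 0 s t) * E (\<kappa> n) s t)" for n
    proof -
      have "integral {-pi..pi} (\<lambda>s. G 0 s t * E (\<kappa> n) s t + (G (ep n) s t - G 0 s t) * E (\<kappa> n) s t)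
        = integral {-pi..pi} (\<lambda>s. G 0 s t * E (\<kappa> n) s t) + integral {-pi..pi} (\<lambda>s. (G (ep n) s t - G 0 s t) * E (\<kappa> n) s t)"
        by (intro integral_add integrable_continuous_interval continuous_intros ci cG0 cE)
      then show ?thesis unfolding J_def by (simp add: left_diff_distrib)
    qed
    with tendsto_add[OF 1 2] show ?thesis by simp
  qed
  have cJ: "continuous_on UNIV (J n)" for n
    unfolding J_def by (rule continuous_on_integral_param) (intro continuous_intros cG[OF ep] cE)
  have lim_J: "(\<lambda>n. integral {-pi..pi} (J n)) \<longlonglongrightarrow> 0"
    by (rule integral_tendsto_0_negligible[OF negligible_finite[OF Z] _ _ J_le J0])
       (auto intro!: integrable_continuous_interval continuous_on_subset[OF cJ] integrable_on_mult_right u)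
  define R where "R n t = integral {-pi..pi} (\<lambda>s. a s t * complex_of_real (ep n / (NN s t + ep n)) * E (\<kappa> n) s t)" for n t
  have cR: "continuous_on UNIV (\<lambda>p. a (fst p) (snd p) * complex_of_real (ep n / (NN (fst p) (snd p) + ep n)) * E (\<kappa> n) (fst p) (snd p))" for n
    by (intro continuous_intros ca cE) (use Ne0[OF ep] in auto)
  have cRt: "continuous_on {-pi..pi} (R n)" for n unfolding R_def
    by (rule continuous_on_subset[OF continuous_on_integral_param[OF cR]]) simp
  have R_le: "norm (integral {-pi..pi} (R n)) \<le> C / p * (1 / (\<kappa> n)\<^sup>2) * (2 * pi) * (2 * pi)" for n
  proof -
    have "norm (R n t) \<le> C / p * (1 / (\<kappa> n)\<^sup>2) * (pi - -pi)" if t: "t \<in> {-pi..pi}" for t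
      unfolding R_def
    proof (rule norm_integral_le_real)
      show "continuous_on {-pi..pi} (\<lambda>s. a s t * complex_of_real (ep n / (NN s t + ep n)) * E (\<kappa> n) s t)"
        by (intro continuous_intros ca1 cE) (use Ne0[OF ep] in auto)
      fix s assume s: "s \<in> {-pi..pi}"
      define S where "S = sqrt (NN s t)"
      define d where "d = 1 / (\<kappa> n)\<^sup>2"
      have d: "d > 0" "ep n = d * d" using \<kappa>_pos[of n] by (auto simp: d_def ep_def power2_eq_square)
      have S: "S \<ge> 0" "NN s t = S * S" using NN_nonneg[of s t] by (auto simp: S_def)
      have pos: "S * S + d * d > 0" using d(1) by (intro add_nonneg_pos) auto
      have "0 \<le> S * d" "2 * (S * d) \<le> S * S + d * d"
        using sum_squares_bound[of S d] S(1) d(1) by (simp_all add: power2_eq_square)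
      then have "S * d \<le> S * S + d * d" by linarith
      then have "S * d / (S * S + d * d) \<le> 1" using pos by simp
      then have "S * d / (S * S + d * d) * d \<le> 1 * d" using d by (intro mult_right_mono) auto
      then have *: "S * (d * d / (S * S + d * d)) \<le> d" by (simp add: mult_ac)
      have "norm (a s t * complex_of_real (ep n / (NN s t + ep n)) * E (\<kappa> n) s t) = norm (a s t) * (d * d / (S * S + d * d))"
        using pos unfolding norm_mult nE norm_of_real S(2) d(2) by simp
      also have "\<dots> \<le> C / p * S * (d * d / (S * S + d * d))"
        using a_le[OF s t] pos unfolding S_def[symmetric] by (intro mult_right_mono) auto
      also have "\<dots> \<le> C / p * d" using mult_left_mono[OF *, of "C / p"] C p by (simp add: mult.assoc)
      finally show "norm (a s t * complex_of_real (ep n / (NN s t + ep n)) * E (\<kappa> n) s t) \<le> C / p * (1 / (\<kappa> n)\<^sup>2)"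
        by (simp add: d_def)
    qed simp
    then have "norm (integral {-pi..pi} (R n)) \<le> C / p * (1 / (\<kappa> n)\<^sup>2) * (pi - -pi) * (pi - -pi)"
      by (intro norm_integral_le_real cRt) auto
    then show ?thesis by simp
  qed
  have lim_R: "(\<lambda>n. \<kappa> n * integral {-pi..pi} (R n)) \<longlonglongrightarrow> 0"
  proof (rule Lim_null_comparison)
    have "(\<lambda>n. C / p * (2 * pi) * (2 * pi) * (1 / \<kappa> n)) \<longlonglongrightarrow> C / p * (2 * pi) * (2 * pi) * 0"
      by (intro tendsto_intros inv)
    then show "(\<lambda>n. C / p * (2 * pi) * (2 * pi) * (1 / \<kappa> n)) \<longlonglongrightarrow> 0" by simp
    have "norm (\<kappa> n * integral {-pi..pi} (R n)) \<le> C / p * (2 * pi) * (2 * pi) * (1 / \<kappa> n)" for n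
    proof -
      have "\<kappa> n * norm (integral {-pi..pi} (R n)) \<le> \<kappa> n * (C / p * (1 / (\<kappa> n)\<^sup>2) * (2 * pi) * (2 * pi))"
        using R_le[of n] \<kappa>_pos[of n] by (intro mult_left_mono) auto
      also have "\<dots> = C / p * (2 * pi) * (2 * pi) * (1 / \<kappa> n)" using \<kappa>_pos[of n] p(1) by (simp add: field_simps power2_eq_square)
      finally show ?thesis using \<kappa>_pos[of n] by (simp add: norm_mult)
    qed
    then show "\<forall>\<^sub>F n in sequentially. norm (\<kappa> n * integral {-pi..pi} (R n)) \<le> C / p * (2 * pi) * (2 * pi) * (1 / \<kappa> n)" by simp
  qed
  \<comment> \<open>The amplitude is split by 1 = NN / (NN + ep) + ep / (NN + ep). Integration by
    parts turns the first share, W, into J and absorbs the factor \<kappa>; the second share, R, is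
    small by the choice of ep.\<close>
  have main: "\<kappa> n * integral {-pi..pi} (\<lambda>t. integral {-pi..pi} (\<lambda>s. a s t * E (\<kappa> n) s t))
      = \<i> * integral {-pi..pi} (J n) + \<kappa> n * integral {-pi..pi} (R n)" for n
  proof -
    define W where "W t = integral {-pi..pi} (\<lambda>s. a s t * complex_of_real (NN s t / (NN s t + ep n)) * E (\<kappa> n) s t)" for t
    have cW: "continuous_on UNIV (\<lambda>p. a (fst p) (snd p) * complex_of_real (NN (fst p) (snd p) / (NN (fst p) (snd p) + ep n)) * E (\<kappa> n) (fst p) (snd p))"
      by (intro continuous_intros ca cE) (use Ne0[OF ep] in auto)
    have cWt: "continuous_on {-pi..pi} W" unfolding W_def
      by (rule continuous_on_subset[OF continuous_on_integral_param[OF cW]]) simp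
    have cJt: "continuous_on {-pi..pi} (J n)" by (rule continuous_on_subset[OF cJ]) simp
    have "integral {-pi..pi} (\<lambda>s. (G (ep n) s t + \<i> * complex_of_real (\<kappa> n) * a s t * complex_of_real (NN s t / (NN s t + ep n))) * E (\<kappa> n) s t)
        = J n t + \<i> * complex_of_real (\<kappa> n) * W t" for t
    proof -
      have 1: "(\<lambda>s. G (ep n) s t * E (\<kappa> n) s t) integrable_on {-pi..pi}"
        by (intro integrable_continuous_interval continuous_intros cont2[OF cG[OF ep]] cE)
      have 2: "(\<lambda>s. \<i> * complex_of_real (\<kappa> n) * (a s t * complex_of_real (NN s t / (NN s t + ep n)) * E (\<kappa> n) s t)) integrable_on {-pi..pi}"
        by (intro integrable_continuous_interval continuous_intros ca1 cE) (use Ne0[OF ep] in auto)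
      have 3: "\<i> * complex_of_real (\<kappa> n) * W t = integral {-pi..pi} (\<lambda>s. \<i> * complex_of_real (\<kappa> n) * (a s t * complex_of_real (NN s t / (NN s t + ep n)) * E (\<kappa> n) s t))"
        unfolding W_def by (rule integral_mult_right[symmetric])
      show ?thesis unfolding 3 J_def integral_add[OF 1 2, symmetric] by (simp only: distrib_right mult.assoc)
    qed
    then have "integral {-pi..pi} (\<lambda>t. J n t + \<i> * complex_of_real (\<kappa> n) * W t) = 0"
      using parts[OF ep[of n], of "\<kappa> n"] by simp
    moreover have "integral {-pi..pi} (\<lambda>t. J n t + \<i> * complex_of_real (\<kappa> n) * W t) = integral {-pi..pi} (J n) + \<i> * complex_of_real (\<kappa> n) * integral {-pi..pi} W"
      by (subst integral_add) (auto intro!: integrable_continuous_interval continuous_intros cWt cJt)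
    ultimately have W: "\<kappa> n * integral {-pi..pi} W = \<i> * integral {-pi..pi} (J n)"
    proof -
      assume "integral {-pi..pi} (\<lambda>t. J n t + \<i> * complex_of_real (\<kappa> n) * W t) = 0"
        and "integral {-pi..pi} (\<lambda>t. J n t + \<i> * complex_of_real (\<kappa> n) * W t) = integral {-pi..pi} (J n) + \<i> * complex_of_real (\<kappa> n) * integral {-pi..pi} W"
      then have "\<i> * (integral {-pi..pi} (J n) + \<i> * complex_of_real (\<kappa> n) * integral {-pi..pi} W) = 0" by simp
      moreover have "\<i> * (x + \<i> * y * z) = \<i> * x - y * z" for x y z by (simp add: algebra_simps)
      ultimately show ?thesis by simp
    qed
    have "integral {-pi..pi} (\<lambda>s. a s t * E (\<kappa> n) s t) = W t + R n t" for t
    proof -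
      have 1: "a s t * E (\<kappa> n) s t = a s t * complex_of_real (NN s t / (NN s t + ep n)) * E (\<kappa> n) s t + a s t * complex_of_real (ep n / (NN s t + ep n)) * E (\<kappa> n) s t" for s
      proof -
        have "complex_of_real (NN s t / (NN s t + ep n)) + complex_of_real (ep n / (NN s t + ep n)) = 1"
          unfolding of_real_add[symmetric] add_divide_distrib[symmetric] using Ne0[OF ep] by simp
        then show ?thesis by (metis distrib_left distrib_right mult.right_neutral)
      qed
      show ?thesis unfolding W_def R_def 1
        by (intro integral_add integrable_continuous_interval continuous_intros ca1 cE) (use Ne0[OF ep] in auto)
    qed
    then have "integral {-pi..pi} (\<lambda>t. integral {-pi..pi} (\<lambda>s. a s t * E (\<kappa> n) s t)) = integral {-pi..pi} W + integral {-pi..pi} (R n)"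
      by (simp add: integral_add integrable_continuous_interval cWt cRt)
    then show ?thesis using W by (simp add: distrib_left)
  qed
  have "(\<lambda>n. \<i> * integral {-pi..pi} (J n) + \<kappa> n * integral {-pi..pi} (R n)) \<longlonglongrightarrow> \<i> * 0 + 0"
    by (intro tendsto_intros lim_J lim_R)
  then show ?thesis unfolding main[symmetric] E_def by simp
qed

end

section \<open>Stationary phase and the Fresnel integral\<close>

lemma has_integral_inverse_square:
  fixes x0 :: real
  assumes "u \<le> v" "\<And>x. x \<in> {u..v} \<Longrightarrow> x \<noteq> x0"
  shows "((\<lambda>x. 1 / (x - x0)\<^sup>2) has_integral (1 / (u - x0) - 1 / (v - x0))) {u..v}"
proof -
  have "((\<lambda>x. 1 / (x - x0)\<^sup>2) has_integral (- 1 / (v - x0) - - 1 / (u - x0))) {u..v}"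
  proof (rule fundamental_theorem_of_calculus[OF assms(1)])
    fix x assume "x \<in> {u..v}"
    then have "x \<noteq> x0" by (rule assms(2))
    then have "((\<lambda>x. - 1 / (x - x0)) has_real_derivative 1 / (x - x0)\<^sup>2) (at x within {u..v})"
      by (auto intro!: derivative_eq_intros simp: power2_eq_square)
    then show "((\<lambda>x. - 1 / (x - x0)) has_vector_derivative 1 / (x - x0)\<^sup>2) (at x within {u..v})"
      by (simp add: has_real_derivative_iff_has_vector_derivative)
  qed
  then show ?thesis by simp
qed

text \<open>One integration by parts with the quotient b / f1. Its derivative is of order 1 / (x -
  x0)^2, which integrates to at most 1 / \<delta> at distance \<delta> from the stationary point.
  With \<delta> = R / sqrt k the bound becomes O(1 / (R sqrt k)), the scale needed for stationary
  phase.\<close>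

lemma oscillatory_tail_bound:
  fixes b b' :: "real \<Rightarrow> complex" and f f1 f2 :: "real \<Rightarrow> real"
  assumes f: "\<And>x. x \<in> {u..v} \<Longrightarrow> (f has_real_derivative f1 x) (at x)"
    and f1: "\<And>x. x \<in> {u..v} \<Longrightarrow> (f1 has_real_derivative f2 x) (at x)" and f2: "continuous_on {u..v} f2"
    and b: "\<And>x. x \<in> {u..v} \<Longrightarrow> (b has_vector_derivative b' x) (at x)" and b': "continuous_on {u..v} b'"
    and uv: "u \<le> v" and \<delta>: "\<delta> > 0" "\<And>x. x \<in> {u..v} \<Longrightarrow> \<delta> \<le> \<bar>x - x0\<bar>"
    and D: "\<And>x. x \<in> {u..v} \<Longrightarrow> \<bar>x - x0\<bar> \<le> D"
    and m: "m > 0" "\<And>x. x \<in> {u..v} \<Longrightarrow> m * \<bar>x - x0\<bar> \<le> \<bar>f1 x\<bar>"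
    and M: "M \<ge> 0" "\<And>x. x \<in> {u..v} \<Longrightarrow> norm (b x) \<le> M" "\<And>x. x \<in> {u..v} \<Longrightarrow> \<bar>f2 x\<bar> \<le> M"
    and M': "M' \<ge> 0" "\<And>x. x \<in> {u..v} \<Longrightarrow> norm (b' x) \<le> M'"
    and k: "k > 0"
  shows "norm (integral {u..v} (\<lambda>x. b x * expi (k * f x))) \<le> (2 * M / m + (M' * D / m + M * M / m\<^sup>2)) / (k * \<delta>)"
proof -
  define E where "E x = expi (k * f x)" for x
  define H where "H x = b x * complex_of_real (1 / f1 x)" for x
  define H' where "H' x = b x * complex_of_real (- f2 x / (f1 x)\<^sup>2) + b' x * complex_of_real (1 / f1 x)" for x
  define K where "K = M' * D / m + M * M / m\<^sup>2"
  have x0: "x \<noteq> x0" if "x \<in> {u..v}" for x using \<delta>(1) \<delta>(2)[OF that] by auto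
  have f1nz: "f1 x \<noteq> 0" if "x \<in> {u..v}" for x
    using m(1) m(2)[OF that] x0[OF that] by (auto simp: mult_le_0_iff)
  have nE: "norm (E x) = 1" for x unfolding E_def by (rule norm_exp_i_real)
  have H: "(H has_vector_derivative H' x) (at x)" if x: "x \<in> {u..v}" for x
  proof -
    have "((\<lambda>x. 1 / f1 x) has_real_derivative - f2 x / (f1 x)\<^sup>2) (at x)"
      using f1nz[OF x] f1[OF x] by (auto intro!: derivative_eq_intros simp: power2_eq_square)
    from has_vector_derivative_mult[OF b[OF x] has_vector_derivative_of_real[OF this]]
    show ?thesis unfolding H_def H'_def .
  qed
  have E: "(E has_vector_derivative \<i> * complex_of_real (k * f1 x) * E x) (at x)" if x: "x \<in> {u..v}" for x
    unfolding E_def by (rule has_vector_derivative_exp_i[OF DERIV_cmult[OF f[OF x]]])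
  have cE: "continuous_on {u..v} E" and cH: "continuous_on {u..v} H"
    using E H by (meson continuous_at_imp_continuous_on has_vector_derivative_continuous)+
  have cf1: "continuous_on {u..v} f1" and cb: "continuous_on {u..v} b"
    using f1 b by (meson continuous_at_imp_continuous_on DERIV_isCont has_vector_derivative_continuous)+
  have cH': "continuous_on {u..v} H'"
    unfolding H'_def using f1nz by (intro continuous_intros cb b' f2 cf1) auto
  have 1: "((\<lambda>x. H x * (\<i> * complex_of_real (k * f1 x) * E x) + H' x * E x) has_integral H v * E v - H u * E u) {u..v}"
    by (rule fundamental_theorem_of_calculus[OF uv])
       (rule has_vector_derivative_at_within[OF has_vector_derivative_mult[OF H E]])
  have i2: "(\<lambda>x. H' x * E x) integrable_on {u..v}" by (intro integrable_continuous_interval continuous_intros cE cH')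
  have "((\<lambda>x. \<i> * complex_of_real k * (b x * E x)) has_integral (H v * E v - H u * E u) - integral {u..v} (\<lambda>x. H' x * E x)) {u..v}"
  proof (rule has_integral_eq[OF _ has_integral_diff[OF 1 integrable_integral[OF i2]]])
    fix x assume x: "x \<in> {u..v}"
    show "H x * (\<i> * complex_of_real (k * f1 x) * E x) + H' x * E x - H' x * E x = \<i> * complex_of_real k * (b x * E x)"
      using f1nz[OF x] by (simp add: H_def)
  qed
  then have "\<i> * complex_of_real k * integral {u..v} (\<lambda>x. b x * E x) = (H v * E v - H u * E u) - integral {u..v} (\<lambda>x. H' x * E x)"
    by (metis integral_mult_right integral_unique)
  then have "k * norm (integral {u..v} (\<lambda>x. b x * E x)) = norm ((H v * E v - H u * E u) - integral {u..v} (\<lambda>x. H' x * E x))"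
    using k by (metis abs_of_pos norm_ii norm_mult norm_of_real mult_1)
  also have "\<dots> \<le> (norm (H v) + norm (H u)) + norm (integral {u..v} (\<lambda>x. H' x * E x))"
    using norm_triangle_ineq4[of "H v * E v" "H u * E u"]
    by (intro order_trans[OF norm_triangle_ineq4] add_right_mono) (simp add: norm_mult nE)
  also have "norm (integral {u..v} (\<lambda>x. H' x * E x)) \<le> integral {u..v} (\<lambda>x. K * (1 / (x - x0)\<^sup>2))"
  proof (rule integral_norm_bound_integral[OF i2])
    show "(\<lambda>x. K * (1 / (x - x0)\<^sup>2)) integrable_on {u..v}"
      by (intro integrable_on_mult_right has_integral_integrable[OF has_integral_inverse_square[OF uv x0]])
    fix x assume x: "x \<in> {u..v}"
    define y where "y = \<bar>x - x0\<bar>"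
    have y: "y > 0" "y \<le> D" "m * y \<le> \<bar>f1 x\<bar>" using \<delta>(1) \<delta>(2)[OF x] D[OF x] m(2)[OF x] by (auto simp: y_def)
    have my: "m * y > 0" using m y by simp
    have "norm (H' x * E x) \<le> norm (b x) * (\<bar>f2 x\<bar> / \<bar>f1 x\<bar>\<^sup>2) + norm (b' x) * (1 / \<bar>f1 x\<bar>)"
      unfolding H'_def norm_mult nE mult_1_right
      by (rule order_trans[OF norm_triangle_ineq]) (simp add: norm_mult norm_divide norm_power abs_divide)
    also have "\<dots> \<le> M * (M / (m * y)\<^sup>2) + M' * (1 / (m * y))"
      using y my M(1) M(2-3)[OF x] M'(1) M'(2)[OF x] by (intro add_mono mult_mono frac_le power_mono) auto
    \<comment> \<open>The factor D / y, at least 1, brings the term with b' to the same order 1 /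
      y^2 as the other one.\<close>
    also have "\<dots> \<le> M * (M / (m * y)\<^sup>2) + M' * (D / y * (1 / (m * y)))"
    proof -
      have "1 * (1 / (m * y)) \<le> D / y * (1 / (m * y))" using y my by (intro mult_right_mono) auto
      then show ?thesis using M'(1) by (intro add_left_mono mult_left_mono) auto
    qed
    also have "\<dots> = K * (1 / y\<^sup>2)" using m(1) y(1) by (simp add: K_def field_simps power2_eq_square)
    finally show "norm (H' x * E x) \<le> K * (1 / (x - x0)\<^sup>2)" by (simp add: y_def)
  qed
  also have "\<dots> = K * (1 / (u - x0) - 1 / (v - x0))"
    by (rule integral_unique[OF has_integral_mult_right[OF has_integral_inverse_square[OF uv x0]]])
  also have "\<dots> \<le> K * (1 / \<delta>)"
  proof (rule mult_left_mono)
    have K0: "D \<ge> 0" using D[of u] uv by (meson abs_ge_zero atLeastAtMost_iff order_refl order_trans)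
    then show "K \<ge> 0" using M(1) M'(1) m(1) by (simp add: K_def)
    show "1 / (u - x0) - 1 / (v - x0) \<le> 1 / \<delta>"
    proof (cases "x0 < u")
      case True
      then have "1 / (u - x0) \<le> 1 / \<delta>" using \<delta>(1) \<delta>(2)[of u] uv by (intro divide_left_mono) auto
      moreover have "1 / (v - x0) \<ge> 0" using True uv by simp
      ultimately show ?thesis by linarith
    next
      case False
      have "v < x0" using False x0[of x0] by force
      then have "1 / (x0 - v) \<le> 1 / \<delta>" using \<delta>(1) \<delta>(2)[of v] uv by (intro divide_left_mono) auto
      moreover have "1 / (u - x0) \<le> 0" using \<open>v < x0\<close> uv by (simp add: divide_le_0_iff)
      moreover have "1 / (v - x0) = - (1 / (x0 - v))" by (metis minus_diff_eq minus_divide_right)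
      ultimately show ?thesis by linarith
    qed
  qed
  also have "norm (H v) + norm (H u) \<le> 2 * (M / (m * \<delta>))"
  proof -
    have "norm (H x) \<le> M / (m * \<delta>)" if x: "x \<in> {u..v}" for x
    proof -
      have "m * \<delta> \<le> m * \<bar>x - x0\<bar>" using m(1) \<delta>(2)[OF x] by simp
      then have "m * \<delta> \<le> \<bar>f1 x\<bar>" using m(2)[OF x] by linarith
      then show ?thesis unfolding H_def norm_mult norm_of_real
        using frac_le[OF M(1) M(2)[OF x], of "m * \<delta>" "\<bar>f1 x\<bar>"] m(1) \<delta>(1) by (simp add: abs_divide)
    qed
    then have "norm (H u) \<le> M / (m * \<delta>)" "norm (H v) \<le> M / (m * \<delta>)" using uv by auto
    from add_mono[OF this(2,1)] show ?thesis by (simp only: mult_2)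
  qed
  finally have "k * norm (integral {u..v} (\<lambda>x. b x * E x)) \<le> 2 * (M / (m * \<delta>)) + K * (1 / \<delta>)" by simp
  also have "\<dots> = (2 * M / m + K) / \<delta>" using m(1) \<delta>(1) by (simp add: field_simps)
  finally show ?thesis using k \<delta>(1) unfolding E_def K_def by (simp add: field_simps)
qed

section \<open>Fresnel integrals\<close>

definition fresnel :: "real \<Rightarrow> complex" where
  "fresnel R = integral {-R..R} (\<lambda>y. expi (y\<^sup>2))"

lemma fresnel_tail:
  assumes "0 < R" "R \<le> S"
  shows "norm (fresnel S - fresnel R) \<le> 6 / R"
proof -
  define E where "E y = expi (y\<^sup>2)" for y :: real
  have cE: "continuous_on A E" for A unfolding E_def by (intro continuous_intros)
  have i: "E integrable_on {u..v}" for u v by (intro integrable_continuous_interval cE)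
  have split: "fresnel S = integral {-S..-R} E + fresnel R + integral {R..S} E"
  proof -
    have "integral {-S..R} E = integral {-S..-R} E + integral {-R..R} E"
      by (rule Henstock_Kurzweil_Integration.integral_combine[symmetric]) (use assms i in auto)
    moreover have "integral {-S..S} E = integral {-S..R} E + integral {R..S} E"
      by (rule Henstock_Kurzweil_Integration.integral_combine[symmetric]) (use assms i in auto)
    ultimately show ?thesis unfolding fresnel_def E_def[symmetric] by simp
  qed
  \<comment> \<open>For the phase y^2 one may take m = 2, and M = 2 dominates both the amplitude 1
    and the second derivative 2; the constants add up to 3, and two tails give 6.\<close>
  have tail: "norm (integral {u..v} E) \<le> 3 / R" if uv: "u \<le> v" "\<And>x. x \<in> {u..v} \<Longrightarrow> R \<le> \<bar>x\<bar>" for u v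
  proof -
    have D: "\<bar>x - 0\<bar> \<le> \<bar>u\<bar> + \<bar>v\<bar>" if "x \<in> {u..v}" for x using that by auto
    have "norm (integral {u..v} (\<lambda>x. 1 * expi (1 * x\<^sup>2))) \<le>
        (2 * 2 / 2 + (0 * (\<bar>u\<bar> + \<bar>v\<bar>) / 2 + 2 * 2 / 2\<^sup>2)) / (1 * R)"
      by (rule oscillatory_tail_bound[where ?f1.0 = "\<lambda>x. 2 * x" and ?f2.0 = "\<lambda>x. 2" and b' = "\<lambda>x. 0", OF _ _ _ _ _ uv(1) assms(1) _ D])
         (use uv(2) in \<open>auto intro!: derivative_eq_intros simp: abs_mult\<close>)
    then show ?thesis unfolding E_def by simp
  qed
  have "norm (fresnel S - fresnel R) = norm (integral {-S..-R} E + integral {R..S} E)" by (simp add: split)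
  also have "\<dots> \<le> 3 / R + 3 / R" by (intro norm_triangle_mono tail) (use assms in auto)
  finally show ?thesis by simp
qed

lemma convergent_fresnel: obtains F where "(fresnel \<longlongrightarrow> F) at_top" "\<And>R. R > 0 \<Longrightarrow> norm (F - fresnel R) \<le> 6 / R"
proof -
  have "Cauchy (\<lambda>n. fresnel (real (Suc n)))"
  proof (rule metric_CauchyI)
    fix e :: real assume e: "e > 0"
    then obtain N where N: "real (Suc N) > 12 / e" by (meson less_SucI reals_Archimedean2 of_nat_less_iff lessI less_trans)
    show "\<exists>M. \<forall>m\<ge>M. \<forall>n\<ge>M. dist (fresnel (real (Suc m))) (fresnel (real (Suc n))) < e"
    proof (intro exI allI impI)
      fix m n assume mn: "m \<ge> N" "n \<ge> N"
      have "6 / real (Suc N) < e / 2" using N e by (simp add: field_simps)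
      moreover have "norm (fresnel (real (Suc m)) - fresnel (real (Suc N))) \<le> 6 / real (Suc N)"
        "norm (fresnel (real (Suc n)) - fresnel (real (Suc N))) \<le> 6 / real (Suc N)"
        by (rule fresnel_tail; use mn in simp)+
      ultimately show "dist (fresnel (real (Suc m))) (fresnel (real (Suc n))) < e"
        by (metis dist_norm dist_triangle_half_l order_le_less_trans)
    qed
  qed
  then obtain F where F: "(\<lambda>n. fresnel (real (Suc n))) \<longlonglongrightarrow> F" using Cauchy_convergent convergent_def by blast
  have le: "norm (F - fresnel R) \<le> 6 / R" if R: "R > 0" for R
  proof -
    obtain N where N: "R \<le> real N" using real_arch_simple by blast
    have "(\<lambda>n. norm (fresnel (real (Suc n)) - fresnel R)) \<longlonglongrightarrow> norm (F - fresnel R)" by (intro tendsto_intros F)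
    moreover have "\<forall>n\<ge>N. norm (fresnel (real (Suc n)) - fresnel R) \<le> 6 / R"
      using R N by (intro allI impI fresnel_tail) auto
    ultimately show ?thesis by (rule Lim_bounded)
  qed
  have "(fresnel \<longlongrightarrow> F) at_top"
  proof (rule LIM_zero_cancel, rule Lim_null_comparison)
    show "\<forall>\<^sub>F R in at_top. norm (fresnel R - F) \<le> 6 / R"
      using eventually_gt_at_top[of 0] by eventually_elim (use le in \<open>simp add: norm_minus_commute\<close>)
    show "((\<lambda>R::real. 6 / R) \<longlongrightarrow> 0) at_top"
      by (intro tendsto_divide_0[OF tendsto_const] filterlim_at_top_imp_at_infinity filterlim_ident)
  qed
  with le show thesis by (rule that[rotated])
qed

definition Fresnel :: complex where "Fresnel = (SOME F. (fresnel \<longlongrightarrow> F) at_top)"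

lemma fresnel_tendsto: "(fresnel \<longlongrightarrow> Fresnel) at_top"
proof -
  obtain F where "(fresnel \<longlongrightarrow> F) at_top" using convergent_fresnel by blast
  then show ?thesis unfolding Fresnel_def by (rule someI)
qed

lemma fresnel_error: assumes "R > 0" shows "norm (Fresnel - fresnel R) \<le> 6 / R"
proof -
  obtain F where F: "(fresnel \<longlongrightarrow> F) at_top" "norm (F - fresnel R) \<le> 6 / R"
    using convergent_fresnel assms by blast
  have "F = Fresnel" by (rule tendsto_unique[OF _ F(1) fresnel_tendsto]) simp
  with F(2) show ?thesis by simp
qed

text \<open>A lower bound for the imaginary part avoids evaluating the integral: the integral of
  \<open>sin (y\<^sup>2)\<close> is at least 13/42 over [0, 1] and at least -1/4 over [1, R]; twice
  the difference is 5/42, above 1/10.\<close>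

lemma Fresnel_nonzero: "Fresnel \<noteq> 0"
proof -
  have ci: "(\<lambda>y. sin (y\<^sup>2)) integrable_on {u..v}" for u v :: real
    by (intro integrable_continuous_interval continuous_intros)
  have Im: "Im (fresnel R) = integral {-R..R} (\<lambda>y. sin (y\<^sup>2))" for R
  proof -
    have "(\<lambda>y. expi (y\<^sup>2)) integrable_on {-R..R}"
      by (intro integrable_continuous_interval continuous_intros)
    from integral_unique[OF has_integral_linear[OF integrable_integral[OF this] bounded_linear_Im]]
    show ?thesis by (simp add: fresnel_def o_def Im_exp)
  qed
  have sym: "integral {-R..R} (\<lambda>y::real. sin (y\<^sup>2)) = 2 * integral {0..R} (\<lambda>y. sin (y\<^sup>2))" if "R \<ge> 0" for R
  proof -
    have "integral {-R..R} (\<lambda>y::real. sin (y\<^sup>2)) = integral {-R..0} (\<lambda>y. sin (y\<^sup>2)) + integral {0..R} (\<lambda>y. sin (y\<^sup>2))"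
      by (rule Henstock_Kurzweil_Integration.integral_combine[symmetric]) (use that ci in auto)
    moreover have "integral {-R..-0} (\<lambda>y::real. sin ((-y)\<^sup>2)) = integral {0..R} (\<lambda>y. sin (y\<^sup>2))"
      by (rule Henstock_Kurzweil_Integration.integral_reflect_real)
    ultimately show ?thesis by simp
  qed
  have low: "integral {0..1} (\<lambda>y::real. sin (y\<^sup>2)) \<ge> 13/42"
  proof -
    \<comment> \<open>The Taylor minorant of the sine at y^2; its integral is 1/3 - 1/42 =
      13/42.\<close>
    have "((\<lambda>y::real. y\<^sup>2 - y^6 / 6) has_integral (1^3 / 3 - 1^7 / 42) - (0^3 / 3 - 0^7 / 42)) {0..1}"
      by (rule fundamental_theorem_of_calculus)
         (auto intro!: derivative_eq_intros simp: has_real_derivative_iff_has_vector_derivative[symmetric])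
    moreover have "y\<^sup>2 - y^6 / 6 \<le> sin (y\<^sup>2)" for y :: real
    proof -
      have "(\<Sum>m<3. sin_coeff m * (y\<^sup>2) ^ m) = y\<^sup>2"
        by (simp add: numeral_3_eq_3 sin_coeff_def)
      then have "y\<^sup>2 - (y\<^sup>2)^3 / 6 \<le> sin (y\<^sup>2)"
        using Maclaurin_sin_bound[of "y\<^sup>2" 3] unfolding abs_le_iff by (simp add: fact_numeral)
      then show ?thesis by (simp add: power_mult[symmetric])
    qed
    ultimately have "(1^3 / 3 - 1^7 / 42) - (0^3 / 3 - 0^7 / 42) \<le> integral {0..1} (\<lambda>y::real. sin (y\<^sup>2))"
      by (intro has_integral_le[OF _ integrable_integral[OF ci]]) auto
    then show ?thesis by simp
  qed
  have tail: "integral {1..R} (\<lambda>y::real. sin (y\<^sup>2)) \<ge> - (1/4)" if R: "R \<ge> 1" for R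
  proof -
    \<comment> \<open>A primitive of \<open>sin (y\<^sup>2)\<close> up to a correction. Using 1 -
      cos instead of - cos gives the correction a sign and makes w nonnegative, so only
      \<open>w 1\<close> enters, and it is at most 1/4 because \<open>cos 1\<close> is at least
      1/2.\<close>
    define w where "w y = (1 - cos (y\<^sup>2)) / (2 * y)" for y :: real
    have c1: "cos 1 \<ge> (1/2 :: real)" 
    proof -
      have "cos (2 * (1/2)) = 1 - 2 * (sin (1/2 :: real))\<^sup>2" by (rule cos_double_sin)
      moreover have "(sin (1/2 :: real))\<^sup>2 \<le> (1/2)\<^sup>2"
        by (intro power_mono sin_x_le_x sin_ge_zero) (use pi_gt3 in auto)
      ultimately show ?thesis by (simp add: power2_eq_square)
    qed
    have "((\<lambda>y. sin (y\<^sup>2) + - ((1 - cos (y\<^sup>2)) / (2 * y\<^sup>2))) has_integral w R - w 1) {1..R}"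
    proof (rule fundamental_theorem_of_calculus[OF R])
      fix y assume "y \<in> {1..R}"
      then show "(w has_vector_derivative sin (y\<^sup>2) + - ((1 - cos (y\<^sup>2)) / (2 * y\<^sup>2))) (at y within {1..R})"
        unfolding has_real_derivative_iff_has_vector_derivative[symmetric] w_def
        by (auto intro!: derivative_eq_intros simp: field_simps power2_eq_square)
    qed
    moreover have "sin (y\<^sup>2) + - ((1 - cos (y\<^sup>2)) / (2 * y\<^sup>2)) \<le> sin (y\<^sup>2)" for y :: real by simp
    ultimately have "w R - w 1 \<le> integral {1..R} (\<lambda>y. sin (y\<^sup>2))"
      by (intro has_integral_le[OF _ integrable_integral[OF ci]]) auto
    moreover have "w R \<ge> 0" using R by (simp add: w_def)
    moreover have "w 1 \<le> 1 / 4" using c1 by (simp add: w_def)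
    ultimately show ?thesis by linarith
  qed
  have "Im (fresnel R) \<ge> 1/10" if R: "R \<ge> 1" for R
  proof -
    have "integral {0..R} (\<lambda>y::real. sin (y\<^sup>2)) = integral {0..1} (\<lambda>y. sin (y\<^sup>2)) + integral {1..R} (\<lambda>y. sin (y\<^sup>2))"
      by (rule Henstock_Kurzweil_Integration.integral_combine[symmetric]) (use that ci in auto)
    then show ?thesis using low tail[OF R] R by (simp add: Im sym)
  qed
  then have "eventually (\<lambda>R. 1/10 \<le> Im (fresnel R)) at_top" by (rule eventually_mono[OF eventually_ge_at_top[of 1]])
  from tendsto_lowerbound[OF tendsto_Im[OF fresnel_tendsto] this] have "Im Fresnel \<ge> 1/10" by simp
  then show ?thesis by auto
qed

lemma scaled_fresnel:
  assumes "D \<noteq> 0" "R \<ge> 0"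
  shows "integral {-R..R} (\<lambda>y. expi (D / 2 * y\<^sup>2)) =
     complex_of_real (1 / sqrt (\<bar>D\<bar> / 2)) * (if D > 0 then fresnel (sqrt (\<bar>D\<bar> / 2) * R) else cnj (fresnel (sqrt (\<bar>D\<bar> / 2) * R)))"
proof -
  define \<mu> where "\<mu> = sqrt (\<bar>D\<bar> / 2)"
  have \<mu>: "\<mu> > 0" "\<mu>\<^sup>2 = \<bar>D\<bar> / 2" using assms by (auto simp: \<mu>_def)
  have ci: "(\<lambda>y. expi (c * y\<^sup>2)) integrable_on {u..v}" for c u v :: real
    by (intro integrable_continuous_interval continuous_intros)
  have "((\<lambda>y. expi (y\<^sup>2)) has_integral fresnel (\<mu> * R)) (cbox (- (\<mu> * R)) (\<mu> * R))"
    unfolding fresnel_def using integrable_integral[OF ci[of 1 "- (\<mu> * R)" "\<mu> * R"]] by simp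
  from has_integral_affinity'[OF this \<mu>(1), of 0]
  have "((\<lambda>y. expi (\<mu>\<^sup>2 * y\<^sup>2)) has_integral complex_of_real (1 / \<mu>) * fresnel (\<mu> * R)) {-R..R}"
    using \<mu>(1) by (simp add: power_mult_distrib scaleR_conv_of_real inverse_eq_divide)
  then have pos: "((\<lambda>y. expi (\<bar>D\<bar> / 2 * y\<^sup>2)) has_integral complex_of_real (1 / \<mu>) * fresnel (\<mu> * R)) {-R..R}"
    unfolding \<mu>(2) .
  show ?thesis
  proof (cases "D > 0")
    case True
    with integral_unique[OF pos] show ?thesis by (simp add: \<mu>_def)
  next
    case False
    have "((\<lambda>y. cnj (expi (\<bar>D\<bar> / 2 * y\<^sup>2))) has_integral cnj (complex_of_real (1 / \<mu>) * fresnel (\<mu> * R))) {-R..R}"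
      using has_integral_linear[OF pos bounded_linear_cnj] by (simp add: o_def)
    moreover have "cnj (expi (\<bar>D\<bar> / 2 * y\<^sup>2)) = expi (D / 2 * y\<^sup>2)" for y
    proof -
      have "cnj (expi x) = expi (- x)" for x by (simp add: exp_cnj)
      moreover have "- (\<bar>D\<bar> / 2 * y\<^sup>2) = D / 2 * y\<^sup>2" using False by simp
      ultimately show ?thesis by metis
    qed
    ultimately show ?thesis using False by (simp add: \<mu>_def integral_unique)
  qed
qed

text \<open>In the window of radius R / sqrt \<kappa> around x0, rescaling turns the phase into a
  quadratic one and dominated convergence gives a truncated Fresnel integral. Outside, the tail
  bound is C / R uniformly in n. The statement compares with an oscillating term since
  \<open>expi (\<kappa> n * f x0)\<close> need not converge.\<close>

lemma stationary_phase_1d: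
  fixes b b' :: "real \<Rightarrow> complex" and f f1 f2 :: "real \<Rightarrow> real" and \<kappa> :: "nat \<Rightarrow> real"
  assumes f: "\<And>x. (f has_real_derivative f1 x) (at x)"
    and f1: "\<And>x. (f1 has_real_derivative f2 x) (at x)" and f2: "continuous_on UNIV f2"
    and b: "\<And>x. (b has_vector_derivative b' x) (at x)" and b': "continuous_on UNIV b'"
    and b_bd: "\<And>x. norm (b x) \<le> B"
    and x0: "\<alpha> < x0" "x0 < \<beta>" "f1 x0 = 0" "f2 x0 \<noteq> 0"
    and nz: "\<And>x. x \<in> {\<alpha>..\<beta>} \<Longrightarrow> f1 x = 0 \<Longrightarrow> x = x0"
    and \<kappa>: "filterlim \<kappa> at_top sequentially" and \<kappa>_pos: "\<And>n. \<kappa> n > 0"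
  shows "(\<lambda>n. sqrt (\<kappa> n) * integral {\<alpha>..\<beta>} (\<lambda>x. b x * expi (\<kappa> n * f x))
      - expi (\<kappa> n * f x0) * (b x0 * complex_of_real (1 / sqrt (\<bar>f2 x0\<bar> / 2)) * (if f2 x0 > 0 then Fresnel else cnj Fresnel))) \<longlonglongrightarrow> 0"
proof -
  define D where "D = f2 x0"
  define \<mu> where "\<mu> = sqrt (\<bar>D\<bar> / 2)"
  have D: "D \<noteq> 0" using x0 by (simp add: D_def)
  have \<mu>: "\<mu> > 0" using D by (simp add: \<mu>_def)
  have cf: "continuous_on A f" and cf1: "continuous_on A f1" for A
    using f f1 by (meson continuous_at_imp_continuous_on DERIV_isCont)+
  have cb: "continuous_on A b" for A
    using b by (meson continuous_at_imp_continuous_on has_vector_derivative_continuous)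
  obtain d where d: "d > 0" "\<And>y. \<bar>y - x0\<bar> < d \<Longrightarrow> \<bar>f1 y\<bar> \<ge> \<bar>D\<bar> / 2 * \<bar>y - x0\<bar>"
    using simple_zero_lower_bound[OF f1 x0(3) x0(4)] unfolding D_def by blast
  \<comment> \<open>Near x0 the zero of f1 is simple; on the rest of the interval |f1| has a
    positive minimum, and |x - x0| is at most \<beta> - \<alpha>.\<close>
  obtain m where m: "m > 0" "\<And>x. x \<in> {\<alpha>..\<beta>} \<Longrightarrow> m * \<bar>x - x0\<bar> \<le> \<bar>f1 x\<bar>"
  proof -
    define S where "S = {\<alpha>..\<beta>} \<inter> {y. d \<le> \<bar>y - x0\<bar>}"
    have S: "compact S" unfolding S_def
      by (intro compact_Int_closed compact_Icc closed_Collect_le continuous_intros)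
    have "\<exists>c>0. \<forall>x\<in>S. c \<le> \<bar>f1 x\<bar>"
    proof (cases "S = {}")
      case False
      obtain x where x: "x \<in> S" "\<And>y. y \<in> S \<Longrightarrow> \<bar>f1 x\<bar> \<le> \<bar>f1 y\<bar>"
        using continuous_attains_inf[OF S False, of "\<lambda>x. \<bar>f1 x\<bar>"] cf1 by (auto intro!: continuous_intros)
      have "f1 x \<noteq> 0" using nz[of x] x(1) d(1) by (auto simp: S_def)
      with x show ?thesis by (intro exI[of _ "\<bar>f1 x\<bar>"]) auto
    qed (use zero_less_one in blast)
    then obtain c where c: "c > 0" "\<And>x. x \<in> S \<Longrightarrow> c \<le> \<bar>f1 x\<bar>" by blast
    define m where "m = min (\<bar>D\<bar> / 2) (c / (\<beta> - \<alpha>))"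
    show thesis
    proof (rule that[of m])
      show "m > 0" using D c x0 by (simp add: m_def)
      fix x assume x: "x \<in> {\<alpha>..\<beta>}"
      show "m * \<bar>x - x0\<bar> \<le> \<bar>f1 x\<bar>"
      proof (cases "\<bar>x - x0\<bar> < d")
        case True
        have "m * \<bar>x - x0\<bar> \<le> \<bar>D\<bar> / 2 * \<bar>x - x0\<bar>" unfolding m_def by (intro mult_right_mono min.cobounded1 abs_ge_zero)
        with d(2)[OF True] show ?thesis by linarith
      next
        case False
        then have "c \<le> \<bar>f1 x\<bar>" using c(2)[of x] x by (auto simp: S_def)
        moreover have "m * \<bar>x - x0\<bar> \<le> c / (\<beta> - \<alpha>) * (\<beta> - \<alpha>)"
          unfolding m_def using x x0 c(1) D by (intro mult_mono min.cobounded2) auto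
        ultimately show ?thesis using x0 by simp
      qed
    qed
  qed
  have bd: "\<exists>M\<ge>0. \<forall>x\<in>{\<alpha>..\<beta>}. norm (g x) \<le> M" if "continuous_on {\<alpha>..\<beta>} g" for g :: "real \<Rightarrow> 'c::real_normed_vector"
    using compact_imp_bounded[OF compact_continuous_image[OF that compact_Icc]] unfolding bounded_pos
    by (metis image_eqI less_imp_le)
  obtain M1 where M1: "M1 \<ge> 0" "\<And>x. x \<in> {\<alpha>..\<beta>} \<Longrightarrow> norm (b' x) \<le> M1"
    using bd[OF continuous_on_subset[OF b' subset_UNIV]] by blast
  obtain M2 where M2: "M2 \<ge> 0" "\<And>x. x \<in> {\<alpha>..\<beta>} \<Longrightarrow> \<bar>f2 x\<bar> \<le> M2"
    using bd[OF continuous_on_subset[OF f2 subset_UNIV]] by auto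
  have B: "B \<ge> 0" using order_trans[OF norm_ge_zero b_bd] .
  define M where "M = max B M2"
  define C where "C = 2 * M / m + (M1 * (\<beta> - \<alpha>) / m + M * M / m\<^sup>2)"
  define E where "E n x = expi (\<kappa> n * f x)" for n x
  have cE: "continuous_on A (E n)" for n A unfolding E_def by (intro continuous_intros cf)
  have int: "(\<lambda>x. b x * E n x) integrable_on {u..v}" for n u v
    by (intro integrable_continuous_interval continuous_intros cb cE)
  have M0: "M \<ge> 0" using B by (simp add: M_def)
  have C0: "C \<ge> 0" unfolding C_def using M0 M1(1) m(1) x0 by (intro add_nonneg_nonneg divide_nonneg_nonneg mult_nonneg_nonneg) auto
  have tail: "sqrt (\<kappa> n) * norm (integral {u..v} (\<lambda>x. b x * E n x)) \<le> C / R"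
    if uv: "u \<le> v" "{u..v} \<subseteq> {\<alpha>..\<beta>}" and R: "R > 0" "\<And>x. x \<in> {u..v} \<Longrightarrow> R / sqrt (\<kappa> n) \<le> \<bar>x - x0\<bar>" for n u v R
  proof -
    have k: "sqrt (\<kappa> n) > 0" using \<kappa>_pos[of n] by simp
    have "norm (integral {u..v} (\<lambda>x. b x * E n x)) \<le> C / (\<kappa> n * (R / sqrt (\<kappa> n)))"
      unfolding E_def C_def
    proof (rule oscillatory_tail_bound[where ?f1.0 = f1 and ?f2.0 = f2 and b' = b' and ?x0.0 = x0])
      show "norm (b x) \<le> M" for x using b_bd[of x] by (simp add: M_def)
      show "\<bar>x - x0\<bar> \<le> \<beta> - \<alpha>" if "x \<in> {u..v}" for x using that uv x0 by auto
      show "\<bar>f2 x\<bar> \<le> M" if "x \<in> {u..v}" for x using M2(2)[of x] that uv(2) by (auto simp: M_def)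
      show "norm (b' x) \<le> M1" if "x \<in> {u..v}" for x using M1(2)[of x] that uv(2) by auto
      show "m * \<bar>x - x0\<bar> \<le> \<bar>f1 x\<bar>" if "x \<in> {u..v}" for x using m(2)[of x] that uv(2) by auto
      show "R / sqrt (\<kappa> n) > 0" using R k by simp
    qed (use f f1 b m M0 M1 \<kappa>_pos uv R in \<open>auto intro: continuous_on_subset[OF f2] continuous_on_subset[OF b']\<close>)
    also have "\<kappa> n * (R / sqrt (\<kappa> n)) = sqrt (\<kappa> n) * R"
      using k \<kappa>_pos[of n] by (metis less_imp_le real_div_sqrt times_divide_eq_left times_divide_eq_right mult.commute)
    finally have "sqrt (\<kappa> n) * norm (integral {u..v} (\<lambda>x. b x * E n x)) \<le> sqrt (\<kappa> n) * (C / (sqrt (\<kappa> n) * R))"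
      using k by (intro mult_left_mono) auto
    then show ?thesis using k by simp
  qed
  have sk: "filterlim (\<lambda>n. sqrt (\<kappa> n)) at_top sequentially"
    by (rule filterlim_compose[OF sqrt_at_top \<kappa>])
  have inv: "(\<lambda>n. 1 / sqrt (\<kappa> n)) \<longlonglongrightarrow> 0"
    using tendsto_inverse_0_at_top[OF sk] by (simp add: inverse_eq_divide)
  define e0 where "e0 n = expi (\<kappa> n * f x0)" for n
  have ne0: "norm (e0 n) = 1" for n unfolding e0_def by (rule norm_exp_i_real)
  define mid where "mid R n = integral {-R..R} (\<lambda>y. b (x0 + y / sqrt (\<kappa> n)) * expi (\<kappa> n * (f (x0 + y / sqrt (\<kappa> n)) - f x0)))" for R n
  \<comment> \<open>The second-order behaviour of f at x0 by one use of l'Hopital's rule and the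
    derivative of f1 at x0.\<close>
  have second: "((\<lambda>h. (f (x0 + h) - f x0) / h\<^sup>2) \<longlongrightarrow> D / 2) (at 0)"
  proof (rule lhopital[where f' = "\<lambda>h. f1 (x0 + h)" and g' = "\<lambda>h. 2 * h"])
    have "((\<lambda>h. f (x0 + h) - f x0) \<longlongrightarrow> f (x0 + 0) - f x0) (at 0)"
      by (intro tendsto_intros isCont_tendsto_compose[OF DERIV_isCont[OF f]])
    then show "((\<lambda>h. f (x0 + h) - f x0) \<longlongrightarrow> 0) (at 0)" by simp
    show "((\<lambda>h::real. h\<^sup>2) \<longlongrightarrow> 0) (at 0)" by (rule tendsto_eq_intros | simp)+
    show "\<forall>\<^sub>F h::real in at 0. h\<^sup>2 \<noteq> 0" "\<forall>\<^sub>F h::real in at 0. 2 * h \<noteq> 0" by (auto simp: eventually_at_filter)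
    show "\<forall>\<^sub>F h in at 0. ((\<lambda>h. f (x0 + h) - f x0) has_real_derivative f1 (x0 + h)) (at h)"
    proof (intro always_eventually allI)
      fix h
      have "((\<lambda>h. f (h + x0)) has_real_derivative f1 (h + x0)) (at h)" using f[of "h + x0"] by (simp add: DERIV_shift)
      then show "((\<lambda>h. f (x0 + h) - f x0) has_real_derivative f1 (x0 + h)) (at h)"
        by (auto intro!: derivative_eq_intros simp: add.commute)
    qed
    show "\<forall>\<^sub>F h::real in at 0. ((\<lambda>h. h\<^sup>2) has_real_derivative 2 * h) (at h)"
      by (auto intro!: always_eventually derivative_eq_intros)
    have "((\<lambda>h. (f1 (x0 + h) - f1 x0) / h) \<longlongrightarrow> D) (at 0)" using f1[of x0] unfolding D_def by (simp add: DERIV_def)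
    from tendsto_divide[OF this tendsto_const[of 2]]
    show "((\<lambda>h. f1 (x0 + h) / (2 * h)) \<longlongrightarrow> D / 2) (at 0)" using x0(3) by (simp add: mult.commute)
  qed
  have mid_lim: "mid R \<longlonglongrightarrow> b x0 * integral {-R..R} (\<lambda>y. expi (D / 2 * y\<^sup>2))" for R
  proof -
    have "mid R \<longlonglongrightarrow> integral {-R..R} (\<lambda>y. b x0 * expi (D / 2 * y\<^sup>2))"
      unfolding mid_def
    proof (rule dominated_convergence(2)[where h = "\<lambda>y. B"])
      show "(\<lambda>y. b (x0 + y / sqrt (\<kappa> n)) * expi (\<kappa> n * (f (x0 + y / sqrt (\<kappa> n)) - f x0))) integrable_on {-R..R}" for n
        using \<kappa>_pos[of n] by (intro integrable_continuous_interval continuous_intros continuous_on_compose2[OF cb[of UNIV]] continuous_on_compose2[OF cf[of UNIV]]) auto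
      show "(\<lambda>y. B) integrable_on {-R..R}" by (intro integrable_continuous_interval continuous_intros)
      show "norm (b (x0 + y / sqrt (\<kappa> n)) * expi (\<kappa> n * (f (x0 + y / sqrt (\<kappa> n)) - f x0))) \<le> B" for n y
        using b_bd unfolding norm_mult norm_exp_i_real by simp
      fix y assume "y \<in> {-R..R}"
      have h: "(\<lambda>n. y / sqrt (\<kappa> n)) \<longlonglongrightarrow> 0" using tendsto_mult[OF tendsto_const[of y] inv] by simp
      have 1: "(\<lambda>n. b (x0 + y / sqrt (\<kappa> n))) \<longlonglongrightarrow> b (x0 + 0)"
        by (rule isCont_tendsto_compose[OF _ tendsto_add[OF tendsto_const h]])
           (use has_vector_derivative_continuous[OF b[of x0]] in simp)
      have 2: "(\<lambda>n. \<kappa> n * (f (x0 + y / sqrt (\<kappa> n)) - f x0)) \<longlonglongrightarrow> D / 2 * y\<^sup>2"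
      proof (cases "y = 0")
        case False
        have "filterlim (\<lambda>n. y / sqrt (\<kappa> n)) (at 0) sequentially"
          unfolding filterlim_at using h False \<kappa>_pos by (auto intro!: always_eventually simp: less_imp_neq[symmetric])
        from tendsto_mult[OF filterlim_compose[OF second this] tendsto_const[of "y\<^sup>2"]]
        have "(\<lambda>n. (f (x0 + y / sqrt (\<kappa> n)) - f x0) / (y / sqrt (\<kappa> n))\<^sup>2 * y\<^sup>2) \<longlonglongrightarrow> D / 2 * y\<^sup>2" .
        moreover have "(f (x0 + y / sqrt (\<kappa> n)) - f x0) / (y / sqrt (\<kappa> n))\<^sup>2 * y\<^sup>2 = \<kappa> n * (f (x0 + y / sqrt (\<kappa> n)) - f x0)" for n
          using False \<kappa>_pos[of n] by (simp add: power_divide)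
        ultimately show ?thesis by simp
      qed simp
      show "(\<lambda>n. b (x0 + y / sqrt (\<kappa> n)) * expi (\<kappa> n * (f (x0 + y / sqrt (\<kappa> n)) - f x0))) \<longlonglongrightarrow> b x0 * expi (D / 2 * y\<^sup>2)"
        using 1 by (intro tendsto_intros 2) simp
    qed
    then show ?thesis by simp
  qed
  define Fr where "Fr = (if D > 0 then Fresnel else cnj Fresnel)"
  define L where "L = b x0 * complex_of_real (1 / \<mu>) * Fr"
  have L_err: "norm (b x0 * integral {-R..R} (\<lambda>y. expi (D / 2 * y\<^sup>2)) - L) \<le> B * (6 / \<mu>\<^sup>2) / R" if R: "R > 0" for R
  proof -
    define G where "G = (if D > 0 then fresnel (\<mu> * R) else cnj (fresnel (\<mu> * R)))"
    have "norm (G - Fr) = norm (Fresnel - fresnel (\<mu> * R))"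
      unfolding G_def Fr_def by (metis complex_cnj_diff complex_mod_cnj norm_minus_commute)
    also have "\<dots> \<le> 6 / (\<mu> * R)" using fresnel_error \<mu> R by simp
    finally have G: "norm (G - Fr) \<le> 6 / (\<mu> * R)" .
    have "b x0 * integral {-R..R} (\<lambda>y. expi (D / 2 * y\<^sup>2)) - L = b x0 * (complex_of_real (1 / \<mu>) * (G - Fr))"
      using scaled_fresnel[OF D less_imp_le[OF R]] unfolding L_def G_def \<mu>_def by (simp add: algebra_simps)
    also have "norm \<dots> \<le> B * (1 / \<mu> * (6 / (\<mu> * R)))"
      unfolding norm_mult norm_of_real using b_bd[of x0] G \<mu> B by (intro mult_mono) auto
    finally show ?thesis by (simp add: power2_eq_square)
  qed
  define S where "S n = sqrt (\<kappa> n) * integral {\<alpha>..\<beta>} (\<lambda>x. b x * E n x)" for n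
  have split: "norm (S n - e0 n * mid R n) \<le> 2 * (C / R)"
    if R: "R > 0" and small: "R / sqrt (\<kappa> n) < x0 - \<alpha>" "R / sqrt (\<kappa> n) < \<beta> - x0" for R n
  proof -
    define k where "k = sqrt (\<kappa> n)"
    have k: "k > 0" using \<kappa>_pos[of n] by (simp add: k_def)
    define \<delta> where "\<delta> = R / k"
    have \<delta>: "\<delta> > 0" "\<delta> < x0 - \<alpha>" "\<delta> < \<beta> - x0" using small R k by (auto simp: \<delta>_def k_def)
    let ?I = "\<lambda>u v. integral {u..v} (\<lambda>x. b x * E n x)"
    have "?I \<alpha> (x0 + \<delta>) = ?I \<alpha> (x0 - \<delta>) + ?I (x0 - \<delta>) (x0 + \<delta>)"
      by (rule Henstock_Kurzweil_Integration.integral_combine[symmetric]) (use \<delta> int in auto)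
    moreover have "?I \<alpha> \<beta> = ?I \<alpha> (x0 + \<delta>) + ?I (x0 + \<delta>) \<beta>"
      by (rule Henstock_Kurzweil_Integration.integral_combine[symmetric]) (use \<delta> x0 int in auto)
    ultimately have sum: "?I \<alpha> \<beta> = ?I \<alpha> (x0 - \<delta>) + ?I (x0 - \<delta>) (x0 + \<delta>) + ?I (x0 + \<delta>) \<beta>" by simp
    have "((\<lambda>x. b x * E n x) has_integral ?I (x0 - \<delta>) (x0 + \<delta>)) (cbox (x0 - \<delta>) (x0 + \<delta>))"
      using integrable_integral[OF int] by simp
    from has_integral_affinity'[OF this, of "1 / k" x0] k
    have "((\<lambda>y. b (x0 + y / k) * E n (x0 + y / k)) has_integral k * ?I (x0 - \<delta>) (x0 + \<delta>)) {-R..R}"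
      by (simp add: \<delta>_def add.commute scaleR_conv_of_real)
    then have "k * ?I (x0 - \<delta>) (x0 + \<delta>) = integral {-R..R} (\<lambda>y. b (x0 + y / k) * E n (x0 + y / k))"
      by (simp add: integral_unique)
    also have "\<dots> = integral {-R..R} (\<lambda>y. e0 n * (b (x0 + y / k) * expi (\<kappa> n * (f (x0 + y / k) - f x0))))"
    proof (rule integral_cong)
      fix y
      have "E n (x0 + y / k) = e0 n * expi (\<kappa> n * (f (x0 + y / k) - f x0))"
        unfolding E_def e0_def exp_add[symmetric] by (simp add: algebra_simps)
      then show "b (x0 + y / k) * E n (x0 + y / k) = e0 n * (b (x0 + y / k) * expi (\<kappa> n * (f (x0 + y / k) - f x0)))"
        by simp
    qed
    also have "\<dots> = e0 n * mid R n" unfolding mid_def k_def by (rule integral_mult_right)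
    finally have "S n - e0 n * mid R n = k * ?I \<alpha> (x0 - \<delta>) + k * ?I (x0 + \<delta>) \<beta>"
      unfolding S_def sum k_def by (simp add: distrib_left)
    also have "norm \<dots> \<le> C / R + C / R"
    proof (rule norm_triangle_mono)
      show "norm (complex_of_real k * ?I \<alpha> (x0 - \<delta>)) \<le> C / R"
        using tail[of \<alpha> "x0 - \<delta>" R n] \<delta> x0 R k by (simp add: norm_mult k_def[symmetric] \<delta>_def[symmetric])
      show "norm (complex_of_real k * ?I (x0 + \<delta>) \<beta>) \<le> C / R"
        using tail[of "x0 + \<delta>" \<beta> R n] \<delta> x0 R k by (simp add: norm_mult k_def[symmetric] \<delta>_def[symmetric])
    qed
    finally show ?thesis by simp
  qed
  have "(\<lambda>n. S n - e0 n * L) \<longlonglongrightarrow> 0"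
  proof (rule LIMSEQ_I)
    fix e :: real assume e: "e > 0"
    \<comment> \<open>R is fixed first so that the tails and the truncation of the Fresnel integral
      together stay below Q / R < e / 2; only then does n grow.\<close>
    define Q where "Q = 2 * C + B * (6 / \<mu>\<^sup>2)"
    have Q: "Q \<ge> 0" using C0 B by (simp add: Q_def)
    define R where "R = 2 * (Q + 1) / e"
    have R: "R > 0" using Q e by (simp add: R_def)
    have QR: "Q / R < e / 2" using Q e by (simp add: R_def field_simps)
    obtain N1 where N1: "\<And>n. n \<ge> N1 \<Longrightarrow> norm (mid R n - b x0 * integral {-R..R} (\<lambda>y. expi (D / 2 * y\<^sup>2))) < e / 2"
      using LIMSEQ_D[OF mid_lim[of R], of "e / 2"] e by auto
    have "(\<lambda>n. R / sqrt (\<kappa> n)) \<longlonglongrightarrow> 0" using tendsto_mult[OF tendsto_const[of R] inv] by simp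
    then have "\<forall>\<^sub>F n in sequentially. R / sqrt (\<kappa> n) < min (x0 - \<alpha>) (\<beta> - x0)"
      by (rule order_tendstoD) (use x0 in simp)
    then obtain N2 where N2: "\<And>n. n \<ge> N2 \<Longrightarrow> R / sqrt (\<kappa> n) < min (x0 - \<alpha>) (\<beta> - x0)"
      by (auto simp: eventually_sequentially)
    show "\<exists>no. \<forall>n\<ge>no. norm (S n - e0 n * L - 0) < e"
    proof (intro exI allI impI)
      fix n assume n: "n \<ge> max N1 N2"
      let ?m = "b x0 * integral {-R..R} (\<lambda>y. expi (D / 2 * y\<^sup>2))"
      have "S n - e0 n * L = (S n - e0 n * mid R n) + e0 n * (mid R n - ?m) + e0 n * (?m - L)" by (simp add: algebra_simps)
      also have "norm \<dots> \<le> norm (S n - e0 n * mid R n) + norm (e0 n * (mid R n - ?m)) + norm (e0 n * (?m - L))"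
        by (intro norm_triangle_mono order_refl)
      also have "\<dots> < 2 * (C / R) + e / 2 + B * (6 / \<mu>\<^sup>2) / R"
        using split[OF R, of n] N2[of n] n N1[of n] L_err[OF R] by (simp add: norm_mult ne0)
      also have "\<dots> = Q / R + e / 2" by (simp add: Q_def add_divide_distrib)
      also have "\<dots> < e" using QR by linarith
      finally show "norm (S n - e0 n * L - 0) < e" by simp
    qed
  qed
  then show ?thesis unfolding S_def E_def e0_def L_def Fr_def \<mu>_def D_def by (simp add: mult.assoc)
qed

lemma integral_periodic_shift:
  fixes f :: "real \<Rightarrow> complex"
  assumes f: "continuous_on UNIV f" and per: "\<And>x. f (x + 2 * pi) = f x"
  shows "integral {-pi..pi} (\<lambda>x. f (x + c)) = integral {-pi..pi} f"
proof -
  \<comment> \<open>A base point to the left of -pi and c - pi, so that F is differentiable at all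
    endpoints that occur.\<close>
  define u where "u = - pi - \<bar>c\<bar> - 1"
  define F where "F x = integral {u..x} f" for x
  have int: "f integrable_on {x..y}" for x y
    by (intro integrable_continuous_interval continuous_on_subset[OF f]) simp
  have F: "(F has_vector_derivative f x) (at x)" if "x > u" for x
  proof -
    have "(F has_vector_derivative f x) (at x within {u..x+1})" unfolding F_def
      by (rule integral_has_vector_derivative[OF continuous_on_subset[OF f]]) (use that in auto)
    moreover have "at x within {u..x+1} = at x" by (rule at_within_Icc_at) (use that in auto)
    ultimately show ?thesis by (simp only:)
  qed
  have diff: "F y - F x = integral {x..y} f" if "u \<le> x" "x \<le> y" for x y
  proof -
    have "integral {u..y} f = integral {u..x} f + integral {x..y} f"
      by (rule Henstock_Kurzweil_Integration.integral_combine[symmetric, OF that int])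
    then show ?thesis unfolding F_def by simp
  qed
  have shift: "integral {-pi..pi} (\<lambda>x. f (x + d)) = integral {-pi + d..pi + d} f" for d
    using integral_shift_real_ivl[of "- pi + d" d "pi + d" f] by simp
  have lin: "((\<lambda>d. d + w) has_vector_derivative 1) (at x)" for x w :: real
    unfolding has_real_derivative_iff_has_vector_derivative[symmetric] by (auto intro!: derivative_eq_intros)
  define S where "S = {u + pi<..}"
  obtain k where k: "\<And>d. d \<in> S \<Longrightarrow> F (d + pi) - F (d - pi) = k"
  proof (rule has_vector_derivative_zero_constant[of S "\<lambda>d. F (d + pi) - F (d - pi)"])
    show "convex S" unfolding S_def by (rule convex_real_interval)
    fix x assume "x \<in> S"
    then have "u + pi < x" by (simp add: S_def)
    then have x: "u < x - pi" "u < x + pi" using pi_gt_zero by linarith+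
    have "((\<lambda>d. F (d + pi)) has_vector_derivative 1 *\<^sub>R f (x + pi)) (at x)"
      using vector_diff_chain_at[OF lin F, of x pi] x(2) by (simp add: o_def)
    moreover have "((\<lambda>d. F (d - pi)) has_vector_derivative 1 *\<^sub>R f (x - pi)) (at x)"
      using vector_diff_chain_at[OF lin F, of x "- pi"] x(1) by (simp add: o_def)
    ultimately have "((\<lambda>d. F (d + pi) - F (d - pi)) has_vector_derivative 1 *\<^sub>R f (x + pi) - 1 *\<^sub>R f (x - pi)) (at x)"
      by (rule has_vector_derivative_diff)
    moreover have "f (x + pi) = f (x - pi)" using per[of "x - pi"] by (simp add: add.commute)
    ultimately show "((\<lambda>d. F (d + pi) - F (d - pi)) has_vector_derivative 0) (at x within S)"
      by (simp add: has_vector_derivative_at_within)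
  qed auto
  have "c \<in> S" "0 \<in> S" by (auto simp: S_def u_def)
  then have "F (c + pi) - F (c - pi) = F pi - F (-pi)" using k[of c] k[of 0] by simp
  moreover have "u \<le> c - pi" "c - pi \<le> c + pi" "u \<le> -pi" "-pi \<le> pi" unfolding u_def by auto
  ultimately have "integral {c - pi..c + pi} f = integral {-pi..pi} f" by (simp add: diff)
  then show ?thesis unfolding shift by (simp add: add.commute)
qed

text \<open>\<open>cutA s\<close> and \<open>cutA (s + pi)\<close> separate the stationary points \<open>s = 0\<close> and \<open>s = pi\<close> of \<open>cos\<close>;
  their sum \<open>1 - (sin s)\<^sup>2 / 2\<close> need only be 1 at these two points.\<close>
definition cutA :: "real \<Rightarrow> real" where "cutA s = ((1 + cos s) / 2)\<^sup>2"

lemma continuous_on_cutA [continuous_intros]: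
  fixes f :: "'a::t2_space \<Rightarrow> real"
  shows "continuous_on A f \<Longrightarrow> continuous_on A (\<lambda>x. cutA (f x))"
  unfolding cutA_def by (intro continuous_intros) auto

section \<open>The model integral over the relative angle\<close>

text \<open>The contribution of s = 0 to the inner integral, with the oscillation
  \<open>expi l\<close> of the critical value factored out.\<close>

definition K0 :: "real \<Rightarrow> complex" where
  "K0 l = integral {-pi..pi} (\<lambda>s. complex_of_real (cutA s) * expi (l * (cos s - 1)))"

lemma exp_cos_deriv:
  "((\<lambda>s. expi (l * (cos s - 1))) has_vector_derivative
     - (\<i> * complex_of_real (l * sin s)) * expi (l * (cos s - 1))) (at s)"
proof -
  have "((\<lambda>s. l * (cos s - 1)) has_real_derivative - (l * sin s)) (at s)"
    by (auto intro!: derivative_eq_intros)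
  from has_vector_derivative_exp_i[OF this] show ?thesis by simp
qed

lemma of_real_mult_exp_cos_deriv:
  assumes "(V has_real_derivative V') (at s)"
  shows "((\<lambda>s. complex_of_real (V s) * expi (l * (cos s - 1))) has_vector_derivative
     complex_of_real V' * expi (l * (cos s - 1))
      - \<i> * complex_of_real l * (complex_of_real (V s * sin s) * expi (l * (cos s - 1)))) (at s)"
  using has_vector_derivative_mult[OF has_vector_derivative_of_real[OF assms] exp_cos_deriv[of l]]
  by (rule has_vector_derivative_eq_rhs) (simp add: algebra_simps)

text \<open>Integration by parts over a period. The product of V and sin is called W so that it can
  be supplied in simplified form.\<close>

lemma integral_periodic_exp_cos:
  fixes V V' W :: "real \<Rightarrow> real"
  assumes V: "\<And>s. (V has_real_derivative V' s) (at s)" and per: "V pi = V (-pi)"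
    and V': "continuous_on UNIV V'" and W: "continuous_on UNIV W" "\<And>s. W s = V s * sin s"
  shows "integral {-pi..pi} (\<lambda>s. complex_of_real (V' s) * expi (l * (cos s - 1)))
       = \<i> * complex_of_real l * integral {-pi..pi} (\<lambda>s. complex_of_real (W s) * expi (l * (cos s - 1)))"
proof -
  define E where "E s = expi (l * (cos s - 1))" for s
  have cE: "continuous_on A E" for A unfolding E_def by (intro continuous_intros)
  have c: "continuous_on A V'" "continuous_on A W" for A using V' W continuous_on_subset by blast+
  have "((\<lambda>s. complex_of_real (V' s) * E s - \<i> * complex_of_real l * (complex_of_real (W s) * E s)) has_integral
      complex_of_real (V pi) * E pi - complex_of_real (V (-pi)) * E (-pi)) {-pi..pi}"
    by (rule fundamental_theorem_of_calculus)
       (use has_vector_derivative_at_within[OF of_real_mult_exp_cos_deriv[OF V]] in \<open>auto simp: E_def W(2)\<close>)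
  from integral_unique[OF this]
  have "integral {-pi..pi} (\<lambda>s. complex_of_real (V' s) * E s - \<i> * complex_of_real l * (complex_of_real (W s) * E s)) = 0"
    by (simp add: per E_def)
  moreover have "integral {-pi..pi} (\<lambda>s. complex_of_real (V' s) * E s - \<i> * complex_of_real l * (complex_of_real (W s) * E s))
     = integral {-pi..pi} (\<lambda>s. complex_of_real (V' s) * E s) - integral {-pi..pi} (\<lambda>s. \<i> * complex_of_real l * (complex_of_real (W s) * E s))"
    by (intro integral_diff integrable_continuous_interval continuous_intros c cE)
  ultimately show ?thesis unfolding E_def integral_mult_right by simp
qed

text \<open>Up to the factor \<open>expi (- l)\<close> this is a Bessel integral of order 1.\<close>

definition Jcos :: "real \<Rightarrow> complex" where
  "Jcos l = integral {-pi..pi} (\<lambda>s. complex_of_real (cos s) * expi (l * (cos s - 1)))"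

lemma Jcos_tendsto: "(Jcos \<longlongrightarrow> 0) at_top"
proof (rule tendsto_at_topI_sequentially)
  fix X :: "nat \<Rightarrow> real" assume X: "filterlim X at_top sequentially"
  have sin_simple: "cos x \<noteq> 0" if "sin x = 0" for x :: real
    using sin_zero_abs_cos_one[OF that] by auto
  have fin: "finite {s \<in> {-pi..pi}. - sin s = (0::real)}"
    using finite_simple_zeros[OF DERIV_sin sin_simple, of "-pi" pi] by simp
  show "(\<lambda>n. Jcos (X n)) \<longlonglongrightarrow> 0" unfolding Jcos_def
    by (rule Riemann_Lebesgue_phase_finite[OF _ _ _ _ fin X]) (auto intro!: continuous_intros derivative_eq_intros)
qed

definition T0 :: "real \<Rightarrow> complex" where "T0 l = complex_of_real (sqrt l) * K0 l"

text \<open>Since \<open>cutA\<close> is a polynomial in cos, two integrations by parts collapse K0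
  + 2 l K0', which is the derivative up to the factor 1 / (2 sqrt l), to a multiple of Jcos / l. The
  result is o(1) times a power -3/2 of l, so the distance of T0 from its limit can be found by
  integration.\<close>

lemma T0_deriv:
  assumes l: "l > 0"
  shows "(T0 has_vector_derivative complex_of_real (3 / (8 * l * sqrt l)) * (- \<i> * Jcos l)) (at l)"
proof -
  define E where "E l s = expi (l * (cos s - 1))" for l s
  define K1 where "K1 = integral {-pi..pi} (\<lambda>s. complex_of_real (cutA s) * (\<i> * complex_of_real (cos s - 1) * E l s))"
  have cE: "continuous_on A (E l)" for A l unfolding E_def by (intro continuous_intros)
  have "((\<lambda>l. integral (cbox (-pi) pi) (\<lambda>s. complex_of_real (cutA s) * E l s)) has_vector_derivative
      integral (cbox (-pi) pi) (\<lambda>s. complex_of_real (cutA s) * (\<i> * complex_of_real (cos s - 1) * E l s))) (at l within UNIV)"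
  proof (rule leibniz_rule_vector_derivative)
    fix x s :: real
    have "((\<lambda>l. l * (cos s - 1)) has_real_derivative (cos s - 1)) (at x)" by (auto intro!: derivative_eq_intros)
    from has_vector_derivative_mult_right[OF has_vector_derivative_exp_i[OF this], of "complex_of_real (cutA s)"]
    show "((\<lambda>l. complex_of_real (cutA s) * E l s) has_vector_derivative complex_of_real (cutA s) * (\<i> * complex_of_real (cos s - 1) * E x s)) (at x within UNIV)"
      unfolding E_def by simp
  next
    show "(\<lambda>s. complex_of_real (cutA s) * E x s) integrable_on cbox (-pi) pi" for x
      by (intro integrable_continuous continuous_intros cE)
    show "continuous_on (UNIV \<times> cbox (-pi) pi) (\<lambda>(x, s). complex_of_real (cutA s) * (\<i> * complex_of_real (cos s - 1) * E x s))"
      unfolding E_def case_prod_unfold by (intro continuous_intros)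
  qed auto
  then have K: "(K0 has_vector_derivative K1) (at l)" unfolding K0_def K1_def E_def by simp
  \<comment> \<open>Chosen so that V times sin is 2 (1 - cos) cutA: integration by parts then
    converts l times K1, the derivative of K0, into an integral of V', and cutA - V' reduces to 3/4
    of the squared sine.\<close>
  define V where "V s = sin s * (1 + cos s) / 2" for s :: real
  define V' where "V' s = (cos s * (1 + cos s) - sin s * sin s) / 2" for s :: real
  have V: "(V has_real_derivative V' s) (at s)" for s
    unfolding V_def V'_def by (auto intro!: derivative_eq_intros simp: field_simps)
  have Vs: "2 * (1 - cos s) * cutA s = V s * sin s" for s
  proof -
    have "V s * sin s = (sin s)\<^sup>2 * (1 + cos s) / 2" by (simp add: V_def power2_eq_square algebra_simps)
    also have "\<dots> = 2 * (1 - cos s) * cutA s" unfolding sin_squared_eq cutA_def by (simp add: power2_eq_square field_simps)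
    finally show ?thesis by simp
  qed
  have p1: "integral {-pi..pi} (\<lambda>s. complex_of_real (V' s) * E l s) = \<i> * complex_of_real l * integral {-pi..pi} (\<lambda>s. complex_of_real (2 * (1 - cos s) * cutA s) * E l s)"
    unfolding E_def by (rule integral_periodic_exp_cos[OF V _ _ _ Vs]) (auto simp: V_def V'_def intro!: continuous_intros)
  have p2: "integral {-pi..pi} (\<lambda>s. complex_of_real (cos s) * E l s) = \<i> * complex_of_real l * integral {-pi..pi} (\<lambda>s. complex_of_real ((sin s)\<^sup>2) * E l s)"
    unfolding E_def by (rule integral_periodic_exp_cos[OF DERIV_sin]) (auto simp: power2_eq_square intro!: continuous_intros)
  have k1: "2 * complex_of_real l * K1 = - integral {-pi..pi} (\<lambda>s. complex_of_real (V' s) * E l s)"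
  proof -
    have "K1 = integral {-pi..pi} (\<lambda>s. (- \<i> / 2) * (complex_of_real (2 * (1 - cos s) * cutA s) * E l s))"
      unfolding K1_def by (rule integral_cong) (simp add: algebra_simps)
    then have "K1 = (- \<i> / 2) * integral {-pi..pi} (\<lambda>s. complex_of_real (2 * (1 - cos s) * cutA s) * E l s)"
      by (simp only: integral_mult_right)
    then show ?thesis unfolding p1 by simp
  qed
  have sum: "K0 l + 2 * complex_of_real l * K1 = complex_of_real (3/4) * integral {-pi..pi} (\<lambda>s. complex_of_real ((sin s)\<^sup>2) * E l s)"
  proof -
    have "K0 l + 2 * complex_of_real l * K1 = integral {-pi..pi} (\<lambda>s. complex_of_real (cutA s) * E l s) - integral {-pi..pi} (\<lambda>s. complex_of_real (V' s) * E l s)"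
      unfolding k1 by (simp add: K0_def E_def)
    also have "\<dots> = integral {-pi..pi} (\<lambda>s. complex_of_real (cutA s) * E l s - complex_of_real (V' s) * E l s)"
      by (intro integral_diff[symmetric] integrable_continuous_interval continuous_intros cE) (auto simp: V'_def intro!: continuous_intros)
    also have "\<dots> = integral {-pi..pi} (\<lambda>s. complex_of_real (3/4) * (complex_of_real ((sin s)\<^sup>2) * E l s))"
    proof (rule integral_cong)
      fix s
      have "cutA s - V' s = 3/4 * (sin s)\<^sup>2"
        unfolding cutA_def V'_def power2_eq_square[of "sin s", symmetric] sin_squared_eq by (simp add: power2_eq_square field_simps)
      then show "complex_of_real (cutA s) * E l s - complex_of_real (V' s) * E l s = complex_of_real (3/4) * (complex_of_real ((sin s)\<^sup>2) * E l s)"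
        by (metis left_diff_distrib mult.assoc of_real_diff of_real_mult)
    qed
    finally show ?thesis by (simp only: integral_mult_right)
  qed
  have s: "sqrt l > 0" "sqrt l * sqrt l = l" using l by auto
  have "((\<lambda>l. complex_of_real (sqrt l)) has_vector_derivative complex_of_real (inverse (sqrt l) / 2)) (at l)"
    by (rule has_vector_derivative_of_real[OF DERIV_real_sqrt[OF l]])
  from has_vector_derivative_mult[OF this K]
  have "(T0 has_vector_derivative complex_of_real (sqrt l) * K1 + complex_of_real (inverse (sqrt l) / 2) * K0 l) (at l)"
    unfolding T0_def .
  also have "complex_of_real (sqrt l) * K1 + complex_of_real (inverse (sqrt l) / 2) * K0 l = complex_of_real (inverse (sqrt l) / 2) * (K0 l + 2 * complex_of_real l * K1)"
  proof -
    have "sqrt l = inverse (sqrt l) / 2 * (2 * l)" using s by (simp add: field_simps)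
    then have "complex_of_real (sqrt l) = complex_of_real (inverse (sqrt l) / 2) * (2 * complex_of_real l)"
      by (metis of_real_mult of_real_numeral)
    then show ?thesis by (simp add: algebra_simps)
  qed
  also have "\<dots> = complex_of_real (3 / (8 * l * sqrt l)) * (- \<i> * Jcos l)"
  proof -
    have "- \<i> * Jcos l = complex_of_real l * integral {-pi..pi} (\<lambda>s. complex_of_real ((sin s)\<^sup>2) * E l s)"
    proof -
      have "- \<i> * (\<i> * x * y) = x * y" for x y by (simp flip: mult.assoc)
      then show ?thesis unfolding Jcos_def E_def[symmetric] p2 .
    qed
    moreover have "complex_of_real (inverse (sqrt l) / 2) * complex_of_real (3/4) = complex_of_real (3 / (8 * l * sqrt l)) * complex_of_real l"
      unfolding of_real_mult[symmetric] using l s by (simp add: field_simps)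
    ultimately show ?thesis unfolding sum by (simp only: mult.assoc[symmetric])
  qed
  finally show ?thesis .
qed

text \<open>The stationary phase constant at s = 0: the second derivative of cos there is -1, which
  gives 1 / sqrt (1/2) and, for a maximum, the conjugate.\<close>

definition T0_inf :: complex where "T0_inf = complex_of_real (sqrt 2) * cnj Fresnel"

lemma T0_inf_nonzero: "T0_inf \<noteq> 0"
  using Fresnel_nonzero by (simp add: T0_inf_def)

text \<open>Stationary phase covers [-pi/2, pi/2]. On the outer arcs the stationary point pi is
  harmless, because \<open>cutA\<close> vanishes there to fourth order and one integration by parts
  gives O(1 / l).\<close>

lemma T0_tendsto: "(T0 \<longlongrightarrow> T0_inf) at_top"
proof (rule tendsto_at_topI_sequentially)
  fix X :: "nat \<Rightarrow> real" assume X: "filterlim X at_top sequentially"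
  then have "\<forall>\<^sub>F n in sequentially. X n > 0" unfolding filterlim_at_top_dense by blast
  then obtain N where N: "\<And>n. n \<ge> N \<Longrightarrow> X n > 0" by (auto simp: eventually_sequentially)
  define Y where "Y n = X (n + N)" for n
  have Y: "filterlim Y at_top sequentially" "Y n > 0" for n
    unfolding Y_def using X N by (auto intro: filterlim_compose[OF X filterlim_add_const_nat_at_top])
  define E where "E l s = expi (l * (cos s - 1))" for l s
  have cE: "continuous_on A (E l)" for A l unfolding E_def by (intro continuous_intros)
  let ?I = "\<lambda>l u v. integral {u..v} (\<lambda>s. complex_of_real (cutA s) * E l s)"
  have int: "(\<lambda>s. complex_of_real (cutA s) * E l s) integrable_on {u..v}" for l u v
    by (intro integrable_continuous_interval continuous_intros cE)
  have mid: "(\<lambda>n. complex_of_real (sqrt (Y n)) * ?I (Y n) (-pi/2) (pi/2)) \<longlonglongrightarrow> T0_inf"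
  proof -
    have d: "(cutA has_real_derivative (- sin s * (1 + cos s) / 2)) (at s)" for s
      unfolding cutA_def by (auto intro!: derivative_eq_intros simp: algebra_simps)
    have nA: "norm (complex_of_real (cutA s)) \<le> 1" for s
    proof -
      have "0 \<le> 1 + cos s" using cos_ge_minus_one[of s] by linarith
      then have "0 \<le> (1 + cos s) / 2" by simp
      moreover have "(1 + cos s) / 2 \<le> 1" by simp
      ultimately show ?thesis unfolding norm_of_real cutA_def by (simp add: power_le_one)
    qed
    have z: "x = 0" if "x \<in> {-pi/2..pi/2}" "- sin x = 0" for x :: real
    proof (rule sin_eq_0_pi)
      have "- (pi / 2) \<le> x" "x \<le> pi / 2" using that by auto
      then show "- pi < x" "x < pi" using pi_gt_zero by linarith+
    qed (use that in simp)
    have "(\<lambda>n. complex_of_real (sqrt (Y n)) * integral {-pi/2..pi/2} (\<lambda>s. complex_of_real (cutA s) * expi (Y n * (cos s - 1)))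
       - expi (Y n * (cos 0 - 1)) * (complex_of_real (cutA 0) * complex_of_real (1 / sqrt (\<bar>- cos 0\<bar> / 2)) * (if - cos (0::real) > 0 then Fresnel else cnj Fresnel))) \<longlonglongrightarrow> 0"
      by (rule stationary_phase_1d[where ?f1.0 = "\<lambda>x. - sin x" and ?f2.0 = "\<lambda>x. - cos x" and B = 1 and \<kappa> = Y, OF _ _ _ has_vector_derivative_of_real[OF d] _ nA _ _ _ _ z Y])
         (auto intro!: derivative_eq_intros continuous_intros)
    then have "(\<lambda>n. complex_of_real (sqrt (Y n)) * ?I (Y n) (-pi/2) (pi/2) - T0_inf) \<longlonglongrightarrow> 0"
      unfolding E_def T0_inf_def by (simp add: cutA_def real_sqrt_divide)
    then show ?thesis by (rule LIM_zero_cancel)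
  qed
  \<comment> \<open>This is cutA / sin, rewritten with the half-angle cancellation so that it is
    smooth at pi.\<close>
  define G where "G s = sin s * (1 + cos s) / (4 * (1 - cos s))" for s :: real
  define G' where "G' s = ((cos s * (1 + cos s) - sin s * sin s) * (4 * (1 - cos s)) - sin s * (1 + cos s) * (4 * sin s)) / (4 * (1 - cos s) * (4 * (1 - cos s)))" for s :: real
  have cos1: "cos s \<noteq> 1" if "s \<in> {pi/2..pi}" for s :: real
    using that cos_monotone_0_pi_le[of "pi/2" s] pi_gt_zero by auto
  have G: "(G has_real_derivative G' s) (at s)" if "s \<in> {pi/2..pi}" for s
  proof -
    have "((\<lambda>s. sin s * (1 + cos s)) has_real_derivative (cos s * (1 + cos s) - sin s * sin s)) (at s)"
      "((\<lambda>s. 4 * (1 - cos s)) has_real_derivative 4 * sin s) (at s)"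
      by (auto intro!: derivative_eq_intros simp: algebra_simps)
    from DERIV_divide[OF this] cos1[OF that] show ?thesis unfolding G_def G'_def by simp
  qed
  have Gs: "G s * sin s = cutA s" if "s \<in> {pi/2..pi}" for s
  proof -
    have "G s * sin s = (sin s)\<^sup>2 * (1 + cos s) / (4 * (1 - cos s))" by (simp add: G_def power2_eq_square)
    also have "\<dots> = ((1 - cos s) * ((1 + cos s) * (1 + cos s))) / ((1 - cos s) * 4)"
      unfolding sin_squared_eq by (simp add: power2_eq_square algebra_simps)
    also have "\<dots> = ((1 + cos s) * (1 + cos s)) / 4"
      by (rule mult_divide_mult_cancel_left) (use cos1[OF that] in simp)
    also have "\<dots> = cutA s" by (simp add: cutA_def power2_eq_square)
    finally show ?thesis .
  qed
  have cG': "continuous_on {pi/2..pi} G'" unfolding G'_def using cos1 by (auto intro!: continuous_intros)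
  obtain M where "\<forall>x\<in>G' ` {pi/2..pi}. norm x \<le> M"
    using compact_imp_bounded[OF compact_continuous_image[OF cG' compact_Icc]] unfolding bounded_iff by blast
  then have M: "\<bar>G' s\<bar> \<le> M" if "s \<in> {pi/2..pi}" for s using that by simp
  have right: "norm (?I l (pi/2) pi) \<le> (\<bar>G pi\<bar> + \<bar>G (pi/2)\<bar> + M * (pi/2)) / l" if l: "l > 0" for l
  proof -
    have "((\<lambda>s. complex_of_real (G' s) * E l s - \<i> * complex_of_real l * (complex_of_real (cutA s) * E l s)) has_integral
        complex_of_real (G pi) * E l pi - complex_of_real (G (pi/2)) * E l (pi/2)) {pi/2..pi}"
    proof (rule fundamental_theorem_of_calculus)
      fix s assume s: "s \<in> {pi/2..pi}"
      show "((\<lambda>s. complex_of_real (G s) * E l s) has_vector_derivative complex_of_real (G' s) * E l s - \<i> * complex_of_real l * (complex_of_real (cutA s) * E l s)) (at s within {pi/2..pi})"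
        using has_vector_derivative_at_within[OF of_real_mult_exp_cos_deriv[OF G[OF s], of l]] unfolding E_def Gs[OF s] .
    qed simp
    note X = this
    have i: "(\<lambda>s. complex_of_real (G' s) * E l s) integrable_on {pi/2..pi}"
      by (intro integrable_continuous_interval continuous_intros cE cG')
    have "((\<lambda>s. \<i> * complex_of_real l * (complex_of_real (cutA s) * E l s)) has_integral
        integral {pi/2..pi} (\<lambda>s. complex_of_real (G' s) * E l s) - (complex_of_real (G pi) * E l pi - complex_of_real (G (pi/2)) * E l (pi/2))) {pi/2..pi}"
      by (rule has_integral_eq[OF _ has_integral_diff[OF integrable_integral[OF i] X]]) simp
    then have "\<i> * complex_of_real l * ?I l (pi/2) pi = integral {pi/2..pi} (\<lambda>s. complex_of_real (G' s) * E l s) - (complex_of_real (G pi) * E l pi - complex_of_real (G (pi/2)) * E l (pi/2))"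
      unfolding integral_mult_right[symmetric] by (rule integral_unique)
    moreover have "l * norm (?I l (pi/2) pi) = norm (\<i> * complex_of_real l * ?I l (pi/2) pi)" using l by (simp add: norm_mult)
    ultimately have "l * norm (?I l (pi/2) pi) = norm (integral {pi/2..pi} (\<lambda>s. complex_of_real (G' s) * E l s) - (complex_of_real (G pi) * E l pi - complex_of_real (G (pi/2)) * E l (pi/2)))"
      by (simp only:)
    also have "\<dots> \<le> norm (integral {pi/2..pi} (\<lambda>s. complex_of_real (G' s) * E l s)) + (norm (complex_of_real (G pi) * E l pi) + norm (complex_of_real (G (pi/2)) * E l (pi/2)))"
      by (intro order_trans[OF norm_triangle_ineq4] add_left_mono norm_triangle_ineq4)
    also have "norm (integral {pi/2..pi} (\<lambda>s. complex_of_real (G' s) * E l s)) \<le> M * (pi - pi/2)"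
    proof (rule norm_integral_le_real)
      show "continuous_on {pi/2..pi} (\<lambda>s. complex_of_real (G' s) * E l s)" by (intro continuous_intros cE cG')
      show "norm (complex_of_real (G' s) * E l s) \<le> M" if "s \<in> {pi/2..pi}" for s
        using M[OF that] unfolding E_def norm_mult norm_exp_i_real by simp
    qed simp
    finally have "l * norm (?I l (pi/2) pi) \<le> \<bar>G pi\<bar> + \<bar>G (pi/2)\<bar> + M * (pi/2)"
      unfolding E_def norm_mult norm_exp_i_real by simp
    then show ?thesis using l by (simp only: pos_le_divide_eq mult.commute)
  qed
  have left: "?I l (-pi) (-pi/2) = ?I l (pi/2) pi" for l
  proof -
    have "?I l (-pi) (-(pi/2)) = integral {-pi..-(pi/2)} (\<lambda>s. complex_of_real (cutA (-s)) * E l (-s))"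
      by (simp only: cutA_def E_def cos_minus)
    also have "\<dots> = ?I l (pi/2) pi" by (rule Henstock_Kurzweil_Integration.integral_reflect_real)
    finally show ?thesis by (simp only: minus_divide_left)
  qed
  have tails: "(\<lambda>n. complex_of_real (sqrt (Y n)) * (2 * ?I (Y n) (pi/2) pi)) \<longlonglongrightarrow> 0"
  proof (rule Lim_null_comparison)
    define Q where "Q = 2 * (\<bar>G pi\<bar> + \<bar>G (pi/2)\<bar> + M * (pi/2))"
    have "norm (complex_of_real (sqrt (Y n)) * (2 * ?I (Y n) (pi/2) pi)) \<le> Q * (1 / sqrt (Y n))" for n
    proof -
      have "norm (complex_of_real (sqrt (Y n)) * (2 * ?I (Y n) (pi/2) pi)) \<le> sqrt (Y n) * (Q / Y n)"
      proof -
        have "Q / Y n = 2 * ((\<bar>G pi\<bar> + \<bar>G (pi/2)\<bar> + M * (pi/2)) / Y n)" unfolding Q_def by (simp only: times_divide_eq_right)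
        then have "2 * norm (?I (Y n) (pi/2) pi) \<le> Q / Y n" using right[OF Y(2)[of n]] by linarith
        then have "sqrt (Y n) * (2 * norm (?I (Y n) (pi/2) pi)) \<le> sqrt (Y n) * (Q / Y n)"
          using Y(2)[of n] by (intro mult_left_mono) auto
        then show ?thesis using Y(2)[of n] by (simp add: norm_mult)
      qed
      also have "\<dots> = Q * (sqrt (Y n) / Y n)" by simp
      also have "sqrt (Y n) / Y n = 1 / sqrt (Y n)" using Y(2)[of n] by (simp add: sqrt_divide_self_eq inverse_eq_divide)
      finally show ?thesis .
    qed
    then show "\<forall>\<^sub>F n in sequentially. norm (complex_of_real (sqrt (Y n)) * (2 * ?I (Y n) (pi/2) pi)) \<le> Q * (1 / sqrt (Y n))" by simp
    have "filterlim (\<lambda>n. sqrt (Y n)) at_top sequentially" by (rule filterlim_compose[OF sqrt_at_top Y(1)])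
    from tendsto_mult[OF tendsto_const[of Q] tendsto_inverse_0_at_top[OF this]]
    show "(\<lambda>n. Q * (1 / sqrt (Y n))) \<longlonglongrightarrow> 0" by (simp add: divide_inverse)
  qed
  have T: "T0 l = complex_of_real (sqrt l) * ?I l (-pi/2) (pi/2) + complex_of_real (sqrt l) * (2 * ?I l (pi/2) pi)" for l
  proof -
    have "?I l (-pi) (pi/2) = ?I l (-pi) (-pi/2) + ?I l (-pi/2) (pi/2)"
      by (rule Henstock_Kurzweil_Integration.integral_combine[symmetric, OF _ _ int]) auto
    moreover have "?I l (-pi) pi = ?I l (-pi) (pi/2) + ?I l (pi/2) pi"
      by (rule Henstock_Kurzweil_Integration.integral_combine[symmetric, OF _ _ int]) auto
    ultimately show ?thesis unfolding T0_def K0_def E_def[symmetric] left by (simp add: algebra_simps)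
  qed
  have "(\<lambda>n. T0 (Y n)) \<longlonglongrightarrow> T0_inf"
    using tendsto_add[OF mid tails] unfolding T by simp
  then show "(\<lambda>n. T0 (X n)) \<longlonglongrightarrow> T0_inf" unfolding Y_def by (rule LIMSEQ_offset)
qed

text \<open>Integrate \<open>T0_deriv\<close> from l to infinity. The rate o(1 / sqrt l) is what the
  boundary reduction needs: after multiplication by \<kappa> the model integral still carries a
  factor sqrt \<kappa>, which has to be absorbed.\<close>

lemma T0_rate:
  assumes e: "e > 0"
  obtains L where "L > 0" "\<And>l. l \<ge> L \<Longrightarrow> norm (T0 l - T0_inf) \<le> e / sqrt l"
proof -
  have "\<forall>\<^sub>F l in at_top. norm (Jcos l) < e"
    using tendstoD[OF Jcos_tendsto e] by simp
  then obtain L0 where L0: "\<And>l. l \<ge> L0 \<Longrightarrow> norm (Jcos l) < e" by (auto simp: eventually_at_top_linorder)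
  define L where "L = max L0 1"
  show thesis
  proof (rule that[of L])
    show "L > 0" by (simp add: L_def)
    fix l assume l: "l \<ge> L"
    have l1: "l > 0" "l \<ge> L0" using l by (auto simp: L_def)
    have "norm (T0 x - T0 l) \<le> e / sqrt l" if x: "x > l" for x
    proof -
      \<comment> \<open>A primitive of 3/8 e y^(-3/2), the bound for the derivative of T0.\<close>
      define p where "p y = - (3/4 * e) * inverse (sqrt y)" for y
      have d: "(p has_real_derivative (3/8 * e / (y * sqrt y))) (at y)" if "y > 0" for y
        unfolding p_def using that by (auto intro!: derivative_eq_intros simp: field_simps)
      have "norm (T0 x - T0 l) \<le> p x - p l"
      proof (rule differentiable_bound_general[OF x])
        show "continuous_on {l..x} p"
          unfolding p_def using l1 by (auto intro!: continuous_intros)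
        show "continuous_on {l..x} T0"
          by (rule continuous_at_imp_continuous_on) (use has_vector_derivative_continuous[OF T0_deriv] l1 in auto)
        fix y assume y: "l < y" "y < x"
        then have y0: "y > 0" using l1 by simp
        show "(p has_vector_derivative 3/8 * e / (y * sqrt y)) (at y)" using d[OF y0] by (simp add: has_real_derivative_iff_has_vector_derivative)
        show "(T0 has_vector_derivative complex_of_real (3 / (8 * y * sqrt y)) * (- \<i> * Jcos y)) (at y)" by (rule T0_deriv[OF y0])
        have "norm (complex_of_real (3 / (8 * y * sqrt y)) * (- \<i> * Jcos y)) = 3 / (8 * y * sqrt y) * norm (Jcos y)"
          unfolding norm_mult norm_of_real using y0 by simp
        also have "\<dots> \<le> 3 / (8 * y * sqrt y) * e" using L0[of y] y y0 l1 by (intro mult_left_mono) auto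
        finally show "norm (complex_of_real (3 / (8 * y * sqrt y)) * (- \<i> * Jcos y)) \<le> 3/8 * e / (y * sqrt y)" by (simp add: mult_ac)
      qed
      also have "\<dots> \<le> 3/4 * e * inverse (sqrt l)" using l1 x e by (simp add: p_def)
      also have "\<dots> \<le> e / sqrt l" using l1 e by (simp add: field_simps)
      finally show ?thesis .
    qed
    then have "\<forall>\<^sub>F x in at_top. norm (T0 x - T0 l) \<le> e / sqrt l"
      by (intro eventually_mono[OF eventually_gt_at_top[of l]])
    moreover have "((\<lambda>x. norm (T0 x - T0 l)) \<longlongrightarrow> norm (T0_inf - T0 l)) at_top" by (intro tendsto_intros T0_tendsto)
    ultimately have "norm (T0_inf - T0 l) \<le> e / sqrt l" by (intro tendsto_upperbound) auto
    then show "norm (T0 l - T0_inf) \<le> e / sqrt l" by (simp add: norm_minus_commute)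
  qed
qed

section \<open>Reduction to the boundary angle\<close>

lemma norm_diff_le_integral:
  fixes f f' :: "real \<Rightarrow> complex"
  assumes f: "\<And>x. (f has_vector_derivative f' x) (at x)" and c: "continuous_on UNIV f'"
    and B: "\<And>x. x \<in> {-pi..pi} \<Longrightarrow> norm (f' x) \<le> B" and xy: "x \<in> {-pi..pi}" "y \<in> {-pi..pi}" "x \<le> y"
  shows "norm (f y - f x) \<le> B * (y - x)"
proof -
  have "(f' has_integral f y - f x) {x..y}"
    by (rule fundamental_theorem_of_calculus[OF xy(3)]) (rule has_vector_derivative_at_within[OF f])
  then have "f y - f x = integral {x..y} f'" by (simp add: integral_unique)
  also have "norm \<dots> \<le> B * (y - x)"
    by (rule norm_integral_le_real[OF xy(3) continuous_on_subset[OF c]]) (use B xy in auto)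
  finally show ?thesis .
qed

lemma abs_le_two_abs_sin:
  fixes x :: real
  assumes "\<bar>x\<bar> \<le> pi / 2"
  shows "\<bar>x\<bar> \<le> 2 * \<bar>sin x\<bar>"
proof -
  have *: "y \<le> 2 * sin y" if y: "0 \<le> y" "y \<le> pi / 2" for y :: real
  proof -
    have "(\<Sum>m<3. sin_coeff m * y ^ m) = y" by (simp add: numeral_3_eq_3 sin_coeff_def)
    then have "y - y ^ 3 / 6 \<le> sin y"
      using Maclaurin_sin_bound[of y 3] y unfolding abs_le_iff by (simp add: fact_numeral)
    moreover have "y ^ 3 \<le> 3 * y"
    proof -
      have "y * y \<le> (16/10) * (16/10)" using y pi_less_4 pi_approx by (intro mult_mono) auto
      then have "y * y \<le> 3" by simp
      from mult_right_mono[OF this y(1)] show ?thesis by (simp add: power3_eq_cube)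
    qed
    ultimately show ?thesis by linarith
  qed
  show ?thesis
  proof (cases "x \<ge> 0")
    case True then show ?thesis using *[of x] assms abs_ge_self[of "sin x"] by linarith
  next
    case False then show ?thesis using *[of "-x"] assms abs_ge_minus_self[of "sin x"] by simp
  qed
qed

lemma K0_eq: "l > 0 \<Longrightarrow> K0 l = T0 l / complex_of_real (sqrt l)"
  by (simp add: T0_def)

lemma continuous_on_K0: "continuous_on {0<..} K0"
proof -
  have "continuous_on {0<..} T0"
    by (rule continuous_at_imp_continuous_on) (use has_vector_derivative_continuous[OF T0_deriv] in auto)
  then have "continuous_on {0<..} (\<lambda>l. T0 l / complex_of_real (sqrt l))"
    by (intro continuous_intros) auto
  then show ?thesis by (rule continuous_on_eq) (simp add: K0_eq)
qed

context polar_phase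
begin

text \<open>With l = \<kappa> r, the factor \<kappa> K(l) equals sqrt (\<kappa> / r) times sqrt l
  K(l); replacing the latter by Ki costs o(1 / sqrt l), hence o(1) in total. K is left general in
  order to serve both K0 and its conjugate.\<close>

lemma main_part_tendsto_0:
  fixes b :: "real \<Rightarrow> complex" and f :: "real \<Rightarrow> real" and \<kappa> :: "nat \<Rightarrow> real"
  assumes rate: "\<And>e. e > 0 \<Longrightarrow> \<exists>L>0. \<forall>l\<ge>L. norm (complex_of_real (sqrt l) * K l - Ki) \<le> e / sqrt l"
    and K: "continuous_on {0<..} K" and b: "continuous_on UNIV b" and f: "continuous_on UNIV f"
    and \<kappa>: "filterlim \<kappa> at_top sequentially" and \<kappa>_pos: "\<And>n. \<kappa> n > 0"
  shows "(\<lambda>n. \<kappa> n * integral {-pi..pi} (\<lambda>t. b t * (expi (\<kappa> n * f t) * K (\<kappa> n * r t)))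
      - sqrt (\<kappa> n) * integral {-pi..pi} (\<lambda>t. b t * (Ki / complex_of_real (sqrt (r t))) * expi (\<kappa> n * f t))) \<longlonglongrightarrow> 0"
proof (rule LIMSEQ_I)
  fix e :: real assume e: "e > 0"
  have "\<exists>x\<in>{-pi..pi}. \<forall>y\<in>{-pi..pi}. r x \<le> r y"
    by (rule continuous_attains_inf) (auto intro!: continuous_intros)
  then obtain p where p: "p > 0" "\<And>t. t \<in> {-pi..pi} \<Longrightarrow> p \<le> r t" using r_pos by blast
  obtain B where B: "B > 0" "\<And>t. t \<in> {-pi..pi} \<Longrightarrow> norm (b t) \<le> B"
    using compact_imp_bounded[OF compact_continuous_image[OF continuous_on_subset[OF b subset_UNIV] compact_Icc]]
    unfolding bounded_pos by blast
  \<comment> \<open>Then B d / p times the length 2 pi of the interval is e / 2.\<close>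
  define d where "d = e * p / (4 * pi * B)"
  have d: "d > 0" using e p B by (simp add: d_def)
  obtain L where L: "L > 0" "\<And>l. l \<ge> L \<Longrightarrow> norm (complex_of_real (sqrt l) * K l - Ki) \<le> d / sqrt l"
    using rate[OF d] by blast
  have "\<forall>\<^sub>F n in sequentially. \<kappa> n > L / p" using \<kappa> unfolding filterlim_at_top_dense by blast
  then obtain N where N: "\<And>n. n \<ge> N \<Longrightarrow> \<kappa> n > L / p" by (auto simp: eventually_sequentially)
  show "\<exists>no. \<forall>n\<ge>no. norm (\<kappa> n * integral {-pi..pi} (\<lambda>t. b t * (expi (\<kappa> n * f t) * K (\<kappa> n * r t)))
      - sqrt (\<kappa> n) * integral {-pi..pi} (\<lambda>t. b t * (Ki / complex_of_real (sqrt (r t))) * expi (\<kappa> n * f t)) - 0) < e"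
  proof (intro exI allI impI)
    fix n assume n: "n \<ge> N"
    define k where "k = \<kappa> n"
    have k: "k > 0" "k * p > L" using \<kappa>_pos[of n] N[OF n] p(1) by (auto simp: k_def field_simps)
    define E where "E t = expi (k * f t)" for t
    have nE: "norm (E t) = 1" for t unfolding E_def by (rule norm_exp_i_real)
    have cE: "continuous_on A E" for A unfolding E_def by (intro continuous_intros continuous_on_subset[OF f]) auto
    have cb: "continuous_on A b" for A using b continuous_on_subset by blast
    have cK: "continuous_on A (\<lambda>t. K (k * r t))" for A
      by (rule continuous_on_compose2[OF K]) (use r_pos k in \<open>auto intro!: continuous_intros\<close>)
    have rs: "sqrt (r t) > 0" for t using r_pos by simp
    have rs0: "sqrt (r t) \<noteq> 0" for t using r_pos[of t] by simp
    have c1: "continuous_on A (\<lambda>t. b t * (E t * K (k * r t)))" for A by (intro continuous_intros cb cE cK)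
    have c2: "continuous_on A (\<lambda>t. b t * (Ki / complex_of_real (sqrt (r t))) * E t)" for A
      using rs0 by (auto intro!: continuous_intros cb cE)
    have "k * integral {-pi..pi} (\<lambda>t. b t * (E t * K (k * r t))) - sqrt k * integral {-pi..pi} (\<lambda>t. b t * (Ki / complex_of_real (sqrt (r t))) * E t)
       = integral {-pi..pi} (\<lambda>t. k * (b t * (E t * K (k * r t))) - sqrt k * (b t * (Ki / complex_of_real (sqrt (r t))) * E t))"
      unfolding integral_mult_right[symmetric]
      by (intro integral_diff[symmetric] integrable_continuous_interval continuous_intros c1 c2)
    also have "norm \<dots> \<le> (B * d / p) * (pi - -pi)"
    proof (rule norm_integral_le_real)
      show "continuous_on {-pi..pi} (\<lambda>t. k * (b t * (E t * K (k * r t))) - sqrt k * (b t * (Ki / complex_of_real (sqrt (r t))) * E t))"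
        by (intro continuous_intros c1 c2)
      fix t assume t: "t \<in> {-pi..pi}"
      define l where "l = k * r t"
      have l: "l > 0" "l \<ge> L" "sqrt l = sqrt k * sqrt (r t)"
      proof -
        have "k * p \<le> k * r t" using mult_left_mono[OF p(2)[OF t], of k] k by simp
        then show "l \<ge> L" using k unfolding l_def by linarith
      qed (use k r_pos[of t] in \<open>auto simp: l_def real_sqrt_mult\<close>)
      have kk: "complex_of_real k = complex_of_real (sqrt k) * complex_of_real (sqrt k)"
      proof -
        have "sqrt k * sqrt k = k" using k by simp
        then show ?thesis by (metis of_real_mult)
      qed
      have "complex_of_real k * K l = complex_of_real (sqrt k / sqrt (r t)) * (complex_of_real (sqrt l) * K l)"
        unfolding l(3) of_real_mult of_real_divide kk using rs0[of t] by simp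
      note F = this
      have gen: "x * (\<beta> * (\<epsilon> * h)) - y * (\<beta> * (z / w) * \<epsilon>) = \<beta> * \<epsilon> * (y / w) * (v - z)" if "x * h = (y / w) * v" for x \<beta> \<epsilon> h y z w v :: complex
      proof -
        have "x * (\<beta> * (\<epsilon> * h)) = \<beta> * \<epsilon> * (x * h)" by (simp only: mult_ac)
        also have "\<dots> = \<beta> * \<epsilon> * (y / w) * v" unfolding that by (simp only: mult_ac)
        finally show ?thesis by (simp add: right_diff_distrib)
      qed
      have "k * (b t * (E t * K (k * r t))) - sqrt k * (b t * (Ki / complex_of_real (sqrt (r t))) * E t)
          = b t * E t * complex_of_real (sqrt k / sqrt (r t)) * (complex_of_real (sqrt l) * K l - Ki)"
        unfolding l_def[symmetric] of_real_divide by (rule gen) (use F in simp)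
      also have "norm \<dots> = norm (b t) * (sqrt k / sqrt (r t)) * norm (complex_of_real (sqrt l) * K l - Ki)"
        using k rs[of t] unfolding norm_mult nE norm_of_real by simp
      also have "\<dots> \<le> B * (sqrt k / sqrt (r t)) * (d / sqrt l)"
        using B(2)[OF t] k rs[of t] L(2)[OF l(2)] B(1) by (intro mult_mono) auto
      also have "\<dots> = B * d / r t"
        unfolding l(3) using k rs[of t] r_pos[of t] by (simp add: field_simps)
      also have "\<dots> \<le> B * d / p" using p(2)[OF t] p(1) B d by (intro divide_left_mono) auto
      finally show "norm (k * (b t * (E t * K (k * r t))) - sqrt k * (b t * (Ki / complex_of_real (sqrt (r t))) * E t)) \<le> B * d / p" .
    qed simp
    also have "\<dots> = e / 2" using B p e by (simp add: d_def)
    also have "\<dots> < e" using e by simp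
    finally show "norm (\<kappa> n * integral {-pi..pi} (\<lambda>t. b t * (expi (\<kappa> n * f t) * K (\<kappa> n * r t)))
      - sqrt (\<kappa> n) * integral {-pi..pi} (\<lambda>t. b t * (Ki / complex_of_real (sqrt (r t))) * expi (\<kappa> n * f t)) - 0) < e"
      unfolding k_def E_def by simp
  qed
qed

lemma cutA_integral_plus:
  "integral {-pi..pi} (\<lambda>s. complex_of_real (cutA s) * expi (k * Phi s t)) = expi (k * (m t + r t)) * K0 (k * r t)"
proof -
  have "expi (k * Phi s t) = expi (k * (m t + r t)) * expi (k * r t * (cos s - 1))" for s
    unfolding exp_add[symmetric] Phi_def by (simp add: algebra_simps)
  then have "integral {-pi..pi} (\<lambda>s. complex_of_real (cutA s) * expi (k * Phi s t))
     = integral {-pi..pi} (\<lambda>s. expi (k * (m t + r t)) * (complex_of_real (cutA s) * expi (k * r t * (cos s - 1))))"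
    by (simp only: mult_ac)
  then show ?thesis unfolding K0_def integral_mult_right .
qed

text \<open>A shift by pi turns cos into - cos, so the stationary point s = pi reproduces the model
  integral with conjugated exponential.\<close>

lemma cutA_integral_minus:
  "integral {-pi..pi} (\<lambda>s. complex_of_real (cutA (s + pi)) * expi (k * Phi s t)) = expi (k * (m t - r t)) * cnj (K0 (k * r t))"
proof -
  define g where "g s = complex_of_real (cutA s) * expi (k * (m t - r t * cos s))" for s
  have g: "g (s + pi) = complex_of_real (cutA (s + pi)) * expi (k * Phi s t)" for s
    unfolding g_def Phi_def by (simp add: add.commute)
  have gcnj: "g s = expi (k * (m t - r t)) * cnj (complex_of_real (cutA s) * expi (k * r t * (cos s - 1)))" for s
  proof -
    have cn: "cnj (expi x) = expi (- x)" for x by (simp add: exp_cnj)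
    have "expi (k * (m t - r t)) * cnj (complex_of_real (cutA s) * expi (k * r t * (cos s - 1)))
       = complex_of_real (cutA s) * (expi (k * (m t - r t)) * expi (- (k * r t * (cos s - 1))))"
      unfolding complex_cnj_mult complex_cnj_complex_of_real cn by (simp only: mult_ac)
    also have "\<dots> = g s" unfolding exp_add[symmetric] g_def by (simp add: algebra_simps)
    finally show ?thesis by simp
  qed
  have i: "(\<lambda>s. complex_of_real (cutA s) * expi (k * r t * (cos s - 1))) integrable_on {-pi..pi}"
    by (intro integrable_continuous_interval continuous_intros)
  have "integral {-pi..pi} (\<lambda>s. g (s + pi)) = integral {-pi..pi} g"
    by (rule integral_periodic_shift) (auto simp: g_def cutA_def intro!: continuous_intros)
  also have "\<dots> = expi (k * (m t - r t)) * integral {-pi..pi} (\<lambda>s. cnj (complex_of_real (cutA s) * expi (k * r t * (cos s - 1))))"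
    unfolding gcnj integral_mult_right ..
  also have "integral {-pi..pi} (\<lambda>s. cnj (complex_of_real (cutA s) * expi (k * r t * (cos s - 1)))) = cnj (K0 (k * r t))"
    using integral_unique[OF has_integral_linear[OF integrable_integral[OF i] bounded_linear_cnj]] unfolding K0_def o_def .
  finally show ?thesis unfolding g .
qed

lemma K0_rate: "e > 0 \<Longrightarrow> \<exists>L>0. \<forall>l\<ge>L. norm (complex_of_real (sqrt l) * K0 l - T0_inf) \<le> e / sqrt l"
  using T0_rate[of e] unfolding T0_def by metis

lemma cnj_K0_rate: assumes "e > 0" shows "\<exists>L>0. \<forall>l\<ge>L. norm (complex_of_real (sqrt l) * cnj (K0 l) - cnj T0_inf) \<le> e / sqrt l"
proof -
  have "norm (complex_of_real (sqrt l) * cnj (K0 l) - cnj T0_inf) = norm (complex_of_real (sqrt l) * K0 l - T0_inf)" for l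
    by (metis complex_cnj_complex_of_real complex_cnj_diff complex_cnj_mult complex_mod_cnj)
  with K0_rate[OF assms] show ?thesis by simp
qed

text \<open>Subtracting from the amplitude its values at s = 0 and s = pi, weighted by the two
  cutoffs, leaves something that vanishes at both points, so \<open>remainder_tendsto_0\<close>
  applies. The weighted values contribute exactly K0 and its conjugate.\<close>

lemma reduction_to_boundary_angle:
  fixes a a1 a2 :: "real \<Rightarrow> real \<Rightarrow> complex" and \<kappa> :: "nat \<Rightarrow> real"
  assumes a1: "\<And>s t. ((\<lambda>s. a s t) has_vector_derivative a1 s t) (at s)"
    and a2: "\<And>s t. ((\<lambda>t. a s t) has_vector_derivative a2 s t) (at t)"
    and ca: "continuous_on UNIV (\<lambda>p. a (fst p) (snd p))"
    and ca1: "continuous_on UNIV (\<lambda>p. a1 (fst p) (snd p))"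
    and ca2: "continuous_on UNIV (\<lambda>p. a2 (fst p) (snd p))"
    and per: "\<And>s t. a (s + 2 * pi) t = a s t" "\<And>s t. a s (t + 2 * pi) = a s t"
    and \<kappa>: "filterlim \<kappa> at_top sequentially" and \<kappa>_pos: "\<And>n. \<kappa> n > 0"
  shows "(\<lambda>n. \<kappa> n * integral {-pi..pi} (\<lambda>t. integral {-pi..pi} (\<lambda>s. a s t * expi (\<kappa> n * Phi s t)))
     - (sqrt (\<kappa> n) * integral {-pi..pi} (\<lambda>t. a 0 t * (T0_inf / complex_of_real (sqrt (r t))) * expi (\<kappa> n * (m t + r t)))
      + sqrt (\<kappa> n) * integral {-pi..pi} (\<lambda>t. a pi t * (cnj T0_inf / complex_of_real (sqrt (r t))) * expi (\<kappa> n * (m t - r t))))) \<longlonglongrightarrow> 0"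
proof -
  have cont2: "continuous_on A (\<lambda>x. h (f x) (g x))" if h: "continuous_on UNIV (\<lambda>p. h (fst p) (snd p))"
      and fg: "continuous_on A f" "continuous_on A g"
    for h :: "real \<Rightarrow> real \<Rightarrow> complex" and f g :: "'b::t2_space \<Rightarrow> real" and A
    using continuous_on_compose2[OF h continuous_on_Pair[OF fg]] by simp
  have dA: "(cutA has_real_derivative (- sin s * (1 + cos s) / 2)) (at s)" for s
    unfolding cutA_def by (auto intro!: derivative_eq_intros simp: field_simps)
  have dA': "((\<lambda>s. cutA (s + pi)) has_real_derivative (- sin (s + pi) * (1 + cos (s + pi)) / 2)) (at s)" for s
    using dA[of "s + pi"] by (subst (asm) DERIV_shift)
  define c where "c s t = a s t - (complex_of_real (cutA s) * a 0 t + complex_of_real (cutA (s + pi)) * a pi t)" for s t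
  define c1 where "c1 s t = a1 s t - (complex_of_real (- sin s * (1 + cos s) / 2) * a 0 t + complex_of_real (- sin (s + pi) * (1 + cos (s + pi)) / 2) * a pi t)" for s t
  define c2 where "c2 s t = a2 s t - (complex_of_real (cutA s) * a2 0 t + complex_of_real (cutA (s + pi)) * a2 pi t)" for s t
  have d1: "((\<lambda>s. c s t) has_vector_derivative c1 s t) (at s)" for s t
    unfolding c_def c1_def
    by (intro has_vector_derivative_diff a1 has_vector_derivative_add has_vector_derivative_mult_left has_vector_derivative_of_real dA dA')
  have d2: "((\<lambda>t. c s t) has_vector_derivative c2 s t) (at t)" for s t
    unfolding c_def c2_def
    by (intro has_vector_derivative_diff a2 has_vector_derivative_add has_vector_derivative_mult_right)
  have cc: "continuous_on UNIV (\<lambda>p. c (fst p) (snd p))" "continuous_on UNIV (\<lambda>p. c2 (fst p) (snd p))" 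
    unfolding c_def c2_def by (intro continuous_intros cont2[OF ca] cont2[OF ca2])+
  have cc1: "continuous_on UNIV (\<lambda>p. c1 (fst p) (snd p))"
    unfolding c1_def by (intro continuous_intros cont2[OF ca] cont2[OF ca1]) auto
  have cper: "c (s + 2 * pi) t = c s t" "c s (t + 2 * pi) = c s t" for s t
  proof -
    have "cutA (x + 2 * pi) = cutA x" for x by (simp add: cutA_def)
    from this[of s] this[of "s + pi"] have "cutA (s + 2 * pi) = cutA s" "cutA (s + 2 * pi + pi) = cutA (s + pi)"
      by (simp_all only: ac_simps)
    then show "c (s + 2 * pi) t = c s t" "c s (t + 2 * pi) = c s t" unfolding c_def per by simp_all
  qed
  have "compact ({-pi..pi} \<times> {-pi..pi})" by (intro compact_Times compact_Icc)
  then have "bounded ((\<lambda>p. c1 (fst p) (snd p)) ` ({-pi..pi} \<times> {-pi..pi}))"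
    by (intro compact_imp_bounded compact_continuous_image continuous_on_subset[OF cc1]) auto
  then obtain M where M: "M > 0" "\<And>s t. s \<in> {-pi..pi} \<Longrightarrow> t \<in> {-pi..pi} \<Longrightarrow> norm (c1 s t) \<le> M"
    unfolding bounded_pos by fastforce
  have zeros: "c 0 t = 0" "c pi t = 0" "c (-pi) t = 0" for t
    using per(1)[of "-pi" t] by (auto simp: c_def cutA_def)
  have van: "norm (c s t) \<le> 2 * M * \<bar>sin s\<bar>" if s: "s \<in> {-pi..pi}" and t: "t \<in> {-pi..pi}" for s t
  proof -
    have lip: "norm (c y t - c x t) \<le> M * (y - x)" if "x \<in> {-pi..pi}" "y \<in> {-pi..pi}" "x \<le> y" for x y
      by (rule norm_diff_le_integral[OF d1 _ M(2) that]) (use t in \<open>auto intro!: cont2[OF cc1] continuous_intros\<close>)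
    \<comment> \<open>z is the signed distance, up to orientation, from s to the nearest of the
      zeros 0, pi, -pi of c; the Lipschitz bound there is then expressed through the sine.\<close>
    have "\<exists>z. norm (c s t) \<le> M * \<bar>z\<bar> \<and> \<bar>z\<bar> \<le> pi / 2 \<and> \<bar>sin z\<bar> = \<bar>sin s\<bar>"
    proof (cases "\<bar>s\<bar> \<le> pi / 2")
      case True
      have "norm (c s t) \<le> M * \<bar>s\<bar>"
        using lip[of 0 s] lip[of s 0] s zeros(1)[of t] by (cases "s \<ge> 0") (auto simp: abs_if)
      with True show ?thesis by blast
    next
      case False
      show ?thesis
      proof (cases "s \<ge> 0")
        case True
        have "norm (c s t) \<le> M * \<bar>pi - s\<bar>" using lip[of s pi] s zeros(2)[of t] by auto
        moreover have "\<bar>pi - s\<bar> \<le> pi / 2" using s True False by (auto simp: abs_if)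
        ultimately show ?thesis by (intro exI[of _ "pi - s"]) auto
      next
        case neg: False
        have "norm (c s t) \<le> M * \<bar>s + pi\<bar>" using lip[of "-pi" s] s zeros(3)[of t] by auto
        moreover have "\<bar>s + pi\<bar> \<le> pi / 2" using s neg False by (auto simp: abs_if)
        ultimately show ?thesis by (intro exI[of _ "s + pi"]) auto
      qed
    qed
    then obtain z where z: "norm (c s t) \<le> M * \<bar>z\<bar>" "\<bar>z\<bar> \<le> pi / 2" "\<bar>sin z\<bar> = \<bar>sin s\<bar>" by blast
    have "M * \<bar>z\<bar> \<le> M * (2 * \<bar>sin z\<bar>)" using abs_le_two_abs_sin[OF z(2)] M by (intro mult_left_mono) auto
    with z show ?thesis by simp
  qed
  define E where "E n s t = expi (\<kappa> n * Phi s t)" for n s t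
  have cE: "continuous_on A (\<lambda>x. E n (f x) (g x))" if "continuous_on A f" "continuous_on A g"
    for n A and f g :: "'b::t2_space \<Rightarrow> real"
    unfolding E_def by (intro continuous_intros that)
  have R: "(\<lambda>n. \<kappa> n * integral {-pi..pi} (\<lambda>t. integral {-pi..pi} (\<lambda>s. c s t * E n s t))) \<longlonglongrightarrow> 0"
    unfolding E_def by (rule remainder_tendsto_0[OF d1 d2 cc(1) cc1 cc(2) cper van \<kappa> \<kappa>_pos])
  have cb: "continuous_on UNIV (a 0)" "continuous_on UNIV (a pi)" by (intro cont2[OF ca] continuous_intros)+
  have cnjK: "continuous_on {0<..} (\<lambda>l. cnj (K0 l))" by (intro continuous_intros continuous_on_K0)
  have cmr: "continuous_on UNIV (\<lambda>t. m t + r t)" "continuous_on UNIV (\<lambda>t. m t - r t)" by (intro continuous_intros)+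
  note P = main_part_tendsto_0[OF K0_rate continuous_on_K0 cb(1) cmr(1) \<kappa> \<kappa>_pos]
  note Q = main_part_tendsto_0[OF cnj_K0_rate cnjK cb(2) cmr(2) \<kappa> \<kappa>_pos]
  define U where "U n = integral {-pi..pi} (\<lambda>t. a 0 t * (expi (\<kappa> n * (m t + r t)) * K0 (\<kappa> n * r t)))" for n
  define V where "V n = integral {-pi..pi} (\<lambda>t. a pi t * (expi (\<kappa> n * (m t - r t)) * cnj (K0 (\<kappa> n * r t))))" for n
  have split: "integral {-pi..pi} (\<lambda>t. integral {-pi..pi} (\<lambda>s. a s t * E n s t))
     = integral {-pi..pi} (\<lambda>t. integral {-pi..pi} (\<lambda>s. c s t * E n s t)) + (U n + V n)" for n
  proof -
    have inner: "integral {-pi..pi} (\<lambda>s. a s t * E n s t) = integral {-pi..pi} (\<lambda>s. c s t * E n s t)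
       + (a 0 t * (expi (\<kappa> n * (m t + r t)) * K0 (\<kappa> n * r t)) + a pi t * (expi (\<kappa> n * (m t - r t)) * cnj (K0 (\<kappa> n * r t))))" for t
    proof -
      have "a s t * E n s t = c s t * E n s t + (a 0 t * (complex_of_real (cutA s) * E n s t) + a pi t * (complex_of_real (cutA (s + pi)) * E n s t))" for s
        unfolding c_def by (simp add: algebra_simps)
      then have "integral {-pi..pi} (\<lambda>s. a s t * E n s t) = integral {-pi..pi} (\<lambda>s. c s t * E n s t + (a 0 t * (complex_of_real (cutA s) * E n s t) + a pi t * (complex_of_real (cutA (s + pi)) * E n s t)))"
        by simp
      also have "\<dots> = integral {-pi..pi} (\<lambda>s. c s t * E n s t) + integral {-pi..pi} (\<lambda>s. a 0 t * (complex_of_real (cutA s) * E n s t) + a pi t * (complex_of_real (cutA (s + pi)) * E n s t))"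
        by (intro integral_add integrable_continuous_interval continuous_intros cont2[OF cc(1)] cE)
      also have "integral {-pi..pi} (\<lambda>s. a 0 t * (complex_of_real (cutA s) * E n s t) + a pi t * (complex_of_real (cutA (s + pi)) * E n s t))
         = integral {-pi..pi} (\<lambda>s. a 0 t * (complex_of_real (cutA s) * E n s t)) + integral {-pi..pi} (\<lambda>s. a pi t * (complex_of_real (cutA (s + pi)) * E n s t))"
        by (intro integral_add integrable_continuous_interval continuous_intros cE)
      finally show ?thesis unfolding integral_mult_right E_def cutA_integral_plus cutA_integral_minus .
    qed
    have cK: "continuous_on A (\<lambda>t. K0 (\<kappa> n * r t))" for A
      by (rule continuous_on_compose2[OF continuous_on_K0]) (use r_pos \<kappa>_pos in \<open>auto intro!: continuous_intros\<close>)
    have cI: "continuous_on {-pi..pi} (\<lambda>t. integral {-pi..pi} (\<lambda>s. c s t * E n s t))"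
      by (rule continuous_on_subset[OF continuous_on_integral_param]) (auto intro!: continuous_intros cc cE)
    have cU: "continuous_on {-pi..pi} (\<lambda>t. a 0 t * (expi (\<kappa> n * (m t + r t)) * K0 (\<kappa> n * r t)))"
      and cV: "continuous_on {-pi..pi} (\<lambda>t. a pi t * (expi (\<kappa> n * (m t - r t)) * cnj (K0 (\<kappa> n * r t))))"
      by (intro continuous_intros cK cont2[OF ca])+
    note i = integrable_continuous_interval[OF cI] integrable_continuous_interval[OF cU] integrable_continuous_interval[OF cV]
    show ?thesis unfolding inner U_def V_def integral_add[OF i(2,3), symmetric] integral_add[OF i(1) integrable_add[OF i(2,3)], symmetric] ..
  qed
  have "(\<lambda>n. \<kappa> n * integral {-pi..pi} (\<lambda>t. integral {-pi..pi} (\<lambda>s. c s t * E n s t))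
     + ((\<kappa> n * U n - sqrt (\<kappa> n) * integral {-pi..pi} (\<lambda>t. a 0 t * (T0_inf / complex_of_real (sqrt (r t))) * expi (\<kappa> n * (m t + r t))))
     + (\<kappa> n * V n - sqrt (\<kappa> n) * integral {-pi..pi} (\<lambda>t. a pi t * (cnj T0_inf / complex_of_real (sqrt (r t))) * expi (\<kappa> n * (m t - r t)))))) \<longlonglongrightarrow> 0 + (0 + 0)"
    unfolding U_def V_def by (intro tendsto_add R P Q)
  then show ?thesis unfolding E_def[symmetric] split by (simp add: algebra_simps)
qed

end

text \<open>Cutting the period at u and v isolates one critical point on each arc; the maximum
  contributes the conjugate Fresnel constant and the minimum the constant itself.\<close>

lemma two_point_stationary_phase:
  fixes b b' :: "real \<Rightarrow> complex" and f f1 f2 :: "real \<Rightarrow> real" and \<kappa> :: "nat \<Rightarrow> real"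
  assumes f: "\<And>x. (f has_real_derivative f1 x) (at x)"
    and f1: "\<And>x. (f1 has_real_derivative f2 x) (at x)" and f2: "continuous_on UNIV f2"
    and b: "\<And>x. (b has_vector_derivative b' x) (at x)" and b': "continuous_on UNIV b'"
    and per: "\<And>x. f (x + 2 * pi) = f x" "\<And>x. b (x + 2 * pi) = b x"
    and x1: "u < x1" "x1 < v" "f1 x1 = 0" "f2 x1 < 0" "\<And>x. x \<in> {u..v} \<Longrightarrow> f1 x = 0 \<Longrightarrow> x = x1"
    and x2: "v < x2" "x2 < u + 2 * pi" "f1 x2 = 0" "f2 x2 > 0" "\<And>x. x \<in> {v..u + 2 * pi} \<Longrightarrow> f1 x = 0 \<Longrightarrow> x = x2"
    and \<kappa>: "filterlim \<kappa> at_top sequentially" and \<kappa>_pos: "\<And>n. \<kappa> n > 0"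
  shows "(\<lambda>n. sqrt (\<kappa> n) * integral {-pi..pi} (\<lambda>x. b x * expi (\<kappa> n * f x))
      - (expi (\<kappa> n * f x1) * (b x1 * complex_of_real (1 / sqrt (\<bar>f2 x1\<bar> / 2)) * cnj Fresnel)
       + expi (\<kappa> n * f x2) * (b x2 * complex_of_real (1 / sqrt (\<bar>f2 x2\<bar> / 2)) * Fresnel))) \<longlonglongrightarrow> 0"
proof -
  have cf: "continuous_on A f" and cb: "continuous_on A b" for A
    using f b by (meson continuous_at_imp_continuous_on DERIV_isCont has_vector_derivative_continuous)+
  obtain B where B: "\<And>x. norm (b x) \<le> B"
  proof -
    obtain B where B: "\<And>x. x \<in> {-pi..pi} \<Longrightarrow> norm (b x) \<le> B"
      using compact_imp_bounded[OF compact_continuous_image[OF cb compact_Icc[of "-pi" pi]]] unfolding bounded_iff by blast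
    have "norm (b x) \<le> B" for x
    proof -
      have iter: "b (y + 2 * pi * real j) = b y" for y j
      proof (induction j)
        case (Suc j)
        have "b (y + 2 * pi * real (Suc j)) = b ((y + 2 * pi * real j) + 2 * pi)" by (simp add: algebra_simps)
        with per(2) Suc show ?case by simp
      qed simp
      have iter_int: "b (y + 2 * pi * real_of_int j) = b y" for y j
      proof (cases "j \<ge> 0")
        case True then show ?thesis using iter[of y "nat j"] by simp
      next
        case False then show ?thesis using iter[of "y + 2 * pi * real_of_int j" "nat (- j)"] by (simp add: algebra_simps)
      qed
      define j where "j = \<lfloor>(x + pi) / (2 * pi)\<rfloor>"
      define y where "y = x - 2 * pi * real_of_int j"
      have "real_of_int j \<le> (x + pi) / (2 * pi)" "(x + pi) / (2 * pi) < real_of_int j + 1" unfolding j_def by linarith+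
      then have "real_of_int j * (2 * pi) \<le> x + pi" "x + pi < (real_of_int j + 1) * (2 * pi)" using pi_gt_zero by (auto simp: field_simps)
      then have "y \<in> {-pi..pi}" unfolding y_def by (auto simp: algebra_simps)
      moreover have "b x = b y" using iter_int[of y j] by (simp add: y_def)
      ultimately show ?thesis using B by simp
    qed
    then show thesis by (rule that)
  qed
  define g where "g n x = b x * expi (\<kappa> n * f x)" for n x
  have cg: "continuous_on A (g n)" for A n unfolding g_def by (intro continuous_intros cb cf)
  have "integral {-pi..pi} (g n) = integral {u..v} (g n) + integral {v..u + 2 * pi} (g n)" for n
  proof -
    have "integral {-pi..pi} (g n) = integral {-pi..pi} (\<lambda>x. g n (x + (u + pi)))"
      by (rule integral_periodic_shift[symmetric, OF cg]) (simp add: g_def per)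
    also have "\<dots> = integral {u..u + 2 * pi} (g n)"
      using integral_shift_real_ivl[of u "u + pi" "u + 2 * pi" "g n"] by simp
    also have "\<dots> = integral {u..v} (g n) + integral {v..u + 2 * pi} (g n)"
      by (rule Henstock_Kurzweil_Integration.integral_combine[symmetric]) (use x1 x2 in \<open>auto intro!: integrable_continuous_interval cg\<close>)
    finally show ?thesis .
  qed
  moreover have "(\<lambda>n. (sqrt (\<kappa> n) * integral {u..v} (g n) - expi (\<kappa> n * f x1) * (b x1 * complex_of_real (1 / sqrt (\<bar>f2 x1\<bar> / 2)) * (if f2 x1 > 0 then Fresnel else cnj Fresnel)))
     + (sqrt (\<kappa> n) * integral {v..u + 2 * pi} (g n) - expi (\<kappa> n * f x2) * (b x2 * complex_of_real (1 / sqrt (\<bar>f2 x2\<bar> / 2)) * (if f2 x2 > 0 then Fresnel else cnj Fresnel)))) \<longlonglongrightarrow> 0 + 0"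
    unfolding g_def
    by (intro tendsto_add stationary_phase_1d[OF f f1 f2 b b' B _ _ _ _ _ \<kappa> \<kappa>_pos]) (use x1 x2 in auto)
  ultimately show ?thesis using x1(4) x2(4) unfolding g_def by (simp add: algebra_simps)
qed

section \<open>Critical angles and Snell's law\<close>

lemma periodic_of_int:
  fixes f :: "real \<Rightarrow> 'a"
  assumes "\<And>x. f (x + p) = f x"
  shows "f (x + p * real_of_int n) = f x"
proof -
  have nat: "f (x + p * real k) = f x" for x k
  proof (induction k)
    case (Suc k)
    have "x + p * real (Suc k) = (x + p * real k) + p" by (simp add: distrib_left)
    then show ?case using assms Suc by metis
  qed simp
  show ?thesis
  proof (cases "n \<ge> 0")
    case True
    then show ?thesis using nat[of x "nat n"] by simp
  next
    case False
    then have e: "x + p * real_of_int n + p * real (nat (- n)) = x" by simp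
    show ?thesis using nat[of "x + p * real_of_int n" "nat (- n)"] unfolding e ..
  qed
qed

text \<open>In the application c is sqrt q, and \<open>adm\<close> is admissibility with the second
  derivative of the logarithm written out.\<close>

locale star_curve =
  fixes c :: real and \<rho> \<rho>1 \<rho>2 :: "real \<Rightarrow> real"
  assumes c: "c > 1"
    and \<rho>_pos: "\<And>t. \<rho> t > 0"
    and \<rho>_per: "\<And>t. \<rho> (t + 2 * pi) = \<rho> t"
    and \<rho>_deriv: "\<And>t. (\<rho> has_real_derivative \<rho>1 t) (at t)"
    and \<rho>1_deriv: "\<And>t. (\<rho>1 has_real_derivative \<rho>2 t) (at t)"
    and \<rho>2_cont: "continuous_on UNIV \<rho>2"
    and adm: "\<And>t. \<rho>2 t / \<rho> t - (\<rho>1 t / \<rho> t)\<^sup>2 < c / (1 + c)"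
begin

lemma cont_\<rho> [continuous_intros]: "continuous_on A f \<Longrightarrow> continuous_on A (\<lambda>x. \<rho> (f x))"
  and cont_\<rho>1 [continuous_intros]: "continuous_on A f \<Longrightarrow> continuous_on A (\<lambda>x. \<rho>1 (f x))"
  and cont_\<rho>2 [continuous_intros]: "continuous_on A f \<Longrightarrow> continuous_on A (\<lambda>x. \<rho>2 (f x))"
  for f :: "'a::t2_space \<Rightarrow> real"
proof -
  have *: "continuous_on UNIV \<rho>" "continuous_on UNIV \<rho>1"
    using \<rho>_deriv \<rho>1_deriv DERIV_continuous_on by (metis UNIV_I)+
  show "continuous_on A f \<Longrightarrow> continuous_on A (\<lambda>x. \<rho> (f x))"
    "continuous_on A f \<Longrightarrow> continuous_on A (\<lambda>x. \<rho>1 (f x))"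
    "continuous_on A f \<Longrightarrow> continuous_on A (\<lambda>x. \<rho>2 (f x))"
    using * \<rho>2_cont by (auto intro: continuous_on_compose2)
qed

lemma \<rho>_nz [simp]: "\<rho> t \<noteq> 0" using \<rho>_pos[of t] by simp

lemma \<rho>1_per: "\<rho>1 (t + 2 * pi) = \<rho>1 t"
proof -
  have "((\<lambda>t. \<rho> (t + 2 * pi)) has_real_derivative \<rho>1 (t + 2 * pi)) (at t)"
    using \<rho>_deriv[of "t + 2 * pi"] by (subst (asm) DERIV_shift)
  then show ?thesis using \<rho>_per \<rho>_deriv[of t] by (simp add: DERIV_unique)
qed

section \<open>Normal angle and refraction\<close>

text \<open>\<open>b1\<close> and \<open>b2\<close> are the first two derivatives of the logarithm
  of \<rho>.\<close>

definition "b1 t = \<rho>1 t / \<rho> t"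
definition "b2 t = \<rho>2 t / \<rho> t - (\<rho>1 t / \<rho> t)\<^sup>2"

text \<open>The angle between the outer normal and the radial direction.\<close>
definition "al t = arctan (b1 t)"

text \<open>Snell's law: the direction at angle \<open>T \<sigma> t\<close> from the radial one is refracted from
  the radial ray of orientation \<open>\<sigma>\<close>, with \<open>c\<close> the ratio of the indices.\<close>
definition "T \<sigma> t = al t + \<sigma> * arcsin (sin (al t) / c)"
definition "T1 \<sigma> t = b2 t / (1 + (b1 t)\<^sup>2) * (1 + \<sigma> * (cos (al t) / c / sqrt (1 - (sin (al t) / c)\<^sup>2)))"
definition "E \<sigma> t = t - T \<sigma> t"

lemma b1_deriv: "(b1 has_real_derivative b2 t) (at t)"
  unfolding b1_def b2_def
  by (auto intro!: derivative_eq_intros \<rho>_deriv \<rho>1_deriv simp: power2_eq_square diff_divide_distrib)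

lemma al_deriv: "(al has_real_derivative b2 t / (1 + (b1 t)\<^sup>2)) (at t)"
  unfolding al_def using DERIV_chain2[OF DERIV_arctan b1_deriv] by (simp add: divide_inverse mult.commute)

lemma al_bounds: "- (pi / 2) < al t" "al t < pi / 2" "cos (al t) > 0"
  unfolding al_def using arctan_lbound arctan_ubound by (auto intro!: cos_gt_zero_pi)

lemma sin_al_c: "\<bar>sin (al t) / c\<bar> < 1"
proof -
  have "\<bar>sin (al t)\<bar> \<le> 1" by simp
  also have "1 < c" by (rule c)
  finally show ?thesis using c by (simp add: abs_divide)
qed

lemma sin_al_c': "- 1 < sin (al t) / c" "sin (al t) / c < 1"
  using sin_al_c[of t] unfolding abs_less_iff by linarith+

lemma sqrt_ge_cos: "sqrt (1 - (sin (al t) / c)\<^sup>2) \<ge> cos (al t)" "sqrt (1 - (sin (al t) / c)\<^sup>2) > 0"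
proof -
  have "(sin (al t) / c)\<^sup>2 \<le> (sin (al t))\<^sup>2"
    using c by (simp add: power_divide divide_le_eq mult_le_cancel_left1 power2_eq_square) (smt (verit) mult_less_cancel_left2 zero_le_square)
  then have "(cos (al t))\<^sup>2 \<le> 1 - (sin (al t) / c)\<^sup>2" by (simp add: cos_squared_eq)
  then show "sqrt (1 - (sin (al t) / c)\<^sup>2) \<ge> cos (al t)" by (rule real_le_rsqrt)
  with al_bounds(3)[of t] show "sqrt (1 - (sin (al t) / c)\<^sup>2) > 0" by linarith
qed

lemma T_deriv: "(T \<sigma> has_real_derivative T1 \<sigma> t) (at t)"
proof -
  have "((\<lambda>t. sin (al t) / c) has_real_derivative cos (al t) * (b2 t / (1 + (b1 t)\<^sup>2)) / c) (at t)"
    by (intro DERIV_cdivide DERIV_chain2[OF DERIV_sin al_deriv])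
  from DERIV_chain2[OF DERIV_arcsin[OF sin_al_c'] this]
  have "((\<lambda>t. arcsin (sin (al t) / c)) has_real_derivative inverse (sqrt (1 - (sin (al t) / c)\<^sup>2)) * (cos (al t) * (b2 t / (1 + (b1 t)\<^sup>2)) / c)) (at t)"
    by simp
  from DERIV_add[OF al_deriv DERIV_cmult[OF this, of \<sigma>]]
  show ?thesis unfolding T_def T1_def
    by (rule DERIV_cong) (simp add: divide_inverse algebra_simps)
qed

lemma cont_b [continuous_intros]: "continuous_on A b1" "continuous_on A b2" "continuous_on A al"
proof -
  show "continuous_on A b1" "continuous_on A b2" unfolding b1_def b2_def by (auto intro!: continuous_intros)
  then show "continuous_on A al" unfolding al_def by (intro continuous_intros)
qed

lemma cont_T [continuous_intros]: "continuous_on A (T \<sigma>)" "continuous_on A (T1 \<sigma>)"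
proof -
  show "continuous_on A (T \<sigma>)" by (rule DERIV_continuous_on) (rule has_field_derivative_at_within[OF T_deriv])
  have "sqrt (1 - (sin (al t) / c)\<^sup>2) \<noteq> 0" "1 + (b1 t)\<^sup>2 \<noteq> 0" for t
    using sqrt_ge_cos(2)[of t] zero_le_power2[of "b1 t"] by linarith+
  then show "continuous_on A (T1 \<sigma>)" unfolding T1_def using c by (auto intro!: continuous_intros)
qed

text \<open>Snell's law multiplies the derivative of \<open>al\<close> by 1 + \<sigma> w with 0
  \<le> w \<le> 1 / c, and that derivative is at most b2 when b2 is positive. Admissibility bounds
  b2 by c / (1 + c), the reciprocal of 1 + 1 / c.\<close>

lemma T1_less_1:
  assumes "\<bar>\<sigma>\<bar> = 1"
  shows "T1 \<sigma> t < 1"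
proof -
  define w where "w = cos (al t) / c / sqrt (1 - (sin (al t) / c)\<^sup>2)"
  have "w = (cos (al t) / sqrt (1 - (sin (al t) / c)\<^sup>2)) / c" by (simp add: w_def)
  also have "\<dots> \<le> 1 / c" using sqrt_ge_cos[of t] c by (intro divide_right_mono) auto
  finally have w1: "w \<le> 1 / c" .
  have w0: "w \<ge> 0" using al_bounds(3)[of t] sqrt_ge_cos(2)[of t] c by (simp add: w_def)
  have "1 / c < 1" using c by simp
  have \<sigma>w: "\<bar>\<sigma> * w\<bar> = w" using assms w0 by (simp add: abs_mult)
  have s: "0 < 1 + \<sigma> * w" "1 + \<sigma> * w \<le> 1 + 1 / c" using \<sigma>w w1 \<open>1 / c < 1\<close> by (auto simp: abs_if split: if_splits)
  have d: "1 + (b1 t)\<^sup>2 \<ge> 1" by simp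
  show ?thesis
  proof (cases "b2 t \<le> 0")
    case True
    have "0 < 1 + (b1 t)\<^sup>2" using d by linarith
    with True have "b2 t / (1 + (b1 t)\<^sup>2) \<le> 0" by (intro divide_nonpos_pos)
    then have "T1 \<sigma> t \<le> 0" unfolding T1_def w_def[symmetric] using s by (intro mult_nonpos_nonneg) auto
    then show ?thesis by simp
  next
    case False
    have pos: "0 < 1 + (b1 t)\<^sup>2" using d by linarith
    have "b2 t / (1 + (b1 t)\<^sup>2) \<le> b2 t / 1"
      unfolding div_by_1 pos_divide_le_eq[OF pos] using mult_left_mono[OF d, of "b2 t"] False by simp
    then have "T1 \<sigma> t \<le> b2 t * (1 + 1 / c)"
      unfolding T1_def w_def[symmetric] using s False by (intro mult_mono) auto
    also have "\<dots> < c / (1 + c) * (1 + 1 / c)"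
      using adm[of t] c by (intro mult_strict_right_mono) (auto simp: b2_def intro!: add_pos_pos)
    also have "1 + 1 / c = (1 + c) / c" using c by (simp add: field_simps)
    also have "c / (1 + c) * ((1 + c) / c) = 1" using c by simp
    finally show ?thesis .
  qed
qed

lemma E_deriv: "(E \<sigma> has_real_derivative 1 - T1 \<sigma> t) (at t)"
  unfolding E_def by (auto intro!: derivative_eq_intros T_deriv)

text \<open>As c > 1, the refracted angle is smaller in modulus than \<open>al\<close>, so adding or
  subtracting it cannot change the sign; both angles lie below pi / 2.\<close>

lemma sgn_T:
  assumes \<sigma>: "\<bar>\<sigma>\<bar> = 1"
  shows "sgn (T \<sigma> t) = sgn (\<rho>1 t)" "\<bar>T \<sigma> t\<bar> < pi"
proof -
  have s: "sgn (al t) = sgn (\<rho>1 t)"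
    using \<rho>_pos[of t] by (simp add: al_def b1_def sgn_if zero_less_divide_iff)
  define x where "x = arcsin (sin (al t) / c)"
  note sn = sin_al_c'[of t]
  have "- (pi / 2) < x" "x < pi / 2" using arcsin_lt_bounded[OF sn] by (auto simp: x_def)
  then have xb: "\<bar>x\<bar> < pi / 2" unfolding abs_less_iff by linarith
  have \<sigma>x: "\<bar>\<sigma> * x\<bar> = \<bar>x\<bar>" using \<sigma> by (simp add: abs_mult)
  have "\<bar>T \<sigma> t\<bar> \<le> \<bar>al t\<bar> + \<bar>x\<bar>" unfolding T_def x_def[symmetric] using abs_triangle_ineq[of "al t" "\<sigma> * x"] \<sigma>x by simp
  moreover have "\<bar>al t\<bar> < pi / 2" using al_bounds(1,2)[of t] by (simp add: abs_less_iff)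
  ultimately show "\<bar>T \<sigma> t\<bar> < pi" using xb by simp
  have lt: "\<bar>x\<bar> < \<bar>al t\<bar>" if "al t \<noteq> 0"
  proof -
    have pos: "arcsin (sin y / c) < y \<and> 0 < arcsin (sin y / c)" if y: "0 < y" "y < pi / 2" for y
    proof -
      have sy: "0 < sin y" "sin y \<le> 1" using y pi_gt_zero by (auto intro!: sin_gt_zero)
      have sc: "sin y / c < sin y" "0 < sin y / c" using sy c by (auto simp: divide_less_eq)
      have "arcsin (sin y / c) < arcsin (sin y)" using sc sy by (intro arcsin_less_arcsin) auto
      also have "arcsin (sin y) = y" using y by (intro arcsin_sin) auto
      finally have "arcsin (sin y / c) < y" .
      moreover have "sin y / c \<le> 1" using sc sy by linarith
      ultimately show ?thesis using sc arcsin_less_arcsin[of 0 "sin y / c"] by simp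
    qed
    show ?thesis
    proof (cases "al t > 0")
      case True
      then show ?thesis using pos[OF True al_bounds(2)] unfolding x_def by simp
    next
      case False
      then have a: "0 < - al t" "- al t < pi / 2" using \<open>al t \<noteq> 0\<close> al_bounds(1)[of t] by auto
      have "arcsin (sin (- al t) / c) = - x"
        unfolding x_def using sn by (simp add: arcsin_minus)
      then show ?thesis using pos[OF a] a by simp
    qed
  qed
  show "sgn (T \<sigma> t) = sgn (\<rho>1 t)"
  proof (cases "al t = 0")
    case True
    then show ?thesis using s by (simp add: T_def)
  next
    case False
    have "\<bar>\<sigma> * x\<bar> < \<bar>al t\<bar>" using lt[OF False] \<sigma>x by simp
    then have "sgn (al t + \<sigma> * x) = sgn (al t)" by (auto simp: sgn_if abs_if split: if_splits)
    then show ?thesis using s unfolding T_def x_def[symmetric] by simp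
  qed
qed

lemma E_strict_mono: assumes "\<bar>\<sigma>\<bar> = 1" shows "strict_mono (E \<sigma>)"
proof (rule strict_monoI)
  fix x y :: real assume "x < y"
  then show "E \<sigma> x < E \<sigma> y"
    by (rule DERIV_pos_imp_increasing) (use E_deriv T1_less_1[OF assms] in \<open>metis diff_gt_0_iff_gt\<close>)
qed

lemma cont_E [continuous_intros]: "continuous_on A (E \<sigma>)"
  unfolding E_def by (intro continuous_intros)

lemma al_per: "al (t + 2 * pi) = al t"
  by (simp add: al_def b1_def \<rho>_per \<rho>1_per)

lemma T_per: "T \<sigma> (t + 2 * pi) = T \<sigma> t"
  by (simp add: T_def al_per)

lemma E_per: "E \<sigma> (t + 2 * pi) = E \<sigma> t + 2 * pi"
  by (simp add: E_def T_per)

text \<open>\<open>P \<sigma> \<eta>\<close> is the boundary angle at which the ray of orientation \<open>\<sigma>\<close> leaves in direction \<open>\<eta>\<close>.\<close>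
definition "P \<sigma> = inv (E \<sigma>)"

text \<open>The critical value of the phase has derivative \<open>c D \<sigma> \<eta>\<close> with respect to the direction \<open>\<eta>\<close>.\<close>
definition "D \<sigma> y = \<rho> (P \<sigma> y) * sin (P \<sigma> y - y)"

context
  fixes \<sigma> :: real
  assumes \<sigma>: "\<bar>\<sigma>\<bar> = 1"
begin

text \<open>Surjectivity is the intermediate value theorem: E differs from the identity by less than
  pi.\<close>

lemma bij_E: "bij (E \<sigma>)"
proof (rule bijI)
  show "inj (E \<sigma>)" using E_strict_mono[OF \<sigma>] by (rule strict_mono_imp_inj_on)
  show "surj (E \<sigma>)"
    unfolding surj_def
  proof
    fix y
    have "E \<sigma> (y - pi) \<le> y" "y \<le> E \<sigma> (y + pi)"
      using sgn_T(2)[OF \<sigma>, of "y - pi"] sgn_T(2)[OF \<sigma>, of "y + pi"] by (auto simp: E_def abs_less_iff)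
    then have "\<exists>x\<ge>y - pi. x \<le> y + pi \<and> E \<sigma> x = y"
      by (intro IVT') (auto intro!: continuous_intros)
    then show "\<exists>x. y = E \<sigma> x" by metis
  qed
qed

lemma E_P [simp]: "E \<sigma> (P \<sigma> y) = y" and P_E [simp]: "P \<sigma> (E \<sigma> x) = x"
  unfolding P_def using bij_E by (auto simp: bij_is_surj surj_f_inv_f bij_is_inj)

lemma P_strict_mono: "x < y \<Longrightarrow> P \<sigma> x < P \<sigma> y"
  using strict_mono_less[OF E_strict_mono[OF \<sigma>], of "P \<sigma> x" "P \<sigma> y"] by simp

lemma P_per: "P \<sigma> (y + 2 * pi) = P \<sigma> y + 2 * pi"
proof -
  have "P \<sigma> (E \<sigma> (P \<sigma> y + 2 * pi)) = P \<sigma> (y + 2 * pi)" unfolding E_per by simp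
  then show ?thesis by simp
qed

lemma P_deriv: "(P \<sigma> has_real_derivative inverse (1 - T1 \<sigma> (P \<sigma> y))) (at y)"
proof (rule DERIV_inverse_function[where f = "E \<sigma>" and a = "y - 1" and b = "y + 1"])
  show "(E \<sigma> has_real_derivative 1 - T1 \<sigma> (P \<sigma> y)) (at (P \<sigma> y))" by (rule E_deriv)
  show "1 - T1 \<sigma> (P \<sigma> y) \<noteq> 0" using T1_less_1[OF \<sigma>, of "P \<sigma> y"] by simp
  have "isCont (P \<sigma>) (E \<sigma> (P \<sigma> y))"
    by (rule isCont_inverse_function[where d = 1]) (use continuous_on_eq_continuous_at[of UNIV "E \<sigma>"] cont_E in auto)
  then show "isCont (P \<sigma>) y" by simp
qed auto

lemma cont_P [continuous_intros]: "continuous_on A f \<Longrightarrow> continuous_on A (\<lambda>x. P \<sigma> (f x))"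
proof -
  have "continuous_on UNIV (P \<sigma>)" 
    by (rule DERIV_continuous_on) (rule has_field_derivative_at_within[OF P_deriv])
  then show "continuous_on A f \<Longrightarrow> continuous_on A (\<lambda>x. P \<sigma> (f x))" by (auto intro: continuous_on_compose2)
qed

lemma P_minus: "P \<sigma> y - y = T \<sigma> (P \<sigma> y)"
  using E_P[of y] by (simp add: E_def)

lemma P_fixed: "\<rho>1 z = 0 \<Longrightarrow> P \<sigma> z = z"
proof -
  assume "\<rho>1 z = 0"
  then have "T \<sigma> z = 0" using sgn_T(1)[OF \<sigma>, of z] by (simp add: sgn_zero_iff)
  then show ?thesis using P_E[of z] by (simp add: E_def)
qed

text \<open>P is strictly increasing and fixes every zero of \<rho>1, so it cannot carry a point
  across a zero.\<close>

lemma sgn_P: "sgn (\<rho>1 (P \<sigma> y)) = sgn (\<rho>1 y)"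
proof (rule ccontr)
  assume neq: "sgn (\<rho>1 (P \<sigma> y)) \<noteq> sgn (\<rho>1 y)"
  have c1: "continuous_on A \<rho>1" for A using cont_\<rho>1[of A "\<lambda>x. x"] by simp
  have nz: "\<rho>1 y \<noteq> 0" using P_fixed[of y] neq by auto
  have nP: "\<rho>1 (P \<sigma> y) \<noteq> 0"
  proof
    assume z: "\<rho>1 (P \<sigma> y) = 0"
    from P_fixed[OF this] have "P \<sigma> y = y" by (metis E_P)
    with z nz show False by simp
  qed
  have "\<exists>z. (y \<le> z \<and> z \<le> P \<sigma> y \<or> P \<sigma> y \<le> z \<and> z \<le> y) \<and> \<rho>1 z = 0"
  proof (cases "y \<le> P \<sigma> y")
    case True
    have "\<rho>1 y \<le> 0 \<and> 0 \<le> \<rho>1 (P \<sigma> y) \<or> \<rho>1 (P \<sigma> y) \<le> 0 \<and> 0 \<le> \<rho>1 y" using neq nz nP by (auto simp: sgn_if split: if_splits)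
    then show ?thesis using IVT'[of \<rho>1 y 0 "P \<sigma> y"] IVT2'[of \<rho>1 "P \<sigma> y" 0 y] True c1 by blast
  next
    case False
    have "\<rho>1 y \<le> 0 \<and> 0 \<le> \<rho>1 (P \<sigma> y) \<or> \<rho>1 (P \<sigma> y) \<le> 0 \<and> 0 \<le> \<rho>1 y" using neq nz nP by (auto simp: sgn_if split: if_splits)
    then show ?thesis using IVT'[of \<rho>1 "P \<sigma> y" 0 y] IVT2'[of \<rho>1 y 0 "P \<sigma> y"] False c1 by (metis linear)
  qed
  then obtain z where z: "y \<le> z \<and> z \<le> P \<sigma> y \<or> P \<sigma> y \<le> z \<and> z \<le> y" "\<rho>1 z = 0" by blast
  have Pz: "P \<sigma> z = z" by (rule P_fixed[OF z(2)])
  have "z \<noteq> y" using z(2) nz by auto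
  from z(1) show False
  proof (elim disjE)
    assume "y \<le> z \<and> z \<le> P \<sigma> y"
    then show False using P_strict_mono[of y z] \<open>z \<noteq> y\<close> Pz by simp
  next
    assume "P \<sigma> y \<le> z \<and> z \<le> y"
    then show False using P_strict_mono[of z y] \<open>z \<noteq> y\<close> Pz by simp
  qed
qed

text \<open>The angle P y - y is T at P y, which lies in (-pi, pi) and has the sign of \<rho>1; sine
  keeps this sign.\<close>

lemma sgn_D: "sgn (D \<sigma> y) = sgn (\<rho>1 y)"
proof -
  define x where "x = T \<sigma> (P \<sigma> y)"
  have x: "\<bar>x\<bar> < pi" "sgn x = sgn (\<rho>1 y)" unfolding x_def using sgn_T[OF \<sigma>, of "P \<sigma> y"] sgn_P[of y] by auto
  have "sgn (sin x) = sgn x"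
  proof (cases x "0::real" rule: linorder_cases)
    case less
    then have "sin x < 0" using x(1) sin_gt_zero[of "- x"] by (simp add: abs_less_iff)
    with less show ?thesis by simp
  next
    case greater
    then have "sin x > 0" using x(1) by (intro sin_gt_zero) auto
    with greater show ?thesis by simp
  qed simp
  then show ?thesis using x(2) \<rho>_pos[of "P \<sigma> y"] unfolding D_def P_minus x_def[symmetric] by (simp add: sgn_mult)
qed

end

section \<open>The phase on the boundary and its critical angles\<close>

text \<open>The two-angle phase restricted to \<open>cos s = \<sigma>\<close>: \<sigma> = 1 belongs
  to s = 0 and \<sigma> = -1 to s = pi. \<open>F1\<close> and \<open>F2\<close> are the derivatives
  in t.\<close>

definition "F \<sigma> \<eta> t = \<rho> t * (\<sigma> + c * cos (t - \<eta>))"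
definition "F1 \<sigma> \<eta> t = \<rho>1 t * (\<sigma> + c * cos (t - \<eta>)) - \<rho> t * (c * sin (t - \<eta>))"
definition "F2 \<sigma> \<eta> t = \<rho>2 t * (\<sigma> + c * cos (t - \<eta>)) - 2 * (\<rho>1 t * (c * sin (t - \<eta>))) - \<rho> t * (c * cos (t - \<eta>))"

lemma F_deriv: "(F \<sigma> \<eta> has_real_derivative F1 \<sigma> \<eta> t) (at t)"
  unfolding F_def F1_def by (auto intro!: derivative_eq_intros \<rho>_deriv)

lemma F1_deriv: "(F1 \<sigma> \<eta> has_real_derivative F2 \<sigma> \<eta> t) (at t)"
  unfolding F1_def F2_def by (auto intro!: derivative_eq_intros \<rho>_deriv \<rho>1_deriv simp: algebra_simps)

lemma cont_F: "continuous_on A (F \<sigma> \<eta>)" "continuous_on A (F2 \<sigma> \<eta>)"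
  unfolding F_def F2_def by (intro continuous_intros)+

lemma F_per: "F \<sigma> \<eta> (t + 2 * pi) = F \<sigma> \<eta> t"
proof -
  have "cos (t + 2 * pi - \<eta>) = cos (t - \<eta>)" using cos_periodic[of "t - \<eta>"] by (simp add: algebra_simps)
  then show ?thesis by (simp add: F_def \<rho>_per)
qed

text \<open>Write A for \<sigma> + c cos (t - \<eta>) and u for \<sigma> cos (t - \<eta>).
  Eliminating \<rho>1 by the critical equation gives F2 A = \<rho> (b2 A^2 - (c^2 + c u)), and
  admissibility makes the bracket negative.\<close>

lemma F2_at_critical:
  assumes \<sigma>: "\<bar>\<sigma>\<bar> = 1" and z: "F1 \<sigma> \<eta> t = 0" and A: "\<sigma> + c * cos (t - \<eta>) \<noteq> 0"
  shows "F2 \<sigma> \<eta> t * (\<sigma> + c * cos (t - \<eta>)) < 0"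
proof -
  define A where "A = \<sigma> + c * cos (t - \<eta>)"
  define s where "s = c * sin (t - \<eta>)"
  define u where "u = \<sigma> * cos (t - \<eta>)"
  have s\<sigma>: "\<sigma> * \<sigma> = 1" using \<sigma> by (metis abs_mult_self_eq mult_1)
  have cosu: "cos (t - \<eta>) = \<sigma> * u" using s\<sigma> by (simp add: u_def mult.assoc[symmetric])
  have u: "\<bar>u\<bar> \<le> 1" using \<sigma> by (simp add: u_def abs_mult)
  have z': "\<rho>1 t * A = \<rho> t * s" using z by (simp add: F1_def A_def s_def)
  have ss: "s\<^sup>2 = c\<^sup>2 * (1 - u\<^sup>2)"
  proof -
    have "u\<^sup>2 = (cos (t - \<eta>))\<^sup>2" using s\<sigma> by (simp add: u_def power_mult_distrib power2_eq_square)
    then show ?thesis by (simp add: s_def power_mult_distrib sin_squared_eq)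
  qed
  have AA: "A = \<sigma> * (1 + c * u)" "A\<^sup>2 = (1 + c * u)\<^sup>2"
  proof -
    show "A = \<sigma> * (1 + c * u)" unfolding A_def cosu by (simp add: algebra_simps)
    then show "A\<^sup>2 = (1 + c * u)\<^sup>2" using s\<sigma> by (simp add: power_mult_distrib power2_eq_square)
  qed
  have "A\<^sup>2 > 0" using A by (simp add: A_def)
  have "b2 t * A\<^sup>2 < c / (1 + c) * A\<^sup>2" by (rule mult_strict_right_mono[OF adm[of t, folded b2_def] \<open>A\<^sup>2 > 0\<close>])
  \<comment> \<open>Here A^2 = (1 + c u)^2 and |u| \<le> 1. The constant c / (1 + c) is the largest
    one for which the estimate holds for all such u; equality occurs at u = 1.\<close>
  also have "\<dots> \<le> c\<^sup>2 + c * u"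
  proof -
    have "(c\<^sup>2 + c * u) * (1 + c) - c * A\<^sup>2 = c * ((1 - u) * (c\<^sup>2 * (1 + u) + (c - 1)))"
      unfolding AA(2) by (simp add: power2_eq_square algebra_simps)
    moreover have "0 \<le> c * ((1 - u) * (c\<^sup>2 * (1 + u) + (c - 1)))"
    proof -
      have u': "0 \<le> 1 - u" "0 \<le> 1 + u" using u unfolding abs_le_iff by linarith+
      have "0 \<le> c\<^sup>2 * (1 + u)" using u'(2) by simp
      then have "0 \<le> c\<^sup>2 * (1 + u) + (c - 1)" using c by linarith
      with u'(1) c show ?thesis by (intro mult_nonneg_nonneg) auto
    qed
    ultimately have "c * A\<^sup>2 \<le> (c\<^sup>2 + c * u) * (1 + c)" by linarith
    then show ?thesis using c by (simp add: divide_le_eq)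
  qed
  finally have neg: "b2 t * A\<^sup>2 < c\<^sup>2 + c * u" .
  have b2: "\<rho> t * (b2 t * A\<^sup>2) = \<rho>2 t * A\<^sup>2 - \<rho> t * s\<^sup>2"
  proof -
    have "\<rho>1 t / \<rho> t * A = (\<rho>1 t * A) / \<rho> t" by simp
    also have "\<dots> = s" unfolding z' by simp
    finally have "(\<rho>1 t / \<rho> t)\<^sup>2 * A\<^sup>2 = s\<^sup>2" unfolding power_mult_distrib[symmetric] by simp
    moreover have "\<rho> t * (b2 t * A\<^sup>2) = \<rho> t * (\<rho>2 t / \<rho> t * A\<^sup>2) - \<rho> t * ((\<rho>1 t / \<rho> t)\<^sup>2 * A\<^sup>2)"
      unfolding b2_def by (simp only: left_diff_distrib right_diff_distrib)
    ultimately show ?thesis by simp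
  qed
  have "F2 \<sigma> \<eta> t * A = \<rho>2 t * A\<^sup>2 - 2 * (\<rho>1 t * A * s) - \<rho> t * (c * (\<sigma> * u) * A)"
    unfolding F2_def A_def[symmetric] s_def[symmetric] unfolding cosu by (simp add: power2_eq_square algebra_simps)
  also have "\<dots> = \<rho>2 t * A\<^sup>2 - 2 * (\<rho> t * s * s) - \<rho> t * (c * (\<sigma> * u) * A)" unfolding z' ..
  also have "c * (\<sigma> * u) * A = c * u + c\<^sup>2 * u\<^sup>2"
  proof -
    have "c * (\<sigma> * u) * A = (\<sigma> * \<sigma>) * (c * u * (1 + c * u))" unfolding AA(1) by (simp only: mult_ac)
    then show ?thesis unfolding s\<sigma> by (simp add: power2_eq_square algebra_simps)
  qed
  also have "\<rho>2 t * A\<^sup>2 - 2 * (\<rho> t * s * s) - \<rho> t * (c * u + c\<^sup>2 * u\<^sup>2) = \<rho> t * (b2 t * A\<^sup>2) - \<rho> t * (s\<^sup>2 + c * u + c\<^sup>2 * u\<^sup>2)"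
    unfolding b2 by (simp add: power2_eq_square algebra_simps)
  also have "s\<^sup>2 + c * u + c\<^sup>2 * u\<^sup>2 = c\<^sup>2 + c * u" unfolding ss by (simp add: algebra_simps)
  also have "\<rho> t * (b2 t * A\<^sup>2) - \<rho> t * (c\<^sup>2 + c * u) = \<rho> t * (b2 t * A\<^sup>2 - (c\<^sup>2 + c * u))" by (simp only: right_diff_distrib)
  also have "\<dots> < 0" using neg \<rho>_pos[of t] by (simp add: mult_less_0_iff)
  finally show ?thesis by (simp add: A_def)
qed

text \<open>Multiplied by cos (al t), the critical equation becomes sin (\<tau> - a) = sin x with x
  the refracted angle. Its two families of solutions, \<tau> - a = x and \<tau> - a = pi - x, are
  the rays of orientation \<sigma> in direction \<eta> and of orientation - \<sigma> in direction
  \<eta> + pi.\<close>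

lemma critical_iff:
  assumes \<sigma>: "\<bar>\<sigma>\<bar> = 1"
  shows "F1 \<sigma> \<eta> t = 0 \<longleftrightarrow> (\<exists>n::int. E \<sigma> t = \<eta> + 2 * pi * n) \<or> (\<exists>n::int. E (- \<sigma>) t = \<eta> + pi + 2 * pi * n)"
    and "E \<sigma> t = \<eta> + 2 * pi * real_of_int n \<Longrightarrow> \<sigma> + c * cos (t - \<eta>) > 0"
    and "E (- \<sigma>) t = \<eta> + pi + 2 * pi * real_of_int n \<Longrightarrow> \<sigma> + c * cos (t - \<eta>) < 0"
proof -
  define a where "a = al t"
  define x where "x = \<sigma> * arcsin (sin a / c)"
  define \<tau> where "\<tau> = t - \<eta>"
  have s\<sigma>: "\<sigma> * \<sigma> = 1" using \<sigma> by (metis abs_mult_self_eq mult_1)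
  have \<sigma>1: "\<sigma> = 1 \<or> \<sigma> = -1" using \<sigma> by (auto simp: abs_if split: if_splits)
  have sa: "- 1 \<le> sin a / c" "sin a / c \<le> 1" using sin_al_c'[of t] by (auto simp: a_def)
  have sx: "c * sin x = \<sigma> * sin a" using \<sigma>1 c sa by (auto simp: x_def)
  have cosa: "cos a > 0" using al_bounds(3)[of t] by (simp add: a_def)
  have cx: "cos x = sqrt (1 - (sin a / c)\<^sup>2)" using \<sigma>1 cos_arcsin[OF sa] by (auto simp: x_def)
  have cx0: "cos x > 0" unfolding cx using sqrt_ge_cos(2)[of t] by (simp add: a_def)
  have ccx: "c * cos x > cos a"
  proof -
    have "cos a \<le> cos x" unfolding cx using sqrt_ge_cos(1)[of t] by (simp add: a_def)
    also have "cos x < c * cos x" using cx0 c by simp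
    finally show ?thesis .
  qed
  have b1: "\<rho>1 t * cos a = \<rho> t * sin a"
  proof -
    have "tan a = b1 t" by (simp add: a_def al_def tan_arctan)
    then have "sin a / cos a = \<rho>1 t / \<rho> t" by (simp add: tan_def b1_def)
    then show ?thesis using cosa by (simp add: field_simps)
  qed
  have id: "F1 \<sigma> \<eta> t * cos a = - (\<rho> t * c) * (sin (\<tau> - a) - sin x)"
  proof -
    have "F1 \<sigma> \<eta> t * cos a = (\<rho>1 t * cos a) * (\<sigma> + c * cos \<tau>) - \<rho> t * (c * (sin \<tau> * cos a))"
      unfolding F1_def \<tau>_def[symmetric] by (simp add: algebra_simps)
    also have "\<dots> = \<rho> t * (\<sigma> * sin a - c * (sin \<tau> * cos a - cos \<tau> * sin a))" unfolding b1 by (simp add: algebra_simps)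
    also have "\<dots> = - (\<rho> t * c) * (sin (\<tau> - a) - sin x)" unfolding sin_diff sx[symmetric] by (simp add: algebra_simps)
    finally show ?thesis .
  qed
  have iff1: "F1 \<sigma> \<eta> t = 0 \<longleftrightarrow> sin (\<tau> - a) = sin x"
  proof -
    have "F1 \<sigma> \<eta> t = 0 \<longleftrightarrow> F1 \<sigma> \<eta> t * cos a = 0" using cosa by simp
    also have "\<dots> \<longleftrightarrow> sin (\<tau> - a) = sin x" unfolding id using c by simp
    finally show ?thesis .
  qed
  have E1: "E \<sigma> t = \<eta> + (\<tau> - a - x)" unfolding E_def T_def \<tau>_def a_def x_def by simp
  have E2: "E (- \<sigma>) t = \<eta> + (\<tau> - a + x)" unfolding E_def T_def \<tau>_def a_def x_def by simp
  have e1: "(\<exists>n::int. E \<sigma> t = \<eta> + 2 * pi * n) \<longleftrightarrow> sin (\<tau> - a) = sin x \<and> cos (\<tau> - a) = cos x"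
    unfolding E1 sin_cos_eq_iff by (intro iff_exI) (auto simp: algebra_simps)
  have e2: "(\<exists>n::int. E (- \<sigma>) t = \<eta> + pi + 2 * pi * n) \<longleftrightarrow> sin (\<tau> - a) = sin x \<and> cos (\<tau> - a) = - cos x"
  proof -
    have "(\<exists>n::int. E (- \<sigma>) t = \<eta> + pi + 2 * pi * n) \<longleftrightarrow> sin (\<tau> - a) = sin (pi - x) \<and> cos (\<tau> - a) = cos (pi - x)"
      unfolding E2 sin_cos_eq_iff by (intro iff_exI) (auto simp: algebra_simps)
    then show ?thesis by simp
  qed
  have sq: "cos y = cos x \<or> cos y = - cos x" if "sin y = sin x" for y
  proof -
    have "(cos y)\<^sup>2 = (cos x)\<^sup>2" using that by (simp add: cos_squared_eq)
    then show ?thesis by (simp add: power2_eq_iff)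
  qed
  show "F1 \<sigma> \<eta> t = 0 \<longleftrightarrow> (\<exists>n::int. E \<sigma> t = \<eta> + 2 * pi * n) \<or> (\<exists>n::int. E (- \<sigma>) t = \<eta> + pi + 2 * pi * n)"
    unfolding iff1 e1 e2 using sq by blast
  \<comment> \<open>On critical points this factorisation reduces the sign of \<sigma> + c cos
    \<tau> to the sign of cos (\<tau> - a), because c cos x exceeds cos a.\<close>
  have val: "\<sigma> + c * cos \<tau> = cos a * (\<sigma> * cos a + c * cos (\<tau> - a))" if "sin (\<tau> - a) = sin x"
  proof -
    have "cos \<tau> = cos ((\<tau> - a) + a)" by simp
    also have "\<dots> = cos (\<tau> - a) * cos a - sin x * sin a" unfolding cos_add that ..
    finally have ct: "cos \<tau> = cos (\<tau> - a) * cos a - sin x * sin a" .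
    have "c * cos \<tau> = c * cos (\<tau> - a) * cos a - (c * sin x) * sin a" unfolding ct by (simp add: algebra_simps)
    also have "\<dots> = c * cos (\<tau> - a) * cos a - \<sigma> * (1 - (cos a)\<^sup>2)" unfolding sx using sin_squared_eq[of a] by (simp add: power2_eq_square)
    finally show ?thesis by (simp add: power2_eq_square algebra_simps)
  qed
  {
    assume "E \<sigma> t = \<eta> + 2 * pi * real_of_int n"
    then have "sin (\<tau> - a) = sin x" "cos (\<tau> - a) = cos x" using e1 by blast+
    then show "\<sigma> + c * cos (t - \<eta>) > 0" using val ccx cosa \<sigma>1 unfolding \<tau>_def[symmetric] by auto
  next
    assume "E (- \<sigma>) t = \<eta> + pi + 2 * pi * real_of_int n"
    then have sc: "sin (\<tau> - a) = sin x" "cos (\<tau> - a) = - cos x" using e2 by blast+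
    have "\<sigma> * cos a + c * cos (\<tau> - a) < 0" using sc(2) ccx cosa \<sigma>1 by auto
    then show "\<sigma> + c * cos (t - \<eta>) < 0" using val[OF sc(1)] cosa unfolding \<tau>_def[symmetric] by (simp add: mult_less_0_iff)
  }
qed


lemma P_per_int:
  assumes \<sigma>: "\<bar>\<sigma>\<bar> = 1"
  shows "P \<sigma> (y + 2 * pi * real_of_int n) = P \<sigma> y + 2 * pi * real_of_int n"
proof -
  have "(\<lambda>y. P \<sigma> y - y) (y + 2 * pi * real_of_int n) = (\<lambda>y. P \<sigma> y - y) y"
    by (rule periodic_of_int) (simp add: P_per[OF \<sigma>])
  then show ?thesis by simp
qed

lemma critical_cases:
  assumes \<sigma>: "\<bar>\<sigma>\<bar> = 1" and z: "F1 \<sigma> \<eta> t = 0"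
  obtains n :: int where "t = P \<sigma> \<eta> + 2 * pi * n" "\<sigma> + c * cos (t - \<eta>) > 0"
  | n :: int where "t = P (- \<sigma>) (\<eta> + pi) + 2 * pi * n" "\<sigma> + c * cos (t - \<eta>) < 0"
proof -
  have \<sigma>': "\<bar>- \<sigma>\<bar> = 1" using \<sigma> by simp
  from z[unfolded critical_iff(1)[OF \<sigma>]] consider n :: int where "E \<sigma> t = \<eta> + 2 * pi * n" | n :: int where "E (- \<sigma>) t = \<eta> + pi + 2 * pi * n"
    by (elim disjE exE)
  then show thesis
  proof cases
    case 1
    have "t = P \<sigma> (E \<sigma> t)" by (rule P_E[OF \<sigma>, symmetric])
    then have "t = P \<sigma> \<eta> + 2 * pi * n" unfolding 1 P_per_int[OF \<sigma>] .
    with critical_iff(2)[OF \<sigma> 1] show thesis by (rule that(1)[rotated])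
  next
    case 2
    have "t = P (- \<sigma>) (E (- \<sigma>) t)" by (rule P_E[OF \<sigma>', symmetric])
    then have "t = P (- \<sigma>) (\<eta> + pi) + 2 * pi * n" unfolding 2 P_per_int[OF \<sigma>'] .
    with critical_iff(3)[OF \<sigma> 2] show thesis by (rule that(2)[rotated])
  qed
qed

lemma critical_P:
  assumes \<sigma>: "\<bar>\<sigma>\<bar> = 1"
  shows "F1 \<sigma> \<eta> (P \<sigma> \<eta>) = 0" "\<sigma> + c * cos (P \<sigma> \<eta> - \<eta>) > 0" "F2 \<sigma> \<eta> (P \<sigma> \<eta>) < 0"
    and "F1 \<sigma> \<eta> (P (- \<sigma>) (\<eta> + pi)) = 0" "\<sigma> + c * cos (P (- \<sigma>) (\<eta> + pi) - \<eta>) < 0" "F2 \<sigma> \<eta> (P (- \<sigma>) (\<eta> + pi)) > 0"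
proof -
  have \<sigma>': "\<bar>- \<sigma>\<bar> = 1" using \<sigma> by simp
  have e: "E \<sigma> (P \<sigma> \<eta>) = \<eta> + 2 * pi * real_of_int 0" "E (- \<sigma>) (P (- \<sigma>) (\<eta> + pi)) = \<eta> + pi + 2 * pi * real_of_int 0"
    using E_P[OF \<sigma>] E_P[OF \<sigma>'] by simp_all
  show z1: "F1 \<sigma> \<eta> (P \<sigma> \<eta>) = 0" unfolding critical_iff(1)[OF \<sigma>] by (intro disjI1 exI) (rule e(1))
  show z2: "F1 \<sigma> \<eta> (P (- \<sigma>) (\<eta> + pi)) = 0" unfolding critical_iff(1)[OF \<sigma>] by (intro disjI2 exI) (rule e(2))
  show p: "\<sigma> + c * cos (P \<sigma> \<eta> - \<eta>) > 0" by (rule critical_iff(2)[OF \<sigma> e(1)])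
  show n: "\<sigma> + c * cos (P (- \<sigma>) (\<eta> + pi) - \<eta>) < 0" by (rule critical_iff(3)[OF \<sigma> e(2)])
  show "F2 \<sigma> \<eta> (P \<sigma> \<eta>) < 0" using F2_at_critical[OF \<sigma> z1] p by (auto simp: mult_less_0_iff)
  show "F2 \<sigma> \<eta> (P (- \<sigma>) (\<eta> + pi)) > 0" using F2_at_critical[OF \<sigma> z2] n by (auto simp: mult_less_0_iff)
qed

lemma F1_simple: assumes "\<bar>\<sigma>\<bar> = 1" "F1 \<sigma> \<eta> t = 0" shows "F2 \<sigma> \<eta> t \<noteq> 0"
proof -
  have "\<sigma> + c * cos (t - \<eta>) \<noteq> 0" by (rule critical_cases[OF assms]) simp_all
  with F2_at_critical[OF assms] show ?thesis by auto
qed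

text \<open>The separating points are zeros of \<open>\<sigma> + c cos (t - \<eta>)\<close>.\<close>
lemma critical_separation:
  assumes \<sigma>: "\<bar>\<sigma>\<bar> = 1"
  obtains u v where "u < P \<sigma> \<eta>" "P \<sigma> \<eta> < v" "v < P (- \<sigma>) (\<eta> + pi)" "P (- \<sigma>) (\<eta> + pi) < u + 2 * pi"
    "\<And>t. t \<in> {u..v} \<Longrightarrow> F1 \<sigma> \<eta> t = 0 \<Longrightarrow> t = P \<sigma> \<eta>"
    "\<And>t. t \<in> {v..u + 2 * pi} \<Longrightarrow> F1 \<sigma> \<eta> t = 0 \<Longrightarrow> t = P (- \<sigma>) (\<eta> + pi)"
proof -
  have \<sigma>': "\<bar>- \<sigma>\<bar> = 1" using \<sigma> by simp
  define w where "w = arccos (- \<sigma> / c)"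
  have \<sigma>1: "\<sigma> = 1 \<or> \<sigma> = -1" using \<sigma> by (auto simp: abs_if split: if_splits)
  have "\<bar>- \<sigma> / c\<bar> < 1" using \<sigma> c by (simp add: abs_divide)
  then have b: "- 1 < - \<sigma> / c" "- \<sigma> / c < 1" unfolding abs_less_iff by linarith+
  have w: "0 < w" "w < pi" unfolding w_def using arccos_lt_bounded[OF b] by auto
  have cw: "\<sigma> + c * cos w = 0" unfolding w_def using b c by simp
  have cos_lt: "\<bar>y\<bar> < w" if "\<bar>y\<bar> \<le> pi" "\<sigma> + c * cos y > 0" for y
  proof (rule ccontr)
    assume "\<not> \<bar>y\<bar> < w"
    then have "cos \<bar>y\<bar> \<le> cos w" using w that(1) by (intro cos_monotone_0_pi_le) auto
    then have "c * cos y \<le> c * cos w" using c by simp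
    with cw that(2) show False by linarith
  qed
  have pos: "\<sigma> + c * cos y \<ge> 0" if "\<bar>y\<bar> \<le> w" for y
  proof -
    have "cos w \<le> cos \<bar>y\<bar>" using w that by (intro cos_monotone_0_pi_le) auto
    then have "c * cos w \<le> c * cos y" using c by simp
    with cw show ?thesis by linarith
  qed
  have neg: "\<sigma> + c * cos y \<le> 0" if "w \<le> y" "y \<le> 2 * pi - w" for y
  proof -
    have "cos (pi - w) \<le> cos \<bar>y - pi\<bar>" using w that by (intro cos_monotone_0_pi_le) (auto simp: abs_le_iff)
    then have "- cos w \<le> - cos y" by simp
    then have "c * cos y \<le> c * cos w" using c by simp
    with cw show ?thesis by linarith
  qed
  define x1 where "x1 = P \<sigma> \<eta> - \<eta>"
  define x2 where "x2 = P (- \<sigma>) (\<eta> + pi) - \<eta>"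
  have x1: "\<bar>x1\<bar> < w"
    using sgn_T(2)[OF \<sigma>] critical_P(2)[OF \<sigma>] unfolding x1_def by (intro cos_lt) (simp_all add: P_minus[OF \<sigma>] less_imp_le)
  have x2pi: "\<bar>x2 - pi\<bar> < pi"
    using P_minus[OF \<sigma>', of "\<eta> + pi"] sgn_T(2)[OF \<sigma>', of "P (- \<sigma>) (\<eta> + pi)"] by (simp add: x2_def algebra_simps)
  have x2: "w < x2" "x2 < 2 * pi - w"
  proof -
    have n: "\<sigma> + c * cos x2 < 0" using critical_P(5)[OF \<sigma>] by (simp add: x2_def)
    have "\<not> x2 \<le> w" using pos[of x2] n x2pi by (auto simp: abs_less_iff)
    then show "w < x2" by simp
    have "\<not> 2 * pi - w \<le> x2"
    proof
      assume "2 * pi - w \<le> x2"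
      then have "\<sigma> + c * cos (x2 - 2 * pi) \<ge> 0" using x2pi by (intro pos) (auto simp: abs_le_iff abs_less_iff)
      then show False using n cos_periodic[of "x2 - 2 * pi"] by simp
    qed
    then show "x2 < 2 * pi - w" by simp
  qed
  have small: "n = 0" if "\<bar>2 * pi * real_of_int n\<bar> < 2 * pi" for n :: int
  proof -
    have "2 * pi * \<bar>real_of_int n\<bar> < 2 * pi * 1" using that by (simp add: abs_mult)
    then have "\<bar>real_of_int n\<bar> < 1" by simp
    then show ?thesis by linarith
  qed
  show thesis
  proof (rule that[of "\<eta> - w" "\<eta> + w"])
    show "\<eta> - w < P \<sigma> \<eta>" "P \<sigma> \<eta> < \<eta> + w" using x1 by (auto simp: x1_def abs_less_iff)
    show "\<eta> + w < P (- \<sigma>) (\<eta> + pi)" "P (- \<sigma>) (\<eta> + pi) < \<eta> - w + 2 * pi" using x2 by (auto simp: x2_def)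
    show "t = P \<sigma> \<eta>" if t: "t \<in> {\<eta> - w..\<eta> + w}" "F1 \<sigma> \<eta> t = 0" for t
      using \<sigma> t(2)
    proof (cases rule: critical_cases)
      case (1 n)
      have "\<bar>t - P \<sigma> \<eta>\<bar> < 2 * pi" using t(1) x1 w by (auto simp: x1_def abs_less_iff)
      then have "n = 0" by (intro small) (simp add: 1(1))
      with 1 show ?thesis by simp
    next
      case (2 n)
      with pos[of "t - \<eta>"] t(1) show ?thesis by (auto simp: abs_le_iff)
    qed
    show "t = P (- \<sigma>) (\<eta> + pi)" if t: "t \<in> {\<eta> + w..\<eta> - w + 2 * pi}" "F1 \<sigma> \<eta> t = 0" for t
      using \<sigma> t(2)
    proof (cases rule: critical_cases)
      case (2 n)
      have "\<bar>t - P (- \<sigma>) (\<eta> + pi)\<bar> < 2 * pi" using t(1) x2 w by (auto simp: x2_def abs_less_iff)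
      then have "n = 0" by (intro small) (simp add: 2(1))
      with 2 show ?thesis by simp
    next
      case (1 n)
      with neg[of "t - \<eta>"] t(1) show ?thesis by auto
    qed
  qed
qed

text \<open>A global maximum exists by periodicity and is positive, since the value at t = \<eta>
  is. At a critical point a positive value selects the first family of solutions, which is a single
  point modulo the period.\<close>

lemma F_le_max:
  assumes \<sigma>: "\<bar>\<sigma>\<bar> = 1"
  shows "F \<sigma> \<eta> t \<le> F \<sigma> \<eta> (P \<sigma> \<eta>)"
proof -
  note F_per_int = periodic_of_int[of "F \<sigma> \<eta>" "2 * pi", OF F_per]
  obtain x where x: "x \<in> {\<eta> - 2 * pi..\<eta> + 2 * pi}" "\<And>y. y \<in> {\<eta> - 2 * pi..\<eta> + 2 * pi} \<Longrightarrow> F \<sigma> \<eta> y \<le> F \<sigma> \<eta> x"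
    using continuous_attains_sup[of "{\<eta> - 2 * pi..\<eta> + 2 * pi}" "F \<sigma> \<eta>"] cont_F(1) by auto
  have glob: "F \<sigma> \<eta> y \<le> F \<sigma> \<eta> x" for y
  proof -
    define n where "n = \<lfloor>(y - \<eta>) / (2 * pi)\<rfloor>"
    have "real_of_int n \<le> (y - \<eta>) / (2 * pi)" "(y - \<eta>) / (2 * pi) < real_of_int n + 1" unfolding n_def by linarith+
    then have "real_of_int n * (2 * pi) \<le> y - \<eta>" "y - \<eta> < (real_of_int n + 1) * (2 * pi)" using pi_gt_zero by (auto simp: field_simps)
    then have "y - 2 * pi * real_of_int n \<in> {\<eta> - 2 * pi..\<eta> + 2 * pi}" by (auto simp: algebra_simps)
    from x(2)[OF this] F_per_int[of "y - 2 * pi * real_of_int n" n] show ?thesis by simp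
  qed
  have "F1 \<sigma> \<eta> x = 0" by (rule DERIV_local_max[OF F_deriv zero_less_one]) (use glob in simp)
  have \<sigma>1: "\<sigma> = 1 \<or> \<sigma> = -1" using \<sigma> by (auto simp: abs_if split: if_splits)
  have "F \<sigma> \<eta> \<eta> > 0" using \<sigma>1 c \<rho>_pos[of \<eta>] by (auto simp: F_def)
  with glob[of \<eta>] have "F \<sigma> \<eta> x > 0" by linarith
  then have A: "\<sigma> + c * cos (x - \<eta>) > 0" using \<rho>_pos[of x] by (simp add: F_def zero_less_mult_iff)
  have "F \<sigma> \<eta> x = F \<sigma> \<eta> (P \<sigma> \<eta>)"
    using \<sigma> \<open>F1 \<sigma> \<eta> x = 0\<close>
  proof (cases rule: critical_cases)
    case (1 n)
    then show ?thesis using F_per_int by simp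
  next
    case (2 n)
    with A show ?thesis by simp
  qed
  with glob show ?thesis by simp
qed

text \<open>Equal slopes mean that the boundary points at t and u have the same component d
  orthogonal to the direction \<eta>. Maximality for both orientations gives c |x - y| \<le> \<rho>
  t - \<rho> u for their components x, y along \<eta>, whereas equal d gives |\<rho> t - \<rho> u|
  \<le> |x - y|. As c > 1, the points coincide; the two critical equations then force \<rho>1 =
  0.\<close>

lemma D_plus_minus_distinct:
  assumes "\<rho>1 \<eta> \<noteq> 0"
  shows "D 1 \<eta> \<noteq> D (- 1) \<eta>"
proof
  assume eq: "D 1 \<eta> = D (- 1) \<eta>"
  define t u where "t = P 1 \<eta>" and "u = P (- 1) \<eta>"
  define x y where "x = \<rho> t * cos (t - \<eta>)" and "y = \<rho> u * cos (u - \<eta>)"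
  define d where "d = D 1 \<eta>"
  have d: "\<rho> t * sin (t - \<eta>) = d" "\<rho> u * sin (u - \<eta>) = d" using eq by (auto simp: d_def D_def t_def u_def)
  have r: "(\<rho> t)\<^sup>2 = x\<^sup>2 + d\<^sup>2" "(\<rho> u)\<^sup>2 = y\<^sup>2 + d\<^sup>2"
  proof -
    have gen: "z\<^sup>2 = (z * cos y)\<^sup>2 + (z * sin y)\<^sup>2" for z y :: real
    proof -
      have "(z * cos y)\<^sup>2 + (z * sin y)\<^sup>2 = z\<^sup>2 * ((cos y)\<^sup>2 + (sin y)\<^sup>2)" by (simp only: power_mult_distrib distrib_left)
      then show ?thesis by simp
    qed
    show "(\<rho> t)\<^sup>2 = x\<^sup>2 + d\<^sup>2" using gen[of "\<rho> t" "t - \<eta>"] d(1) by (simp add: x_def)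
    show "(\<rho> u)\<^sup>2 = y\<^sup>2 + d\<^sup>2" using gen[of "\<rho> u" "u - \<eta>"] d(2) by (simp add: y_def)
  qed
  have max: "F 1 \<eta> u \<le> F 1 \<eta> t" "F (- 1) \<eta> t \<le> F (- 1) \<eta> u" unfolding t_def u_def by (rule F_le_max; simp)+
  have m: "\<rho> u + c * y \<le> \<rho> t + c * x" "- \<rho> t + c * x \<le> - \<rho> u + c * y"
    using max unfolding F_def x_def y_def by (simp_all add: algebra_simps)
  have "x = y"
  proof (rule ccontr)
    assume "x \<noteq> y"
    have "c * \<bar>x - y\<bar> \<le> \<rho> t - \<rho> u" using m c by (auto simp: abs_if algebra_simps)
    moreover have "\<bar>x - y\<bar> < c * \<bar>x - y\<bar>" using c \<open>x \<noteq> y\<close> by simp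
    ultimately have lt: "\<bar>x - y\<bar> < \<rho> t - \<rho> u" by linarith
    have "(\<rho> t - \<rho> u) * (\<rho> t + \<rho> u) = (x - y) * (x + y)" using r by (simp add: power2_eq_square algebra_simps)
    also have "\<dots> \<le> \<bar>x - y\<bar> * (\<bar>x\<bar> + \<bar>y\<bar>)" 
      by (rule order_trans[OF abs_ge_self]) (simp add: abs_mult mult_left_mono abs_triangle_ineq)
    also have "\<dots> \<le> \<bar>x - y\<bar> * (\<rho> t + \<rho> u)"
    proof (rule mult_left_mono)
      have "\<bar>x\<bar> \<le> \<rho> t" "\<bar>y\<bar> \<le> \<rho> u"
      proof -
        have "\<bar>x\<bar> \<le> \<bar>\<rho> t\<bar>" "\<bar>y\<bar> \<le> \<bar>\<rho> u\<bar>" unfolding abs_le_square_iff using r by simp_all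
        then show "\<bar>x\<bar> \<le> \<rho> t" "\<bar>y\<bar> \<le> \<rho> u" using \<rho>_pos[of t] \<rho>_pos[of u] by simp_all
      qed
      then show "\<bar>x\<bar> + \<bar>y\<bar> \<le> \<rho> t + \<rho> u" by simp
    qed simp
    finally have "(\<rho> t - \<rho> u) * (\<rho> t + \<rho> u) \<le> \<bar>x - y\<bar> * (\<rho> t + \<rho> u)" .
    then have "\<rho> t - \<rho> u \<le> \<bar>x - y\<bar>" using \<rho>_pos[of t] \<rho>_pos[of u] by (simp add: mult_le_cancel_right)
    with lt show False by (metis not_less)
  qed
  then have "(\<rho> t)\<^sup>2 = (\<rho> u)\<^sup>2" using r by simp
  then have rr: "\<rho> t = \<rho> u" by (rule power2_eq_imp_eq) (simp_all add: \<rho>_pos less_imp_le)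
  have cs: "cos (t - \<eta>) = cos (u - \<eta>)" using \<open>x = y\<close> rr by (simp add: x_def y_def)
  have sn: "sin (t - \<eta>) = sin (u - \<eta>)" using d rr by (metis \<rho>_nz mult_left_cancel)
  have "\<exists>n::int. t - \<eta> = u - \<eta> + 2 * pi * n" by (rule sin_cos_eq_iff[THEN iffD1, OF conjI[OF sn cs]])
  then obtain n :: int where n: "t - \<eta> = u - \<eta> + 2 * pi * n" by (elim exE)
  have "t = u + 2 * pi * real_of_int n" using n by simp
  then have r1: "\<rho>1 t = \<rho>1 u" using periodic_of_int[of \<rho>1 "2 * pi" u n] \<rho>1_per by simp
  have "F1 1 \<eta> t = 0" "F1 (- 1) \<eta> u = 0" using critical_P(1)[of 1 \<eta>] critical_P(1)[of "- 1" \<eta>] unfolding t_def u_def by simp_all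
  \<comment> \<open>The critical equations of the two orientations at one point differ only in the
    summand \<sigma>.\<close>
  then have "\<rho>1 t * (1 + c * cos (t - \<eta>)) = \<rho>1 t * (- 1 + c * cos (t - \<eta>))"
    unfolding F1_def using r1 cs sn rr by simp
  then have "\<rho>1 t = 0" by (simp add: algebra_simps)
  then show False using sgn_P[of 1 \<eta>] assms by (simp add: t_def sgn_zero_iff sgn_if split: if_splits)
qed


section \<open>Slopes near a zero of the radial derivative\<close>

lemma E_fixed: "\<bar>\<sigma>\<bar> = 1 \<Longrightarrow> \<rho>1 z = 0 \<Longrightarrow> E \<sigma> z = z"
  using sgn_T(1)[of \<sigma> z] by (simp add: E_def sgn_zero_iff)

text \<open>With \<eta> = E \<sigma> y this is the limit of D \<sigma> \<eta> / (\<eta> - z) at a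
  fixed direction z, computed as a quotient of two difference quotients in y. At z the refraction
  factor in T1 is 1 + \<sigma> / c.\<close>

lemma slope_limit:
  assumes \<sigma>: "\<bar>\<sigma>\<bar> = 1" and z: "\<rho>1 z = 0"
  shows "((\<lambda>y. \<rho> y * sin (T \<sigma> y) / (E \<sigma> y - z)) \<longlongrightarrow> \<rho> z * (b2 z * (1 + \<sigma> / c)) / (1 - b2 z * (1 + \<sigma> / c))) (at z)"
proof -
  have T0: "T \<sigma> z = 0" using sgn_T(1)[OF \<sigma>, of z] z by (simp add: sgn_zero_iff)
  have "b1 z = 0" "al z = 0" using z by (simp_all add: b1_def al_def)
  then have T1: "T1 \<sigma> z = b2 z * (1 + \<sigma> / c)" by (simp add: T1_def)
  have "((\<lambda>y. \<rho> y * sin (T \<sigma> y)) has_real_derivative \<rho> z * T1 \<sigma> z) (at z)"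
    by (auto intro!: derivative_eq_intros \<rho>_deriv T_deriv simp: T0)
  then have 1: "((\<lambda>y. (\<rho> y * sin (T \<sigma> y)) / (y - z)) \<longlongrightarrow> \<rho> z * T1 \<sigma> z) (at z)"
    by (simp add: has_field_derivative_iff T0)
  have 2: "((\<lambda>y. (E \<sigma> y - z) / (y - z)) \<longlongrightarrow> 1 - T1 \<sigma> z) (at z)"
    using E_deriv[of \<sigma> z] by (simp add: has_field_derivative_iff E_fixed[OF \<sigma> z])
  have "1 - T1 \<sigma> z \<noteq> 0" using T1_less_1[OF \<sigma>, of z] by simp
  from tendsto_divide[OF 1 2 this]
  have "((\<lambda>y. (\<rho> y * sin (T \<sigma> y)) / (y - z) / ((E \<sigma> y - z) / (y - z))) \<longlongrightarrow> \<rho> z * T1 \<sigma> z / (1 - T1 \<sigma> z)) (at z)" .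
  moreover have "\<forall>\<^sub>F y in at z. (\<rho> y * sin (T \<sigma> y)) / (y - z) / ((E \<sigma> y - z) / (y - z)) = \<rho> y * sin (T \<sigma> y) / (E \<sigma> y - z)"
    by (auto simp: eventually_at_filter)
  ultimately have "((\<lambda>y. \<rho> y * sin (T \<sigma> y) / (E \<sigma> y - z)) \<longlongrightarrow> \<rho> z * T1 \<sigma> z / (1 - T1 \<sigma> z)) (at z)"
    by (rule Lim_transform_eventually)
  then show ?thesis unfolding T1 .
qed

text \<open>Both fractions increase strictly with p or m, so the alternatives can only match p with
  p and m with m. Cleared of denominators, an affine equation then holds at two distinct points
  although its slope (r1 + r2) k1 k2 is positive.\<close>

lemma ratio_equations_False:
  fixes k1 k2 r1 r2 p m :: real
  assumes pm: "0 < m" "m < p" and r: "r1 > 0" "r2 > 0" and k: "k1 \<ge> 0" "k2 \<ge> 0" "k1 > 0 \<or> k2 > 0" "k1 * p < 1"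
    and e1: "r1 * (k1 * p) / (1 - k1 * p) = r2 * (k2 * p) / (1 + k2 * p) \<or> r1 * (k1 * p) / (1 - k1 * p) = r2 * (k2 * m) / (1 + k2 * m)"
    and e2: "r1 * (k1 * m) / (1 - k1 * m) = r2 * (k2 * p) / (1 + k2 * p) \<or> r1 * (k1 * m) / (1 - k1 * m) = r2 * (k2 * m) / (1 + k2 * m)"
  shows False
proof -
  have km: "k1 * m < 1" using k pm mult_left_mono[of m p k1] by linarith
  have d: "1 - k1 * p > 0" "1 - k1 * m > 0" "1 + k2 * p > 0" "1 + k2 * m > 0"
    using k km pm by (auto intro!: add_pos_nonneg)
  show False
  proof (cases "k1 = 0")
    case True
    with e1 k pm r d show False by auto
  next
    case False
    then have k1: "k1 > 0" using k by simp
    have Ap: "r1 * (k1 * p) / (1 - k1 * p) > 0" using k1 pm r d by simp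
    have "k2 \<noteq> 0" using e1 Ap by auto
    then have k2: "k2 > 0" using k by simp
    have A: "r1 * (k1 * m) / (1 - k1 * m) < r1 * (k1 * p) / (1 - k1 * p)"
      using k1 pm r d by (simp add: divide_less_eq less_divide_eq pos_less_divide_eq pos_divide_less_eq) (simp add: algebra_simps)
    have B: "r2 * (k2 * m) / (1 + k2 * m) < r2 * (k2 * p) / (1 + k2 * p)"
      using k2 pm r d by (simp add: divide_less_eq less_divide_eq pos_less_divide_eq pos_divide_less_eq) (simp add: algebra_simps)
    have "r1 * (k1 * p) / (1 - k1 * p) = r2 * (k2 * p) / (1 + k2 * p)" "r1 * (k1 * m) / (1 - k1 * m) = r2 * (k2 * m) / (1 + k2 * m)"
      using A B e1 e2 by linarith+
    then have "r1 * (k1 * p) * (1 + k2 * p) = r2 * (k2 * p) * (1 - k1 * p)" "r1 * (k1 * m) * (1 + k2 * m) = r2 * (k2 * m) * (1 - k1 * m)"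
      using d by (simp_all add: frac_eq_eq)
    then have "p * (r1 * k1 * (1 + k2 * p)) = p * (r2 * k2 * (1 - k1 * p))" "m * (r1 * k1 * (1 + k2 * m)) = m * (r2 * k2 * (1 - k1 * m))"
      by (simp_all only: mult_ac)
    then have "r1 * k1 * (1 + k2 * p) = r2 * k2 * (1 - k1 * p)" "r1 * k1 * (1 + k2 * m) = r2 * k2 * (1 - k1 * m)"
      using pm by simp_all
    then have "(r1 * k1 * k2 + r2 * k2 * k1) * (p - m) = 0" by (simp add: algebra_simps)
    moreover have "r1 * k1 * k2 + r2 * k2 * k1 > 0" using r k1 k2 by (intro add_pos_pos mult_pos_pos) auto
    ultimately show False using pm by simp
  qed
qed

text \<open>Under the first alternative \<open>step\<close> contradicts the sign pattern of \<open>\<rho>1\<close>. Under the second one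
  it yields a monotone sequence of active angles with limit a zero of \<open>\<rho>1\<close>, where the two slopes are incompatible.\<close>
theorem no_active_direction:
  assumes zero: "\<And>t. \<rho>1 t = 0 \<longleftrightarrow> \<rho>1 (t + pi) = 0"
    and cond: "(\<forall>t. sgn (\<rho>1 t) = sgn (\<rho>1 (t + pi))) \<or> (\<forall>t. \<rho>1 t = 0 \<longrightarrow> \<bar>\<rho>2 t\<bar> + \<bar>\<rho>2 (t + pi)\<bar> > 0)"
    and Act_pi: "\<And>x. Act (x + pi) \<longleftrightarrow> Act x"
    and step: "\<And>\<sigma> \<eta>. \<bar>\<sigma>\<bar> = 1 \<Longrightarrow> \<rho>1 \<eta> \<noteq> 0 \<Longrightarrow> Act (P \<sigma> \<eta>) \<Longrightarrow>
        \<exists>\<sigma>'. (\<sigma>' = 1 \<or> \<sigma>' = - 1) \<and> D \<sigma>' (\<eta> + pi) = - D \<sigma> \<eta> \<and> Act (P \<sigma>' (\<eta> + pi))"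
    and x: "\<rho>1 x \<noteq> 0"
  shows "\<not> Act x"
proof
  assume Act: "Act x"
  have step': "\<exists>\<sigma>'. (\<sigma>' = 1 \<or> \<sigma>' = - 1) \<and> D \<sigma>' (E \<sigma> y + pi) = - D \<sigma> (E \<sigma> y) \<and> Act (P \<sigma>' (E \<sigma> y + pi))
      \<and> sgn (\<rho>1 (P \<sigma>' (E \<sigma> y + pi))) = - sgn (\<rho>1 y) \<and> sgn (\<rho>1 (E \<sigma> y + pi)) = - sgn (\<rho>1 y) \<and> sgn (\<rho>1 (E \<sigma> y)) = sgn (\<rho>1 y)"
    if \<sigma>: "\<bar>\<sigma>\<bar> = 1" and y: "Act y" "\<rho>1 y \<noteq> 0" for \<sigma> y
  proof -
    have s: "sgn (\<rho>1 (E \<sigma> y)) = sgn (\<rho>1 y)" using sgn_P[OF \<sigma>, of "E \<sigma> y"] \<sigma> by simp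
    then have "\<rho>1 (E \<sigma> y) \<noteq> 0" using y(2) by (metis sgn_zero_iff)
    moreover have "Act (P \<sigma> (E \<sigma> y))" using y(1) \<sigma> by simp
    ultimately obtain \<sigma>' where s': "\<sigma>' = 1 \<or> \<sigma>' = - 1" "D \<sigma>' (E \<sigma> y + pi) = - D \<sigma> (E \<sigma> y)" "Act (P \<sigma>' (E \<sigma> y + pi))"
      using step[OF \<sigma>] by blast
    have \<sigma>': "\<bar>\<sigma>'\<bar> = 1" using s'(1) by auto
    have "sgn (\<rho>1 (E \<sigma> y + pi)) = - sgn (\<rho>1 y)"
      using sgn_D[OF \<sigma>', of "E \<sigma> y + pi"] sgn_D[OF \<sigma>, of "E \<sigma> y"] s'(2) s by (simp add: sgn_minus)
    with s s' sgn_P[OF \<sigma>', of "E \<sigma> y + pi"] show ?thesis by auto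
  qed
  have c1: "continuous_on A \<rho>1" for A using cont_\<rho>1[of A "\<lambda>x. x"] by simp
  \<comment> \<open>Under condition (i) a single link is contradictory: it gives opposite signs of
    \<rho>1 at \<open>E 1 x\<close> and \<open>E 1 x + pi\<close>.\<close>
  have False if "\<forall>t. sgn (\<rho>1 t) = sgn (\<rho>1 (t + pi))"
  proof -
    have "sgn (\<rho>1 (E 1 x + pi)) = - sgn (\<rho>1 x)" "sgn (\<rho>1 (E 1 x)) = sgn (\<rho>1 x)" using step'[OF _ Act x, of 1] by auto
    with that have "sgn (\<rho>1 x) = - sgn (\<rho>1 x)" by metis
    then show False using x by (simp add: sgn_if split: if_splits)
  qed
  with cond have nd: "\<And>t. \<rho>1 t = 0 \<Longrightarrow> \<bar>\<rho>2 t\<bar> + \<bar>\<rho>2 (t + pi)\<bar> > 0" by blast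
  obtain x0 where x0: "Act x0" "\<rho>1 x0 > 0"
  proof (cases "\<rho>1 x > 0")
    case False
    then have "sgn (\<rho>1 x) = - 1" using x by simp
    then obtain \<sigma>' where "Act (P \<sigma>' (E 1 x + pi))" "sgn (\<rho>1 (P \<sigma>' (E 1 x + pi))) = 1" using step'[OF _ Act x, of 1] by auto
    then show thesis by (intro that) (auto simp: sgn_1_pos)
  qed (use Act that in blast)
  have \<rho>1_shift: "\<rho>1 (y - 2 * pi * real k) = \<rho>1 y" for y k
  proof (induction k)
    case (Suc k)
    have "\<rho>1 (y - 2 * pi * real k) = \<rho>1 ((y - 2 * pi * real (Suc k)) + 2 * pi)" by (simp add: algebra_simps)
    then show ?case unfolding \<rho>1_per using Suc by simp
  qed simp
  \<comment> \<open>Its supremum a is the last zero of \<rho>1 before x0; zeros to the left of x0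
    exist by Rolle's theorem and periodicity.\<close>
  define Z where "Z = {z. z \<le> x0 \<and> \<rho>1 z = 0}"
  have "\<exists>z\<in>Z. True"
  proof -
    have "\<exists>z. 0 < z \<and> z < 2 * pi \<and> \<rho>1 z = 0"
    proof -
      have "\<exists>z>0. z < 2 * pi \<and> (\<rho> has_real_derivative 0) (at z)"
        using Rolle[of 0 "2 * pi" \<rho>] \<rho>_per[of 0] \<rho>_deriv cont_\<rho>[of "{0..2*pi}" "\<lambda>x. x"]
        by (auto simp: real_differentiable_def)
      then show ?thesis using \<rho>_deriv DERIV_unique by blast
    qed
    then obtain z where z: "\<rho>1 z = 0" by blast
    obtain k where k: "(z - x0) / (2 * pi) \<le> real k" using real_arch_simple by blast
    then have "z - 2 * pi * real k \<le> x0" using pi_gt_zero by (simp add: field_simps)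
    then have "z - 2 * pi * real k \<in> Z" using z \<rho>1_shift by (simp add: Z_def)
    then show ?thesis by blast
  qed
  then have Zne: "Z \<noteq> {}" by blast
  define a where "a = Sup Z"
  have bdd: "bdd_above Z" unfolding Z_def by (rule bdd_aboveI[of _ x0]) simp
  have "closed Z" unfolding Z_def by (intro closed_Collect_conj closed_Collect_le closed_Collect_eq continuous_intros)
  then have aZ: "a \<in> Z" unfolding a_def by (rule closed_contains_Sup[OF Zne bdd])
  then have a: "\<rho>1 a = 0" "a < x0" using x0(2) by (auto simp: Z_def less_le)
  have api: "\<rho>1 (a + pi) = 0" using zero[of a] a(1) by simp
  have pos: "\<rho>1 y > 0" if y: "a < y" "y \<le> x0" for y
  proof (rule ccontr)
    assume "\<not> \<rho>1 y > 0"
    then have "\<exists>z\<ge>y. z \<le> x0 \<and> \<rho>1 z = 0" using IVT'[of \<rho>1 y 0 x0] x0(2) y c1 by auto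
    then obtain z where "z \<in> Z" "y \<le> z" by (auto simp: Z_def)
    then show False using cSup_upper[OF _ bdd] y(1) unfolding a_def by force
  qed
  \<comment> \<open>From an active y the link in direction \<open>E 1 y + pi\<close> produces an
    active angle; moved back by pi it lies below \<open>E 1 y\<close>, because \<rho>1 is negative
    there, and above a, because a + pi is fixed by P.\<close>
  have "\<exists>X. \<forall>n. (a < X n \<and> X n \<le> x0 \<and> Act (X n)) \<and> X (Suc n) < E 1 (X n)"
  proof (rule dependent_nat_choice)
    show "\<exists>y. a < y \<and> y \<le> x0 \<and> Act y" using x0 a by blast
    fix y and n :: nat assume y: "a < y \<and> y \<le> x0 \<and> Act y"
    then have ry: "\<rho>1 y > 0" using pos by blast
    obtain \<sigma>' where s: "\<sigma>' = 1 \<or> \<sigma>' = - 1" "Act (P \<sigma>' (E 1 y + pi))" "sgn (\<rho>1 (P \<sigma>' (E 1 y + pi))) = - 1"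
      using step'[of 1 y] y ry by auto
    have \<sigma>': "\<bar>\<sigma>'\<bar> = 1" using s(1) by auto
    define w where "w = P \<sigma>' (E 1 y + pi) - pi"
    have "sgn (T \<sigma>' (P \<sigma>' (E 1 y + pi))) = - 1" using sgn_T(1)[OF \<sigma>'] s(3) by simp
    then have w1: "w < E 1 y" using P_minus[OF \<sigma>', of "E 1 y + pi"] unfolding w_def by (simp add: sgn_1_neg)
    have "T 1 y > 0" using sgn_T(1)[of 1 y] ry by (simp add: sgn_1_pos)
    then have "E 1 y < y" by (simp add: E_def)
    moreover have "E 1 y > a" using strict_monoD[OF E_strict_mono[of 1], of a y] y E_fixed[of 1 a] a(1) by simp
    then have "P \<sigma>' (a + pi) < P \<sigma>' (E 1 y + pi)" by (intro P_strict_mono[OF \<sigma>']) simp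
    then have "a < w" using P_fixed[OF \<sigma>' api] by (simp add: w_def)
    moreover have "Act w" using s(2) Act_pi[of w] by (simp add: w_def)
    ultimately show "\<exists>w. (a < w \<and> w \<le> x0 \<and> Act w) \<and> w < E 1 y" using w1 y by (intro exI[of _ w]) auto
  qed
  then obtain X where X: "\<And>n. a < X n" "\<And>n. X n \<le> x0" "\<And>n. Act (X n)" "\<And>n. X (Suc n) < E 1 (X n)" by blast
  have Xpos: "\<rho>1 (X n) > 0" for n using pos X by blast
  have ElX: "E \<sigma> (X n) < X n" if "\<bar>\<sigma>\<bar> = 1" for \<sigma> n
    using sgn_T(1)[OF that, of "X n"] Xpos[of n] by (simp add: E_def sgn_1_pos)
  have dec: "decseq X" by (rule decseq_SucI) (use X(4) ElX[of 1] in \<open>metis abs_one less_imp_le less_trans\<close>)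
  obtain l where l: "X \<longlonglongrightarrow> l" "\<And>n. l \<le> X n"
    using decseq_convergent[OF dec, of a] X(1) less_imp_le by metis
  have la: "a \<le> l" by (rule LIMSEQ_le_const[OF l(1)]) (use X(1) less_imp_le in blast)
  have lx0: "l \<le> x0" using l(2)[of 0] X(2)[of 0] by simp
  have isE: "isCont (E \<sigma>) y" for \<sigma> y using DERIV_isCont[OF E_deriv] .
  \<comment> \<open>Passing to the limit in X (Suc n) < E 1 (X n) gives T 1 l \<le> 0, and T 1 is
    positive on (a, x0].\<close>
  have "l \<le> E 1 l"
  proof (rule LIMSEQ_le[OF LIMSEQ_Suc[OF l(1)] isCont_tendsto_compose[OF isE l(1)]])
    show "\<exists>N. \<forall>n\<ge>N. X (Suc n) \<le> E 1 (X n)" using X(4) less_imp_le by blast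
  qed
  then have "T 1 l \<le> 0" by (simp add: E_def)
  then have "l = a" using pos[of l] la lx0 sgn_T(1)[of 1 l] by (cases "a < l") (auto simp: sgn_1_pos)
  with l have Xa: "X \<longlonglongrightarrow> a" by simp
  have Xat: "filterlim X (at a) sequentially"
    unfolding filterlim_at using Xa X(1) by (auto intro!: always_eventually simp: less_imp_neq[symmetric])
  \<comment> \<open>Limits of difference quotients of \<rho>1 from the right: \<rho>1 is positive
    along X, and negative along \<open>E 1 (X n) + pi\<close>, which settles the sign of \<rho>2 at
    a here and at a + pi below.\<close>
  have k1: "\<rho>2 a \<ge> 0"
  proof (rule tendsto_lowerbound)
    have "((\<lambda>y. (\<rho>1 y - \<rho>1 a) / (y - a)) \<longlongrightarrow> \<rho>2 a) (at a)" using \<rho>1_deriv[of a] by (simp add: has_field_derivative_iff)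
    from filterlim_compose[OF this Xat] show "(\<lambda>n. (\<rho>1 (X n) - \<rho>1 a) / (X n - a)) \<longlonglongrightarrow> \<rho>2 a" .
    show "\<forall>\<^sub>F n in sequentially. 0 \<le> (\<rho>1 (X n) - \<rho>1 a) / (X n - a)"
      using Xpos X(1) a(1) by (auto intro!: always_eventually simp: less_imp_le)
  qed simp
  have eta: "a < E \<sigma> (X n)" if "\<bar>\<sigma>\<bar> = 1" for \<sigma> n
    using strict_monoD[OF E_strict_mono[OF that] X(1)[of n]] E_fixed[OF that a(1)] by simp
  have etalim: "(\<lambda>n. E \<sigma> (X n)) \<longlonglongrightarrow> a" if "\<bar>\<sigma>\<bar> = 1" for \<sigma>
    using isCont_tendsto_compose[OF DERIV_isCont[OF E_deriv[of \<sigma> a]] Xa] E_fixed[OF that a(1)] by simp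
  have k2: "\<rho>2 (a + pi) \<le> 0"
  proof (rule tendsto_upperbound)
    have at: "filterlim (\<lambda>n. E 1 (X n) + pi) (at (a + pi)) sequentially"
      unfolding filterlim_at using tendsto_add[OF etalim[of 1] tendsto_const[of pi]] eta[of 1]
      by (auto intro!: always_eventually simp: less_imp_neq[symmetric])
    have "((\<lambda>y. (\<rho>1 y - \<rho>1 (a + pi)) / (y - (a + pi))) \<longlongrightarrow> \<rho>2 (a + pi)) (at (a + pi))"
      using \<rho>1_deriv[of "a + pi"] by (simp add: has_field_derivative_iff)
    from filterlim_compose[OF this at]
    show "(\<lambda>n. (\<rho>1 (E 1 (X n) + pi) - \<rho>1 (a + pi)) / (E 1 (X n) + pi - (a + pi))) \<longlonglongrightarrow> \<rho>2 (a + pi)" .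
    have "\<rho>1 (E 1 (X n) + pi) < 0" for n
    proof -
      have "sgn (\<rho>1 (E 1 (X n) + pi)) = - 1" using step'[of 1 "X n"] X(3)[of n] Xpos[of n] by auto
      then show ?thesis by (simp add: sgn_1_neg)
    qed
    then show "\<forall>\<^sub>F n in sequentially. (\<rho>1 (E 1 (X n) + pi) - \<rho>1 (a + pi)) / (E 1 (X n) + pi - (a + pi)) \<le> 0"
      using eta[of 1] api by (auto intro!: always_eventually divide_nonpos_pos simp: less_imp_le)
  qed simp
  define A where "A \<sigma> = \<rho> a * (b2 a * (1 + \<sigma> / c)) / (1 - b2 a * (1 + \<sigma> / c))" for \<sigma>
  define B where "B \<sigma> = \<rho> (a + pi) * (b2 (a + pi) * (1 + \<sigma> / c)) / (1 - b2 (a + pi) * (1 + \<sigma> / c))" for \<sigma>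
  \<comment> \<open>The orientation supplied by the link may vary with n. The product of the two
    possible equations vanishes for every n, which spares the passage to a subsequence.\<close>
  have AB: "A \<sigma> = - B 1 \<or> A \<sigma> = - B (- 1)" if \<sigma>: "\<bar>\<sigma>\<bar> = 1" for \<sigma>
  proof -
    define u where "u n = D \<sigma> (E \<sigma> (X n)) / (E \<sigma> (X n) - a)" for n
    define v where "v \<tau> n = D \<tau> (E \<sigma> (X n) + pi) / (E \<sigma> (X n) - a)" for \<tau> n
    have "u \<longlonglongrightarrow> A \<sigma>"
    proof -
      have "u n = \<rho> (X n) * sin (T \<sigma> (X n)) / (E \<sigma> (X n) - a)" for n
        unfolding u_def D_def using P_E[OF \<sigma>] by (simp add: E_def)
      then show ?thesis using filterlim_compose[OF slope_limit[OF \<sigma> a(1)] Xat] unfolding A_def by presburger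
    qed
    moreover have "v \<tau> \<longlonglongrightarrow> B \<tau>" if \<tau>: "\<bar>\<tau>\<bar> = 1" for \<tau>
    proof -
      define y where "y n = P \<tau> (E \<sigma> (X n) + pi)" for n
      have "isCont (P \<tau>) z" for z using DERIV_isCont[OF P_deriv[OF \<tau>]] .
      from isCont_tendsto_compose[OF this[of "a + pi"] tendsto_add[OF etalim[OF \<sigma>] tendsto_const]]
      have ylim: "y \<longlonglongrightarrow> a + pi" unfolding P_fixed[OF \<tau> api] y_def[abs_def] .
      have "a + pi < y n" for n
        using P_strict_mono[OF \<tau>, of "a + pi" "E \<sigma> (X n) + pi"] eta[OF \<sigma>, of n] P_fixed[OF \<tau> api] by (simp add: y_def)
      then have yat: "filterlim y (at (a + pi)) sequentially"
        unfolding filterlim_at using ylim by (auto intro!: always_eventually simp: less_imp_neq[symmetric])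
      have "v \<tau> n = \<rho> (y n) * sin (T \<tau> (y n)) / (E \<tau> (y n) - (a + pi))" for n
        unfolding v_def D_def y_def using E_P[OF \<tau>] P_minus[OF \<tau>] by simp
      then show ?thesis using filterlim_compose[OF slope_limit[OF \<tau> api] yat] unfolding B_def by presburger
    qed
    from this[of 1] this[of "- 1"] have "v 1 \<longlonglongrightarrow> B 1" "v (- 1) \<longlonglongrightarrow> B (- 1)" by simp_all
    ultimately have "(\<lambda>n. (u n + v 1 n) * (u n + v (- 1) n)) \<longlonglongrightarrow> (A \<sigma> + B 1) * (A \<sigma> + B (- 1))"
      by (intro tendsto_intros)
    moreover have "(u n + v 1 n) * (u n + v (- 1) n) = 0" for n
    proof -
      obtain \<sigma>' where "\<sigma>' = 1 \<or> \<sigma>' = - 1" "D \<sigma>' (E \<sigma> (X n) + pi) = - D \<sigma> (E \<sigma> (X n))"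
        using step'[OF \<sigma> X(3)[of n]] Xpos[of n] by auto
      then show ?thesis by (auto simp: u_def v_def)
    qed
    ultimately have "(A \<sigma> + B 1) * (A \<sigma> + B (- 1)) = 0" by (simp add: LIMSEQ_const_iff)
    then show ?thesis by (auto simp: add_eq_0_iff)
  qed
  \<comment> \<open>After the change of sign at a + pi both numbers are nonnegative, and condition
    (ii) makes one of them positive; the factors 1 + 1 / c and 1 - 1 / c of the two orientations
    serve as p and m.\<close>
  define q1 q2 where "q1 = b2 a" and "q2 = - b2 (a + pi)"
  have q: "q1 = \<rho>2 a / \<rho> a" "q2 = - \<rho>2 (a + pi) / \<rho> (a + pi)" using a(1) api by (simp_all add: q1_def q2_def b2_def)
  have B': "- B \<sigma> = \<rho> (a + pi) * (q2 * (1 + \<sigma> / c)) / (1 + q2 * (1 + \<sigma> / c))" for \<sigma>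
    unfolding B_def q2_def by simp
  have A': "A \<sigma> = \<rho> a * (q1 * (1 + \<sigma> / c)) / (1 - q1 * (1 + \<sigma> / c))" for \<sigma>
    unfolding A_def q1_def ..
  show False
  proof (rule ratio_equations_False)
    show "0 < 1 + (- 1) / c" "1 + (- 1) / c < 1 + 1 / c" using c by (auto simp: field_simps)
    show "\<rho> a > 0" "\<rho> (a + pi) > 0" by (rule \<rho>_pos)+
    show "q1 \<ge> 0" "q2 \<ge> 0" using k1 k2 \<rho>_pos[of a] \<rho>_pos[of "a + pi"] unfolding q by (simp_all add: divide_nonpos_pos)
    show "q1 > 0 \<or> q2 > 0"
    proof (cases "\<rho>2 a = 0")
      case True
      then have "\<rho>2 (a + pi) < 0" using nd[OF a(1)] k2 by auto
      then show ?thesis using \<rho>_pos[of "a + pi"] unfolding q by (simp add: divide_neg_pos)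
    next
      case False
      then show ?thesis using k1 \<rho>_pos[of a] unfolding q by simp
    qed
    have "q1 < c / (1 + c)" using adm[of a] by (simp add: q1_def b2_def)
    moreover have "0 < 1 + 1 / c" using c by (simp add: add_pos_pos)
    ultimately have "q1 * (1 + 1 / c) < c / (1 + c) * (1 + 1 / c)" by (rule mult_strict_right_mono)
    moreover have e: "1 + 1 / c = (1 + c) / c" using c by (simp add: field_simps)
    have "c / (1 + c) * (1 + 1 / c) = 1" unfolding e using c by simp
    ultimately show "q1 * (1 + 1 / c) < 1" by (simp only:)
    show "\<rho> a * (q1 * (1 + 1 / c)) / (1 - q1 * (1 + 1 / c)) = \<rho> (a + pi) * (q2 * (1 + 1 / c)) / (1 + q2 * (1 + 1 / c)) \<or>
        \<rho> a * (q1 * (1 + 1 / c)) / (1 - q1 * (1 + 1 / c)) = \<rho> (a + pi) * (q2 * (1 + - 1 / c)) / (1 + q2 * (1 + - 1 / c))"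
      using AB[of 1] unfolding B' A' by simp
    show "\<rho> a * (q1 * (1 + - 1 / c)) / (1 - q1 * (1 + - 1 / c)) = \<rho> (a + pi) * (q2 * (1 + 1 / c)) / (1 + q2 * (1 + 1 / c)) \<or>
        \<rho> a * (q1 * (1 + - 1 / c)) / (1 - q1 * (1 + - 1 / c)) = \<rho> (a + pi) * (q2 * (1 + - 1 / c)) / (1 + q2 * (1 + - 1 / c))"
      using AB[of "- 1"] unfolding B' A' by simp
  qed
qed

end

section \<open>Smooth functions and integration by parts\<close>

text \<open>\<open>flat 0\<close> is the standard smooth function that vanishes on the left
  half-line. The powers in the denominator are included so that the family is closed under
  differentiation up to linear combinations.\<close>

definition flat :: "nat \<Rightarrow> real \<Rightarrow> real" where
  "flat n t = (if t > 0 then exp (- 1 / t) / t ^ n else 0)"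

lemma flat_tendsto_0: "(flat n \<longlongrightarrow> 0) (at 0)"
proof -
  have "((\<lambda>t::real. (1 / t) ^ n / exp (1 / t)) \<longlongrightarrow> 0) (at_right 0)"
    using filterlim_compose[OF tendsto_power_div_exp_0[of n] filterlim_inverse_at_top_right] by (simp add: inverse_eq_divide)
  moreover have "\<forall>\<^sub>F t in at_right 0. (1 / t) ^ n / exp (1 / t) = flat n t"
    by (rule eventually_at_right_less[THEN eventually_mono]) (simp add: flat_def exp_minus divide_inverse power_inverse mult.commute)
  ultimately have r: "(flat n \<longlongrightarrow> 0) (at_right 0)" by (rule Lim_transform_eventually)
  have "\<forall>\<^sub>F t in at_left 0. flat n t = 0"
    by (simp add: eventually_at_filter flat_def)
  then have "(flat n \<longlongrightarrow> 0) (at_left 0)" by (rule tendsto_eventually)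
  with r show ?thesis by (simp add: filterlim_at_split)
qed

lemma flat_deriv: "(flat n has_real_derivative (flat (n + 2) t - real n * flat (n + 1) t)) (at t)"
proof (cases t "0::real" rule: linorder_cases)
  case less
  have "((\<lambda>t. 0) has_real_derivative 0) (at t)" by simp
  then have "(flat n has_real_derivative 0) (at t)"
    by (rule has_field_derivative_transform_within_open[where S = "{..<0}"]) (use less in \<open>auto simp: flat_def\<close>)
  then show ?thesis using less by (simp add: flat_def)
next
  case equal
  have "((\<lambda>h. (flat n (0 + h) - flat n 0) / h) \<longlongrightarrow> 0) (at 0)"
  proof (rule Lim_transform_eventually[OF flat_tendsto_0[of "n + 1"]])
    show "\<forall>\<^sub>F h in at 0. flat (n + 1) h = (flat n (0 + h) - flat n 0) / h"
      by (auto simp: eventually_at_filter flat_def)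
  qed
  then have "(flat n has_real_derivative 0) (at 0)" by (simp add: DERIV_def)
  then show ?thesis using equal by (simp add: flat_def)
next
  case greater
  have "((\<lambda>t. exp (- 1 / t) / t ^ n) has_real_derivative
      (exp (- 1 / t) * (1 / t\<^sup>2) * t ^ n - exp (- 1 / t) * (real n * t ^ (n - 1))) / (t ^ n * t ^ n)) (at t)"
    using greater by (auto intro!: derivative_eq_intros simp: power2_eq_square)
  also have "(exp (- 1 / t) * (1 / t\<^sup>2) * t ^ n - exp (- 1 / t) * (real n * t ^ (n - 1))) / (t ^ n * t ^ n)
      = flat (n + 2) t - real n * flat (n + 1) t"
    using greater by (cases n) (simp_all add: flat_def power2_eq_square field_simps)
  finally show ?thesis
    by (rule has_field_derivative_transform_within_open[where S = "{0<..}"]) (use greater in \<open>auto simp: flat_def\<close>)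
qed

lemma flat_nonneg: "flat n t \<ge> 0" by (simp add: flat_def)
lemma flat_pos: "t > 0 \<Longrightarrow> flat n t > 0" by (simp add: flat_def)

lemma plane_wave_has_derivative:
  fixes v :: "real^2"
  shows "((\<lambda>x. expi (v \<bullet> x)) has_derivative (\<lambda>h. \<Sum>i\<in>UNIV. complex_of_real (h $ i) * ((\<i> * complex_of_real (v $ i)) * expi (v \<bullet> x)))) (at x)"
proof -
  have "((\<lambda>x. \<i> * complex_of_real (v \<bullet> x)) has_derivative (\<lambda>h. \<i> * complex_of_real (v \<bullet> h))) (at x)"
    by (auto intro!: derivative_eq_intros)
  from has_derivative_compose[OF this, of exp "(*) (expi (v \<bullet> x))"]
  have "((\<lambda>x. expi (v \<bullet> x)) has_derivative (\<lambda>h. expi (v \<bullet> x) * (\<i> * complex_of_real (v \<bullet> h)))) (at x)"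
    using DERIV_exp[of "\<i> * complex_of_real (v \<bullet> x)"] by (simp add: has_field_derivative_def)
  then show ?thesis
    by (rule has_derivative_eq_rhs) (auto simp: fun_eq_iff inner_vec_def sum_2 algebra_simps)
qed

text \<open>An algebra of functions containing plane waves and a cutoff that is closed under partial
  derivatives, hence consists of smooth functions. Here \<open>a < b\<close> are the squared radii of the cutoff.\<close>
inductive_set smooth_alg :: "real \<Rightarrow> real \<Rightarrow> (real^2 \<Rightarrow> complex) set" for a b where
  const: "(\<lambda>x. k) \<in> smooth_alg a b"
| coord: "(\<lambda>x. complex_of_real (x $ i)) \<in> smooth_alg a b"
| wave: "(\<lambda>x. expi (v \<bullet> x)) \<in> smooth_alg a b"
| upper: "(\<lambda>x. complex_of_real (flat n (b - x \<bullet> x))) \<in> smooth_alg a b"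
| lower: "(\<lambda>x. complex_of_real (flat n (x \<bullet> x - a))) \<in> smooth_alg a b"
| inv: "(\<lambda>x. complex_of_real (1 / (flat 0 (b - x \<bullet> x) + flat 0 (x \<bullet> x - a)))) \<in> smooth_alg a b"
| add: "f \<in> smooth_alg a b \<Longrightarrow> g \<in> smooth_alg a b \<Longrightarrow> (\<lambda>x. f x + g x) \<in> smooth_alg a b"
| mult: "f \<in> smooth_alg a b \<Longrightarrow> g \<in> smooth_alg a b \<Longrightarrow> (\<lambda>x. f x * g x) \<in> smooth_alg a b"

text \<open>Requiring the partial derivatives to stay in the algebra is what lets one induction
  yield derivatives of every order.\<close>

definition smooth_grad :: "real \<Rightarrow> real \<Rightarrow> (real^2 \<Rightarrow> complex) \<Rightarrow> (2 \<Rightarrow> real^2 \<Rightarrow> complex) \<Rightarrow> bool" where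
  "smooth_grad a b f g \<longleftrightarrow> (\<forall>i. g i \<in> smooth_alg a b) \<and>
     (\<forall>x. (f has_derivative (\<lambda>h. \<Sum>i\<in>UNIV. complex_of_real (h $ i) * g i x)) (at x))"

lemma smooth_grad_radial:
  assumes F: "\<And>t. (F has_real_derivative F' t) (at t)"
    and F': "(\<lambda>x. complex_of_real (F' (x \<bullet> x))) \<in> smooth_alg a b"
  shows "smooth_grad a b (\<lambda>x. complex_of_real (F (x \<bullet> x))) (\<lambda>i x. (2 * complex_of_real (x $ i)) * complex_of_real (F' (x \<bullet> x)))"
  unfolding smooth_grad_def
proof (intro conjI allI)
  show "(\<lambda>x. (2 * complex_of_real (x $ i)) * complex_of_real (F' (x \<bullet> x))) \<in> smooth_alg a b" for i
    by (intro smooth_alg.mult F' smooth_alg.const smooth_alg.coord)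
  fix x :: "real^2"
  have 1: "((\<lambda>x::real^2. x \<bullet> x) has_derivative (\<lambda>h. 2 * (x \<bullet> h))) (at x)"
    by (auto intro!: derivative_eq_intros simp: inner_commute)
  have "((\<lambda>x. F (x \<bullet> x)) has_derivative (\<lambda>h. F' (x \<bullet> x) * (2 * (x \<bullet> h)))) (at x)"
    using has_derivative_compose[OF 1, of F "(*) (F' (x \<bullet> x))"] F[of "x \<bullet> x"]
    by (simp add: has_field_derivative_def)
  from has_derivative_of_real[OF this]
  show "((\<lambda>x. complex_of_real (F (x \<bullet> x))) has_derivative
      (\<lambda>h. \<Sum>i\<in>UNIV. complex_of_real (h $ i) * ((2 * complex_of_real (x $ i)) * complex_of_real (F' (x \<bullet> x))))) (at x)"
    by (rule has_derivative_eq_rhs) (auto simp: fun_eq_iff inner_vec_def sum_2 algebra_simps)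
qed

lemma smooth_alg_scale: "f \<in> smooth_alg a b \<Longrightarrow> (\<lambda>x. k * f x) \<in> smooth_alg a b"
  by (rule smooth_alg.mult[OF smooth_alg.const])

lemma smooth_alg_has_grad:
  assumes ab: "a < b" and "f \<in> smooth_alg a b"
  shows "\<exists>g. smooth_grad a b f g"
  using assms(2)
proof induction
  case (const k)
  have "smooth_grad a b (\<lambda>x. k) (\<lambda>i x. 0)" unfolding smooth_grad_def by (auto intro: smooth_alg.const)
  then show ?case by - (rule exI)
next
  case (coord j)
  have "smooth_grad a b (\<lambda>x. complex_of_real (x $ j)) (\<lambda>i x. if i = j then 1 else 0)"
    unfolding smooth_grad_def
  proof (intro conjI allI)
    show "(\<lambda>x. if i = j then 1 else 0) \<in> smooth_alg a b" for i by (rule smooth_alg.const)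
    fix x :: "real^2"
    have "((\<lambda>x. complex_of_real (x $ j)) has_derivative (\<lambda>h. complex_of_real (h $ j))) (at x)"
      by (intro has_derivative_of_real bounded_linear_imp_has_derivative bounded_linear_vec_nth)
    then show "((\<lambda>x. complex_of_real (x $ j)) has_derivative (\<lambda>h. \<Sum>i\<in>UNIV. complex_of_real (h $ i) * (if i = j then 1 else 0))) (at x)"
      by (rule has_derivative_eq_rhs) (auto simp: fun_eq_iff if_distrib cong: if_cong)
  qed
  then show ?case by - (rule exI)
next
  case (wave v)
  have "smooth_grad a b (\<lambda>x. expi (v \<bullet> x)) (\<lambda>i x. (\<i> * complex_of_real (v $ i)) * expi (v \<bullet> x))"
    unfolding smooth_grad_def
  proof (intro conjI allI)
    show "(\<lambda>x. (\<i> * complex_of_real (v $ i)) * expi (v \<bullet> x)) \<in> smooth_alg a b" for i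
      by (intro smooth_alg.mult smooth_alg.const smooth_alg.wave)
    fix x :: "real^2"
    show "((\<lambda>x. expi (v \<bullet> x)) has_derivative (\<lambda>h. \<Sum>i\<in>UNIV. complex_of_real (h $ i) * ((\<i> * complex_of_real (v $ i)) * expi (v \<bullet> x)))) (at x)"
      by (rule plane_wave_has_derivative)
  qed
  then show ?case by - (rule exI)
next
  case (upper n)
  have "((\<lambda>t. flat n (b - t)) has_real_derivative - (flat (n + 2) (b - t) - real n * flat (n + 1) (b - t))) (at t)" for t
  proof -
    have "((\<lambda>t. b - t) has_real_derivative - 1) (at t)" by (auto intro!: derivative_eq_intros)
    from DERIV_chain2[OF flat_deriv this] show ?thesis by simp
  qed
  then have "smooth_grad a b (\<lambda>x. complex_of_real ((\<lambda>t. flat n (b - t)) (x \<bullet> x)))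
      (\<lambda>i x. (2 * complex_of_real (x $ i)) * complex_of_real ((\<lambda>t. - (flat (n + 2) (b - t) - real n * flat (n + 1) (b - t))) (x \<bullet> x)))"
  proof (rule smooth_grad_radial)
    have "(\<lambda>x. (- 1) * complex_of_real (flat (n + 2) (b - x \<bullet> x)) + complex_of_real (real n) * complex_of_real (flat (n + 1) (b - x \<bullet> x))) \<in> smooth_alg a b"
      by (intro smooth_alg.add smooth_alg_scale smooth_alg.upper)
    then show "(\<lambda>x. complex_of_real ((\<lambda>t. - (flat (n + 2) (b - t) - real n * flat (n + 1) (b - t))) (x \<bullet> x))) \<in> smooth_alg a b"
      by (simp add: algebra_simps)
  qed
  then show ?case by - (rule exI)
next
  case (lower n)
  have "((\<lambda>t. flat n (t - a)) has_real_derivative (flat (n + 2) (t - a) - real n * flat (n + 1) (t - a))) (at t)" for t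
  proof -
    have "((\<lambda>t. t - a) has_real_derivative 1) (at t)" by (auto intro!: derivative_eq_intros)
    from DERIV_chain2[OF flat_deriv this] show ?thesis by simp
  qed
  then have "smooth_grad a b (\<lambda>x. complex_of_real ((\<lambda>t. flat n (t - a)) (x \<bullet> x)))
      (\<lambda>i x. (2 * complex_of_real (x $ i)) * complex_of_real ((\<lambda>t. flat (n + 2) (t - a) - real n * flat (n + 1) (t - a)) (x \<bullet> x)))"
  proof (rule smooth_grad_radial)
    have "(\<lambda>x. complex_of_real (flat (n + 2) (x \<bullet> x - a)) + complex_of_real (- real n) * complex_of_real (flat (n + 1) (x \<bullet> x - a))) \<in> smooth_alg a b"
      by (intro smooth_alg.add smooth_alg_scale smooth_alg.lower)
    then show "(\<lambda>x. complex_of_real ((\<lambda>t. flat (n + 2) (t - a) - real n * flat (n + 1) (t - a)) (x \<bullet> x))) \<in> smooth_alg a b"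
      by (simp add: algebra_simps)
  qed
  then show ?case by - (rule exI)
next
  case inv
  define w where "w t = flat 0 (b - t) + flat 0 (t - a)" for t
  define w' where "w' t = - flat 2 (b - t) + flat 2 (t - a)" for t
  \<comment> \<open>a < b makes the half-lines t < b and t > a cover all values, so one of the two
    summands is positive.\<close>
  have w: "w t > 0" for t
  proof (cases "t < b")
    case True
    then show ?thesis using flat_pos[of "b - t" 0] flat_nonneg[of 0 "t - a"] by (simp add: w_def add_pos_nonneg)
  next
    case False
    then show ?thesis using flat_pos[of "t - a" 0] flat_nonneg[of 0 "b - t"] ab by (simp add: w_def add_nonneg_pos)
  qed
  have f0: "(flat 0 has_real_derivative flat 2 t) (at t)" for t using flat_deriv[of 0 t] by (simp add: numeral_2_eq_2)
  have dw: "(w has_real_derivative w' t) (at t)" for t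
  proof -
    have 1: "((\<lambda>t. b - t) has_real_derivative - 1) (at t)" "((\<lambda>t. t - a) has_real_derivative 1) (at t)"
      by (auto intro!: derivative_eq_intros)
    from DERIV_add[OF DERIV_chain2[OF f0 1(1)] DERIV_chain2[OF f0 1(2)]]
    show ?thesis by (simp add: w_def[abs_def] w'_def)
  qed
  have "((\<lambda>t. 1 / w t) has_real_derivative - w' t * (1 / w t * (1 / w t))) (at t)" for t
    using w[of t] by (auto intro!: derivative_eq_intros dw)
  then have "smooth_grad a b (\<lambda>x. complex_of_real ((\<lambda>t. 1 / w t) (x \<bullet> x)))
      (\<lambda>i x. (2 * complex_of_real (x $ i)) * complex_of_real ((\<lambda>t. - w' t * (1 / w t * (1 / w t))) (x \<bullet> x)))"
  proof (rule smooth_grad_radial)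
    have i: "(\<lambda>x. complex_of_real (1 / w (x \<bullet> x))) \<in> smooth_alg a b" unfolding w_def by (rule smooth_alg.inv)
    have "(\<lambda>x. (complex_of_real (flat 2 (b - x \<bullet> x)) + (- 1) * complex_of_real (flat 2 (x \<bullet> x - a))) * (complex_of_real (1 / w (x \<bullet> x)) * complex_of_real (1 / w (x \<bullet> x)))) \<in> smooth_alg a b"
      by (intro smooth_alg.add smooth_alg.mult i smooth_alg_scale smooth_alg.lower smooth_alg.upper)
    then show "(\<lambda>x. complex_of_real ((\<lambda>t. - w' t * (1 / w t * (1 / w t))) (x \<bullet> x))) \<in> smooth_alg a b"
      by (simp add: w'_def)
  qed
  then show ?case unfolding w_def by - (rule exI)
next
  case (add f g)
  then obtain f' g' where "smooth_grad a b f f'" "smooth_grad a b g g'" by blast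
  then have "smooth_grad a b (\<lambda>x. f x + g x) (\<lambda>i x. f' i x + g' i x)"
    unfolding smooth_grad_def
    by (auto intro!: smooth_alg.add has_derivative_eq_rhs[OF has_derivative_add] simp: fun_eq_iff sum_2 algebra_simps)
  then show ?case by - (rule exI)
next
  case (mult f g)
  then obtain f' g' where fg: "smooth_grad a b f f'" "smooth_grad a b g g'" by blast
  have "smooth_grad a b (\<lambda>x. f x * g x) (\<lambda>i x. f x * g' i x + f' i x * g x)"
    unfolding smooth_grad_def
  proof (intro conjI allI)
    show "(\<lambda>x. f x * g' i x + f' i x * g x) \<in> smooth_alg a b" for i
      using fg mult.hyps unfolding smooth_grad_def by (intro smooth_alg.add smooth_alg.mult) auto
    fix x
    have "(f has_derivative (\<lambda>h. \<Sum>i\<in>UNIV. complex_of_real (h $ i) * f' i x)) (at x)"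
      "(g has_derivative (\<lambda>h. \<Sum>i\<in>UNIV. complex_of_real (h $ i) * g' i x)) (at x)"
      using fg unfolding smooth_grad_def by auto
    from has_derivative_mult[OF this]
    show "((\<lambda>x. f x * g x) has_derivative (\<lambda>h. \<Sum>i\<in>UNIV. complex_of_real (h $ i) * (f x * g' i x + f' i x * g x))) (at x)"
      by (rule has_derivative_eq_rhs) (auto simp: fun_eq_iff sum_2 algebra_simps)
  qed
  then show ?case by - (rule exI)
qed

lemma has_derivative_imp_pd:
  assumes "(f has_derivative (\<lambda>h. \<Sum>i\<in>UNIV. complex_of_real (h $ i) * g i)) (at x)"
  shows "pd j f x = g j"
proof -
  have "frechet_derivative f (at x) = (\<lambda>h. \<Sum>i\<in>UNIV. complex_of_real (h $ i) * g i)"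
    using frechet_derivative_at[OF assms] by simp
  then have "pd j f x = (\<Sum>i\<in>UNIV. complex_of_real (axis j 1 $ i) * g i)" by (simp add: pd_def)
  also have "\<dots> = (\<Sum>i\<in>UNIV. if i = j then g i else 0)" by (rule sum.cong) (auto simp: axis_def)
  finally show ?thesis by simp
qed

lemma smooth_alg_smooth:
  assumes ab: "a < b" and f: "f \<in> smooth_alg a b"
  shows "iter_pd is f \<in> smooth_alg a b" "smooth_fun f"
proof -
  have pd: "pd j f \<in> smooth_alg a b \<and> f differentiable (at x)" if f: "f \<in> smooth_alg a b" for f j x
  proof -
    obtain g where g: "smooth_grad a b f g" using smooth_alg_has_grad[OF ab f] ..
    then have "pd j f = g j" unfolding smooth_grad_def by (intro ext has_derivative_imp_pd) auto
    with g show ?thesis unfolding smooth_grad_def differentiable_def by auto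
  qed
  show *: "iter_pd is f \<in> smooth_alg a b" for "is"
    by (induction "is") (use f pd in auto)
  then show "smooth_fun f" unfolding smooth_fun_def using pd by blast
qed

section \<open>Cutoffs, test functions and partial derivatives\<close>

text \<open>Equal to 1 for \<open>x \<bullet> x \<le> a\<close> and to 0 for
  \<open>x \<bullet> x \<ge> b\<close>. The quotient is written as a product of two generators of
  the algebra.\<close>

definition cutoff :: "real \<Rightarrow> real \<Rightarrow> real^2 \<Rightarrow> complex" where
  "cutoff a b x = complex_of_real (flat 0 (b - x \<bullet> x)) * complex_of_real (1 / (flat 0 (b - x \<bullet> x) + flat 0 (x \<bullet> x - a)))"

lemma cutoff_in: "cutoff a b \<in> smooth_alg a b"
  unfolding cutoff_def[abs_def] by (intro smooth_alg.intros)

lemma cutoff_eq_1: "x \<bullet> x \<le> a \<Longrightarrow> a < b \<Longrightarrow> cutoff a b x = 1"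
  using flat_pos[of "b - x \<bullet> x" 0] unfolding cutoff_def
  by (simp add: flat_def[of 0 "x \<bullet> x - a"])

lemma cutoff_eq_0: "x \<bullet> x \<ge> b \<Longrightarrow> cutoff a b x = 0"
  by (simp add: cutoff_def flat_def)

text \<open>The weak Neumann condition admits only compactly supported test functions on the plane;
  a plane wave has to be cut off before it can be inserted.\<close>

lemma test_fun_cutoff_wave:
  assumes "a < b"
  shows "test_fun UNIV (\<lambda>x. cutoff a b x * expi (v \<bullet> x))"
proof -
  let ?f = "\<lambda>x. cutoff a b x * expi (v \<bullet> x)"
  have "?f \<in> smooth_alg a b" by (intro smooth_alg.mult smooth_alg.wave cutoff_in)
  then have "smooth_fun ?f" by (rule smooth_alg_smooth(2)[OF assms])
  moreover have "{x. ?f x \<noteq> 0} \<subseteq> cball 0 (sqrt b)"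
  proof
    fix x assume "x \<in> {x. ?f x \<noteq> 0}"
    then have "cutoff a b x \<noteq> 0" by simp
    then have "x \<bullet> x \<le> b" using cutoff_eq_0[of b x a] by linarith
    then show "x \<in> cball 0 (sqrt b)" by (simp add: norm_eq_sqrt_inner)
  qed
  then have "bounded {x. ?f x \<noteq> 0}" by (rule bounded_subset[OF bounded_cball])
  then have "compact (closure {x. ?f x \<noteq> 0})" by simp
  ultimately show ?thesis by (simp add: test_fun_def)
qed

lemma smooth_fun_differentiable: "smooth_fun f \<Longrightarrow> f differentiable (at x)"
  unfolding smooth_fun_def by (metis iter_pd.simps(1))

lemma smooth_fun_pd: "smooth_fun f \<Longrightarrow> smooth_fun (pd i f)"
proof -
  assume f: "smooth_fun f"
  have "iter_pd is (pd i f) = iter_pd (is @ [i]) f" for "is" by (induction "is") auto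
  with f show ?thesis unfolding smooth_fun_def by metis
qed

lemma smooth_fun_continuous: "smooth_fun f \<Longrightarrow> continuous_on A f"
  using smooth_fun_differentiable by (meson continuous_at_imp_continuous_on differentiable_imp_continuous_within)

lemma pd_line_derivative:
  fixes f :: "real^2 \<Rightarrow> complex"
  assumes "f differentiable (at (x + t *\<^sub>R axis i 1))"
  shows "((\<lambda>t. f (x + t *\<^sub>R axis i 1)) has_vector_derivative pd i f (x + t *\<^sub>R axis i 1)) (at t)"
proof -
  have 1: "((\<lambda>t. x + t *\<^sub>R axis i 1) has_derivative (\<lambda>h. h *\<^sub>R (axis i 1 :: real^2))) (at t)"
    by (auto intro!: derivative_eq_intros)
  have "(f has_derivative frechet_derivative f (at (x + t *\<^sub>R axis i 1))) (at (x + t *\<^sub>R axis i 1))"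
    using assms by (simp add: frechet_derivative_works)
  from has_derivative_compose[OF 1 this] linear_frechet_derivative[OF assms]
  show ?thesis by (simp add: has_vector_derivative_def pd_def linear_scale)
qed

lemma pd_vanish_outside:
  assumes "x \<notin> closure {x. f x \<noteq> 0}"
  shows "pd i f x = 0"
proof -
  have "((\<lambda>x. 0::complex) has_derivative (\<lambda>h. 0)) (at x)" by simp
  then have "(f has_derivative (\<lambda>h. 0)) (at x)"
  proof (rule has_derivative_transform_within_open)
    show "open (- closure {x. f x \<noteq> 0})" by (rule open_Compl[OF closed_closure])
    show "x \<in> - closure {x. f x \<noteq> 0}" using assms by simp
    show "0 = f y" if "y \<in> - closure {x. f x \<noteq> 0}" for y
      using that closure_subset[of "{x. f x \<noteq> 0}"] by auto
  qed
  from frechet_derivative_at[OF this, symmetric] show ?thesis by (simp add: pd_def)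
qed

lemma pd_eq_locally:
  assumes "open S" "x \<in> S" "\<And>y. y \<in> S \<Longrightarrow> f y = g y" "g differentiable (at x)"
  shows "pd i f x = pd i g x"
proof -
  have "(g has_derivative frechet_derivative g (at x)) (at x)" using assms(4) by (simp add: frechet_derivative_works)
  then have "(f has_derivative frechet_derivative g (at x)) (at x)"
    by (rule has_derivative_transform_within_open[OF _ assms(1,2)]) (use assms(3) in auto)
  from frechet_derivative_at[OF this, symmetric] show ?thesis by (simp add: pd_def)
qed

lemma pd_mult:
  assumes "f differentiable (at x)" "g differentiable (at x)"
  shows "pd i (\<lambda>x. f x * g x) x = f x * pd i g x + pd i f x * g x"
proof -
  have "(f has_derivative frechet_derivative f (at x)) (at x)" "(g has_derivative frechet_derivative g (at x)) (at x)"
    using assms by (simp_all add: frechet_derivative_works)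
  from frechet_derivative_at[OF has_derivative_mult[OF this], symmetric]
  show ?thesis by (simp add: pd_def)
qed

lemma vector_difference_quotient_tendsto:
  fixes f :: "real \<Rightarrow> 'a::real_normed_vector"
  assumes "(f has_vector_derivative v) (at 0)"
  shows "((\<lambda>t. (1 / t) *\<^sub>R (f t - f 0)) \<longlongrightarrow> v) (at 0)"
proof -
  have l: "((\<lambda>t. norm (f t - f 0 - t *\<^sub>R v) / norm t) \<longlongrightarrow> 0) (at 0)"
    using assms unfolding has_vector_derivative_def has_derivative_at by simp
  have "\<forall>\<^sub>F t in at 0. norm (f t - f 0 - t *\<^sub>R v) / norm t = norm ((1 / t) *\<^sub>R (f t - f 0) - v)"
  proof (unfold eventually_at_filter, rule always_eventually, intro allI impI)
    fix t :: real assume "t \<noteq> 0"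
    then have "(1 / t) *\<^sub>R (f t - f 0) - v = (1 / t) *\<^sub>R (f t - f 0 - t *\<^sub>R v)" by (simp add: scaleR_diff_right)
    then show "norm (f t - f 0 - t *\<^sub>R v) / norm t = norm ((1 / t) *\<^sub>R (f t - f 0) - v)" by (simp add: divide_inverse mult.commute)
  qed
  from Lim_transform_eventually[OF l this] show ?thesis
    by (simp add: tendsto_norm_zero_iff Lim_null[of _ v])
qed

text \<open>The difference quotients have integral 0 by translation invariance.\<close>
lemma integral_pd_eq_0:
  fixes f :: "real^2 \<Rightarrow> complex"
  assumes d: "\<And>x. f differentiable (at x)" and c: "continuous_on UNIV (pd i f)"
    and K: "compact K" "\<And>x. x \<notin> K \<Longrightarrow> f x = 0"
  shows "integral\<^sup>L lborel (pd i f) = 0"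
proof -
  define e where "e = (axis i 1 :: real^2)"
  have ne: "norm e = 1" by (simp add: e_def norm_axis_1)
  have cf: "continuous_on UNIV f" using d by (meson continuous_at_imp_continuous_on differentiable_imp_continuous_within)
  obtain r where r: "r > 0" "K \<subseteq> ball 0 r"
    using bounded_subset_ballD[OF compact_imp_bounded[OF K(1)], of 0] by blast
  have f0: "f x = 0" if "norm x \<ge> r" for x using K(2)[of x] r(2) that by (cases "x \<in> K") auto
  have pd0: "pd i f x = 0" if "norm x > r" for x
  proof (rule pd_vanish_outside)
    have "closure {x. f x \<noteq> 0} \<subseteq> cball 0 r" using f0 by (intro closure_minimal) (auto, meson linear)
    then show "x \<notin> closure {x. f x \<noteq> 0}" using that by auto
  qed
  have "bounded (pd i f ` cball 0 r)"
    by (intro compact_imp_bounded compact_continuous_image continuous_on_subset[OF c]) auto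
  then obtain B where B: "B > 0" "\<And>x. x \<in> cball 0 r \<Longrightarrow> norm (pd i f x) \<le> B" unfolding bounded_pos by blast
  have Bd: "norm (pd i f x) \<le> B" for x using B pd0[of x] by (cases "norm x \<le> r") auto
  \<comment> \<open>The increment bound makes the difference quotients uniformly bounded, which
    supplies the dominating function.\<close>
  have incr: "norm (f (x + h *\<^sub>R e) - f x) \<le> B * h" if h: "h \<ge> 0" for x h
  proof -
    have "((\<lambda>t. pd i f (x + t *\<^sub>R e)) has_integral f (x + h *\<^sub>R e) - f (x + 0 *\<^sub>R e)) {0..h}"
      unfolding e_def by (rule fundamental_theorem_of_calculus[OF h has_vector_derivative_at_within[OF pd_line_derivative[OF d]]])
    then have "f (x + h *\<^sub>R e) - f x = integral {0..h} (\<lambda>t. pd i f (x + t *\<^sub>R e))" by (simp add: integral_unique)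
    also have "norm \<dots> \<le> B * (h - 0)"
      by (rule norm_integral_le_real[OF h]) (auto intro!: continuous_on_compose2[OF c] continuous_intros Bd)
    finally show ?thesis by simp
  qed
  define h where "h n = 1 / real (Suc n)" for n
  have h: "h n > 0" "h n \<le> 1" for n by (auto simp: h_def)
  have h0: "h \<longlonglongrightarrow> 0" using LIMSEQ_inverse_real_of_nat unfolding h_def by (simp add: inverse_eq_divide)
  define q where "q n x = (1 / h n) *\<^sub>R (f (x + h n *\<^sub>R e) - f x)" for n x
  have intf: "integrable lborel f"
  proof -
    have "integrable lborel (\<lambda>x. indicator (cball 0 r) x *\<^sub>R f x)"
      by (rule borel_integrable_compact[OF compact_cball continuous_on_subset[OF cf]]) simp
    moreover have "(\<lambda>x. indicator (cball 0 r) x *\<^sub>R f x) = f" using f0 by (auto simp: indicator_def fun_eq_iff)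
    ultimately show ?thesis by simp
  qed
  have bf: "f \<in> borel_measurable borel" by (rule borel_measurable_continuous_onI[OF cf])
  have shift: "integrable lborel (\<lambda>x. f (x + v))" "integral\<^sup>L lborel (\<lambda>x. f (x + v)) = integral\<^sup>L lborel f" for v
  proof -
    have "integrable (distr lborel borel ((+) v)) f" using intf by (simp add: lborel_distr_plus)
    then show "integrable lborel (\<lambda>x. f (x + v))" by (subst (asm) integrable_distr_eq) (use bf in \<open>auto simp: add.commute\<close>)
    have "integral\<^sup>L (distr lborel borel ((+) v)) f = integral\<^sup>L lborel (\<lambda>x. f (v + x))"
      by (rule integral_distr) (use bf in auto)
    then show "integral\<^sup>L lborel (\<lambda>x. f (x + v)) = integral\<^sup>L lborel f" by (simp add: lborel_distr_plus add.commute)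
  qed
  have q0: "integral\<^sup>L lborel (q n) = 0" for n
    unfolding q_def using shift intf by simp
  have "(\<lambda>n. integral\<^sup>L lborel (q n)) \<longlonglongrightarrow> integral\<^sup>L lborel (pd i f)"
  proof (rule integral_dominated_convergence[where w = "\<lambda>x. B * indicator (cball 0 (r + 1)) x"])
    show "pd i f \<in> borel_measurable lborel" using borel_measurable_continuous_onI[OF c] by simp
    show "q n \<in> borel_measurable lborel" for n
      unfolding q_def using borel_measurable_integrable[OF shift(1)] borel_measurable_integrable[OF intf] by measurable
    show "integrable lborel (\<lambda>x::real^2. B * indicator (cball 0 (r + 1)) x)"
      using emeasure_lborel_cball_finite[of "0::real^2" "r + 1"] by (intro integrable_mult_right integrable_real_indicator) auto
    show "AE x in lborel. (\<lambda>n. q n x) \<longlonglongrightarrow> pd i f x"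
    proof (rule AE_I2)
      fix x :: "real^2"
      have "((\<lambda>t. f (x + t *\<^sub>R e)) has_vector_derivative pd i f x) (at 0)"
        using pd_line_derivative[of f x 0 i] d by (simp add: e_def)
      then have "((\<lambda>t. (1 / t) *\<^sub>R (f (x + t *\<^sub>R e) - f x)) \<longlongrightarrow> pd i f x) (at 0)"
        using vector_difference_quotient_tendsto by fastforce
      moreover have "filterlim h (at 0) sequentially"
        unfolding filterlim_at using h0 h(1) by (auto intro!: always_eventually simp: less_imp_neq[symmetric])
      ultimately show "(\<lambda>n. q n x) \<longlonglongrightarrow> pd i f x" unfolding q_def by (rule filterlim_compose)
    qed
    show "AE x in lborel. norm (q n x) \<le> B * indicator (cball 0 (r + 1)) x" for n
    proof (rule AE_I2)
      fix x :: "real^2"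
      show "norm (q n x) \<le> B * indicator (cball 0 (r + 1)) x"
      proof (cases "norm x \<le> r + 1")
        case True
        have "norm (q n x) \<le> (1 / h n) * (B * h n)"
          unfolding q_def norm_scaleR using incr[of "h n" x] h(1)[of n] by (intro mult_mono) auto
        also have "\<dots> = B" using h(1)[of n] by simp
        finally show ?thesis using True by simp
      next
        case False
        have "norm (x + h n *\<^sub>R e) \<ge> norm x - norm (h n *\<^sub>R e)" by (rule norm_diff_ineq)
        then have "norm (x + h n *\<^sub>R e) \<ge> r" using False h[of n] ne by simp
        then show ?thesis using f0[of x] f0[of "x + h n *\<^sub>R e"] False by (simp add: q_def)
      qed
    qed
  qed
  then show ?thesis unfolding q0 by (simp add: LIMSEQ_const_iff)
qed

lemma integral_lebesgue_on_vanish: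
  fixes g :: "real^2 \<Rightarrow> complex"
  assumes "open \<Omega>" "\<And>x. x \<notin> \<Omega> \<Longrightarrow> g x = 0" "continuous_on UNIV g"
  shows "integral\<^sup>L (lebesgue_on \<Omega>) g = integral\<^sup>L lborel g"
proof -
  have "integral\<^sup>L (lebesgue_on \<Omega>) g = integral\<^sup>L lebesgue (\<lambda>x. indicator \<Omega> x *\<^sub>R g x)"
    by (rule integral_restrict_space) (use assms(1) in \<open>simp add: borel_open\<close>)
  also have "(\<lambda>x. indicator \<Omega> x *\<^sub>R g x) = g" using assms(2) by (auto simp: indicator_def fun_eq_iff)
  also have "integral\<^sup>L lebesgue g = integral\<^sup>L lborel g"
    by (rule integral_completion) (use borel_measurable_continuous_onI[OF assms(3)] in simp)
  finally show ?thesis .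
qed

text \<open>The product of \<psi> and g has compact support inside the open set, so the integral of
  its partial derivative is one over the whole plane and vanishes.\<close>

lemma integral_by_parts_test_fun:
  assumes \<Omega>: "open \<Omega>" and \<psi>: "test_fun \<Omega> \<psi>" and g: "smooth_fun g"
  shows "integral\<^sup>L (lebesgue_on \<Omega>) (\<lambda>x. pd i \<psi> x * g x) = - integral\<^sup>L (lebesgue_on \<Omega>) (\<lambda>x. \<psi> x * pd i g x)"
    and "integrable (lebesgue_on \<Omega>) (\<lambda>x. pd i \<psi> x * g x)" "integrable (lebesgue_on \<Omega>) (\<lambda>x. \<psi> x * pd i g x)"
proof -
  have \<psi>s: "smooth_fun \<psi>" and K: "compact (closure {x. \<psi> x \<noteq> 0})" and sub: "closure {x. \<psi> x \<noteq> 0} \<subseteq> \<Omega>"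
    using \<psi> by (auto simp: test_fun_def)
  define K where "K = closure {x. \<psi> x \<noteq> 0}"
  have \<psi>0: "\<psi> x = 0" if "x \<notin> K" for x using that closure_subset[of "{x. \<psi> x \<noteq> 0}"] by (auto simp: K_def)
  have pd\<psi>0: "pd i \<psi> x = 0" if "x \<notin> K" for x using that pd_vanish_outside by (simp add: K_def)
  note d = smooth_fun_differentiable[OF \<psi>s] smooth_fun_differentiable[OF g]
  note c = smooth_fun_continuous[OF \<psi>s] smooth_fun_continuous[OF g] smooth_fun_continuous[OF smooth_fun_pd[OF \<psi>s]] smooth_fun_continuous[OF smooth_fun_pd[OF g]]
  have int: "integrable (lebesgue_on \<Omega>) h" if h: "continuous_on UNIV h" "\<And>x. x \<notin> K \<Longrightarrow> h x = 0" for h :: "real^2 \<Rightarrow> complex"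
  proof -
    have "integrable lborel (\<lambda>x. indicator K x *\<^sub>R h x)"
      by (rule borel_integrable_compact[OF _ continuous_on_subset[OF h(1)]]) (use K in \<open>auto simp: K_def\<close>)
    moreover have "(\<lambda>x. indicator K x *\<^sub>R h x) = h" using h(2) by (auto simp: indicator_def fun_eq_iff)
    ultimately have "integrable lebesgue h" by (simp add: integrable_completion borel_measurable_continuous_onI[OF h(1)])
    then show ?thesis using \<Omega>
      by (subst integrable_restrict_space) (auto intro!: integrable_mult_indicator simp: borel_open)
  qed
  show i1: "integrable (lebesgue_on \<Omega>) (\<lambda>x. pd i \<psi> x * g x)" by (rule int) (auto intro!: continuous_intros c simp: pd\<psi>0)
  show i2: "integrable (lebesgue_on \<Omega>) (\<lambda>x. \<psi> x * pd i g x)" by (rule int) (auto intro!: continuous_intros c simp: \<psi>0)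
  have pd: "pd i (\<lambda>x. \<psi> x * g x) = (\<lambda>x. \<psi> x * pd i g x + pd i \<psi> x * g x)"
    using pd_mult[OF d] by auto
  have cpd: "continuous_on UNIV (pd i (\<lambda>x. \<psi> x * g x))" unfolding pd by (intro continuous_intros c)
  have "integral\<^sup>L lborel (pd i (\<lambda>x. \<psi> x * g x)) = 0"
    by (rule integral_pd_eq_0[OF _ cpd K[folded K_def]]) (auto intro!: differentiable_mult d simp: \<psi>0)
  moreover have "integral\<^sup>L (lebesgue_on \<Omega>) (pd i (\<lambda>x. \<psi> x * g x)) = integral\<^sup>L lborel (pd i (\<lambda>x. \<psi> x * g x))"
  proof (rule integral_lebesgue_on_vanish[OF \<Omega> _ cpd])
    fix x assume "x \<notin> \<Omega>"
    then have "x \<notin> K" using sub unfolding K_def by blast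
    then show "pd i (\<lambda>x. \<psi> x * g x) x = 0" unfolding pd by (simp add: \<psi>0 pd\<psi>0)
  qed
  ultimately have "integral\<^sup>L (lebesgue_on \<Omega>) (\<lambda>x. \<psi> x * pd i g x) + integral\<^sup>L (lebesgue_on \<Omega>) (\<lambda>x. pd i \<psi> x * g x) = 0"
    unfolding pd using i1 i2 by simp
  then show "integral\<^sup>L (lebesgue_on \<Omega>) (\<lambda>x. pd i \<psi> x * g x) = - integral\<^sup>L (lebesgue_on \<Omega>) (\<lambda>x. \<psi> x * pd i g x)"
    by (simp add: add_eq_0_iff)
qed

section \<open>Orthogonality to plane waves\<close>

lemma norm_exp_i_Taylor2: "cmod (expi y - 1 - \<i> * complex_of_real y) \<le> y\<^sup>2"
  using Taylor_exp[of "\<i> * complex_of_real y" 1] by (simp add: norm_mult power2_eq_square diff_diff_eq)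

lemma herglotz_wave_increment:
  fixes x h :: "real^2"
  shows "cmod (expi (k * (cos \<theta> * (x + h)$1 + sin \<theta> * (x + h)$2))
      - expi (k * (cos \<theta> * x$1 + sin \<theta> * x$2))
      - expi (k * (cos \<theta> * x$1 + sin \<theta> * x$2)) * (\<i> * complex_of_real (k * (cos \<theta> * h$1 + sin \<theta> * h$2))))
    \<le> k\<^sup>2 * 4 * (norm h)\<^sup>2"
proof -
  define y where "y = k * (cos \<theta> * h$1 + sin \<theta> * h$2)"
  define e where "e = expi (k * (cos \<theta> * x$1 + sin \<theta> * x$2))"
  have "expi (k * (cos \<theta> * (x + h)$1 + sin \<theta> * (x + h)$2)) = e * expi y"
    unfolding e_def y_def exp_add[symmetric] by (simp add: algebra_simps)
  then have "expi (k * (cos \<theta> * (x + h)$1 + sin \<theta> * (x + h)$2)) - e - e * (\<i> * complex_of_real y)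
      = e * (expi y - 1 - \<i> * complex_of_real y)"
    by (simp add: algebra_simps)
  then have "cmod (expi (k * (cos \<theta> * (x + h)$1 + sin \<theta> * (x + h)$2)) - e - e * (\<i> * complex_of_real y)) \<le> y\<^sup>2"
    using norm_exp_i_Taylor2[of y] by (simp add: norm_mult e_def)
  also have "y\<^sup>2 \<le> k\<^sup>2 * (4 * (norm h)\<^sup>2)"
  proof -
    have "\<bar>cos \<theta> * h$1\<bar> \<le> 1 * norm h" "\<bar>sin \<theta> * h$2\<bar> \<le> 1 * norm h"
      unfolding abs_mult by (intro mult_mono component_le_norm_cart abs_cos_le_one abs_sin_le_one; simp)+
    then have "\<bar>cos \<theta> * h$1 + sin \<theta> * h$2\<bar> \<le> 1 * norm h + 1 * norm h" by linarith
    then have "(cos \<theta> * h$1 + sin \<theta> * h$2)\<^sup>2 \<le> (2 * norm h)\<^sup>2" by (intro abs_le_square_iff[THEN iffD1]) auto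
    then show ?thesis unfolding y_def power_mult_distrib by (intro mult_left_mono) auto
  qed
  finally show ?thesis by (simp add: e_def y_def)
qed

context
  fixes \<phi> :: "real \<Rightarrow> complex" and k :: real
  assumes \<phi>_cont: "continuous_on UNIV \<phi>"
begin

definition herglotz_grad :: "2 \<Rightarrow> real^2 \<Rightarrow> complex" where
  "herglotz_grad i x = integral {-pi..pi} (\<lambda>\<theta>. \<phi> \<theta> * (\<i> * complex_of_real (k * (if i = 1 then cos \<theta> else sin \<theta>)))
      * expi (k * (cos \<theta> * x$1 + sin \<theta> * x$2)))"

lemma continuous_on_herglotz: "continuous_on A (herglotz k \<phi>)"
proof -
  have "continuous_on ((UNIV :: (real^2) set) \<times> cbox (-pi) pi) (\<lambda>(x, \<theta>). \<phi> \<theta> * expi (k * (cos \<theta> * x$1 + sin \<theta> * x$2)) :: complex)"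
    unfolding case_prod_unfold by (intro continuous_intros continuous_on_compose2[OF \<phi>_cont]) auto
  from integral_continuous_on_param[OF this] have "continuous_on UNIV (herglotz k \<phi>)"
    by (simp add: herglotz_def[abs_def])
  then show ?thesis by (rule continuous_on_subset) simp
qed

lemma continuous_on_herglotz_grad: "continuous_on A (herglotz_grad i)"
proof -
  have "continuous_on ((UNIV :: (real^2) set) \<times> cbox (-pi) pi) (\<lambda>(x, \<theta>). \<phi> \<theta> * (\<i> * complex_of_real (k * (if i = 1 then cos \<theta> else sin \<theta>)))
      * expi (k * (cos \<theta> * x$1 + sin \<theta> * x$2)) :: complex)"
    unfolding case_prod_unfold by (cases "i = 1") (auto intro!: continuous_intros continuous_on_compose2[OF \<phi>_cont])
  from integral_continuous_on_param[OF this] have "continuous_on UNIV (herglotz_grad i)"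
    by (simp add: herglotz_grad_def[abs_def])
  then show ?thesis by (rule continuous_on_subset) simp
qed

text \<open>The Taylor remainder of each plane wave is quadratic in h, uniformly in its direction,
  so it survives integration against the bounded density.\<close>

lemma herglotz_has_derivative:
  "(herglotz k \<phi> has_derivative (\<lambda>h. \<Sum>i\<in>UNIV. complex_of_real (h $ i) * herglotz_grad i x)) (at x)"
proof -
  define w where "w \<theta> y = expi (k * (cos \<theta> * y$1 + sin \<theta> * y$2))" for \<theta> and y :: "real^2"
  obtain M where M: "M \<ge> 0" "\<And>\<theta>. \<theta> \<in> {-pi..pi} \<Longrightarrow> cmod (\<phi> \<theta>) \<le> M"
    using compact_imp_bounded[OF compact_continuous_image[OF continuous_on_subset[OF \<phi>_cont subset_UNIV] compact_Icc, of "-pi" pi]]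
    unfolding bounded_pos by (metis image_eqI less_imp_le)
  have cw: "continuous_on A (\<lambda>\<theta>. w \<theta> y)" for A y unfolding w_def by (intro continuous_intros)
  have c\<phi>: "continuous_on A \<phi>" for A using \<phi>_cont continuous_on_subset by blast
  have rem: "cmod (herglotz k \<phi> (x + h) - herglotz k \<phi> x - (\<Sum>i\<in>UNIV. complex_of_real (h $ i) * herglotz_grad i x)) \<le> (8 * pi * M * k\<^sup>2) * (norm h)\<^sup>2" for h
  proof -
    have "herglotz k \<phi> (x + h) - herglotz k \<phi> x - (\<Sum>i\<in>UNIV. complex_of_real (h $ i) * herglotz_grad i x)
      = integral {-pi..pi} (\<lambda>\<theta>. \<phi> \<theta> * w \<theta> (x + h)) - integral {-pi..pi} (\<lambda>\<theta>. \<phi> \<theta> * w \<theta> x)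
        - (complex_of_real (h $ 1) * integral {-pi..pi} (\<lambda>\<theta>. \<phi> \<theta> * (\<i> * complex_of_real (k * cos \<theta>)) * w \<theta> x)
         + complex_of_real (h $ 2) * integral {-pi..pi} (\<lambda>\<theta>. \<phi> \<theta> * (\<i> * complex_of_real (k * sin \<theta>)) * w \<theta> x))"
      by (simp add: herglotz_def herglotz_grad_def sum_2 w_def)
    also have "\<dots> = integral {-pi..pi} (\<lambda>\<theta>. \<phi> \<theta> * w \<theta> (x + h) - \<phi> \<theta> * w \<theta> x
        - (complex_of_real (h $ 1) * (\<phi> \<theta> * (\<i> * complex_of_real (k * cos \<theta>)) * w \<theta> x)
         + complex_of_real (h $ 2) * (\<phi> \<theta> * (\<i> * complex_of_real (k * sin \<theta>)) * w \<theta> x)))"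
      by (subst integral_diff integral_add integral_mult_right;
          (intro integrable_continuous_real continuous_intros c\<phi> cw)?)+ simp
    also have "cmod \<dots> \<le> (M * (k\<^sup>2 * 4 * (norm h)\<^sup>2)) * (pi - - pi)"
    proof (rule norm_integral_le_real)
      show "continuous_on {-pi..pi} (\<lambda>\<theta>. \<phi> \<theta> * w \<theta> (x + h) - \<phi> \<theta> * w \<theta> x
        - (complex_of_real (h $ 1) * (\<phi> \<theta> * (\<i> * complex_of_real (k * cos \<theta>)) * w \<theta> x)
         + complex_of_real (h $ 2) * (\<phi> \<theta> * (\<i> * complex_of_real (k * sin \<theta>)) * w \<theta> x)))"
        by (intro continuous_intros c\<phi> cw)
      fix \<theta> assume \<theta>: "\<theta> \<in> {-pi..pi}"
      have "\<phi> \<theta> * w \<theta> (x + h) - \<phi> \<theta> * w \<theta> x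
        - (complex_of_real (h $ 1) * (\<phi> \<theta> * (\<i> * complex_of_real (k * cos \<theta>)) * w \<theta> x)
         + complex_of_real (h $ 2) * (\<phi> \<theta> * (\<i> * complex_of_real (k * sin \<theta>)) * w \<theta> x))
       = \<phi> \<theta> * (w \<theta> (x + h) - w \<theta> x - w \<theta> x * (\<i> * complex_of_real (k * (cos \<theta> * h$1 + sin \<theta> * h$2))))"
        by (simp add: algebra_simps)
      then show "cmod (\<phi> \<theta> * w \<theta> (x + h) - \<phi> \<theta> * w \<theta> x
        - (complex_of_real (h $ 1) * (\<phi> \<theta> * (\<i> * complex_of_real (k * cos \<theta>)) * w \<theta> x)
         + complex_of_real (h $ 2) * (\<phi> \<theta> * (\<i> * complex_of_real (k * sin \<theta>)) * w \<theta> x))) \<le> M * (k\<^sup>2 * 4 * (norm h)\<^sup>2)"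
        using herglotz_wave_increment[of k \<theta> x h] M \<theta> unfolding w_def by (simp only: norm_mult) (intro mult_mono, auto)
    qed simp
    finally show ?thesis by (simp add: mult_ac)
  qed
  show ?thesis unfolding has_derivative_at
  proof
    show "bounded_linear (\<lambda>h::real^2. \<Sum>i\<in>UNIV. complex_of_real (h $ i) * herglotz_grad i x)"
      by (intro bounded_linear_sum bounded_linear_compose[OF bounded_linear_mult_left]
          bounded_linear_compose[OF bounded_linear_of_real] bounded_linear_vec_nth)
    show "((\<lambda>h. cmod (herglotz k \<phi> (x + h) - herglotz k \<phi> x - (\<Sum>i\<in>UNIV. complex_of_real (h $ i) * herglotz_grad i x)) / norm h) \<longlongrightarrow> 0) (at 0)"
    proof (rule Lim_null_comparison)
      show "\<forall>\<^sub>F h in at 0. norm (cmod (herglotz k \<phi> (x + h) - herglotz k \<phi> x - (\<Sum>i\<in>UNIV. complex_of_real (h $ i) * herglotz_grad i x)) / norm h)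
          \<le> (8 * pi * M * k\<^sup>2) * norm h"
      proof (unfold eventually_at_filter, rule always_eventually, intro allI impI)
        fix h :: "real^2" assume "h \<noteq> 0"
        then show "norm (cmod (herglotz k \<phi> (x + h) - herglotz k \<phi> x - (\<Sum>i\<in>UNIV. complex_of_real (h $ i) * herglotz_grad i x)) / norm h)
          \<le> (8 * pi * M * k\<^sup>2) * norm h"
          using rem[of h] by (simp add: divide_le_eq power2_eq_square mult_ac)
      qed
      show "((\<lambda>h::real^2. (8 * pi * M * k\<^sup>2) * norm h) \<longlongrightarrow> 0) (at 0)"
        by (auto intro!: tendsto_eq_intros)
    qed
  qed
qed

lemma pd_herglotz: "pd i (herglotz k \<phi>) = herglotz_grad i"
  using has_derivative_imp_pd[OF herglotz_has_derivative] by auto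

end

section \<open>Pairing square-integrable functions with bounded ones\<close>

lemma L2_on_add_scale:
  assumes "L2_on \<Omega> f" "L2_on \<Omega> g"
  shows "L2_on \<Omega> (\<lambda>x. f x + c * g x)"
  unfolding L2_on_def
proof
  have m: "f \<in> borel_measurable (lebesgue_on \<Omega>)" "g \<in> borel_measurable (lebesgue_on \<Omega>)"
    and i: "integrable (lebesgue_on \<Omega>) (\<lambda>x. (cmod (f x))\<^sup>2)" "integrable (lebesgue_on \<Omega>) (\<lambda>x. (cmod (g x))\<^sup>2)"
    using assms by (auto simp: L2_on_def)
  show ms: "(\<lambda>x. f x + c * g x) \<in> borel_measurable (lebesgue_on \<Omega>)" using m by measurable
  show "integrable (lebesgue_on \<Omega>) (\<lambda>x. (cmod (f x + c * g x))\<^sup>2)"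
  proof (rule Bochner_Integration.integrable_bound)
    show "integrable (lebesgue_on \<Omega>) (\<lambda>x. 2 * (cmod (f x))\<^sup>2 + (2 * (cmod c)\<^sup>2) * (cmod (g x))\<^sup>2)" using i by simp
    show "(\<lambda>x. (cmod (f x + c * g x))\<^sup>2) \<in> borel_measurable (lebesgue_on \<Omega>)" using ms by measurable
    have "(cmod (f x + c * g x))\<^sup>2 \<le> 2 * (cmod (f x))\<^sup>2 + (2 * (cmod c)\<^sup>2) * (cmod (g x))\<^sup>2" for x
    proof -
      have "(cmod (f x + c * g x))\<^sup>2 \<le> (cmod (f x) + cmod c * cmod (g x))\<^sup>2"
        by (intro power_mono) (auto simp: norm_mult[symmetric] norm_triangle_ineq)
      also have "\<dots> \<le> 2 * (cmod (f x))\<^sup>2 + (2 * (cmod c)\<^sup>2) * (cmod (g x))\<^sup>2"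
        using zero_le_power2[of "cmod (f x) - cmod c * cmod (g x)"] by (simp add: power2_eq_square algebra_simps)
      finally show ?thesis .
    qed
    then show "AE x in lebesgue_on \<Omega>. norm ((cmod (f x + c * g x))\<^sup>2) \<le> norm (2 * (cmod (f x))\<^sup>2 + (2 * (cmod c)\<^sup>2) * (cmod (g x))\<^sup>2)"
      by (intro AE_I2) simp
  qed
qed

lemma L2_on_mult_bounded_integrable:
  assumes fin: "finite_measure (lebesgue_on \<Omega>)" and f: "L2_on \<Omega> f"
    and g: "g \<in> borel_measurable (lebesgue_on \<Omega>)" "\<And>x. x \<in> \<Omega> \<Longrightarrow> cmod (g x) \<le> B"
  shows "integrable (lebesgue_on \<Omega>) (\<lambda>x. f x * g x)"
proof (rule Bochner_Integration.integrable_bound)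
  interpret finite_measure "lebesgue_on \<Omega>" by (rule fin)
  show "integrable (lebesgue_on \<Omega>) (\<lambda>x. (1 + (cmod (f x))\<^sup>2) * B)"
    using f by (auto simp: L2_on_def)
  show "(\<lambda>x. f x * g x) \<in> borel_measurable (lebesgue_on \<Omega>)" using f g by (auto simp: L2_on_def)
  show "AE x in lebesgue_on \<Omega>. norm (f x * g x) \<le> norm ((1 + (cmod (f x))\<^sup>2) * B)"
  proof (rule AE_I2)
    fix x assume "x \<in> space (lebesgue_on \<Omega>)"
    then have B: "cmod (g x) \<le> B" using g(2) by simp
    have "cmod (f x) \<le> 1 + (cmod (f x))\<^sup>2"
      using zero_le_power2[of "cmod (f x) - 1"] by (simp add: power2_eq_square algebra_simps) (use norm_ge_zero[of "f x"] in linarith)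
    then have "cmod (f x) * cmod (g x) \<le> (1 + (cmod (f x))\<^sup>2) * B" using B by (intro mult_mono) auto
    then show "norm (f x * g x) \<le> norm ((1 + (cmod (f x))\<^sup>2) * B)" by (simp add: norm_mult)
  qed
qed

lemma L2_tendsto_integral_mult_bounded:
  assumes fin: "finite_measure (lebesgue_on \<Omega>)"
    and d: "\<And>n. L2_on \<Omega> (d n)" "(\<lambda>n. integral\<^sup>L (lebesgue_on \<Omega>) (\<lambda>x. (cmod (d n x))\<^sup>2)) \<longlonglongrightarrow> 0"
    and g: "g \<in> borel_measurable (lebesgue_on \<Omega>)" "\<And>x. x \<in> \<Omega> \<Longrightarrow> cmod (g x) \<le> B"
  shows "(\<lambda>n. integral\<^sup>L (lebesgue_on \<Omega>) (\<lambda>x. d n x * g x)) \<longlonglongrightarrow> 0"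
proof -
  interpret finite_measure "lebesgue_on \<Omega>" by (rule fin)
  define s where "s n = integral\<^sup>L (lebesgue_on \<Omega>) (\<lambda>x. (cmod (d n x))\<^sup>2)" for n
  \<comment> \<open>The weight in |d| \<le> e + |d|^2 / e. The term 1 / (n + 1) keeps it positive
    when d vanishes almost everywhere.\<close>
  define e where "e n = sqrt (s n) + 1 / real (Suc n)" for n
  define \<mu> where "\<mu> = measure (lebesgue_on \<Omega>) \<Omega>"
  have s0: "s n \<ge> 0" for n unfolding s_def by (intro Bochner_Integration.integral_nonneg) auto
  have e: "e n > 0" "e n \<ge> sqrt (s n)" for n using s0[of n] by (auto simp: e_def add_nonneg_pos)
  have bound: "cmod (integral\<^sup>L (lebesgue_on \<Omega>) (\<lambda>x. d n x * g x)) \<le> \<bar>B\<bar> * (e n * \<mu> + sqrt (s n))" for n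
  proof -
    have i2: "integrable (lebesgue_on \<Omega>) (\<lambda>x. (cmod (d n x))\<^sup>2)" using d(1) by (simp add: L2_on_def)
    have ii: "integrable (lebesgue_on \<Omega>) (\<lambda>x. \<bar>B\<bar> * (e n + (cmod (d n x))\<^sup>2 / e n))" using i2 by auto
    have "cmod (integral\<^sup>L (lebesgue_on \<Omega>) (\<lambda>x. d n x * g x)) \<le> integral\<^sup>L (lebesgue_on \<Omega>) (\<lambda>x. cmod (d n x * g x))"
      by (rule integral_norm_bound)
    also have "\<dots> \<le> integral\<^sup>L (lebesgue_on \<Omega>) (\<lambda>x. \<bar>B\<bar> * (e n + (cmod (d n x))\<^sup>2 / e n))"
    proof (rule integral_mono)
      show "integrable (lebesgue_on \<Omega>) (\<lambda>x. cmod (d n x * g x))"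
        using L2_on_mult_bounded_integrable[OF fin d(1) g] by simp
      show "integrable (lebesgue_on \<Omega>) (\<lambda>x. \<bar>B\<bar> * (e n + (cmod (d n x))\<^sup>2 / e n))" by (rule ii)
      fix x assume "x \<in> space (lebesgue_on \<Omega>)"
      then have B: "cmod (g x) \<le> \<bar>B\<bar>" using g(2)[of x] by simp
      have "cmod (d n x) * e n \<le> (e n)\<^sup>2 + (cmod (d n x))\<^sup>2"
        using zero_le_power2[of "cmod (d n x) - e n"] mult_nonneg_nonneg[OF norm_ge_zero[of "d n x"] less_imp_le[OF e(1)[of n]]]
        by (simp add: power2_eq_square algebra_simps)
      then have "cmod (d n x) \<le> e n + (cmod (d n x))\<^sup>2 / e n"
        using e(1)[of n] by (simp add: field_simps power2_eq_square)
      then have "cmod (d n x) * cmod (g x) \<le> (e n + (cmod (d n x))\<^sup>2 / e n) * \<bar>B\<bar>"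
        using B e(1)[of n] by (intro mult_mono) auto
      then show "cmod (d n x * g x) \<le> \<bar>B\<bar> * (e n + (cmod (d n x))\<^sup>2 / e n)" by (simp add: norm_mult mult.commute)
    qed
    also have "\<dots> = \<bar>B\<bar> * (e n * \<mu> + s n / e n)"
      using i2 by (simp add: \<mu>_def s_def mult.commute)
    also have "\<dots> \<le> \<bar>B\<bar> * (e n * \<mu> + sqrt (s n))"
    proof (intro mult_left_mono add_left_mono)
      have "s n = sqrt (s n) * sqrt (s n)" using s0[of n] by simp
      also have "\<dots> \<le> sqrt (s n) * e n" using e(2)[of n] s0[of n] by (intro mult_left_mono) auto
      finally show "s n / e n \<le> sqrt (s n)" using e(1)[of n] by (simp add: divide_le_eq)
    qed auto
    finally show ?thesis .
  qed
  have ss: "(\<lambda>n. sqrt (s n)) \<longlonglongrightarrow> 0" using tendsto_real_sqrt[OF d(2)] by (simp add: s_def)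
  have "(\<lambda>n. 1 / real (Suc n)) \<longlonglongrightarrow> 0" using LIMSEQ_inverse_real_of_nat by (simp add: inverse_eq_divide)
  with ss have "e \<longlonglongrightarrow> 0" unfolding e_def[abs_def] using tendsto_add by fastforce
  with ss have "(\<lambda>n. \<bar>B\<bar> * (e n * \<mu> + sqrt (s n))) \<longlonglongrightarrow> \<bar>B\<bar> * (0 * \<mu> + 0)" by (intro tendsto_intros)
  then have "(\<lambda>n. \<bar>B\<bar> * (e n * \<mu> + sqrt (s n))) \<longlonglongrightarrow> 0" by simp
  then show ?thesis by (rule Lim_null_comparison[rotated]) (simp add: bound)
qed

lemma finite_measure_lebesgue_on:
  assumes "bounded \<Omega>" "open \<Omega>"
  shows "finite_measure (lebesgue_on \<Omega> :: 'a::euclidean_space measure)"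
proof -
  have "emeasure lborel \<Omega> < \<infinity>" by (rule emeasure_bounded_finite[OF assms(1)])
  then show ?thesis
    using assms(2) by (intro finite_measureI) (simp add: emeasure_restrict_space borel_open)
qed

lemma L2_on_continuous:
  assumes "bounded \<Omega>" "open \<Omega>" "continuous_on UNIV f"
  shows "L2_on \<Omega> f" "f \<in> borel_measurable (lebesgue_on \<Omega>)" "\<exists>B. \<forall>x\<in>\<Omega>. cmod (f x) \<le> B"
proof -
  have "compact (closure \<Omega>)" using assms(1) by simp
  then have "bounded (f ` closure \<Omega>)"
    by (intro compact_imp_bounded compact_continuous_image continuous_on_subset[OF assms(3)]) auto
  then show B: "\<exists>B. \<forall>x\<in>\<Omega>. cmod (f x) \<le> B"
    using closure_subset[of \<Omega>] by (auto simp: bounded_iff)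
  have "f \<in> borel_measurable borel" by (rule borel_measurable_continuous_onI[OF assms(3)])
  then have "f \<in> borel_measurable lebesgue" by (simp add: measurable_completion)
  then show m: "f \<in> borel_measurable (lebesgue_on \<Omega>)" by (rule measurable_restrict_space1)
  interpret finite_measure "lebesgue_on \<Omega>" by (rule finite_measure_lebesgue_on[OF assms(1,2)])
  from B obtain B where B: "\<And>x. x \<in> \<Omega> \<Longrightarrow> cmod (f x) \<le> B" by blast
  have "integrable (lebesgue_on \<Omega>) (\<lambda>x. (cmod (f x))\<^sup>2)"
  proof (rule integrable_const_bound[of _ "B\<^sup>2"])
    show "AE x in lebesgue_on \<Omega>. norm ((cmod (f x))\<^sup>2) \<le> B\<^sup>2"
      by (rule AE_I2) (auto intro!: power_mono B)
    show "(\<lambda>x. (cmod (f x))\<^sup>2) \<in> borel_measurable (lebesgue_on \<Omega>)" using m by measurable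
  qed
  with m show "L2_on \<Omega> f" by (simp add: L2_on_def)
qed

lemma smooth_plane_wave: "smooth_fun (\<lambda>x. expi (v \<bullet> x))"
  by (rule smooth_alg_smooth(2)[OF zero_less_one smooth_alg.wave])

lemma pd_plane_wave:
  "pd i (\<lambda>x. expi (v \<bullet> x)) x = \<i> * complex_of_real (v $ i) * expi (v \<bullet> x)"
  by (rule has_derivative_imp_pd[OF plane_wave_has_derivative])

text \<open>u - H is an H1 limit of test functions, so it may be integrated by parts against a plane
  wave with \<open>v \<bullet> v = k\<^sup>2 * q\<close>: the gradient pairing equals k^2 q times
  the plain pairing. Compared with the weak Neumann condition, in which H enters with k^2, this
  leaves (k^2 q - k^2) times the integral of H and the wave.\<close>

lemma non_scattering_orthogonality:
  fixes v :: "real^2"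
  assumes \<Omega>: "open \<Omega>" "bounded \<Omega>" and \<phi>: "continuous_on UNIV \<phi>"
    and ns: "non_scattering \<Omega> q k \<phi>" and v: "v \<bullet> v = k\<^sup>2 * q" and kq: "k \<noteq> 0" "q \<noteq> 1"
  shows "integral\<^sup>L (lebesgue_on \<Omega>) (\<lambda>x. herglotz k \<phi> x * expi (v \<bullet> x)) = 0"
proof -
  define H where "H = herglotz k \<phi>"
  define \<psi> where "\<psi> x = expi (v \<bullet> x)" for x :: "real^2"
  define L where "L = lebesgue_on \<Omega>"
  define \<nu> where "\<nu> = complex_of_real (k\<^sup>2 * q)"
  obtain u G ps where uG: "H1_with_grad \<Omega> u G"
    and ps: "\<And>n. test_fun \<Omega> (ps n)"
      "(\<lambda>n. integral\<^sup>L L (\<lambda>x. (cmod (ps n x - (u x - H x)))\<^sup>2)) \<longlonglongrightarrow> 0"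
      "\<And>i. (\<lambda>n. integral\<^sup>L L (\<lambda>x. (cmod (pd i (ps n) x - (G i x - pd i H x)))\<^sup>2)) \<longlonglongrightarrow> 0"
    and green: "\<And>\<psi>. test_fun UNIV \<psi> \<Longrightarrow> integral\<^sup>L L (\<lambda>x. (\<Sum>i\<in>UNIV. G i x * pd i \<psi> x) - \<nu> * u x * \<psi> x)
          = integral\<^sup>L L (\<lambda>x. (\<Sum>i\<in>UNIV. pd i H x * pd i \<psi> x) - complex_of_real (k\<^sup>2) * H x * \<psi> x)"
    using ns unfolding non_scattering_def H_def Let_def L_def \<nu>_def by blast
  have fin: "finite_measure (lebesgue_on \<Omega>)" by (rule finite_measure_lebesgue_on[OF \<Omega>(2,1)])
  note cont_L2 = L2_on_continuous[OF \<Omega>(2,1)]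
  have u: "L2_on \<Omega> u" and G: "L2_on \<Omega> (G i)" for i using uG by (auto simp: H1_with_grad_def)
  have H: "L2_on \<Omega> H" unfolding H_def by (rule cont_L2(1)[OF continuous_on_herglotz[OF \<phi>]])
  have pdH: "L2_on \<Omega> (pd i H)" for i unfolding H_def pd_herglotz[OF \<phi>] by (rule cont_L2(1)[OF continuous_on_herglotz_grad[OF \<phi>]])
  have W: "L2_on \<Omega> (\<lambda>x. u x - H x)" "L2_on \<Omega> (\<lambda>x. G i x - pd i H x)" for i
    using L2_on_add_scale[OF u H, of "- 1"] L2_on_add_scale[OF G pdH, of i "- 1" i] by simp_all
  have \<psi>_smooth: "smooth_fun \<psi>" unfolding \<psi>_def[abs_def] by (rule smooth_plane_wave)
  have \<psi>_cont: "continuous_on UNIV \<psi>" by (rule smooth_fun_continuous[OF \<psi>_smooth])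
  have pd\<psi>: "pd i \<psi> = (\<lambda>x. \<i> * complex_of_real (v $ i) * \<psi> x)" for i
    unfolding \<psi>_def[abs_def] by (rule ext) (rule pd_plane_wave)
  have pd\<psi>_cont: "continuous_on UNIV (pd i \<psi>)" for i by (rule smooth_fun_continuous[OF smooth_fun_pd[OF \<psi>_smooth]])
  have pd2\<psi>: "pd i (pd i \<psi>) = (\<lambda>x. - complex_of_real ((v $ i)\<^sup>2) * \<psi> x)" for i
  proof
    fix x
    have "pd i (\<lambda>x. (\<i> * complex_of_real (v $ i)) * \<psi> x) x = (\<i> * complex_of_real (v $ i)) * pd i \<psi> x + pd i (\<lambda>x. \<i> * complex_of_real (v $ i)) x * \<psi> x"
      by (rule pd_mult[OF _ smooth_fun_differentiable[OF \<psi>_smooth]]) simp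
    also have "pd i (\<lambda>x. \<i> * complex_of_real (v $ i)) x = 0" by (simp add: pd_def)
    finally have "pd i (pd i \<psi>) x = (\<i> * \<i>) * (complex_of_real (v $ i) * complex_of_real (v $ i)) * \<psi> x"
      unfolding pd\<psi> by (simp only: mult_ac mult_zero_left add_0_right)
    then show "pd i (pd i \<psi>) x = - complex_of_real ((v $ i)\<^sup>2) * \<psi> x" by (simp add: power2_eq_square)
  qed
  obtain B where B: "\<And>x. x \<in> \<Omega> \<Longrightarrow> cmod (\<psi> x) \<le> B" using cont_L2(3)[OF \<psi>_cont] by blast
  have "\<exists>B. \<forall>i. \<forall>x\<in>\<Omega>. cmod (pd i \<psi> x) \<le> B"
  proof -
    from cont_L2(3)[OF pd\<psi>_cont] obtain C where C: "\<And>i x. x \<in> \<Omega> \<Longrightarrow> cmod (pd i \<psi> x) \<le> C i" by metis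
    show ?thesis by (rule exI[of _ "Max (range C)"]) (meson C Max_ge finite finite_imageI order_trans rangeI)
  qed
  then obtain B' where B': "\<And>i x. x \<in> \<Omega> \<Longrightarrow> cmod (pd i \<psi> x) \<le> B'" by blast
  note m = cont_L2(2)[OF \<psi>_cont] cont_L2(2)[OF pd\<psi>_cont]
  have int: "integrable L (\<lambda>x. f x * \<psi> x)" "integrable L (\<lambda>x. f x * pd i \<psi> x)" if "L2_on \<Omega> f" for f i
    unfolding L_def using L2_on_mult_bounded_integrable[OF fin that m(1) B] L2_on_mult_bounded_integrable[OF fin that m(2) B'] by auto
  have psL2: "L2_on \<Omega> (ps n)" "L2_on \<Omega> (pd i (ps n))" for n i
    using ps(1)[of n] cont_L2(1) smooth_fun_continuous smooth_fun_pd unfolding test_fun_def by auto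
  have lim: "(\<lambda>n. integral\<^sup>L L (\<lambda>x. p n x * g x)) \<longlonglongrightarrow> integral\<^sup>L L (\<lambda>x. w x * g x)"
    if "\<And>n. L2_on \<Omega> (p n)" "L2_on \<Omega> w" "(\<lambda>n. integral\<^sup>L L (\<lambda>x. (cmod (p n x - w x))\<^sup>2)) \<longlonglongrightarrow> 0"
      "g \<in> borel_measurable (lebesgue_on \<Omega>)" "\<And>x. x \<in> \<Omega> \<Longrightarrow> cmod (g x) \<le> C" for p w g C
  proof -
    have "L2_on \<Omega> (\<lambda>x. p n x - w x)" for n using L2_on_add_scale[OF that(1,2), of n "- 1"] by simp
    from L2_tendsto_integral_mult_bounded[OF fin this that(3)[unfolded L_def] that(4,5)]
    have "(\<lambda>n. integral\<^sup>L L (\<lambda>x. (p n x - w x) * g x)) \<longlonglongrightarrow> 0" by (simp add: L_def)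
    also have "(\<lambda>n. integral\<^sup>L L (\<lambda>x. (p n x - w x) * g x)) = (\<lambda>n. integral\<^sup>L L (\<lambda>x. p n x * g x) - integral\<^sup>L L (\<lambda>x. w x * g x))"
      using L2_on_mult_bounded_integrable[OF fin that(1) that(4,5)] L2_on_mult_bounded_integrable[OF fin that(2) that(4,5)]
      by (simp add: left_diff_distrib L_def)
    finally show ?thesis using Lim_null by blast
  qed
  have parts: "integral\<^sup>L L (\<lambda>x. pd i (ps n) x * pd i \<psi> x) = complex_of_real ((v $ i)\<^sup>2) * integral\<^sup>L L (\<lambda>x. ps n x * \<psi> x)" for n i
  proof -
    have "integral\<^sup>L L (\<lambda>x. pd i (ps n) x * pd i \<psi> x) = - integral\<^sup>L L (\<lambda>x. ps n x * pd i (pd i \<psi>) x)"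
      unfolding L_def by (rule integral_by_parts_test_fun(1)[OF \<Omega>(1) ps(1) smooth_fun_pd[OF \<psi>_smooth]])
    also have "(\<lambda>x. ps n x * pd i (pd i \<psi>) x) = (\<lambda>x. - complex_of_real ((v $ i)\<^sup>2) * (ps n x * \<psi> x))"
      by (auto simp: pd2\<psi>)
    finally show ?thesis by simp
  qed
  have "integral\<^sup>L L (\<lambda>x. (G i x - pd i H x) * pd i \<psi> x) = complex_of_real ((v $ i)\<^sup>2) * integral\<^sup>L L (\<lambda>x. (u x - H x) * \<psi> x)" for i
  proof (rule LIMSEQ_unique)
    show "(\<lambda>n. integral\<^sup>L L (\<lambda>x. pd i (ps n) x * pd i \<psi> x)) \<longlonglongrightarrow> integral\<^sup>L L (\<lambda>x. (G i x - pd i H x) * pd i \<psi> x)"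
      by (rule lim[OF psL2(2) W(2) ps(3) m(2) B'])
    show "(\<lambda>n. integral\<^sup>L L (\<lambda>x. pd i (ps n) x * pd i \<psi> x)) \<longlonglongrightarrow> complex_of_real ((v $ i)\<^sup>2) * integral\<^sup>L L (\<lambda>x. (u x - H x) * \<psi> x)"
      unfolding parts by (intro tendsto_mult_left lim[OF psL2(1) W(1) ps(2) m(1) B])
  qed
  then have "(\<Sum>i\<in>UNIV. integral\<^sup>L L (\<lambda>x. (G i x - pd i H x) * pd i \<psi> x)) = complex_of_real (\<Sum>i\<in>UNIV. (v $ i)\<^sup>2) * integral\<^sup>L L (\<lambda>x. (u x - H x) * \<psi> x)"
    by (simp add: sum_distrib_right)
  also have "(\<Sum>i\<in>UNIV. (v $ i)\<^sup>2) = k\<^sup>2 * q" using v by (simp add: inner_vec_def power2_eq_square)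
  finally have key: "(\<Sum>i\<in>UNIV. integral\<^sup>L L (\<lambda>x. G i x * pd i \<psi> x) - integral\<^sup>L L (\<lambda>x. pd i H x * pd i \<psi> x))
      = \<nu> * (integral\<^sup>L L (\<lambda>x. u x * \<psi> x) - integral\<^sup>L L (\<lambda>x. H x * \<psi> x))"
    using int(2)[OF G] int(2)[OF pdH] int(1)[OF u] int(1)[OF H] by (simp add: left_diff_distrib \<nu>_def)
  obtain r where r: "r > 0" "\<Omega> \<subseteq> ball 0 r" using bounded_subset_ballD[OF \<Omega>(2), of 0] by blast
  \<comment> \<open>Squared radii r^2 and r^2 + 1: the cutoff is 1 on a ball containing the domain,
    so on the domain it changes neither the wave nor its derivatives.\<close>
  define \<psi>' where "\<psi>' x = cutoff (r\<^sup>2) (r\<^sup>2 + 1) x * \<psi> x" for x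
  have tf: "test_fun UNIV \<psi>'" unfolding \<psi>'_def[abs_def] \<psi>_def by (rule test_fun_cutoff_wave) simp
  have eq: "\<psi>' x = \<psi> x" if "x \<in> \<Omega>" for x
  proof -
    have "norm x < r" using r that by auto
    then have "x \<bullet> x \<le> r\<^sup>2" by (metis dot_square_norm less_imp_le norm_ge_zero power_mono)
    then show ?thesis by (simp add: \<psi>'_def cutoff_eq_1)
  qed
  have pdeq: "pd i \<psi>' x = pd i \<psi> x" if "x \<in> \<Omega>" for x i
    by (rule pd_eq_locally[OF \<Omega>(1) that eq smooth_fun_differentiable[OF \<psi>_smooth]])
  have "integral\<^sup>L L (\<lambda>x. (\<Sum>i\<in>UNIV. G i x * pd i \<psi> x) - \<nu> * u x * \<psi> x)
      = integral\<^sup>L L (\<lambda>x. (\<Sum>i\<in>UNIV. G i x * pd i \<psi>' x) - \<nu> * u x * \<psi>' x)"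
    by (rule Bochner_Integration.integral_cong) (auto simp: L_def eq pdeq)
  also note green[OF tf]
  also have "integral\<^sup>L L (\<lambda>x. (\<Sum>i\<in>UNIV. pd i H x * pd i \<psi>' x) - complex_of_real (k\<^sup>2) * H x * \<psi>' x)
      = integral\<^sup>L L (\<lambda>x. (\<Sum>i\<in>UNIV. pd i H x * pd i \<psi> x) - complex_of_real (k\<^sup>2) * H x * \<psi> x)"
    by (rule Bochner_Integration.integral_cong) (auto simp: L_def eq pdeq)
  finally have "(\<Sum>i\<in>UNIV. integral\<^sup>L L (\<lambda>x. G i x * pd i \<psi> x)) - \<nu> * integral\<^sup>L L (\<lambda>x. u x * \<psi> x)
    = (\<Sum>i\<in>UNIV. integral\<^sup>L L (\<lambda>x. pd i H x * pd i \<psi> x)) - complex_of_real (k\<^sup>2) * integral\<^sup>L L (\<lambda>x. H x * \<psi> x)"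
    using int(2)[OF G] int(2)[OF pdH] int(1)[OF u] int(1)[OF H] by (simp add: mult.assoc)
  with key[unfolded sum_subtractf] have "(\<nu> - complex_of_real (k\<^sup>2)) * integral\<^sup>L L (\<lambda>x. H x * \<psi> x) = 0"
    by algebra
  moreover have "\<nu> - complex_of_real (k\<^sup>2) \<noteq> 0"
    using kq unfolding \<nu>_def of_real_diff[symmetric] of_real_eq_0_iff by simp
  ultimately have "integral\<^sup>L L (\<lambda>x. H x * \<psi> x) = 0" by simp
  then show ?thesis by (simp add: L_def H_def \<psi>_def)
qed

section \<open>Polar coordinates in a star domain\<close>

text \<open>The identification of pairs with vectors maps boxes to boxes and preserves their
  measure.\<close>

lemma has_integral_vec2:
  fixes f :: "real \<times> real \<Rightarrow> 'b::banach"
  assumes "(f has_integral i) (cbox (a, c) (b, d))"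
  shows "((\<lambda>x::real^2. f (x $ 1, x $ 2)) has_integral i) (cbox (vector [a, c]) (vector [b, d]))"
proof -
  define g where "g x = (x $ 1, x $ 2)" for x :: "real^2"
  define h where "h p = (vector [fst p, snd p] :: real^2)" for p :: "real \<times> real"
  have hg: "h (g x) = x" and gh: "g (h p) = p" for x p
    by (auto simp: g_def h_def vec_eq_iff forall_2)
  have gi: "g ` cbox u v = cbox (g u) (g v)" for u v
  proof
    show "g ` cbox u v \<subseteq> cbox (g u) (g v)" by (auto simp: g_def mem_box_cart)
    show "cbox (g u) (g v) \<subseteq> g ` cbox u v"
    proof
      fix p assume "p \<in> cbox (g u) (g v)"
      then have "h p \<in> cbox u v" by (auto simp: g_def h_def mem_box_cart forall_2 cbox_Pair_eq)
      then show "p \<in> g ` cbox u v" by (metis gh image_eqI)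
    qed
  qed
  have hi: "h ` cbox u v = cbox (h u) (h v)" for u v
    using gi[of "h u" "h v"] by (metis (no_types, lifting) gh hg image_cong image_ident image_image)
  have "((\<lambda>x. f (g x)) has_integral (1 / 1) *\<^sub>R i) (h ` cbox (a, c) (b, d))"
  proof (rule has_integral_twiddle[OF _ hg gh _ _ _ _ assms])
    show "continuous (at x) g" for x unfolding g_def by (intro continuous_intros)
    show "\<exists>w z. g ` cbox u v = cbox w z" "\<exists>w z. h ` cbox p q = cbox w z" for u v p q using gi hi by blast+
    show "measure lborel (g ` cbox u v) = 1 * measure lborel (cbox u v)" for u v
    proof (cases "cbox u v = {}")
      case False
      then have "u $ 1 \<le> v $ 1" "u $ 2 \<le> v $ 2" using interval_ne_empty_cart by auto
      then show ?thesis using False unfolding gi unfolding g_def content_Pair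
        by (simp add: content_cbox_cart prod_2 UNIV_2)
    qed simp
  qed simp
  then show ?thesis by (simp add: hi) (simp add: g_def h_def)
qed

lemma angle_unique:
  assumes "cos x = cos y" "sin x = sin y" "\<bar>x - y\<bar> < 2 * pi"
  shows "x = y"
proof -
  have "cos (x - y) = 1" using assms(1,2) by (simp add: cos_diff power2_eq_square[symmetric])
  then obtain n :: int where n: "x - y = real_of_int n * 2 * pi" unfolding cos_one_2pi_int by blast
  then have "\<bar>real_of_int n\<bar> * (2 * pi) < 1 * (2 * pi)" using assms(3) by (simp add: abs_mult mult.assoc)
  then have "\<bar>real_of_int n\<bar> < 1" by (simp add: mult_less_cancel_right)
  then have "n = 0" by linarith
  with n show ?thesis by simp
qed

text \<open>Polar coordinates with the radius measured in units of \<rho>, so that the domain is the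
  image of a fixed rectangle and the boundary is at first coordinate 1.\<close>

definition star_map :: "(real \<Rightarrow> real) \<Rightarrow> real^2 \<Rightarrow> real^2" where
  "star_map \<rho> x = vector [x$1 * \<rho> (x$2) * cos (x$2), x$1 * \<rho> (x$2) * sin (x$2)]"

lemma norm_star_map: "norm (star_map \<rho> x) = \<bar>x$1 * \<rho> (x$2)\<bar>"
proof -
  have "(norm (star_map \<rho> x))\<^sup>2 = (x$1 * \<rho> (x$2))\<^sup>2 * ((cos (x$2))\<^sup>2 + (sin (x$2))\<^sup>2)"
    unfolding power2_norm_eq_inner by (simp add: star_map_def inner_vec_def sum_2 power2_eq_square del: sin_cos_squared_add sin_cos_squared_add2 sin_cos_squared_add3) (simp only: distrib_left mult_ac)
  then have "(norm (star_map \<rho> x))\<^sup>2 = \<bar>x$1 * \<rho> (x$2)\<bar>\<^sup>2" by simp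
  then show ?thesis by (rule power2_eq_imp_eq) auto
qed


locale star_radius =
  fixes \<rho> \<rho>1 :: "real \<Rightarrow> real"
  assumes \<rho>_pos: "\<And>t. \<rho> t > 0"
    and \<rho>_per: "\<And>t. \<rho> (t + 2 * pi) = \<rho> t"
    and \<rho>_deriv: "\<And>t. (\<rho> has_real_derivative \<rho>1 t) (at t)"
    and \<rho>1_cont: "continuous_on UNIV \<rho>1"
begin

lemma cont_\<rho>: "continuous_on A \<rho>"
  by (intro continuous_at_imp_continuous_on ballI DERIV_isCont[OF \<rho>_deriv])

lemma inj_on_star_map: "inj_on (star_map \<rho>) {x. 0 < x$1 \<and> a < x$2 \<and> x$2 < a + 2 * pi}"
proof
  fix x y :: "real^2"
  assume x: "x \<in> {x. 0 < x$1 \<and> a < x$2 \<and> x$2 < a + 2 * pi}" and y: "y \<in> {x. 0 < x$1 \<and> a < x$2 \<and> x$2 < a + 2 * pi}"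
    and eq: "star_map \<rho> x = star_map \<rho> y"
  define r where "r = x$1 * \<rho> (x$2)"
  have r: "r > 0" using x \<rho>_pos by (simp add: r_def)
  have "r = y$1 * \<rho> (y$2)"
    using arg_cong[OF eq, of norm] x y \<rho>_pos[of "x$2"] \<rho>_pos[of "y$2"] by (simp add: norm_star_map r_def abs_mult)
  then have "r * cos (x$2) = r * cos (y$2)" "r * sin (x$2) = r * sin (y$2)"
    using arg_cong[OF eq, of "\<lambda>v::real^2. v$1"] arg_cong[OF eq, of "\<lambda>v::real^2. v$2"] by (simp_all add: star_map_def r_def)
  then have cs: "cos (x$2) = cos (y$2)" "sin (x$2) = sin (y$2)" using r by simp_all
  have "x$2 = y$2"
  proof (rule angle_unique[OF cs])
    have "a < x$2" "x$2 < a + 2 * pi" "a < y$2" "y$2 < a + 2 * pi" using x y by auto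
    then show "\<bar>x$2 - y$2\<bar> < 2 * pi" by linarith
  qed
  moreover with \<open>r = y$1 * \<rho> (y$2)\<close> have "x$1 = y$1" using less_imp_neq[OF \<rho>_pos[of "y$2"]] unfolding r_def by simp
  ultimately show "x = y" by (simp add: vec_eq_iff forall_2)
qed

lemma star_map_has_derivative:
  "(star_map \<rho> has_derivative (\<lambda>h. vector [h$1 * (\<rho> (x$2) * cos (x$2)) + h$2 * (x$1 * (\<rho>1 (x$2) * cos (x$2) - \<rho> (x$2) * sin (x$2))),
      h$1 * (\<rho> (x$2) * sin (x$2)) + h$2 * (x$1 * (\<rho>1 (x$2) * sin (x$2) + \<rho> (x$2) * cos (x$2)))])) (at x within S)"
proof -
  have p: "((\<lambda>x. x $ i) has_derivative (\<lambda>h. h $ i)) (at x within S)" for i :: 2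
    by (rule bounded_linear_imp_has_derivative[OF bounded_linear_vec_nth])
  have r: "((\<lambda>x. \<rho> (x $ 2)) has_derivative (\<lambda>h. h $ 2 * \<rho>1 (x $ 2))) (at x within S)"
    using has_derivative_compose[OF p[of 2] \<rho>_deriv[of "x$2", unfolded has_field_derivative_def]]
    by (simp add: mult.commute)
  have c: "((\<lambda>x. cos (x $ 2)) has_derivative (\<lambda>h. h $ 2 * - sin (x $ 2))) (at x within S)"
    "((\<lambda>x. sin (x $ 2)) has_derivative (\<lambda>h. h $ 2 * cos (x $ 2))) (at x within S)"
    using has_derivative_compose[OF p[of 2] DERIV_cos[of "x$2", unfolded has_field_derivative_def]]
      has_derivative_compose[OF p[of 2] DERIV_sin[of "x$2", unfolded has_field_derivative_def]]
    by (simp_all add: mult.commute)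
  show ?thesis
  proof (subst has_derivative_componentwise_within, rule ballI)
    fix b :: "real^2" assume "b \<in> Basis"
    then obtain i where b: "b = axis i 1" by (auto simp: Basis_vec_def)
    show "((\<lambda>x. star_map \<rho> x \<bullet> b) has_derivative (\<lambda>h. vector [h$1 * (\<rho> (x$2) * cos (x$2)) + h$2 * (x$1 * (\<rho>1 (x$2) * cos (x$2) - \<rho> (x$2) * sin (x$2))),
      h$1 * (\<rho> (x$2) * sin (x$2)) + h$2 * (x$1 * (\<rho>1 (x$2) * sin (x$2) + \<rho> (x$2) * cos (x$2)))] \<bullet> b)) (at x within S)"
      using exhaust_2[of i]
    proof
      assume i: "i = 1"
      show ?thesis unfolding b i cart_eq_inner_axis[symmetric] star_map_def vector_2
        by (rule has_derivative_eq_rhs[OF has_derivative_mult[OF has_derivative_mult[OF p r] c(1)]]) (auto simp: fun_eq_iff algebra_simps)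
    next
      assume i: "i = 2"
      show ?thesis unfolding b i cart_eq_inner_axis[symmetric] star_map_def vector_2
        by (rule has_derivative_eq_rhs[OF has_derivative_mult[OF has_derivative_mult[OF p r] c(2)]]) (auto simp: fun_eq_iff algebra_simps)
    qed
  qed
qed

lemma continuous_on_star_map: "continuous_on A (star_map \<rho>)"
  by (rule has_derivative_continuous_on[OF star_map_has_derivative])

lemma star_domain_eq:
  "star_domain \<rho> = {x. \<exists>r t. 0 \<le> r \<and> r < 1 \<and> x = star_map \<rho> (vector [r, t])}"
proof -
  have 1: "r *\<^sub>R vector [cos t, sin t] = star_map \<rho> (vector [r / \<rho> t, t])" for r t
    using \<rho>_pos[of t] by (simp add: star_map_def vec_eq_iff forall_2)
  have 2: "star_map \<rho> (vector [r, t]) = (r * \<rho> t) *\<^sub>R vector [cos t, sin t]" for r t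
    by (simp add: star_map_def vec_eq_iff forall_2)
  show ?thesis
  proof (intro set_eqI iffI)
    fix x assume "x \<in> star_domain \<rho>"
    then obtain r t where "x = r *\<^sub>R vector [cos t, sin t]" "0 \<le> r" "r < \<rho> t" by (auto simp: star_domain_def)
    then show "x \<in> {x. \<exists>r t. 0 \<le> r \<and> r < 1 \<and> x = star_map \<rho> (vector [r, t])}"
      using 1[of r t] \<rho>_pos[of t] by (intro CollectI exI[of _ "r / \<rho> t"] exI[of _ t]) auto
  next
    fix x assume "x \<in> {x. \<exists>r t. 0 \<le> r \<and> r < 1 \<and> x = star_map \<rho> (vector [r, t])}"
    then obtain r t where "x = star_map \<rho> (vector [r, t])" "0 \<le> r" "r < 1" by auto
    then show "x \<in> star_domain \<rho>" using 2[of r t] \<rho>_pos[of t] unfolding star_domain_def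
      by (intro CollectI exI[of _ "r * \<rho> t"] exI[of _ t]) auto
  qed
qed

lemma star_map_period: "star_map \<rho> (vector [r, t + 2 * pi * of_int n]) = star_map \<rho> (vector [r, t])"
proof -
  have "\<rho> (t + 2 * pi * of_int n) = \<rho> t" using periodic_of_int[of \<rho> "2 * pi" t n] \<rho>_per by simp
  moreover have "cos (t + 2 * pi * of_int n) = cos t" "sin (t + 2 * pi * of_int n) = sin t"
    using cos.plus_of_int sin.plus_of_int by (simp_all add: cos_add sin_add)
  ultimately show ?thesis by (simp add: star_map_def)
qed

lemma star_domain_polar:
  assumes "x \<in> star_domain \<rho>"
  obtains r t where "0 \<le> r" "r < 1" "a \<le> t" "t < a + 2 * pi" "x = star_map \<rho> (vector [r, t])"
proof -
  obtain r t where rt: "0 \<le> r" "r < 1" "x = star_map \<rho> (vector [r, t])" using assms by (auto simp: star_domain_eq)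
  define n where "n = \<lceil>(a - t) / (2 * pi)\<rceil>"
  have "real_of_int n - 1 < (a - t) / (2 * pi)" "(a - t) / (2 * pi) \<le> real_of_int n" unfolding n_def by linarith+
  then have "(real_of_int n - 1) * (2 * pi) < a - t" "a - t \<le> real_of_int n * (2 * pi)"
    by (simp_all add: pos_less_divide_eq pos_divide_le_eq)
  then have "a \<le> t + 2 * pi * of_int n" "t + 2 * pi * of_int n < a + 2 * pi" by (simp_all add: algebra_simps)
  with rt show ?thesis using that[of r "t + 2 * pi * of_int n"] by (simp add: star_map_period)
qed

lemma \<rho>_bounds: obtains m M where "0 < m" "\<And>t. m \<le> \<rho> t" "\<And>t. \<rho> t \<le> M"
proof -
  obtain t0 where t0: "\<forall>t\<in>{0..2 * pi}. \<rho> t0 \<le> \<rho> t"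
    using continuous_attains_inf[OF compact_Icc _ cont_\<rho>, of 0 "2 * pi"] by auto
  obtain t1 where t1: "\<forall>t\<in>{0..2 * pi}. \<rho> t \<le> \<rho> t1"
    using continuous_attains_sup[OF compact_Icc _ cont_\<rho>, of 0 "2 * pi"] by auto
  have "\<rho> t0 \<le> \<rho> t \<and> \<rho> t \<le> \<rho> t1" for t
  proof -
    define n where "n = \<lfloor>t / (2 * pi)\<rfloor>"
    have "real_of_int n \<le> t / (2 * pi)" "t / (2 * pi) \<le> real_of_int n + 1" unfolding n_def by linarith+
    then have "t - of_int n * (2 * pi) \<in> {0..2 * pi}" by (simp add: pos_le_divide_eq pos_divide_le_eq algebra_simps)
    moreover have "\<rho> (t - of_int n * (2 * pi)) = \<rho> t" using periodic_of_int[of \<rho> "2 * pi" t "- n"] \<rho>_per by (simp add: mult_ac)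
    ultimately show ?thesis using t0 t1 by metis
  qed
  with \<rho>_pos[of t0] show ?thesis using that by blast
qed

lemma bounded_star_domain: "bounded (star_domain \<rho>)"
proof -
  obtain m M where M: "0 < m" "\<And>t. m \<le> \<rho> t" "\<And>t. \<rho> t \<le> M" by (rule \<rho>_bounds) blast
  have "norm x \<le> M" if "x \<in> star_domain \<rho>" for x
  proof -
    from that obtain r t where rt: "0 \<le> r" "r < 1" "x = star_map \<rho> (vector [r, t])" by (auto simp: star_domain_eq)
    have "norm x = r * \<rho> t" using rt \<rho>_pos[of t] by (simp add: norm_star_map)
    also have "\<dots> \<le> 1 * M" using rt M(3)[of t] \<rho>_pos[of t] by (intro mult_mono) auto
    finally show ?thesis by simp
  qed
  then show ?thesis unfolding bounded_iff by blast
qed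

lemma open_star_map_image: "open (star_map \<rho> ` {x. 0 < x$1 \<and> x$1 < 1 \<and> a < x$2 \<and> x$2 < a + 2 * pi})"
proof (rule invariance_of_domain[OF continuous_on_star_map])
  show "open {x::real^2. 0 < x$1 \<and> x$1 < 1 \<and> a < x$2 \<and> x$2 < a + 2 * pi}"
    by (intro open_Collect_conj open_Collect_less continuous_intros)
  show "inj_on (star_map \<rho>) {x. 0 < x$1 \<and> x$1 < 1 \<and> a < x$2 \<and> x$2 < a + 2 * pi}"
    by (rule inj_on_subset[OF inj_on_star_map[of a]]) auto
qed

lemma star_map_image_subset: "star_map \<rho> ` {x. 0 < x$1 \<and> x$1 < 1 \<and> a < x$2 \<and> x$2 < a + 2 * pi} \<subseteq> star_domain \<rho>"
proof
  fix y assume "y \<in> star_map \<rho> ` {x. 0 < x$1 \<and> x$1 < 1 \<and> a < x$2 \<and> x$2 < a + 2 * pi}"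
  then obtain x where x: "y = star_map \<rho> x" "0 < x$1" "x$1 < 1" by auto
  have "x = vector [x$1, x$2]" by (simp add: vec_eq_iff forall_2)
  with x show "y \<in> star_domain \<rho>" unfolding star_domain_eq by (metis (mono_tags, lifting) less_imp_le mem_Collect_eq)
qed

text \<open>Each open polar sector is open by invariance of domain. Two of them with cuts in
  opposite directions, together with a ball about the origin, cover the domain.\<close>

lemma open_star_domain: "open (star_domain \<rho>)"
proof -
  obtain m M where m: "0 < m" "\<And>t. m \<le> \<rho> t" "\<And>t. \<rho> t \<le> M" by (rule \<rho>_bounds) blast
  let ?U = "\<lambda>a. star_map \<rho> ` {x. 0 < x$1 \<and> x$1 < 1 \<and> a < x$2 \<and> x$2 < a + 2 * pi}"
  have eq: "star_domain \<rho> = ball 0 m \<union> ?U (-pi) \<union> ?U 0"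
  proof (intro equalityI Un_least star_map_image_subset subsetI)
    fix x assume "x \<in> star_domain \<rho>"
    then obtain r t where rt: "0 \<le> r" "r < 1" "-pi \<le> t" "t < -pi + 2 * pi" "x = star_map \<rho> (vector [r, t])"
      by (rule star_domain_polar[where a = "-pi"])
    consider "r = 0" | "r > 0" "t > -pi" | "r > 0" "t = -pi" using rt by linarith
    then show "x \<in> ball 0 m \<union> ?U (-pi) \<union> ?U 0"
    proof cases
      case 1
      then have "norm x = 0" using rt by (simp add: norm_star_map)
      then show ?thesis using m(1) by simp
    next
      case 2
      then have "x \<in> ?U (-pi)" using rt by (intro image_eqI[of _ _ "vector [r, t]"]) auto
      then show ?thesis by blast
    next
      case 3
      then have "x = star_map \<rho> (vector [r, pi])" using star_map_period[of r t 1] rt(5) by simp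
      then have "x \<in> ?U 0" using 3 rt by (intro image_eqI[of _ _ "vector [r, pi]"]) auto
      then show ?thesis by blast
    qed
  next
    fix x :: "real^2" assume x: "x \<in> ball 0 m"
    obtain t where t: "x $ 1 = norm x * cos t" "x $ 2 = norm x * sin t"
    proof (cases "x = 0")
      case False
      have "(x$1 / norm x)\<^sup>2 + (x$2 / norm x)\<^sup>2 = (x \<bullet> x) / (norm x)\<^sup>2"
        by (simp add: inner_vec_def sum_2 power_divide power2_eq_square add_divide_distrib)
      also have "\<dots> = 1" using False by (simp add: power2_norm_eq_inner)
      finally obtain t where "x$1 / norm x = cos t" "x$2 / norm x = sin t" using sincos_total_2pi by metis
      then show ?thesis using False that[of t] by (simp add: field_simps)
    qed (use that in auto)
    have "norm x / \<rho> t < 1" using x m(2)[of t] \<rho>_pos[of t] by (simp add: divide_less_eq)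
    moreover have "x = star_map \<rho> (vector [norm x / \<rho> t, t])" using t \<rho>_pos[of t] by (simp add: star_map_def vec_eq_iff forall_2)
    moreover have "0 \<le> norm x / \<rho> t" using \<rho>_pos[of t] by simp
    ultimately show "x \<in> star_domain \<rho>" unfolding star_domain_eq by blast
  qed
  show ?thesis unfolding eq by (intro open_Un open_ball open_star_map_image)
qed


lemma integral_star_domain:
  fixes F :: "real^2 \<Rightarrow> complex"
  assumes F: "continuous_on UNIV F"
  shows "integral\<^sup>L (lebesgue_on (star_domain \<rho>)) F
    = integral {0..1} (\<lambda>t. integral {-pi..pi} (\<lambda>\<theta>. complex_of_real (t * (\<rho> \<theta>)\<^sup>2) * F (star_map \<rho> (vector [t, \<theta>]))))"
proof -
  \<comment> \<open>The change of variables is carried out for vector-valued integrands; L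
    identifies complex values with the plane.\<close>
  define L where "L z = (vector [Re z, Im z] :: real^2)" for z
  have L: "bounded_linear L"
    by (rule linear_conv_bounded_linear[THEN iffD1], rule linearI) (simp_all add: L_def vec_eq_iff forall_2)
  have Linj: "z = w" if "L z = L w" for z w
    using that by (simp add: L_def vec_eq_iff forall_2 complex_eq_iff)
  define S where "S = {x :: real^2. 0 < x$1 \<and> x$1 < 1 \<and> -pi < x$2 \<and> x$2 < -pi + 2 * pi}"
  have S: "S = box (vector [0, -pi]) (vector [1, pi])" by (auto simp: S_def mem_box_cart forall_2)
  define C where "C = cbox (vector [0, -pi]) (vector [1, pi] :: real^2)"
  define G where "G x = complex_of_real (x$1 * (\<rho> (x$2))\<^sup>2) * F (star_map \<rho> x)" for x :: "real^2"
  let ?g' = "\<lambda>x h. vector [h$1 * (\<rho> (x$2) * cos (x$2)) + h$2 * (x$1 * (\<rho>1 (x$2) * cos (x$2) - \<rho> (x$2) * sin (x$2))),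
      h$1 * (\<rho> (x$2) * sin (x$2)) + h$2 * (x$1 * (\<rho>1 (x$2) * sin (x$2) + \<rho> (x$2) * cos (x$2)))] :: real^2"
  have det: "det (matrix (?g' x)) = x$1 * (\<rho> (x$2))\<^sup>2" for x :: "real^2"
  proof -
    have "det (matrix (?g' x)) = \<rho> (x$2) * cos (x$2) * (x$1 * (\<rho>1 (x$2) * sin (x$2) + \<rho> (x$2) * cos (x$2)))
        - (x$1 * (\<rho>1 (x$2) * cos (x$2) - \<rho> (x$2) * sin (x$2))) * (\<rho> (x$2) * sin (x$2))"
      by (simp add: det_2 matrix_def axis_def)
    also have "\<dots> = x$1 * (\<rho> (x$2))\<^sup>2 * ((cos (x$2))\<^sup>2 + (sin (x$2))\<^sup>2)" by algebra
    finally show ?thesis by simp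
  qed
  have cG: "continuous_on A G" for A
    unfolding G_def
    by (intro continuous_intros continuous_on_compose2[OF cont_\<rho>[of UNIV]] continuous_on_compose2[OF F]
        continuous_on_star_map) auto
  have LG: "\<bar>det (matrix (?g' x))\<bar> *\<^sub>R (L \<circ> F) (star_map \<rho> x) = (L \<circ> G) x" if "x \<in> S" for x
  proof -
    have "x$1 * (\<rho> (x$2))\<^sup>2 \<ge> 0" using that by (simp add: S_def)
    then show ?thesis unfolding det by (simp add: L_def G_def vec_eq_iff forall_2)
  qed
  have "(L \<circ> G) absolutely_integrable_on C" unfolding C_def
    by (rule absolutely_integrable_continuous) (intro continuous_on_compose cG linear_continuous_on L)
  then have absS: "(L \<circ> G) absolutely_integrable_on S"
    by (rule set_integrable_subset) (auto simp: S C_def intro: box_subset_cbox[THEN subsetD])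
  have intS: "integral S (L \<circ> G) = integral C (L \<circ> G)" unfolding S C_def by (rule integral_open_interval)
  have Sl: "S \<in> sets lebesgue" unfolding S by simp
  have "(\<lambda>x. \<bar>det (matrix (?g' x))\<bar> *\<^sub>R (L \<circ> F) (star_map \<rho> x)) absolutely_integrable_on S \<and>
      integral S (\<lambda>x. \<bar>det (matrix (?g' x))\<bar> *\<^sub>R (L \<circ> F) (star_map \<rho> x)) = integral C (L \<circ> G)"
  proof
    show "(\<lambda>x. \<bar>det (matrix (?g' x))\<bar> *\<^sub>R (L \<circ> F) (star_map \<rho> x)) absolutely_integrable_on S"
      using absS by (subst set_integrable_cong[OF refl refl LG]) auto
    show "integral S (\<lambda>x. \<bar>det (matrix (?g' x))\<bar> *\<^sub>R (L \<circ> F) (star_map \<rho> x)) = integral C (L \<circ> G)"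
      unfolding intS[symmetric] by (rule integral_cong[OF LG])
  qed
  then have "integral (star_map \<rho> ` S) (L \<circ> F) = integral C (L \<circ> G)"
    by (subst (asm) has_absolute_integral_change_of_variables[OF Sl star_map_has_derivative])
      (auto intro: inj_on_subset[OF inj_on_star_map[of "-pi"]] simp: S_def)
  moreover have "integral (star_domain \<rho>) (L \<circ> F) = integral (star_map \<rho> ` S) (L \<circ> F)"
  proof (rule integral_spike_set)
    \<comment> \<open>What the polar rectangle misses is the origin and the cut at angle -pi, both
      on the horizontal axis.\<close>
    have sub: "star_domain \<rho> - star_map \<rho> ` S \<subseteq> {x. x $ 2 = 0}"
    proof
      fix x assume x: "x \<in> star_domain \<rho> - star_map \<rho> ` S"
      then obtain r t where rt: "0 \<le> r" "r < 1" "-pi \<le> t" "t < -pi + 2 * pi" "x = star_map \<rho> (vector [r, t])"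
        using star_domain_polar[where a = "-pi"] by (metis DiffE)
      have "\<not> (0 < r \<and> -pi < t)"
      proof
        assume "0 < r \<and> -pi < t"
        then have "x \<in> star_map \<rho> ` S" using rt by (intro image_eqI[of _ _ "vector [r, t]"]) (auto simp: S_def)
        with x show False by simp
      qed
      then have "r = 0 \<or> t = -pi" using rt by linarith
      then show "x \<in> {x. x $ 2 = 0}" using rt(5) by (auto simp: star_map_def)
    qed
    then show "negligible {x \<in> star_domain \<rho> - star_map \<rho> ` S. (L \<circ> F) x \<noteq> 0}"
      by (intro negligible_subset[OF negligible_standard_hyperplane_cart[of 2]]) auto
    show "negligible {x \<in> star_map \<rho> ` S - star_domain \<rho>. (L \<circ> F) x \<noteq> 0}"
      using star_map_image_subset[of "-pi"] unfolding S_def by (simp add: Diff_eq_empty_iff[THEN iffD2])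
  qed
  ultimately have LL: "integral (star_domain \<rho>) (L \<circ> F) = integral C (L \<circ> G)" by simp
  note bd = bounded_star_domain open_star_domain
  have iF: "integrable (lebesgue_on (star_domain \<rho>)) F"
    using L2_on_mult_bounded_integrable[OF finite_measure_lebesgue_on[OF bd] L2_on_continuous(1)[OF bd F], where g = "\<lambda>x. 1" and B = 1] by simp
  have m: "star_domain \<rho> \<in> sets lebesgue" using open_star_domain by (simp add: borel_open)
  have "F integrable_on star_domain \<rho>" by (rule integrable_on_lebesgue_on[OF iF m])
  from integral_linear[OF this L] integral_linear[OF integrable_continuous[OF cG] L]
  have "L (integral (star_domain \<rho>) F) = L (integral C G)" using LL unfolding C_def by simp
  then have int_eq: "integral\<^sup>L (lebesgue_on (star_domain \<rho>)) F = integral C G"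
    using Linj lebesgue_integral_eq_integral[OF iF m] by simp
  have v: "continuous_on UNIV (\<lambda>p :: real \<times> real. vector [fst p, snd p] :: real^2)"
  proof (subst continuous_on_componentwise, rule ballI)
    fix b :: "real^2" assume "b \<in> Basis"
    then obtain i where b: "b = axis i 1" by (auto simp: Basis_vec_def)
    show "continuous_on UNIV (\<lambda>p :: real \<times> real. (vector [fst p, snd p] :: real^2) \<bullet> b)"
      unfolding b cart_eq_inner_axis[symmetric]
      using exhaust_2[of i] by (elim disjE) (simp_all add: continuous_on_fst continuous_on_snd continuous_on_id)
  qed
  note int_eq
  also have "integral C G = integral (cbox (0, -pi) (1, pi)) (\<lambda>p. G (vector [fst p, snd p]))"
  proof -
    have c: "continuous_on UNIV (\<lambda>p :: real \<times> real. G (vector [fst p, snd p]))"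
      by (rule continuous_on_compose2[OF cG[of UNIV] v]) simp
    have "((\<lambda>p. G (vector [fst p, snd p])) has_integral integral (cbox (0, -pi) (1, pi)) (\<lambda>p. G (vector [fst p, snd p]))) (cbox (0, -pi) (1, pi))"
      by (intro integrable_integral integrable_continuous continuous_on_subset[OF c]) auto
    from has_integral_vec2[OF this] have "((\<lambda>x. G (vector [x $ 1, x $ 2])) has_integral integral (cbox (0, -pi) (1, pi)) (\<lambda>p. G (vector [fst p, snd p]))) C"
      by (simp add: C_def)
    moreover have "vector [x $ 1, x $ 2] = x" for x :: "real^2" by (simp add: vec_eq_iff forall_2)
    ultimately show ?thesis by (simp add: integral_unique)
  qed
  also have "\<dots> = integral {0..1} (\<lambda>t. integral {-pi..pi} (\<lambda>\<theta>. G (vector [t, \<theta>])))"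
  proof -
    show ?thesis
      using integral_prod_continuous[of 0 "-pi" 1 pi "\<lambda>p. G (vector [fst p, snd p])"]
        continuous_on_compose2[OF cG[of UNIV] v] by (simp add: continuous_on_subset)
  qed
  finally show ?thesis by (simp add: G_def)
qed


section \<open>From the domain to its boundary\<close>

lemmas cont_comp_\<rho> = continuous_on_compose2[OF cont_\<rho>[of UNIV] _ subset_UNIV]
lemmas cont_comp_\<rho>1 = continuous_on_compose2[OF \<rho>1_cont _ subset_UNIV]

text \<open>With \<open>p = (cos \<xi>, sin \<xi>) + c (cos \<eta>, sin \<eta>)\<close> and \<open>V = (cos \<xi>, sin \<xi>) - c (cos \<eta>, sin \<eta>)\<close> this is the
  divergence theorem for \<open>exp (\<i> k p \<bullet> x) V\<close>, whose divergence is \<open>\<i> k (1 - c\<^sup>2) exp (\<i> k p \<bullet> x)\<close>.\<close>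
lemma plane_wave_divergence:
  fixes k c \<eta> \<xi> :: real
  defines "A \<equiv> \<lambda>\<theta>. cos (\<theta> - \<xi>) + c * cos (\<theta> - \<eta>)"
    and "vr \<equiv> \<lambda>\<theta>. cos (\<theta> - \<xi>) - c * cos (\<theta> - \<eta>)"
    and "vt \<equiv> \<lambda>\<theta>. c * sin (\<theta> - \<eta>) - sin (\<theta> - \<xi>)"
  shows "\<i> * complex_of_real (k * (1 - c\<^sup>2)) *
      integral {0..1} (\<lambda>t. integral {-pi..pi} (\<lambda>\<theta>. complex_of_real (t * (\<rho> \<theta>)\<^sup>2) * expi (k * t * \<rho> \<theta> * A \<theta>)))
    = integral {-pi..pi} (\<lambda>\<theta>. complex_of_real (\<rho> \<theta> * vr \<theta> - \<rho>1 \<theta> * vt \<theta>) * expi (k * \<rho> \<theta> * A \<theta>))"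
proof -
  define E where "E t \<theta> = expi (k * t * \<rho> \<theta> * A \<theta>)" for t \<theta>
  define p where "p \<theta> = \<rho> \<theta> * vr \<theta> - \<rho>1 \<theta> * vt \<theta>" for \<theta>
  define A' where "A' \<theta> = - sin (\<theta> - \<xi>) - c * sin (\<theta> - \<eta>)" for \<theta>
  \<comment> \<open>The divergence in polar form: \<open>dP\<close> is the radial derivative of
    \<open>t * p \<theta> * E t \<theta>\<close>, which at t = 1 is the flux density on the
    boundary, and \<open>dQ\<close> is the angular derivative of
    \<open>\<rho> \<theta> * vt \<theta> * E t \<theta>\<close>, whose integral over a period is
    0.\<close>
  define dP where "dP t \<theta> = complex_of_real (p \<theta>) * (E t \<theta> * (1 + \<i> * complex_of_real (k * t * \<rho> \<theta> * A \<theta>)))" for t \<theta>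
  define dQ where "dQ t \<theta> = (complex_of_real (\<rho>1 \<theta> * vt \<theta> - \<rho> \<theta> * vr \<theta>)
      + complex_of_real (\<rho> \<theta> * vt \<theta>) * (\<i> * complex_of_real (k * t * (\<rho>1 \<theta> * A \<theta> + \<rho> \<theta> * A' \<theta>)))) * E t \<theta>" for t \<theta>
  note cont = continuous_intros cont_comp_\<rho> cont_comp_\<rho>1
  have cE: "continuous_on UNIV (\<lambda>x. E (fst x) (snd x))" unfolding E_def A_def by (intro cont)
  have cE1: "continuous_on X (\<lambda>\<theta>. E t \<theta>)" "continuous_on X (\<lambda>t. E t \<theta>)" for X t \<theta> unfolding E_def A_def by (intro cont)+
  have cP: "continuous_on UNIV (\<lambda>x. dP (fst x) (snd x))" unfolding dP_def p_def E_def A_def vr_def vt_def by (intro cont)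
  have cP1: "continuous_on X (\<lambda>\<theta>. dP t \<theta>)" for X t unfolding dP_def p_def E_def A_def vr_def vt_def by (intro cont)
  have cQ1: "continuous_on X (\<lambda>\<theta>. dQ t \<theta>)" for X t unfolding dQ_def E_def A_def A'_def vr_def vt_def by (intro cont)
  have pt: "\<i> * complex_of_real (k * (1 - c\<^sup>2)) * (complex_of_real (t * (\<rho> \<theta>)\<^sup>2) * E t \<theta>) = dP t \<theta> + dQ t \<theta>" for t \<theta>
  proof -
    have "A \<theta> * vr \<theta> + A' \<theta> * vt \<theta> = ((cos (\<theta> - \<xi>))\<^sup>2 + (sin (\<theta> - \<xi>))\<^sup>2) - c\<^sup>2 * ((cos (\<theta> - \<eta>))\<^sup>2 + (sin (\<theta> - \<eta>))\<^sup>2)"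
      unfolding A_def vr_def A'_def vt_def by algebra
    then have "A \<theta> * vr \<theta> + A' \<theta> * vt \<theta> = 1 - c\<^sup>2" by simp
    then have "k * (1 - c\<^sup>2) * (t * (\<rho> \<theta>)\<^sup>2) = p \<theta> * (k * t * \<rho> \<theta> * A \<theta>) + (\<rho> \<theta> * vt \<theta>) * (k * t * (\<rho>1 \<theta> * A \<theta> + \<rho> \<theta> * A' \<theta>))"
      unfolding p_def by algebra
    then have "complex_of_real (k * (1 - c\<^sup>2)) * complex_of_real (t * (\<rho> \<theta>)\<^sup>2) = complex_of_real (p \<theta>) * complex_of_real (k * t * \<rho> \<theta> * A \<theta>)
        + complex_of_real (\<rho> \<theta> * vt \<theta>) * complex_of_real (k * t * (\<rho>1 \<theta> * A \<theta> + \<rho> \<theta> * A' \<theta>))"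
      unfolding of_real_mult[symmetric] of_real_add[symmetric] by (simp only:)
    moreover have "complex_of_real (\<rho>1 \<theta> * vt \<theta> - \<rho> \<theta> * vr \<theta>) = - complex_of_real (p \<theta>)" by (simp add: p_def)
    ultimately show ?thesis unfolding dP_def dQ_def by algebra
  qed
  have Q0: "integral {-pi..pi} (dQ t) = 0" for t
  proof (rule integral_periodic_derivative_0[where U = "\<lambda>\<theta>. complex_of_real (\<rho> \<theta> * vt \<theta>) * E t \<theta>"])
    fix \<theta>
    have dA: "(A has_real_derivative A' \<theta>) (at \<theta>)" "(vt has_real_derivative - vr \<theta>) (at \<theta>)"
      unfolding A_def vt_def by (auto intro!: derivative_eq_intros simp: A'_def vr_def)
    have "((\<lambda>\<theta>. k * t * (\<rho> \<theta> * A \<theta>)) has_real_derivative k * t * (\<rho>1 \<theta> * A \<theta> + A' \<theta> * \<rho> \<theta>)) (at \<theta>)"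
      by (rule DERIV_cmult[OF DERIV_mult[OF \<rho>_deriv dA(1)]])
    from has_vector_derivative_exp_i[OF this]
    have 1: "(E t has_vector_derivative (\<i> * complex_of_real (k * t * (\<rho>1 \<theta> * A \<theta> + \<rho> \<theta> * A' \<theta>))) * E t \<theta>) (at \<theta>)"
      by (simp add: E_def[abs_def] mult_ac)
    have "((\<lambda>\<theta>. \<rho> \<theta> * vt \<theta>) has_real_derivative \<rho>1 \<theta> * vt \<theta> - \<rho> \<theta> * vr \<theta>) (at \<theta>)"
      using DERIV_mult[OF \<rho>_deriv[of \<theta>] dA(2)] by (simp add: mult.commute)
    then have 2: "((\<lambda>\<theta>. complex_of_real (\<rho> \<theta> * vt \<theta>)) has_vector_derivative complex_of_real (\<rho>1 \<theta> * vt \<theta> - \<rho> \<theta> * vr \<theta>)) (at \<theta>)"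
      unfolding has_real_derivative_iff_has_vector_derivative by (rule bounded_linear.has_vector_derivative[OF bounded_linear_of_real])
    show "((\<lambda>\<theta>. complex_of_real (\<rho> \<theta> * vt \<theta>) * E t \<theta>) has_vector_derivative dQ t \<theta>) (at \<theta>)"
      using has_vector_derivative_mult[OF 2 1] by (simp add: dQ_def algebra_simps)
    show "complex_of_real (\<rho> (\<theta> + 2 * pi) * vt (\<theta> + 2 * pi)) * E t (\<theta> + 2 * pi) = complex_of_real (\<rho> \<theta> * vt \<theta>) * E t \<theta>"
    proof -
      have "cos (\<theta> + 2 * pi - a) = cos (\<theta> - a)" "sin (\<theta> + 2 * pi - a) = sin (\<theta> - a)" for a
        by (simp_all add: cos_diff sin_diff)
      then have "A (\<theta> + 2 * pi) = A \<theta>" "vt (\<theta> + 2 * pi) = vt \<theta>" by (simp_all add: A_def vt_def)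
      then show ?thesis by (simp add: E_def \<rho>_per)
    qed
  qed
  have P1: "integral {0..1} (\<lambda>t. dP t \<theta>) = complex_of_real (p \<theta>) * E 1 \<theta>" for \<theta>
  proof -
    have "((\<lambda>t. dP t \<theta>) has_integral complex_of_real (1 * p \<theta>) * E 1 \<theta> - complex_of_real (0 * p \<theta>) * E 0 \<theta>) {0..1}"
    proof (rule fundamental_theorem_of_calculus)
      fix t :: real
      have "((\<lambda>t. k * t * \<rho> \<theta> * A \<theta>) has_real_derivative k * \<rho> \<theta> * A \<theta>) (at t)" by (auto intro!: derivative_eq_intros)
      from has_vector_derivative_exp_i[OF this]
      have 1: "((\<lambda>t. E t \<theta>) has_vector_derivative (\<i> * complex_of_real (k * \<rho> \<theta> * A \<theta>)) * E t \<theta>) (at t)"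
        by (simp add: E_def mult_ac)
      have "((\<lambda>t. t * p \<theta>) has_real_derivative p \<theta>) (at t)" by (auto intro!: derivative_eq_intros)
      then have 2: "((\<lambda>t. complex_of_real (t * p \<theta>)) has_vector_derivative complex_of_real (p \<theta>)) (at t)"
        unfolding has_real_derivative_iff_has_vector_derivative by (rule bounded_linear.has_vector_derivative[OF bounded_linear_of_real])
      have "((\<lambda>t. complex_of_real (t * p \<theta>) * E t \<theta>) has_vector_derivative dP t \<theta>) (at t)"
        using has_vector_derivative_mult[OF 2 1] by (simp add: dP_def algebra_simps)
      then show "((\<lambda>t. complex_of_real (t * p \<theta>) * E t \<theta>) has_vector_derivative dP t \<theta>) (at t within {0..1})"
        by (rule has_vector_derivative_at_within)
    qed simp
    then show ?thesis by (simp add: integral_unique)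
  qed
  have "\<i> * complex_of_real (k * (1 - c\<^sup>2)) *
      integral {0..1} (\<lambda>t. integral {-pi..pi} (\<lambda>\<theta>. complex_of_real (t * (\<rho> \<theta>)\<^sup>2) * E t \<theta>))
    = integral {0..1} (\<lambda>t. integral {-pi..pi} (\<lambda>\<theta>. dP t \<theta> + dQ t \<theta>))"
    unfolding integral_mult_right[symmetric] pt ..
  also have "\<dots> = integral {0..1} (\<lambda>t. integral {-pi..pi} (dP t))"
    by (subst Henstock_Kurzweil_Integration.integral_add) (simp_all add: integrable_continuous_real cP1 cQ1 Q0)
  also have "\<dots> = integral {-pi..pi} (\<lambda>\<theta>. integral {0..1} (\<lambda>t. dP t \<theta>))"
    by (rule integral_swap_real[of "\<lambda>\<theta> t. dP t \<theta>"]) (rule continuous_on_compose2[OF cP, of UNIV "\<lambda>x. (snd x, fst x)", simplified], intro continuous_intros)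
  finally show ?thesis unfolding P1 by (simp add: E_def p_def)
qed

end

lemma continuous_on_integral_param_prod:
  fixes f :: "'a::topological_space \<Rightarrow> real \<Rightarrow> complex"
  assumes "continuous_on UNIV (\<lambda>p. f (fst p) (snd p))"
  shows "continuous_on UNIV (\<lambda>x. integral {a..b} (f x))"
proof -
  have "continuous_on (UNIV \<times> cbox a b) (\<lambda>(x, t). f x t)"
    unfolding case_prod_unfold by (rule continuous_on_subset[OF assms]) auto
  from integral_continuous_on_param[OF this] show ?thesis by simp
qed

context star_radius begin

text \<open>The Herglotz wave is a superposition of plane waves, so after exchanging integrals the
  divergence theorem is applied for each \<xi> separately. Substituting \<xi> = \<theta> + s
  introduces the relative angle.\<close>

lemma herglotz_orthogonality_boundary:
  fixes \<phi> :: "real \<Rightarrow> complex" and k c \<eta> :: real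
  assumes \<phi>: "continuous_on UNIV \<phi>" and \<phi>_per: "\<And>\<theta>. \<phi> (\<theta> + 2 * pi) = \<phi> \<theta>"
    and kc: "k \<noteq> 0" "c\<^sup>2 \<noteq> 1"
    and orth: "integral\<^sup>L (lebesgue_on (star_domain \<rho>))
      (\<lambda>x. herglotz k \<phi> x * expi (vector [k * c * cos \<eta>, k * c * sin \<eta>] \<bullet> x)) = 0"
  shows "integral {-pi..pi} (\<lambda>\<theta>. integral {-pi..pi} (\<lambda>s.
      \<phi> (\<theta> + s) * complex_of_real (\<rho> \<theta> * (cos s - c * cos (\<theta> - \<eta>)) - \<rho>1 \<theta> * (sin s + c * sin (\<theta> - \<eta>)))
      * expi (k * (\<rho> \<theta> * cos s + c * \<rho> \<theta> * cos (\<theta> - \<eta>))))) = 0"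
proof -
  define A where "A \<xi> \<theta> = cos (\<theta> - \<xi>) + c * cos (\<theta> - \<eta>)" for \<xi> \<theta>
  define p where "p \<xi> \<theta> = \<rho> \<theta> * (cos (\<theta> - \<xi>) - c * cos (\<theta> - \<eta>)) - \<rho>1 \<theta> * (c * sin (\<theta> - \<eta>) - sin (\<theta> - \<xi>))" for \<xi> \<theta>
  define G where "G t \<theta> \<xi> = \<phi> \<xi> * (complex_of_real (t * (\<rho> \<theta>)\<^sup>2) * expi (k * t * \<rho> \<theta> * A \<xi> \<theta>))" for t \<theta> \<xi>
  define B where "B \<theta> \<xi> = \<phi> \<xi> * (complex_of_real (p \<xi> \<theta>) * expi (k * \<rho> \<theta> * A \<xi> \<theta>))" for \<theta> \<xi>
  note cont = continuous_intros cont_comp_\<rho> cont_comp_\<rho>1 continuous_on_compose2[OF \<phi> _ subset_UNIV]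
  have cG: "continuous_on UNIV (\<lambda>x. G (f x) (g x) (h x))"
    if "continuous_on UNIV f" "continuous_on UNIV g" "continuous_on UNIV h" for f g h :: "'x::t2_space \<Rightarrow> real"
    unfolding G_def A_def by (intro cont that)
  have cB: "continuous_on UNIV (\<lambda>x. B (fst x) (snd x))" unfolding B_def p_def A_def by (intro cont)
  have "continuous_on UNIV (\<lambda>x. herglotz k \<phi> x * expi (vector [k * c * cos \<eta>, k * c * sin \<eta>] \<bullet> x))"
    by (intro continuous_intros continuous_on_herglotz[OF \<phi>])
  note int = integral_star_domain[OF this]
  have pt: "complex_of_real (t * (\<rho> \<theta>)\<^sup>2) * (herglotz k \<phi> (star_map \<rho> (vector [t, \<theta>]))
      * expi (vector [k * c * cos \<eta>, k * c * sin \<eta>] \<bullet> star_map \<rho> (vector [t, \<theta>]))) = integral {-pi..pi} (G t \<theta>)" for t \<theta>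
  proof -
    have e: "\<phi> \<xi> * expi (k * (cos \<xi> * star_map \<rho> (vector [t, \<theta>]) $ 1 + sin \<xi> * star_map \<rho> (vector [t, \<theta>]) $ 2))
        * (complex_of_real (t * (\<rho> \<theta>)\<^sup>2) * expi (vector [k * c * cos \<eta>, k * c * sin \<eta>] \<bullet> star_map \<rho> (vector [t, \<theta>]))) = G t \<theta> \<xi>" for \<xi>
    proof -
      have "k * (cos \<xi> * star_map \<rho> (vector [t, \<theta>]) $ 1 + sin \<xi> * star_map \<rho> (vector [t, \<theta>]) $ 2)
          + vector [k * c * cos \<eta>, k * c * sin \<eta>] \<bullet> star_map \<rho> (vector [t, \<theta>]) = k * t * \<rho> \<theta> * A \<xi> \<theta>"
        by (simp add: star_map_def inner_vec_def sum_2 A_def cos_diff algebra_simps)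
      then have "expi (k * t * \<rho> \<theta> * A \<xi> \<theta>) = expi (k * (cos \<xi> * star_map \<rho> (vector [t, \<theta>]) $ 1 + sin \<xi> * star_map \<rho> (vector [t, \<theta>]) $ 2))
        * expi (vector [k * c * cos \<eta>, k * c * sin \<eta>] \<bullet> star_map \<rho> (vector [t, \<theta>]))"
        unfolding exp_add[symmetric] distrib_left[symmetric] of_real_add[symmetric] by simp
      then show ?thesis by (simp add: G_def)
    qed
    show ?thesis unfolding herglotz_def e[symmetric] by (subst integral_mult_left) (simp add: mult_ac)
  qed
  have 0: "integral {0..1} (\<lambda>t. integral {-pi..pi} (\<lambda>\<theta>. integral {-pi..pi} (G t \<theta>))) = 0"
    using int orth unfolding pt by simp
  have "integral {0..1} (\<lambda>t. integral {-pi..pi} (\<lambda>\<theta>. integral {-pi..pi} (G t \<theta>)))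
      = integral {0..1} (\<lambda>t. integral {-pi..pi} (\<lambda>\<xi>. integral {-pi..pi} (\<lambda>\<theta>. G t \<theta> \<xi>)))"
    by (subst integral_swap_real) (auto intro!: cG continuous_intros)
  also have "\<dots> = integral {-pi..pi} (\<lambda>\<xi>. integral {0..1} (\<lambda>t. integral {-pi..pi} (\<lambda>\<theta>. G t \<theta> \<xi>)))"
    by (rule integral_swap_real[of "\<lambda>\<xi> t. integral {-pi..pi} (\<lambda>\<theta>. G t \<theta> \<xi>)"])
      (intro continuous_on_integral_param_prod cG continuous_intros)
  also have "(\<lambda>\<xi>. integral {0..1} (\<lambda>t. integral {-pi..pi} (\<lambda>\<theta>. G t \<theta> \<xi>)))
      = (\<lambda>\<xi>. \<phi> \<xi> * integral {0..1} (\<lambda>t. integral {-pi..pi} (\<lambda>\<theta>. complex_of_real (t * (\<rho> \<theta>)\<^sup>2) * expi (k * t * \<rho> \<theta> * A \<xi> \<theta>))))"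
    unfolding G_def by simp
  finally have "\<i> * complex_of_real (k * (1 - c\<^sup>2)) * integral {-pi..pi} (\<lambda>\<xi>. \<phi> \<xi> * integral {0..1} (\<lambda>t. integral {-pi..pi}
      (\<lambda>\<theta>. complex_of_real (t * (\<rho> \<theta>)\<^sup>2) * expi (k * t * \<rho> \<theta> * A \<xi> \<theta>)))) = 0"
    using 0 by simp
  then have "integral {-pi..pi} (\<lambda>\<xi>. \<phi> \<xi> * (\<i> * complex_of_real (k * (1 - c\<^sup>2)) * integral {0..1} (\<lambda>t. integral {-pi..pi}
      (\<lambda>\<theta>. complex_of_real (t * (\<rho> \<theta>)\<^sup>2) * expi (k * t * \<rho> \<theta> * A \<xi> \<theta>))))) = 0"
    unfolding mult.left_commute[of "\<phi> _"] integral_mult_right .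
  then have "integral {-pi..pi} (\<lambda>\<xi>. integral {-pi..pi} (\<lambda>\<theta>. B \<theta> \<xi>)) = 0"
    unfolding A_def plane_wave_divergence unfolding integral_mult_right[symmetric] B_def p_def A_def .
  then have B0: "integral {-pi..pi} (\<lambda>\<theta>. integral {-pi..pi} (B \<theta>)) = 0"
    using integral_swap_real[of B, OF cB] by simp
  have "integral {-pi..pi} (B \<theta>) = integral {-pi..pi} (\<lambda>s. \<phi> (\<theta> + s) * complex_of_real (\<rho> \<theta> * (cos s - c * cos (\<theta> - \<eta>)) - \<rho>1 \<theta> * (sin s + c * sin (\<theta> - \<eta>)))
      * expi (k * (\<rho> \<theta> * cos s + c * \<rho> \<theta> * cos (\<theta> - \<eta>))))" for \<theta>
  proof -
    have "integral {-pi..pi} (B \<theta>) = integral {-pi..pi} (\<lambda>s. B \<theta> (s + \<theta>))"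
    proof (rule integral_periodic_shift[symmetric])
      show "continuous_on UNIV (B \<theta>)" unfolding B_def p_def A_def by (intro cont)
      show "B \<theta> (x + 2 * pi) = B \<theta> x" for x
      proof -
        have "cos (\<theta> - (x + 2 * pi)) = cos (\<theta> - x)" "sin (\<theta> - (x + 2 * pi)) = sin (\<theta> - x)"
          by (simp_all add: cos_diff sin_diff)
        then show ?thesis by (simp add: B_def p_def A_def \<phi>_per)
      qed
    qed
    also have "(\<lambda>s. B \<theta> (s + \<theta>)) = (\<lambda>s. \<phi> (\<theta> + s) * complex_of_real (\<rho> \<theta> * (cos s - c * cos (\<theta> - \<eta>)) - \<rho>1 \<theta> * (sin s + c * sin (\<theta> - \<eta>)))
      * expi (k * (\<rho> \<theta> * cos s + c * \<rho> \<theta> * cos (\<theta> - \<eta>))))"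
      by (simp add: fun_eq_iff B_def p_def A_def algebra_simps)
    finally show ?thesis .
  qed
  with B0 show ?thesis by simp
qed

end

section \<open>Exponential sums\<close>

text \<open>An unbounded set of common zeros contains a suitable sequence. A bounded one
  accumulates, and since each integral is entire in k, the identity theorem makes all of them vanish
  identically; any sequence then does.\<close>

lemma infinite_zero_frequencies:
  fixes a :: "'i \<Rightarrow> real \<times> real \<Rightarrow> complex" and \<Phi> :: "'i \<Rightarrow> real \<times> real \<Rightarrow> real"
  defines "I \<equiv> \<lambda>i k. integral (cbox (-pi, -pi) (pi, pi)) (\<lambda>p. a i p * expi (k * \<Phi> i p))"
  assumes a: "\<And>i. continuous_on UNIV (a i)" and \<Phi>: "\<And>i. continuous_on UNIV (\<Phi> i)"
    and inf: "infinite {k. k > 0 \<and> (\<forall>i. I i k = 0)}"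
  obtains \<kappa> :: "nat \<Rightarrow> real" where "filterlim \<kappa> at_top sequentially" "\<And>n. \<kappa> n > 0" "\<And>i n. I i (\<kappa> n) = 0"
proof (cases "bounded {k. k > 0 \<and> (\<forall>i. I i k = 0)}")
  case False
  have "\<exists>k. k \<ge> real n \<and> k > 0 \<and> (\<forall>i. I i k = 0)" for n
  proof -
    from False obtain k where "k > 0" "\<forall>i. I i k = 0" "\<not> norm k \<le> real n" unfolding bounded_iff by blast
    then show ?thesis by (intro exI[of _ k]) auto
  qed
  then obtain \<kappa> where \<kappa>: "\<And>n. \<kappa> n \<ge> real n" "\<And>n. \<kappa> n > 0" "\<And>n i. I i (\<kappa> n) = 0" by metis
  have "filterlim \<kappa> at_top sequentially"
    by (rule filterlim_at_top_mono[OF filterlim_real_sequentially]) (simp add: \<kappa>(1))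
  with \<kappa> show ?thesis using that by blast
next
  case True
  define Z where "Z = complex_of_real ` {k. k > 0 \<and> (\<forall>i. I i k = 0)}"
  have "infinite Z" unfolding Z_def using inf by (simp add: finite_image_iff inj_on_def)
  moreover have "bounded Z" using True unfolding Z_def bounded_iff by auto
  ultimately obtain w where w: "w islimpt Z" using bounded_infinite_imp_islimpt by blast
  define f where "f i z = integral (cbox (-pi, -pi) (pi, pi)) (\<lambda>p. a i p * exp (\<i> * (z * complex_of_real (\<Phi> i p))))" for i z
  have fI: "f i (complex_of_real k) = I i k" for i k by (simp add: f_def I_def)
  note cont = continuous_intros continuous_on_compose2[OF a _ subset_UNIV] continuous_on_compose2[OF \<Phi> _ subset_UNIV]
  have hol: "f i holomorphic_on UNIV" for i
    unfolding f_def
  proof (rule leibniz_rule_holomorphic)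
    show "((\<lambda>z. a i p * exp (\<i> * (z * complex_of_real (\<Phi> i p)))) has_field_derivative
        a i p * (exp (\<i> * (z * complex_of_real (\<Phi> i p))) * (\<i> * complex_of_real (\<Phi> i p)))) (at z within UNIV)" for z p
      by (auto intro!: derivative_eq_intros)
    show "(\<lambda>p. a i p * exp (\<i> * (z * complex_of_real (\<Phi> i p)))) integrable_on cbox (-pi, -pi) (pi, pi)" for z
      by (intro integrable_continuous cont)
    show "continuous_on (UNIV \<times> cbox (-pi, -pi) (pi, pi)) (\<lambda>(z, p). a i p * (exp (\<i> * (z * complex_of_real (\<Phi> i p))) * (\<i> * complex_of_real (\<Phi> i p))))"
      unfolding case_prod_unfold by (intro cont)
  qed auto
  have "f i z = 0" for i z
    by (rule analytic_continuation[OF hol open_UNIV connected_UNIV subset_UNIV UNIV_I w])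
      (auto simp: Z_def fI)
  then have I0: "I i k = 0" for i k by (metis fI)
  show ?thesis
  proof (rule that)
    show "filterlim (\<lambda>n. real (Suc n)) at_top sequentially"
      by (rule filterlim_at_top_mono[OF filterlim_real_sequentially]) simp
  qed (simp_all add: I0)
qed

text \<open>Multiply by \<open>exp (- \<i> \<kappa> (h i))\<close> and average over a short interval next to \<open>y\<close>: by the Riemann--Lebesgue
  lemma only the terms whose phase has the same slope at \<open>y\<close> survive.\<close>
lemma exponential_sum_coefficient_bound:
  fixes a :: "'j \<Rightarrow> real \<Rightarrow> complex" and h h' :: "'j \<Rightarrow> real \<Rightarrow> real" and \<kappa> :: "nat \<Rightarrow> real"
  assumes J: "finite J" "i \<in> J"
    and a: "\<And>j. j \<in> J \<Longrightarrow> continuous_on UNIV (a j)"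
    and h: "\<And>j x. j \<in> J \<Longrightarrow> (h j has_real_derivative h' j x) (at x)"
    and h': "\<And>j. j \<in> J \<Longrightarrow> continuous_on UNIV (h' j)"
    and \<kappa>: "filterlim \<kappa> at_top sequentially"
    and lim: "\<And>x. (\<lambda>n. \<Sum>j\<in>J. expi (\<kappa> n * h j x) * a j x) \<longlonglongrightarrow> 0"
  shows "cmod (a i y) \<le> (\<Sum>j | j \<in> J \<and> j \<noteq> i \<and> h' j y = h' i y. cmod (a j y))"
proof -
  \<comment> \<open>C collects the other indices with the same slope at y, N those with a different
    one.\<close>
  define C where "C = {j \<in> J. j \<noteq> i \<and> h' j y = h' i y}"
  define N where "N = {j \<in> J. h' j y \<noteq> h' i y}"
  have fin: "finite C" "finite N" using J by (auto simp: C_def N_def)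
  have split: "sum g J = g i + sum g C + sum g N" for g :: "'j \<Rightarrow> complex"
  proof -
    have "J = insert i (C \<union> N)" using J by (auto simp: C_def N_def)
    moreover have "i \<notin> C \<union> N" "C \<inter> N = {}" by (auto simp: C_def N_def)
    ultimately show ?thesis using fin by (simp add: sum.union_disjoint add.assoc)
  qed
  have ch: "continuous_on X (h j)" if "j \<in> J" for j X
    using h[OF that] by (intro continuous_at_imp_continuous_on ballI DERIV_isCont)
  have ca: "continuous_on X (a j)" if "j \<in> J" for j X using continuous_on_subset[OF a[OF that]] by simp
  have main: "cmod (a i y) \<le> (\<Sum>j\<in>C. cmod (a j y)) + e * (1 + real (card C))" if e: "e > 0" for e
  proof -
    have "\<forall>\<^sub>F x in nhds y. \<forall>j\<in>J. cmod (a j x - a j y) < e"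
    proof (rule eventually_ball_finite[OF J(1)], rule ballI)
      fix j assume "j \<in> J"
      then have "isCont (a j) y" using a continuous_on_eq_continuous_at open_UNIV by blast
      then have "(a j \<longlongrightarrow> a j y) (nhds y)" using isCont_def tendsto_nhds_iff by blast
      from tendstoD[OF this e] show "\<forall>\<^sub>F x in nhds y. cmod (a j x - a j y) < e" by (simp add: dist_norm)
    qed
    moreover have "\<forall>\<^sub>F x in nhds y. \<forall>j\<in>N. h' j x - h' i x \<noteq> 0"
    proof (rule eventually_ball_finite[OF fin(2)], rule ballI)
      fix j assume j: "j \<in> N"
      then have "isCont (\<lambda>x. h' j x - h' i x) y"
        using h' J unfolding N_def by (intro continuous_intros) (use continuous_on_eq_continuous_at open_UNIV in blast)+
      then have "((\<lambda>x. h' j x - h' i x) \<longlongrightarrow> h' j y - h' i y) (nhds y)" using isCont_def tendsto_nhds_iff by fastforce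
      from tendsto_imp_eventually_ne[OF this, of 0] j show "\<forall>\<^sub>F x in nhds y. h' j x - h' i x \<noteq> 0" by (simp add: N_def)
    qed
    ultimately have "\<forall>\<^sub>F x in nhds y. (\<forall>j\<in>J. cmod (a j x - a j y) < e) \<and> (\<forall>j\<in>N. h' j x - h' i x \<noteq> 0)"
      by (rule eventually_conj)
    then obtain d where d: "d > 0" "\<And>x. dist x y < d \<Longrightarrow> (\<forall>j\<in>J. cmod (a j x - a j y) < e) \<and> (\<forall>j\<in>N. h' j x - h' i x \<noteq> 0)"
      unfolding eventually_nhds_metric by blast
    \<comment> \<open>On [y, y + \<delta>] all coefficients stay within e of their values at y, and
      the slopes of indices in N stay different from that of i.\<close>
    define \<delta> where "\<delta> = d / 2"
    have \<delta>: "\<delta> > 0" using d by (simp add: \<delta>_def)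
    have near: "cmod (a j x - a j y) \<le> e" if "j \<in> J" "x \<in> {y..y + \<delta>}" for j x
      using d(2)[of x] that \<delta> by (auto simp: \<delta>_def dist_real_def intro: less_imp_le)
    have nz: "h' j x - h' i x \<noteq> 0" if "j \<in> N" "x \<in> {y..y + \<delta>}" for j x
      using d(2)[of x] that \<delta> by (auto simp: \<delta>_def dist_real_def)
    define R where "R j n = integral {y..y + \<delta>} (\<lambda>x. a j x * expi (\<kappa> n * (h j x - h i x)))" for j n
    define I where "I n = integral {y..y + \<delta>} (\<lambda>x. (\<Sum>j\<in>J. expi (\<kappa> n * h j x) * a j x) * exp (- (\<i> * complex_of_real (\<kappa> n * h i x))))" for n
    have cI: "continuous_on X (\<lambda>x. \<Sum>j\<in>J. expi (\<kappa> n * h j x) * a j x)" for n X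
      by (intro continuous_intros ch ca)
    have I0: "I \<longlonglongrightarrow> 0" unfolding I_def[abs_def]
    proof (rule integral_tendsto_0_negligible[where T = "{}" and h = "\<lambda>x. \<Sum>j\<in>J. cmod (a j x)"])
      show "(\<lambda>x. (\<Sum>j\<in>J. expi (\<kappa> n * h j x) * a j x) * exp (- (\<i> * complex_of_real (\<kappa> n * h i x)))) integrable_on {y..y + \<delta>}" for n
        by (intro integrable_continuous_real continuous_intros cI ch J)
      show "(\<lambda>x. \<Sum>j\<in>J. cmod (a j x)) integrable_on {y..y + \<delta>}"
        by (intro integrable_continuous_real continuous_intros ca)
      have e1: "cmod (exp (- (\<i> * complex_of_real t))) = 1" for t by (simp add: norm_exp_eq_Re)
      show "norm ((\<Sum>j\<in>J. expi (\<kappa> n * h j x) * a j x) * exp (- (\<i> * complex_of_real (\<kappa> n * h i x)))) \<le> (\<Sum>j\<in>J. cmod (a j x))" for n x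
        unfolding norm_mult e1 mult_1_right by (rule order_trans[OF norm_sum]) (simp add: norm_mult)
      show "(\<lambda>n. (\<Sum>j\<in>J. expi (\<kappa> n * h j x) * a j x) * exp (- (\<i> * complex_of_real (\<kappa> n * h i x)))) \<longlonglongrightarrow> 0" for x
      proof (rule Lim_null_comparison[OF _ tendsto_norm_zero[OF lim[of x]]])
        show "\<forall>\<^sub>F n in sequentially. norm ((\<Sum>j\<in>J. expi (\<kappa> n * h j x) * a j x) * exp (- (\<i> * complex_of_real (\<kappa> n * h i x))))
            \<le> norm (\<Sum>j\<in>J. expi (\<kappa> n * h j x) * a j x)"
          unfolding norm_mult e1 by simp
      qed
    qed simp
    have IR: "I n = integral {y..y + \<delta>} (a i) + (\<Sum>j\<in>C. R j n) + (\<Sum>j\<in>N. R j n)" for n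
    proof -
      have "(\<Sum>j\<in>J. expi (\<kappa> n * h j x) * a j x) * exp (- (\<i> * complex_of_real (\<kappa> n * h i x)))
          = (\<Sum>j\<in>J. a j x * expi (\<kappa> n * (h j x - h i x)))" for x
        unfolding sum_distrib_right
        by (rule sum.cong) (simp_all add: exp_minus exp_diff right_diff_distrib divide_inverse mult_ac)
      then have "I n = (\<Sum>j\<in>J. R j n)" unfolding I_def R_def
        by (simp only:) (intro integral_sum J integrable_continuous_real continuous_intros ch ca, auto)
      also have "\<dots> = R i n + (\<Sum>j\<in>C. R j n) + (\<Sum>j\<in>N. R j n)" by (rule split)
      finally show ?thesis by (simp add: R_def)
    qed
    have RN: "(\<lambda>n. \<Sum>j\<in>N. cmod (R j n)) \<longlonglongrightarrow> 0"
    proof (rule tendsto_null_sum)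
      fix j assume j: "j \<in> N"
      then have jJ: "j \<in> J" by (simp add: N_def)
      have "R j \<longlonglongrightarrow> 0" unfolding R_def[abs_def]
      proof (rule Riemann_Lebesgue_phase[where \<psi>' = "\<lambda>x. h' j x - h' i x"])
        show "((\<lambda>x. h j x - h i x) has_real_derivative h' j x - h' i x) (at x within {y..y + \<delta>})" for x
          by (rule has_field_derivative_at_within[OF DERIV_diff[OF h[OF jJ] h[OF J(2)]]])
        show "continuous_on {y..y + \<delta>} (\<lambda>x. h' j x - h' i x)"
          by (intro continuous_intros continuous_on_subset[OF h'] jJ J) auto
      qed (use \<delta> nz j jJ ca \<kappa> in auto)
      then show "(\<lambda>n. cmod (R j n)) \<longlonglongrightarrow> 0" by (rule tendsto_norm_zero)
    qed
    have RC: "cmod (R j n) \<le> (cmod (a j y) + e) * \<delta>" if j: "j \<in> C" for j n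
    proof -
      have jJ: "j \<in> J" using j by (simp add: C_def)
      have "cmod (R j n) \<le> (cmod (a j y) + e) * (y + \<delta> - y)" unfolding R_def
      proof (rule norm_integral_le_real)
        show "continuous_on {y..y + \<delta>} (\<lambda>x. a j x * expi (\<kappa> n * (h j x - h i x)))"
          by (intro continuous_intros ch ca jJ J)
        fix x assume "x \<in> {y..y + \<delta>}"
        from near[OF jJ this] norm_triangle_ineq2[of "a j x" "a j y"]
        show "norm (a j x * expi (\<kappa> n * (h j x - h i x))) \<le> cmod (a j y) + e"
          by (simp add: norm_mult del: of_real_mult of_real_diff)
      qed (use \<delta> in simp)
      then show ?thesis by simp
    qed
    have ai: "\<delta> * cmod (a i y) - e * \<delta> \<le> cmod (integral {y..y + \<delta>} (a i))"
    proof -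
      have "cmod (integral {y..y + \<delta>} (\<lambda>x. a i x - a i y)) \<le> e * (y + \<delta> - y)"
        by (rule norm_integral_le_real) (use \<delta> near[OF J(2)] in \<open>auto intro!: continuous_intros ca J\<close>)
      moreover have "integral {y..y + \<delta>} (\<lambda>x. a i x - a i y) = integral {y..y + \<delta>} (a i) - \<delta> *\<^sub>R a i y"
        using \<delta> by (subst Henstock_Kurzweil_Integration.integral_diff) (auto intro!: integrable_continuous_real ca J)
      moreover have "cmod (\<delta> *\<^sub>R a i y) = \<delta> * cmod (a i y)" using \<delta> by simp
      moreover have "cmod (\<delta> *\<^sub>R a i y) - cmod (integral {y..y + \<delta>} (a i)) \<le> cmod (integral {y..y + \<delta>} (a i) - \<delta> *\<^sub>R a i y)"
        using norm_triangle_ineq2[of "\<delta> *\<^sub>R a i y" "integral {y..y + \<delta>} (a i)"] by (simp add: norm_minus_commute)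
      ultimately show ?thesis using \<delta> by simp
    qed
    have "(\<lambda>n. cmod (I n) + (\<Sum>j\<in>N. cmod (R j n))) \<longlonglongrightarrow> 0 + 0"
      by (intro tendsto_add tendsto_norm_zero I0 RN)
    moreover have "\<delta> * cmod (a i y) - e * \<delta> - (\<Sum>j\<in>C. (cmod (a j y) + e) * \<delta>) \<le> cmod (I n) + (\<Sum>j\<in>N. cmod (R j n))" for n
    proof -
      have "integral {y..y + \<delta>} (a i) = I n - (\<Sum>j\<in>C. R j n) - (\<Sum>j\<in>N. R j n)" unfolding IR by simp
      then have "cmod (integral {y..y + \<delta>} (a i)) \<le> cmod (I n) + cmod (\<Sum>j\<in>C. R j n) + cmod (\<Sum>j\<in>N. R j n)"
        by (metis (no_types, lifting) add_mono_thms_linordered_semiring(3) norm_triangle_ineq4 order_trans)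
      also have "\<dots> \<le> cmod (I n) + (\<Sum>j\<in>C. (cmod (a j y) + e) * \<delta>) + (\<Sum>j\<in>N. cmod (R j n))"
        by (intro add_mono order_refl norm_sum order_trans[OF norm_sum sum_mono] RC)
      finally show ?thesis using ai by linarith
    qed
    ultimately have "\<delta> * cmod (a i y) - e * \<delta> - (\<Sum>j\<in>C. (cmod (a j y) + e) * \<delta>) \<le> 0"
      by (intro LIMSEQ_le_const[where X = "\<lambda>n. cmod (I n) + (\<Sum>j\<in>N. cmod (R j n))"]) auto
    then have "\<delta> * (cmod (a i y) - e - (\<Sum>j\<in>C. cmod (a j y) + e)) \<le> 0"
      unfolding sum_distrib_right[symmetric] by (simp only: right_diff_distrib mult.commute[of \<delta>])
    then have "cmod (a i y) - e - (\<Sum>j\<in>C. cmod (a j y) + e) \<le> 0" using \<delta> by (simp add: mult_le_0_iff)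
    then show ?thesis by (simp add: sum.distrib algebra_simps)
  qed
  have "cmod (a i y) \<le> (\<Sum>j\<in>C. cmod (a j y))"
  proof (rule field_le_epsilon)
    fix e :: real assume e: "e > 0"
    \<comment> \<open>The error e enters \<open>main\<close> once for i and once for each element of
      C, hence the division.\<close>
    have "cmod (a i y) \<le> (\<Sum>j\<in>C. cmod (a j y)) + (e / (1 + real (card C))) * (1 + real (card C))"
      by (rule main) (use e in \<open>simp add: add_pos_nonneg\<close>)
    then show "cmod (a i y) \<le> (\<Sum>j\<in>C. cmod (a j y)) + e" by (simp add: add_nonneg_eq_0_iff)
  qed
  then show ?thesis by (simp add: C_def)
qed

section \<open>Vanishing of the Herglotz density\<close>

locale star_wave = star_curve +
  fixes \<phi> \<phi>1 :: "real \<Rightarrow> complex" and \<kappa> :: "nat \<Rightarrow> real"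
  assumes \<phi>_deriv: "\<And>x. (\<phi> has_vector_derivative \<phi>1 x) (at x)"
    and \<phi>1_cont: "continuous_on UNIV \<phi>1"
    and \<phi>_per: "\<And>x. \<phi> (x + 2 * pi) = \<phi> x"
    and \<kappa>: "filterlim \<kappa> at_top sequentially" and \<kappa>_pos: "\<And>n. \<kappa> n > 0"
    and vanish: "\<And>\<eta> n. integral {-pi..pi} (\<lambda>\<theta>. integral {-pi..pi} (\<lambda>s.
      \<phi> (\<theta> + s) * complex_of_real (\<rho> \<theta> * (cos s - c * cos (\<theta> - \<eta>)) - \<rho>1 \<theta> * (sin s + c * sin (\<theta> - \<eta>)))
      * expi (\<kappa> n * (\<rho> \<theta> * cos s + c * \<rho> \<theta> * cos (\<theta> - \<eta>))))) = 0"
begin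

lemma cont_\<phi>: "continuous_on A f \<Longrightarrow> continuous_on A (\<lambda>x. \<phi> (f x))"
  using continuous_on_compose2[OF _ _ subset_UNIV, of \<phi> A f] \<phi>_deriv
  by (meson continuous_at_imp_continuous_on has_vector_derivative_continuous)

lemma cont_\<phi>1: "continuous_on A f \<Longrightarrow> continuous_on A (\<lambda>x. \<phi>1 (f x))"
  by (rule continuous_on_compose2[OF \<phi>1_cont _ subset_UNIV])

lemma \<phi>_shift_deriv: "((\<lambda>x. \<phi> (x + d)) has_vector_derivative \<phi>1 (x + d)) (at x)"
proof -
  have "((\<lambda>x. x + d) has_vector_derivative 1) (at x)" by (auto intro!: derivative_eq_intros)
  from vector_diff_chain_at[OF this \<phi>_deriv] show ?thesis by (simp add: o_def)
qed

lemmas cont_all = continuous_intros cont_\<phi> cont_\<phi>1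

text \<open>The density at incidence angle t + s for the two stationary values s = 0 and s = pi.
  \<open>amp\<close> is the amplitude there, with \<open>cos s = \<sigma>\<close> and
  \<open>sin s = 0\<close>, and \<open>boundary_amp\<close> adds the constant of the
  s-integral.\<close>

definition "\<phi>s \<sigma> t = (if \<sigma> = 1 then \<phi> t else \<phi> (t + pi))" for \<sigma> :: real
definition "amp \<sigma> \<eta> t = \<rho> t * (\<sigma> - c * cos (t - \<eta>)) - \<rho>1 t * (c * sin (t - \<eta>))"
definition "amp1 \<sigma> \<eta> t = \<rho>1 t * (\<sigma> - c * cos (t - \<eta>)) + \<rho> t * (c * sin (t - \<eta>))
   - (\<rho>2 t * (c * sin (t - \<eta>)) + \<rho>1 t * (c * cos (t - \<eta>)))"
definition "boundary_amp \<sigma> \<eta> t = \<phi>s \<sigma> t * complex_of_real (amp \<sigma> \<eta> t / sqrt (\<rho> t)) * (if \<sigma> = 1 then T0_inf else cnj T0_inf)"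

lemma amp_deriv: "(amp \<sigma> \<eta> has_real_derivative amp1 \<sigma> \<eta> t) (at t)"
  unfolding amp_def[abs_def] amp1_def
  by (auto intro!: derivative_eq_intros \<rho>_deriv \<rho>1_deriv simp: algebra_simps)

lemma cos_sin_per: "cos (t + 2 * pi - \<eta>) = cos (t - \<eta>)" "sin (t + 2 * pi - \<eta>) = sin (t - \<eta>)"
  by (simp_all add: cos_diff sin_diff)

lemma boundary_amp_per: "boundary_amp \<sigma> \<eta> (t + 2 * pi) = boundary_amp \<sigma> \<eta> t"
  using \<phi>_per[of t] \<phi>_per[of "t + pi"] unfolding boundary_amp_def \<phi>s_def amp_def \<rho>_per \<rho>1_per cos_sin_per
  by (simp add: add.assoc add.commute)

lemma boundary_amp_deriv:
  obtains b' where "\<And>t. (boundary_amp \<sigma> \<eta> has_vector_derivative b' t) (at t)" "continuous_on UNIV b'"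
proof -
  define g where "g t = amp \<sigma> \<eta> t / sqrt (\<rho> t)" for t
  define g1 where "g1 t = (amp1 \<sigma> \<eta> t * sqrt (\<rho> t) - amp \<sigma> \<eta> t * (inverse (sqrt (\<rho> t)) / 2 * \<rho>1 t)) / (sqrt (\<rho> t) * sqrt (\<rho> t))" for t
  define f1 where "f1 t = (if \<sigma> = 1 then \<phi>1 t else \<phi>1 (t + pi))" for t
  define K where "K = (if \<sigma> = 1 then T0_inf else cnj T0_inf)"
  have g: "(g has_real_derivative g1 t) (at t)" for t
  proof -
    have "((\<lambda>t. sqrt (\<rho> t)) has_real_derivative inverse (sqrt (\<rho> t)) / 2 * \<rho>1 t) (at t)"
      by (rule DERIV_chain2[OF DERIV_real_sqrt[OF \<rho>_pos] \<rho>_deriv])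
    from DERIV_divide[OF amp_deriv this] \<rho>_pos[of t] show ?thesis unfolding g_def[abs_def] g1_def by simp
  qed
  have f: "(\<phi>s \<sigma> has_vector_derivative f1 t) (at t)" for t
    unfolding \<phi>s_def[abs_def] f1_def using \<phi>_shift_deriv[of 0 t] \<phi>_shift_deriv[of pi t] by simp
  have cf: "continuous_on UNIV (\<phi>s \<sigma>)" "continuous_on UNIV f1"
    unfolding \<phi>s_def[abs_def] f1_def[abs_def] by (cases "\<sigma> = 1"; simp; intro cont_all)+
  have s0: "sqrt (\<rho> t) \<noteq> 0" for t using \<rho>_pos[of t] by simp
  have cg: "continuous_on UNIV g" "continuous_on UNIV g1"
    unfolding g_def[abs_def] g1_def[abs_def] amp_def amp1_def by (intro cont_all; use s0 in simp)+
  show ?thesis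
  proof
    fix t
    have g': "((\<lambda>t. complex_of_real (g t)) has_vector_derivative complex_of_real (g1 t)) (at t)"
      using g[of t] unfolding has_real_derivative_iff_has_vector_derivative
      by (rule bounded_linear.has_vector_derivative[OF bounded_linear_of_real])
    from has_vector_derivative_mult[OF has_vector_derivative_mult[OF f g'] has_vector_derivative_const[of K]]
    show "(boundary_amp \<sigma> \<eta> has_vector_derivative (\<phi>s \<sigma> t * complex_of_real (g1 t) + f1 t * complex_of_real (g t)) * K) (at t)"
      unfolding boundary_amp_def[abs_def] K_def g_def by simp
    show "continuous_on UNIV (\<lambda>t. (\<phi>s \<sigma> t * complex_of_real (g1 t) + f1 t * complex_of_real (g t)) * K)"
      by (intro continuous_intros cf cg)
  qed
qed

text \<open>The identity behind it is the product of p = (sum) and V = (difference) of the incident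
  unit vector and c times the outgoing one, which is 1 - c^2: if the amplitude and F1 both vanished,
  this would be 0.\<close>

lemma amp_at_critical:
  assumes \<sigma>: "\<bar>\<sigma>\<bar> = 1" and z: "F1 \<sigma> \<eta> t = 0" and A: "\<sigma> + c * cos (t - \<eta>) \<noteq> 0"
  shows "amp \<sigma> \<eta> t \<noteq> 0"
proof
  assume 0: "amp \<sigma> \<eta> t = 0"
  have "\<sigma> * \<sigma> = 1" using \<sigma> by (metis abs_mult_self_eq mult_1)
  have "amp \<sigma> \<eta> t * (\<sigma> + c * cos (t - \<eta>)) + F1 \<sigma> \<eta> t * (c * sin (t - \<eta>))
      = \<rho> t * (\<sigma> * \<sigma> - c\<^sup>2 * ((cos (t - \<eta>))\<^sup>2 + (sin (t - \<eta>))\<^sup>2))"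
    unfolding amp_def F1_def by algebra
  then have "\<rho> t * (1 - c\<^sup>2) = 0" using 0 z \<open>\<sigma> * \<sigma> = 1\<close> by simp
  moreover have "c\<^sup>2 > 1" using c by (simp add: one_less_power)
  ultimately show False using \<rho>_pos[of t] by simp
qed

lemma reduced_asymptotics:
  "(\<lambda>n. sqrt (\<kappa> n) * integral {-pi..pi} (\<lambda>t. boundary_amp 1 \<eta> t * expi (\<kappa> n * F 1 \<eta> t))
      + sqrt (\<kappa> n) * integral {-pi..pi} (\<lambda>t. boundary_amp (-1) \<eta> t * expi (\<kappa> n * F (-1) \<eta> t))) \<longlonglongrightarrow> 0"
proof -
  \<comment> \<open>This is \<open>c * \<rho> t * cos (t - \<eta>)\<close>, written as a difference
    so that the derivatives of m + \<rho> and m - \<rho> are those of F.\<close>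
  define m where "m t = F 1 \<eta> t - \<rho> t" for t
  define m1 where "m1 t = F1 1 \<eta> t - \<rho>1 t" for t
  define m2 where "m2 t = F2 1 \<eta> t - \<rho>2 t" for t
  have mF: "m t + \<rho> t = F 1 \<eta> t" "m t - \<rho> t = F (-1) \<eta> t" "m1 t + \<rho>1 t = F1 1 \<eta> t" "m1 t - \<rho>1 t = F1 (-1) \<eta> t"
    "m2 t + \<rho>2 t = F2 1 \<eta> t" "m2 t - \<rho>2 t = F2 (-1) \<eta> t" for t
    by (simp_all add: m_def m1_def m2_def F_def F1_def F2_def algebra_simps)
  interpret pp: polar_phase \<rho> \<rho>1 \<rho>2 m m1 m2
  proof
    show "(m has_real_derivative m1 t) (at t)" "(m1 has_real_derivative m2 t) (at t)" for t
      unfolding m_def[abs_def] m1_def[abs_def] m2_def by (intro DERIV_diff F_deriv F1_deriv \<rho>_deriv \<rho>1_deriv)+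
    show "continuous_on UNIV m2" unfolding m2_def[abs_def] by (intro continuous_intros cont_F \<rho>2_cont)
    show "m (t + 2 * pi) = m t" for t by (simp add: m_def F_per \<rho>_per)
    show "m1 t + \<rho>1 t = 0 \<Longrightarrow> m2 t + \<rho>2 t \<noteq> 0" "m1 t - \<rho>1 t = 0 \<Longrightarrow> m2 t - \<rho>2 t \<noteq> 0" for t
      unfolding mF using F1_simple[of 1 \<eta> t] F1_simple[of "-1" \<eta> t] by auto
  qed (rule \<rho>_deriv \<rho>1_deriv \<rho>2_cont \<rho>_pos \<rho>_per)+
  define f where "f s t = \<rho> t * (cos s - c * cos (t - \<eta>)) - \<rho>1 t * (sin s + c * sin (t - \<eta>))" for s t
  define fs where "fs s t = - \<rho> t * sin s - \<rho>1 t * cos s" for s t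
  define ft where "ft s t = \<rho>1 t * (cos s - c * cos (t - \<eta>)) + \<rho> t * (c * sin (t - \<eta>))
     - (\<rho>2 t * (sin s + c * sin (t - \<eta>)) + \<rho>1 t * (c * cos (t - \<eta>)))" for s t
  define a where "a s t = \<phi> (t + s) * complex_of_real (f s t)" for s t
  define as where "as s t = \<phi> (t + s) * complex_of_real (fs s t) + \<phi>1 (t + s) * complex_of_real (f s t)" for s t
  define at' where "at' s t = \<phi> (t + s) * complex_of_real (ft s t) + \<phi>1 (t + s) * complex_of_real (f s t)" for s t
  have df: "((\<lambda>s. complex_of_real (f s t)) has_vector_derivative complex_of_real (fs s t)) (at s)"
    "((\<lambda>t. complex_of_real (f s t)) has_vector_derivative complex_of_real (ft s t)) (at t)" for s t
  proof -
    have "((\<lambda>s. f s t) has_real_derivative fs s t) (at s)"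
      unfolding f_def fs_def by (auto intro!: derivative_eq_intros)
    then show "((\<lambda>s. complex_of_real (f s t)) has_vector_derivative complex_of_real (fs s t)) (at s)"
      unfolding has_real_derivative_iff_has_vector_derivative by (rule bounded_linear.has_vector_derivative[OF bounded_linear_of_real])
    have "((\<lambda>t. f s t) has_real_derivative ft s t) (at t)"
      unfolding f_def ft_def by (auto intro!: derivative_eq_intros \<rho>_deriv \<rho>1_deriv simp: algebra_simps)
    then show "((\<lambda>t. complex_of_real (f s t)) has_vector_derivative complex_of_real (ft s t)) (at t)"
      unfolding has_real_derivative_iff_has_vector_derivative by (rule bounded_linear.has_vector_derivative[OF bounded_linear_of_real])
  qed
  have "(\<lambda>n. \<kappa> n * integral {-pi..pi} (\<lambda>t. integral {-pi..pi} (\<lambda>s. a s t * expi (\<kappa> n * pp.Phi s t)))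
     - (sqrt (\<kappa> n) * integral {-pi..pi} (\<lambda>t. a 0 t * (T0_inf / complex_of_real (sqrt (\<rho> t))) * expi (\<kappa> n * (m t + \<rho> t)))
      + sqrt (\<kappa> n) * integral {-pi..pi} (\<lambda>t. a pi t * (cnj T0_inf / complex_of_real (sqrt (\<rho> t))) * expi (\<kappa> n * (m t - \<rho> t))))) \<longlonglongrightarrow> 0"
  proof (rule pp.reduction_to_boundary_angle[OF _ _ _ _ _ _ _ \<kappa> \<kappa>_pos])
    show "((\<lambda>s. a s t) has_vector_derivative as s t) (at s)" for s t
      unfolding a_def as_def using has_vector_derivative_mult[OF \<phi>_shift_deriv[of t s] df(1)[of t s]] by (simp add: add.commute)
    show "((\<lambda>t. a s t) has_vector_derivative at' s t) (at t)" for s t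
      unfolding a_def at'_def by (rule has_vector_derivative_mult[OF \<phi>_shift_deriv df(2)])
    show "continuous_on UNIV (\<lambda>p. a (fst p) (snd p))" unfolding a_def f_def by (intro cont_all)
    show "continuous_on UNIV (\<lambda>p. as (fst p) (snd p))" unfolding as_def f_def fs_def by (intro cont_all)
    show "continuous_on UNIV (\<lambda>p. at' (fst p) (snd p))" unfolding at'_def f_def ft_def by (intro cont_all)
    show "a (s + 2 * pi) t = a s t" for s t
      using \<phi>_per[of "t + s"] by (simp add: a_def f_def add.assoc[symmetric])
    show "a s (t + 2 * pi) = a s t" for s t
      using \<phi>_per[of "t + s"] unfolding a_def f_def \<rho>_per \<rho>1_per cos_sin_per by (simp add: add_ac)
  qed
  moreover have "integral {-pi..pi} (\<lambda>t. integral {-pi..pi} (\<lambda>s. a s t * expi (\<kappa> n * pp.Phi s t))) = 0" for n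
    using vanish[of \<eta> n] by (simp add: a_def f_def pp.Phi_def m_def F_def distrib_left mult_ac)
  moreover have "a 0 t * (T0_inf / complex_of_real (sqrt (\<rho> t))) = boundary_amp 1 \<eta> t" for t
    by (simp add: a_def f_def boundary_amp_def \<phi>s_def amp_def)
  moreover have "a pi t * (cnj T0_inf / complex_of_real (sqrt (\<rho> t))) = boundary_amp (-1) \<eta> t" for t
    by (simp add: a_def f_def boundary_amp_def \<phi>s_def amp_def)
  ultimately have l: "(\<lambda>n. 0 - (sqrt (\<kappa> n) * integral {-pi..pi} (\<lambda>t. boundary_amp 1 \<eta> t * expi (\<kappa> n * F 1 \<eta> t))
      + sqrt (\<kappa> n) * integral {-pi..pi} (\<lambda>t. boundary_amp (-1) \<eta> t * expi (\<kappa> n * F (-1) \<eta> t)))) \<longlonglongrightarrow> 0"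
    by (simp only: mF mult_zero_right)
  from tendsto_minus[OF this] show ?thesis by (simp add: add.commute)
qed

text \<open>A branch is a pair of the orientation and a flag telling the maximum of the phase (\<open>True\<close>) from its minimum.\<close>
definition "crit_angle j y = (if snd j then P (fst j) y else P (- fst j) (y + pi))"
definition "crit_coeff j y = boundary_amp (fst j) y (crit_angle j y) * complex_of_real (1 / sqrt (\<bar>F2 (fst j) y (crit_angle j y)\<bar> / 2)) * (if snd j then cnj Fresnel else Fresnel)"
definition "crit_slope j y = (if snd j then c * D (fst j) y else - c * D (- fst j) (y + pi))"

lemma branch_asymptotics:
  assumes \<sigma>: "\<sigma> = 1 \<or> \<sigma> = - 1"
  shows "(\<lambda>n. sqrt (\<kappa> n) * integral {-pi..pi} (\<lambda>t. boundary_amp \<sigma> y t * expi (\<kappa> n * F \<sigma> y t))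
    - (expi (\<kappa> n * F \<sigma> y (crit_angle (\<sigma>, True) y)) * crit_coeff (\<sigma>, True) y
     + expi (\<kappa> n * F \<sigma> y (crit_angle (\<sigma>, False) y)) * crit_coeff (\<sigma>, False) y)) \<longlonglongrightarrow> 0"
proof -
  have s: "\<bar>\<sigma>\<bar> = 1" using \<sigma> by auto
  obtain b' where b: "\<And>t. (boundary_amp \<sigma> y has_vector_derivative b' t) (at t)" "continuous_on UNIV b'" using boundary_amp_deriv by blast
  obtain u v where uv: "u < P \<sigma> y" "P \<sigma> y < v" "v < P (- \<sigma>) (y + pi)" "P (- \<sigma>) (y + pi) < u + 2 * pi"
    "\<And>t. t \<in> {u..v} \<Longrightarrow> F1 \<sigma> y t = 0 \<Longrightarrow> t = P \<sigma> y"
    "\<And>t. t \<in> {v..u + 2 * pi} \<Longrightarrow> F1 \<sigma> y t = 0 \<Longrightarrow> t = P (- \<sigma>) (y + pi)"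
    using critical_separation[OF s] by blast
  note cr = critical_P[OF s, of y]
  have "(\<lambda>n. sqrt (\<kappa> n) * integral {-pi..pi} (\<lambda>t. boundary_amp \<sigma> y t * expi (\<kappa> n * F \<sigma> y t))
      - (expi (\<kappa> n * F \<sigma> y (P \<sigma> y)) * (boundary_amp \<sigma> y (P \<sigma> y) * complex_of_real (1 / sqrt (\<bar>F2 \<sigma> y (P \<sigma> y)\<bar> / 2)) * cnj Fresnel)
       + expi (\<kappa> n * F \<sigma> y (P (- \<sigma>) (y + pi))) * (boundary_amp \<sigma> y (P (- \<sigma>) (y + pi)) * complex_of_real (1 / sqrt (\<bar>F2 \<sigma> y (P (- \<sigma>) (y + pi))\<bar> / 2)) * Fresnel))) \<longlonglongrightarrow> 0"
  proof (rule two_point_stationary_phase[where f = "F \<sigma> y" and ?f1.0 = "F1 \<sigma> y" and ?f2.0 = "F2 \<sigma> y" and b = "boundary_amp \<sigma> y"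
      and b' = b' and u = u and v = v and ?x1.0 = "P \<sigma> y" and ?x2.0 = "P (- \<sigma>) (y + pi)" and \<kappa> = \<kappa>])
  qed (fact F_deriv F1_deriv cont_F(2) b F_per boundary_amp_per uv cr \<kappa> \<kappa>_pos)+
  then show ?thesis by (simp only: crit_coeff_def crit_angle_def fst_conv snd_conv if_True if_False)
qed

definition "branches = {1, - 1 :: real} \<times> (UNIV :: bool set)"

lemma branch_critical:
  assumes j: "j \<in> branches"
  shows "\<bar>fst j\<bar> = 1" "F1 (fst j) y (crit_angle j y) = 0" "fst j + c * cos (crit_angle j y - y) \<noteq> 0" "F2 (fst j) y (crit_angle j y) \<noteq> 0"
proof -
  show s: "\<bar>fst j\<bar> = 1" using j by (auto simp: branches_def)
  from critical_P[OF s, of y] show "F1 (fst j) y (crit_angle j y) = 0" "fst j + c * cos (crit_angle j y - y) \<noteq> 0" "F2 (fst j) y (crit_angle j y) \<noteq> 0"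
    by (auto simp: crit_angle_def)
qed

lemma crit_angle_deriv:
  assumes j: "j \<in> branches"
  obtains t' where "(crit_angle j has_real_derivative t') (at y)"
proof -
  have s: "\<bar>fst j\<bar> = 1" "\<bar>- fst j\<bar> = 1" using branch_critical(1)[OF j] by auto
  have "(P (- fst j) has_real_derivative inverse (1 - T1 (- fst j) (P (- fst j) (y + pi)))) (at (y + pi))" by (rule P_deriv[OF s(2)])
  then have "((\<lambda>y. P (- fst j) (y + pi)) has_real_derivative inverse (1 - T1 (- fst j) (P (- fst j) (y + pi)))) (at y)"
    by (simp add: DERIV_shift)
  with P_deriv[OF s(1), of y] that show ?thesis unfolding crit_angle_def[abs_def] by (cases "snd j") auto
qed

lemma cont_crit_angle: "j \<in> branches \<Longrightarrow> continuous_on A f \<Longrightarrow> continuous_on A (\<lambda>x. crit_angle j (f x))"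
proof -
  assume j: "j \<in> branches" and f: "continuous_on A f"
  have s: "\<bar>fst j\<bar> = 1" "\<bar>- fst j\<bar> = 1" using branch_critical(1)[OF j] by auto
  show ?thesis unfolding crit_angle_def by (cases "snd j"; simp; intro continuous_intros cont_P s f)
qed

text \<open>The envelope principle: the motion of the critical angle contributes F1 = 0, and only
  the explicit dependence on the direction remains. For a minimum the ray direction is y + pi, and
  the sine changes sign.\<close>

lemma branch_phase_deriv:
  assumes j: "j \<in> branches"
  shows "((\<lambda>y. F (fst j) y (crit_angle j y)) has_real_derivative crit_slope j y) (at y)"
proof -
  obtain t' where t': "(crit_angle j has_real_derivative t') (at y)" by (rule crit_angle_deriv[OF j])
  have 1: "((\<lambda>y. \<rho> (crit_angle j y)) has_real_derivative \<rho>1 (crit_angle j y) * t') (at y)" by (rule DERIV_chain2[OF \<rho>_deriv t'])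
  have "((\<lambda>y. F (fst j) y (crit_angle j y)) has_real_derivative
      \<rho>1 (crit_angle j y) * t' * (fst j + c * cos (crit_angle j y - y)) + (- (c * (sin (crit_angle j y - y) * (t' - 1)))) * \<rho> (crit_angle j y)) (at y)"
    unfolding F_def by (rule DERIV_mult[OF 1]) (auto intro!: derivative_eq_intros t')
  also have "\<rho>1 (crit_angle j y) * t' * (fst j + c * cos (crit_angle j y - y)) + (- (c * (sin (crit_angle j y - y) * (t' - 1)))) * \<rho> (crit_angle j y)
      = t' * F1 (fst j) y (crit_angle j y) + c * (\<rho> (crit_angle j y) * sin (crit_angle j y - y))"
    unfolding F1_def by algebra
  also have "\<dots> = crit_slope j y"
  proof (cases "snd j")
    case True
    then show ?thesis unfolding branch_critical(2)[OF j] by (simp add: crit_slope_def D_def crit_angle_def)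
  next
    case False
    have "sin (P (- fst j) (y + pi) - y) = - sin (P (- fst j) (y + pi) - (y + pi))" by (simp add: diff_diff_eq[symmetric] sin_diff[of _ pi])
    with False show ?thesis unfolding branch_critical(2)[OF j] by (simp add: crit_slope_def D_def crit_angle_def)
  qed
  finally show ?thesis .
qed

text \<open>All factors other than the density are nonzero: the amplitude by
  \<open>amp_at_critical\<close>, the second derivative by nondegeneracy, and the two constants
  because the Fresnel integral is nonzero.\<close>

lemma crit_coeff_nonzero_iff: "j \<in> branches \<Longrightarrow> crit_coeff j y \<noteq> 0 \<longleftrightarrow> \<phi>s (fst j) (crit_angle j y) \<noteq> 0"
  using amp_at_critical[OF branch_critical(1-3), of j y] branch_critical(4)[of j y] \<rho>_pos[of "crit_angle j y"] T0_inf_nonzero Fresnel_nonzero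
  by (auto simp: crit_coeff_def boundary_amp_def)

lemma cont_crit_coeff: assumes j: "j \<in> branches" shows "continuous_on UNIV (crit_coeff j)"
proof -
  have "sqrt (\<bar>F2 (fst j) y (crit_angle j y)\<bar> / 2) \<noteq> 0" for y using branch_critical(4)[OF j] by simp
  moreover have "sqrt (\<rho> (crit_angle j y)) \<noteq> 0" for y using \<rho>_pos[of "crit_angle j y"] by simp
  ultimately show ?thesis
    unfolding crit_coeff_def[abs_def] boundary_amp_def \<phi>s_def amp_def F2_def
    by (cases "fst j = 1"; cases "snd j"; simp only: if_True if_False simp_thms)
      (intro cont_all cont_crit_angle[OF j]; simp)+
qed

lemma cont_crit_slope: assumes j: "j \<in> branches" shows "continuous_on UNIV (crit_slope j)"
proof -
  have s: "\<bar>fst j\<bar> = 1" "\<bar>- fst j\<bar> = 1" using branch_critical(1)[OF j] by auto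
  show ?thesis unfolding crit_slope_def[abs_def] D_def by (cases "snd j"; simp; intro cont_all cont_P s)
qed

text \<open>The boundary integrals of the two orientations cancel between the reduced asymptotics
  and the stationary phase expansions.\<close>

lemma branch_sum_tendsto_0:
  "(\<lambda>n. \<Sum>j\<in>branches. expi (\<kappa> n * F (fst j) y (crit_angle j y)) * crit_coeff j y) \<longlonglongrightarrow> 0"
proof -
  have "(\<lambda>n. (sqrt (\<kappa> n) * integral {-pi..pi} (\<lambda>t. boundary_amp 1 y t * expi (\<kappa> n * F 1 y t))
      + sqrt (\<kappa> n) * integral {-pi..pi} (\<lambda>t. boundary_amp (-1) y t * expi (\<kappa> n * F (-1) y t)))
     - (sqrt (\<kappa> n) * integral {-pi..pi} (\<lambda>t. boundary_amp 1 y t * expi (\<kappa> n * F 1 y t))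
    - (expi (\<kappa> n * F 1 y (crit_angle (1, True) y)) * crit_coeff (1, True) y
     + expi (\<kappa> n * F 1 y (crit_angle (1, False) y)) * crit_coeff (1, False) y))
     - (sqrt (\<kappa> n) * integral {-pi..pi} (\<lambda>t. boundary_amp (-1) y t * expi (\<kappa> n * F (-1) y t))
    - (expi (\<kappa> n * F (-1) y (crit_angle (-1, True) y)) * crit_coeff (-1, True) y
     + expi (\<kappa> n * F (-1) y (crit_angle (-1, False) y)) * crit_coeff (-1, False) y))) \<longlonglongrightarrow> 0 - 0 - 0"
    by (intro tendsto_diff reduced_asymptotics branch_asymptotics) auto
  then show ?thesis by (simp add: branches_def sum.cartesian_product[symmetric] UNIV_bool algebra_simps)
qed

lemma crit_coeff_bound:
  assumes i: "i \<in> branches"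
  shows "cmod (crit_coeff i y) \<le> (\<Sum>j | j \<in> branches \<and> j \<noteq> i \<and> crit_slope j y = crit_slope i y. cmod (crit_coeff j y))"
  by (rule exponential_sum_coefficient_bound[where h = "\<lambda>j y. F (fst j) y (crit_angle j y)", OF _ i cont_crit_coeff
      branch_phase_deriv cont_crit_slope \<kappa> branch_sum_tendsto_0]) (simp_all add: branches_def)

text \<open>If every other branch with the same slope had coefficient 0, the bound would force the
  coefficient of i to vanish.\<close>

lemma coincident_branch:
  assumes i: "i \<in> branches" and nz: "\<phi>s (fst i) (crit_angle i y) \<noteq> 0"
  obtains j where "j \<in> branches" "j \<noteq> i" "crit_slope j y = crit_slope i y" "\<phi>s (fst j) (crit_angle j y) \<noteq> 0"
proof -
  have "\<not> (\<forall>j\<in>{j. j \<in> branches \<and> j \<noteq> i \<and> crit_slope j y = crit_slope i y}. crit_coeff j y = 0)"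
  proof
    assume "\<forall>j\<in>{j. j \<in> branches \<and> j \<noteq> i \<and> crit_slope j y = crit_slope i y}. crit_coeff j y = 0"
    then have "(\<Sum>j | j \<in> branches \<and> j \<noteq> i \<and> crit_slope j y = crit_slope i y. cmod (crit_coeff j y)) = 0" by (intro sum.neutral) auto
    with crit_coeff_bound[OF i, of y] crit_coeff_nonzero_iff[OF i, of y] nz show False by simp
  qed
  then show ?thesis using that crit_coeff_nonzero_iff by blast
qed

section \<open>Links between active angles\<close>

text \<open>Orientation 1 sees the density at the boundary angle, orientation -1 at the antipodal
  angle. The disjunction is independent of the orientation and pi-periodic, as the iteration of
  links requires.\<close>

definition "active x \<longleftrightarrow> \<phi> x \<noteq> 0 \<or> \<phi> (x + pi) \<noteq> 0"

lemma active_pi: "active (x + pi) \<longleftrightarrow> active x"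
  using \<phi>_per[of x] by (auto simp: active_def add.assoc)

lemma \<phi>s_active: "\<phi>s \<sigma> x \<noteq> 0 \<Longrightarrow> active x" by (auto simp: active_def \<phi>s_def split: if_splits)

text \<open>Two maxima, or two minima, never share a slope where \<rho>1 is nonzero, so the partner
  of a surviving maximum is a minimum and conversely. Comparing their slopes gives the relation
  between D at y and at y + pi.\<close>

lemma active_step:
  assumes \<sigma>: "\<bar>\<sigma>\<bar> = 1" and y: "\<rho>1 y \<noteq> 0" and act: "active (P \<sigma> y)"
  shows "\<exists>\<sigma>'. (\<sigma>' = 1 \<or> \<sigma>' = - 1) \<and> D \<sigma>' (y + pi) = - D \<sigma> y \<and> active (P \<sigma>' (y + pi))"
proof -
  have s: "\<sigma> = 1 \<or> \<sigma> = - 1" using \<sigma> by linarith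
  have ne: "D (- \<sigma>) y \<noteq> D \<sigma> y" using D_plus_minus_distinct[OF y] s by auto
  have c0: "c \<noteq> 0" using c by simp
  show ?thesis
  proof (cases "\<phi>s \<sigma> (P \<sigma> y) = 0")
    case False
    have i: "(\<sigma>, True) \<in> branches" using s by (auto simp: branches_def)
    have "\<phi>s (fst (\<sigma>, True)) (crit_angle (\<sigma>, True) y) \<noteq> 0" using False by (simp add: crit_angle_def)
    from coincident_branch[OF i this] obtain j where j: "j \<in> branches" "j \<noteq> (\<sigma>, True)" "crit_slope j y = crit_slope (\<sigma>, True) y" "\<phi>s (fst j) (crit_angle j y) \<noteq> 0" by blast
    have "\<not> snd j"
    proof
      assume "snd j"
      then have "fst j = - \<sigma>" using j(1,2) s by (cases j) (auto simp: branches_def)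
      with \<open>snd j\<close> j(3) ne c0 show False by (simp add: crit_slope_def)
    qed
    then have "c * D (- fst j) (y + pi) = - (c * D \<sigma> y)" "active (P (- fst j) (y + pi))"
      using j(3) \<phi>s_active[OF j(4)] by (auto simp: crit_slope_def crit_angle_def)
    then have "D (- fst j) (y + pi) = - D \<sigma> y" using c0 by (metis minus_mult_right mult_left_cancel)
    moreover have "- fst j = 1 \<or> - fst j = - 1" using j(1) by (auto simp: branches_def)
    ultimately show ?thesis using \<open>active (P (- fst j) (y + pi))\<close> by blast
  next
    case True
    \<comment> \<open>The density is then nonzero for the opposite orientation. The angle P \<sigma>
      y occurs there as the minimum for direction y - pi, and the conclusion is transported from y -
      pi to y + pi by periodicity.\<close>
    have nz: "\<phi>s (- \<sigma>) (P \<sigma> y) \<noteq> 0" using True act s by (auto simp: \<phi>s_def active_def split: if_splits)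
    have i: "(- \<sigma>, False) \<in> branches" using s by (auto simp: branches_def)
    have "\<phi>s (fst (- \<sigma>, False)) (crit_angle (- \<sigma>, False) (y - pi)) \<noteq> 0" using nz by (simp add: crit_angle_def)
    from coincident_branch[OF i this] obtain j where j: "j \<in> branches" "j \<noteq> (- \<sigma>, False)" "crit_slope j (y - pi) = crit_slope (- \<sigma>, False) (y - pi)" "\<phi>s (fst j) (crit_angle j (y - pi)) \<noteq> 0" by blast
    have sj: "snd j"
    proof (rule ccontr)
      assume "\<not> snd j"
      then have "fst j = \<sigma>" using j(1,2) s by (cases j) (auto simp: branches_def)
      with \<open>\<not> snd j\<close> j(3) ne c0 show False by (simp add: crit_slope_def)
    qed
    have s': "\<bar>fst j\<bar> = 1" by (rule branch_critical(1)[OF j(1)])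
    have P: "P (fst j) (y + pi) = P (fst j) (y - pi) + 2 * pi" 
    proof -
      have "y - pi + 2 * pi = y + pi" by simp
      with P_per[OF s', of "y - pi"] show ?thesis by (simp only:)
    qed
    have "D (fst j) (y + pi) = D (fst j) (y - pi)" unfolding D_def P \<rho>_per using cos_sin_per(2)[of "P (fst j) (y - pi)" "y + pi"] 
      sin_periodic[of "P (fst j) (y - pi) - (y + pi)"] sin_periodic[of "P (fst j) (y - pi) + 2 * pi - (y + pi)"] by (simp add: algebra_simps)
    moreover have "c * D (fst j) (y - pi) = - (c * D \<sigma> y)" using j(3) sj by (simp add: crit_slope_def)
    then have "D (fst j) (y - pi) = - D \<sigma> y" using c0 by (metis minus_mult_right mult_left_cancel)
    moreover have "active (P (fst j) (y - pi))" using \<phi>s_active[OF j(4)] sj by (simp add: crit_angle_def)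
    then have "active (P (fst j) (y + pi))" using active_pi[of "P (fst j) (y - pi)"] active_pi[of "P (fst j) (y - pi) + pi"] unfolding P by (simp add: add.assoc)
    moreover have "fst j = 1 \<or> fst j = - 1" using j(1) by (auto simp: branches_def)
    ultimately show ?thesis by metis
  qed
qed

theorem herglotz_density_vanishes:
  assumes "\<And>t. \<rho>1 t = 0 \<longleftrightarrow> \<rho>1 (t + pi) = 0"
    and "(\<forall>t. sgn (\<rho>1 t) = sgn (\<rho>1 (t + pi))) \<or> (\<forall>t. \<rho>1 t = 0 \<longrightarrow> \<bar>\<rho>2 t\<bar> + \<bar>\<rho>2 (t + pi)\<bar> > 0)"
    and "\<rho>1 x \<noteq> 0"
  shows "\<phi> x = 0"
proof -
  have "\<not> active x" by (rule no_active_direction[OF assms(1,2) active_pi active_step assms(3)])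
  then show ?thesis by (simp add: active_def)
qed

end

section \<open>Proof of finiteness\<close>

lemma C2_fun_derivs:
  assumes "C2_fun f"
  shows "(f has_real_derivative deriv f t) (at t)" "(deriv f has_real_derivative deriv (deriv f) t) (at t)"
    "continuous_on UNIV (deriv (deriv f))"
  using assms by (auto simp: C2_fun_def DERIV_deriv_iff_real_differentiable)

lemma deriv2_ln:
  assumes pos: "\<And>t. f t > 0" and f: "\<And>t. (f has_real_derivative f1 t) (at t)" "\<And>t. (f1 has_real_derivative f2 t) (at t)"
  shows "deriv (deriv (\<lambda>s. ln (f s))) t = f2 t / f t - (f1 t / f t)\<^sup>2"
proof -
  have "deriv (\<lambda>s. ln (f s)) t = f1 t / f t" for t
    using DERIV_chain2[OF DERIV_ln_divide[OF pos[of t]] f(1)] by (intro DERIV_imp_deriv) simp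
  then have "deriv (\<lambda>s. ln (f s)) = (\<lambda>t. f1 t / f t)" by auto
  moreover have "((\<lambda>t. f1 t / f t) has_real_derivative f2 t / f t - (f1 t / f t)\<^sup>2) (at t)"
  proof -
    have "f t \<noteq> 0" using pos[of t] by simp
    from DERIV_divide[OF f(2) f(1) this] \<open>f t \<noteq> 0\<close> show ?thesis by (simp add: field_simps power2_eq_square)
  qed
  ultimately show ?thesis by (simp add: DERIV_imp_deriv)
qed

theorem theorem5:
  fixes q :: real and \<rho> :: "real \<Rightarrow> real" and \<phi> :: "real \<Rightarrow> complex"
  assumes q_gt: "q > 1"
    and \<rho>_pos: "\<forall>t. \<rho> t > 0"
    and \<rho>_per: "\<forall>t. \<rho> (t + 2 * pi) = \<rho> t"
    and \<rho>_C2: "C2_fun \<rho>"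
    and \<rho>_adm: "admissible q \<rho>"
    and \<rho>'_ae: "{t \<in> {0..<2 * pi}. deriv \<rho> t = 0} \<in> null_sets lborel"
    and \<rho>'_zero: "\<forall>t. deriv \<rho> t = 0 \<longleftrightarrow> deriv \<rho> (t + pi) = 0"
    and cond: "(\<forall>t. sgn (deriv \<rho> t) = sgn (deriv \<rho> (t + pi)))
             \<or> (\<forall>t. deriv \<rho> t = 0 \<longrightarrow>
                   \<bar>deriv (deriv \<rho>) t\<bar> + \<bar>deriv (deriv \<rho>) (t + pi)\<bar> > 0)"
    and \<phi>_per: "\<forall>\<theta>. \<phi> (\<theta> + 2 * pi) = \<phi> \<theta>"
    and \<phi>_C1: "\<phi> C1_differentiable_on UNIV"
    and \<phi>_nz: "\<exists>\<theta>. \<phi> \<theta> \<noteq> 0"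
  shows "finite {k :: real. k > 0 \<and> non_scattering (star_domain \<rho>) q k \<phi>}"
proof (rule ccontr)
  assume inf: "infinite {k :: real. k > 0 \<and> non_scattering (star_domain \<rho>) q k \<phi>}"
  define c where "c = sqrt q"
  have c: "c > 1" "c\<^sup>2 = q" using q_gt by (auto simp: c_def)
  note d\<rho> = C2_fun_derivs[OF \<rho>_C2]
  have cont_d\<rho>: "continuous_on UNIV (deriv \<rho>)" by (intro continuous_at_imp_continuous_on ballI DERIV_isCont[OF d\<rho>(2)])
  interpret curve: star_curve c \<rho> "deriv \<rho>" "deriv (deriv \<rho>)"
  proof
    fix t
    have "deriv (deriv \<rho>) t / \<rho> t - (deriv \<rho> t / \<rho> t)\<^sup>2 = deriv (deriv (\<lambda>s. ln (\<rho> s))) t"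
      using deriv2_ln[of \<rho> "deriv \<rho>" "deriv (deriv \<rho>)" t] d\<rho>(1,2) \<rho>_pos by simp
    also have "\<dots> < c / (1 + c)" using \<rho>_adm by (simp add: admissible_def c_def)
    finally show "deriv (deriv \<rho>) t / \<rho> t - (deriv \<rho> t / \<rho> t)\<^sup>2 < c / (1 + c)" .
  qed (use c \<rho>_pos \<rho>_per d\<rho> in auto)
  interpret rad: star_radius \<rho> "deriv \<rho>"
    by unfold_locales (use \<rho>_pos \<rho>_per d\<rho> cont_d\<rho> in auto)
  obtain \<phi>1 where \<phi>1: "\<And>x. (\<phi> has_vector_derivative \<phi>1 x) (at x)" "continuous_on UNIV \<phi>1"
    using \<phi>_C1 by (auto simp: C1_differentiable_on_def)
  have cont_\<phi>: "continuous_on UNIV \<phi>"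
    using \<phi>1(1) by (meson continuous_at_imp_continuous_on has_vector_derivative_continuous)
  define a where "a \<eta> p = \<phi> (fst p + snd p) * complex_of_real (\<rho> (fst p) * (cos (snd p) - c * cos (fst p - \<eta>))
      - deriv \<rho> (fst p) * (sin (snd p) + c * sin (fst p - \<eta>)))" for \<eta> p
  define \<Phi> where "\<Phi> \<eta> p = \<rho> (fst p) * cos (snd p) + c * \<rho> (fst p) * cos (fst p - \<eta>)" for \<eta> p
  note cont = continuous_intros rad.cont_comp_\<rho> rad.cont_comp_\<rho>1 continuous_on_compose2[OF cont_\<phi> _ subset_UNIV]
  have ca: "continuous_on UNIV (a \<eta>)" and c\<Phi>: "continuous_on UNIV (\<Phi> \<eta>)" for \<eta>
    unfolding a_def \<Phi>_def by (intro cont)+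
  define I where "I \<eta> k = integral (cbox (-pi, -pi) (pi, pi)) (\<lambda>p. a \<eta> p * expi (k * \<Phi> \<eta> p))" for \<eta> k
  have I: "I \<eta> k = integral {-pi..pi} (\<lambda>\<theta>. integral {-pi..pi} (\<lambda>s.
      \<phi> (\<theta> + s) * complex_of_real (\<rho> \<theta> * (cos s - c * cos (\<theta> - \<eta>)) - deriv \<rho> \<theta> * (sin s + c * sin (\<theta> - \<eta>)))
      * expi (k * (\<rho> \<theta> * cos s + c * \<rho> \<theta> * cos (\<theta> - \<eta>)))))" for \<eta> k
  proof -
    have "continuous_on (cbox (-pi, -pi) (pi, pi)) (\<lambda>p. a \<eta> p * expi (k * \<Phi> \<eta> p))"
      by (rule continuous_on_subset[of UNIV]) (intro continuous_intros ca c\<Phi>, simp)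
    from integral_prod_continuous[OF this] show ?thesis by (simp add: I_def a_def \<Phi>_def)
  qed
  \<comment> \<open>For every direction \<eta> the wave vector of length k c is real and satisfies
    the interior dispersion relation, so orthogonality holds for all \<eta> simultaneously.\<close>
  have "{k. k > 0 \<and> non_scattering (star_domain \<rho>) q k \<phi>} \<subseteq> {k. k > 0 \<and> (\<forall>\<eta>. I \<eta> k = 0)}"
  proof safe
    fix k \<eta> assume k: "k > 0" and ns: "non_scattering (star_domain \<rho>) q k \<phi>"
    let ?v = "vector [k * c * cos \<eta>, k * c * sin \<eta>] :: real^2"
    have "?v \<bullet> ?v = k\<^sup>2 * c\<^sup>2 * ((cos \<eta>)\<^sup>2 + (sin \<eta>)\<^sup>2)"
      unfolding inner_vec_def sum_2 vector_2 inner_real_def by algebra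
    then have v: "?v \<bullet> ?v = k\<^sup>2 * q" using c by simp
    have "integral\<^sup>L (lebesgue_on (star_domain \<rho>)) (\<lambda>x. herglotz k \<phi> x * expi (?v \<bullet> x)) = 0"
      by (rule non_scattering_orthogonality[OF rad.open_star_domain rad.bounded_star_domain cont_\<phi> ns v]) (use k q_gt in auto)
    then show "I \<eta> k = 0" unfolding I
      by (intro rad.herglotz_orthogonality_boundary cont_\<phi>) (use \<phi>_per k c q_gt in auto)
  qed
  with inf have infI: "infinite {k. k > 0 \<and> (\<forall>\<eta>. I \<eta> k = 0)}" using infinite_super by blast
  obtain \<kappa> :: "nat \<Rightarrow> real" where \<kappa>: "filterlim \<kappa> at_top sequentially" "\<And>n. \<kappa> n > 0" "\<And>\<eta> n. I \<eta> (\<kappa> n) = 0"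
    by (rule infinite_zero_frequencies[of a \<Phi>, OF ca c\<Phi>, folded I_def, OF infI]) blast
  interpret wave: star_wave c \<rho> "deriv \<rho>" "deriv (deriv \<rho>)" \<phi> \<phi>1 \<kappa>
    by unfold_locales (use \<phi>1 \<phi>_per \<kappa> in \<open>auto simp: I\<close>)
  have zero: "\<phi> x = 0" if "deriv \<rho> x \<noteq> 0" for x
    by (rule wave.herglotz_density_vanishes[OF _ _ that]) (use \<rho>'_zero cond in blast)+
  obtain \<theta> where \<theta>: "\<phi> \<theta> \<noteq> 0" using \<phi>_nz by blast
  \<comment> \<open>A point with nonzero density is moved into [0, 2 pi), the interval in which the
    zeros of the derivative are assumed to form a null set.\<close>
  define n where "n = \<lfloor>\<theta> / (2 * pi)\<rfloor>"
  define x where "x = \<theta> + 2 * pi * real_of_int (- n)"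
  have "real_of_int n \<le> \<theta> / (2 * pi)" "\<theta> / (2 * pi) < real_of_int n + 1" unfolding n_def by linarith+
  then have x: "0 \<le> x" "x < 2 * pi" by (simp_all add: x_def pos_le_divide_eq pos_divide_less_eq algebra_simps)
  have "\<phi> x \<noteq> 0" using periodic_of_int[of \<phi> "2 * pi" \<theta> "- n"] \<theta> \<phi>_per unfolding x_def by simp
  moreover have "(\<phi> \<longlongrightarrow> \<phi> x) (nhds x)"
    using cont_\<phi> by (simp add: continuous_on_eq_continuous_at isCont_def tendsto_nhds_iff)
  ultimately have "\<forall>\<^sub>F y in nhds x. \<phi> y \<noteq> 0" by (rule tendsto_imp_eventually_ne[rotated])
  then obtain d where d: "d > 0" "\<And>y. dist y x < d \<Longrightarrow> \<phi> y \<noteq> 0" unfolding eventually_nhds_metric by blast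
  \<comment> \<open>By continuity the density is nonzero on [x, x + d); cut off at 2 pi, this
    interval of positive length would consist of zeros of the derivative of \<rho>.\<close>
  define e where "e = min (x + d) (2 * pi)"
  have "{x..<e} \<subseteq> {t \<in> {0..<2 * pi}. deriv \<rho> t = 0}"
    using x d(2) zero by (fastforce simp: e_def dist_real_def)
  then have "{x..<e} \<in> null_sets lborel" using null_sets_subset[OF \<rho>'_ae] by simp
  moreover have "x < e" using x d(1) by (simp add: e_def)
  ultimately show False by (simp add: null_sets_def)
qed

end
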